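(* Let $X=\mathbb{C}^n$ with $n\ge2$, and let $f$ be a polynomial which is weighted homogeneous with weight vector $w=(w_1,\dots,w_n)\in\mathbb{Q}_{>0}^n$, i.e. $E(f)=f$ where $E:=\sum_{i=1}^nw_ix_i\partial_i$, and which has an isolated singularity at the origin. Write $|w|=\sum_iw_i$. Then, for all $k\in\mathbb{Z}_{\ge 0}$: (i) If $\alpha\in\mathbb{Q}\cap(0,1)$, then $W_{n+1}\mathcal{M}(f^{-\alpha})=\mathcal{M}(f^{-\alpha})$ and $$F^H_kW_n\mathcal{M}(f^{-\alpha})=\sum_{j\ge0}F_{k-j}\mathcal{D}_X\cdot\mathcal{O}^{>\alpha+j-|w|}f^{-j-\alpha}.$$ (ii) $W_{n+2}\mathcal{O}_X( *f)=\mathcal{O}_X( *f)$ and $$F^H_kW_{n+1}\mathcal{O}_X( *f)=\sum_{j\ge0}F_{k-j}\mathcal{D}_X\cdot\mathcal{O}^{>1+j-|w|}f^{-j-1}.$$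
   Context: Mixed Hodge module structure. Put $U:=X\setminus f^{-1}(0)$, $j:U\hookrightarrow X$. $\mathcal{M}(f^{-\alpha}):=\mathcal{O}_X( *f)f^{-\alpha}$, with $\mathcal{O}_X( *f)=\mathcal{O}_X[f^{-1}]$, is the left $\mathcal{D}_X$-module with action $\delta\cdot(uf^{-\alpha})=\delta(u)f^{-\alpha}-\alpha u\,\delta(f)f^{-\alpha-1}$ for vector fields $\delta$. The line bundle $\mathcal{O}_{\mathbb{C}^*}$ with connection $u\mapsto(\partial_tu-\alpha u/t)dt$ and trivial Hodge filtration (jumping only in degree $0$) is a polarisable variation of $\mathbb{C}$-Hodge structure of weight $0$; it defines a pure complex Hodge module of weight $1$ on $\mathbb{C}^*$, whose pullback along $f|_U$ is a pure complex Hodge module $\underline{\mathbb{C}}_{U,-\alpha f}[n]$ of weight $n$ on $U$, with underlying left $\mathcal{D}_U$-module $\mathcal{O}_Uf^{-\alpha}$ and $F_k=\mathcal{O}_Uf^{-\alpha}$ for $k\ge0$, $F_k=0$ for $k<0$. The complex mixed Hodge module $M(f^{-\alpha}):=j_*\underline{\mathbb{C}}_{U,-\alpha f}[n]$ has underlying $\mathcal{D}_X$-module $\mathcal{M}(f^{-\alpha})$, which thereby carries a Hodge filtration $F^H_\bullet$ (by $\mathcal{O}_X$-submodules) and a finite weight filtration $W_\bullet$ (by $\mathcal{D}_X$-submodules), with lowest nonzero step $W_n$. Each $W_{n+l}\mathcal{M}(f^{-\alpha})$ carries the induced filtration $F^H_\bullet$. The case $\alpha\in\mathbb{Z}$ gives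 $\mathcal{O}_X( *f)$. Notation. A polynomial $g$ is homogeneous with respect to $w$ if $E(g)=\rho(g)g$ for some $\rho(g)\in\mathbb{Q}$. $\mathcal{O}^{>\gamma}\subseteq\mathcal{O}_X$ is the span (an ideal of $\mathcal{O}_X$) of the polynomials $g$ homogeneous with respect to $w$ with $\rho(g)>\gamma$. $F_\bullet\mathcal{D}_X$ is the order filtration, with $F_i\mathcal{D}_X=0$ for $i<0$. *)

theory Defs
  imports "HOL-Analysis.Analysis" "HOL-Library.Function_Algebras" "HOL-Library.Set_Algebras"
begin

section \<open>Polynomials on affine space\<close>

text \<open>
  The space \<open>X = \<complex>\<^sup>n\<close> is \<open>complex ^ 'n\<close>. It is affine, so algebraic \<open>\<O>\<^sub>X\<close>- and \<open>\<D>\<^sub>X\<close>-modules are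
  replaced by their modules of global sections.
\<close>

inductive_set polyfun :: "(complex ^ 'n \<Rightarrow> complex) set" where
  const: "(\<lambda>x. c) \<in> polyfun"
| coord: "(\<lambda>x. x $ i) \<in> polyfun"
| add: "p \<in> polyfun \<Longrightarrow> q \<in> polyfun \<Longrightarrow> (\<lambda>x. p x + q x) \<in> polyfun"
| mult: "p \<in> polyfun \<Longrightarrow> q \<in> polyfun \<Longrightarrow> (\<lambda>x. p x * q x) \<in> polyfun"

definition pd :: "'n \<Rightarrow> (complex ^ 'n \<Rightarrow> complex) \<Rightarrow> complex ^ 'n \<Rightarrow> complex" where
  "pd i u x = deriv (\<lambda>z. u (x + axis i z)) 0"

definition euler :: "rat ^ 'n \<Rightarrow> (complex ^ 'n \<Rightarrow> complex) \<Rightarrow> complex ^ 'n \<Rightarrow> complex" where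
  "euler w g x = (\<Sum>i\<in>UNIV. of_rat (w $ i) * x $ i * pd i g x)"

text \<open>The singular points of the hypersurface \<open>f = 0\<close>.\<close>

definition sing :: "(complex ^ 'n \<Rightarrow> complex) \<Rightarrow> (complex ^ 'n) set" where
  "sing f = {x. f x = 0 \<and> (\<forall>i. pd i f x = 0)}"

definition add_span :: "'a :: monoid_add set \<Rightarrow> 'a set" where
  "add_span S = {sum_list xs | xs. set xs \<subseteq> S}"

text \<open>
  \<open>\<O>\<^sup>>\<^sup>\<gamma>\<close>. The homogeneous polynomials of a given degree are closed under scalars, so the
  additive span is the \<open>\<complex>\<close>-linear span.
\<close>

definition O_gt :: "rat ^ 'n \<Rightarrow> rat \<Rightarrow> (complex ^ 'n \<Rightarrow> complex) set" where
  "O_gt w \<gamma> = add_span {g \<in> polyfun. \<exists>\<rho>>\<gamma>. euler w g = (\<lambda>x. of_rat \<rho> * g x)}"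


section \<open>The \<open>\<D>\<^sub>X\<close>-module \<open>\<M>(f\<^sup>-\<^sup>\<alpha>)\<close>\<close>

text \<open>
  The element \<open>u f\<^sup>-\<^sup>\<alpha>\<close> is represented by the regular function \<open>u\<close> on \<open>U = {f \<noteq> 0}\<close>, extended by
  \<open>0\<close> to \<open>X\<close>. The module depends on \<open>\<alpha>\<close> only through the action \<open>conn f \<alpha>\<close> of the vector fields.
\<close>

definition loc_elt ::
  "(complex ^ 'n \<Rightarrow> complex) \<Rightarrow> (complex ^ 'n \<Rightarrow> complex) \<Rightarrow> nat \<Rightarrow> complex ^ 'n \<Rightarrow> complex" where
  "loc_elt f g k x = (if f x = 0 then 0 else g x / f x ^ k)"

definition localization :: "(complex ^ 'n \<Rightarrow> complex) \<Rightarrow> (complex ^ 'n \<Rightarrow> complex) set" where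
  "localization f = {loc_elt f g k | g k. g \<in> polyfun}"

definition conn ::
  "(complex ^ 'n \<Rightarrow> complex) \<Rightarrow> rat \<Rightarrow> 'n \<Rightarrow> (complex ^ 'n \<Rightarrow> complex) \<Rightarrow> complex ^ 'n \<Rightarrow> complex" where
  "conn f \<alpha> i u x = (if f x = 0 then 0 else pd i u x - of_rat \<alpha> * u x * pd i f x / f x)"

definition DX_submodule ::
  "(complex ^ 'n \<Rightarrow> complex) \<Rightarrow> rat \<Rightarrow> (complex ^ 'n \<Rightarrow> complex) set \<Rightarrow> bool" where
  "DX_submodule f \<alpha> P \<longleftrightarrow> P \<subseteq> localization f \<and> 0 \<in> P \<and> (\<forall>u\<in>P. \<forall>v\<in>P. u + v \<in> P) \<and>
     (\<forall>g\<in>polyfun. \<forall>u\<in>P. g * u \<in> P) \<and> (\<forall>i. \<forall>u\<in>P. conn f \<alpha> i u \<in> P)"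

text \<open>
  \<open>F\<^sub>i\<D>\<^sub>X \<cdot> S\<close>: the operators of order at most \<open>i\<close> are the sums of \<open>g \<partial>\<^bsub>\<beta>1\<^esub> \<dots> \<partial>\<^bsub>\<beta>m\<^esub>\<close> with
  \<open>m \<le> i\<close>. For \<open>i < 0\<close> this is \<open>{0}\<close>.
\<close>

definition FD ::
  "(complex ^ 'n \<Rightarrow> complex) \<Rightarrow> rat \<Rightarrow> int \<Rightarrow> (complex ^ 'n \<Rightarrow> complex) set \<Rightarrow> (complex ^ 'n \<Rightarrow> complex) set"
  where
  "FD f \<alpha> i S =
     add_span {g * foldr (conn f \<alpha>) \<beta> u | g \<beta> u. g \<in> polyfun \<and> int (length \<beta>) \<le> i \<and> u \<in> S}"


section \<open>The direct image under the graph embedding\<close>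

text \<open>
  Let \<open>i\<^sub>f : X \<rightarrow> X \<times> \<complex>\<close>, \<open>x \<mapsto> (x, f x)\<close>, and let \<open>t\<close> be the last coordinate. The element
  \<open>\<Sum>\<^sub>j b\<^sub>j \<otimes> \<partial>\<^sub>t\<^sup>j \<delta>\<close> of \<open>i\<^bsub>f+\<^esub>P = P \<otimes> \<complex>[\<partial>\<^sub>t] \<delta>\<close> is the finitely supported sequence \<open>b\<close>. The actions are
  \<open>t (m \<partial>\<^sub>t\<^sup>j \<delta>) = f m \<partial>\<^sub>t\<^sup>j \<delta> - j m \<partial>\<^sub>t\<^sup>j\<^sup>-\<^sup>1 \<delta>\<close> and
  \<open>\<partial>\<^sub>i (m \<partial>\<^sub>t\<^sup>j \<delta>) = (\<partial>\<^sub>i m) \<partial>\<^sub>t\<^sup>j \<delta> - (\<partial>\<^sub>i f) m \<partial>\<^sub>t\<^sup>j\<^sup>+\<^sup>1 \<delta>\<close>.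
\<close>

type_synonym 'n graph_elt = "nat \<Rightarrow> complex ^ 'n \<Rightarrow> complex"

definition graph_module :: "(complex ^ 'n \<Rightarrow> complex) set \<Rightarrow> 'n graph_elt set" where
  "graph_module P = {b. (\<forall>j. b j \<in> P) \<and> finite {j. b j \<noteq> 0}}"

definition g_delta :: "(complex ^ 'n \<Rightarrow> complex) \<Rightarrow> 'n graph_elt" where
  "g_delta m = (\<lambda>j. if j = 0 then m else 0)"

definition g_mul :: "(complex ^ 'n \<Rightarrow> complex) \<Rightarrow> 'n graph_elt \<Rightarrow> 'n graph_elt" where
  "g_mul g b = (\<lambda>j. g * b j)"

definition g_t :: "(complex ^ 'n \<Rightarrow> complex) \<Rightarrow> 'n graph_elt \<Rightarrow> 'n graph_elt" where
  "g_t f b = (\<lambda>j x. f x * b j x - of_nat (Suc j) * b (Suc j) x)"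

definition g_dt :: "'n graph_elt \<Rightarrow> 'n graph_elt" where
  "g_dt b = (\<lambda>j. case j of 0 \<Rightarrow> 0 | Suc i \<Rightarrow> b i)"

definition g_dx ::
  "(complex ^ 'n \<Rightarrow> complex) \<Rightarrow> rat \<Rightarrow> 'n \<Rightarrow> 'n graph_elt \<Rightarrow> 'n graph_elt" where
  "g_dx f \<alpha> i b = (\<lambda>j. conn f \<alpha> i (b j) - (case j of 0 \<Rightarrow> 0 | Suc k \<Rightarrow> pd i f * b k))"

text \<open>\<open>\<partial>\<^sub>t t - a\<close>\<close>

definition g_dtt :: "(complex ^ 'n \<Rightarrow> complex) \<Rightarrow> rat \<Rightarrow> 'n graph_elt \<Rightarrow> 'n graph_elt" where
  "g_dtt f a b = g_dt (g_t f b) - g_mul (\<lambda>x. of_rat a) b"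


section \<open>The Kashiwara--Malgrange filtration along \<open>t = 0\<close>\<close>

text \<open>\<open>V\<^sup>0\<D>\<^bsub>X\<times>\<complex>\<^esub> = \<D>\<^sub>X[t, \<partial>\<^sub>t t]\<close>.\<close>

definition V0D_submodule ::
  "(complex ^ 'n \<Rightarrow> complex) \<Rightarrow> rat \<Rightarrow> 'n graph_elt set \<Rightarrow> bool" where
  "V0D_submodule f \<alpha> P \<longleftrightarrow> P \<subseteq> graph_module (localization f) \<and> 0 \<in> P \<and>
     (\<forall>b\<in>P. \<forall>c\<in>P. b + c \<in> P) \<and>
     (\<forall>g\<in>polyfun. \<forall>b\<in>P. g_mul g b \<in> P) \<and> (\<forall>i. \<forall>b\<in>P. g_dx f \<alpha> i b \<in> P) \<and>
     (\<forall>b\<in>P. g_t f b \<in> P) \<and> (\<forall>b\<in>P. g_dt (g_t f b) \<in> P)"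

definition V0D_fin_gen ::
  "(complex ^ 'n \<Rightarrow> complex) \<Rightarrow> rat \<Rightarrow> 'n graph_elt set \<Rightarrow> bool" where
  "V0D_fin_gen f \<alpha> P \<longleftrightarrow> V0D_submodule f \<alpha> P \<and>
     (\<exists>S\<subseteq>P. finite S \<and> (\<forall>Q. V0D_submodule f \<alpha> Q \<longrightarrow> S \<subseteq> Q \<longrightarrow> P \<subseteq> Q))"

definition V_gt :: "(rat \<Rightarrow> 'a set) \<Rightarrow> rat \<Rightarrow> 'a set" where
  "V_gt V a = (\<Union>b\<in>{a<..}. V b)"

text \<open>
  Decreasing rational indexing for left modules: \<open>\<partial>\<^sub>t t - a\<close> is nilpotent on \<open>gr\<^sub>V\<^sup>a\<close>. The third condition
  says that the filtration is discretely and left-continuously indexed.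
\<close>

definition KM_filtration ::
  "(complex ^ 'n \<Rightarrow> complex) \<Rightarrow> rat \<Rightarrow> (rat \<Rightarrow> 'n graph_elt set) \<Rightarrow> bool" where
  "KM_filtration f \<alpha> V \<longleftrightarrow>
     antimono V \<and> (\<Union>a. V a) = graph_module (localization f) \<and>
     (\<exists>l::nat. l > 0 \<and> (\<forall>a. V a = V (of_int \<lceil>of_nat l * a\<rceil> / of_nat l))) \<and>
     (\<forall>a. V0D_fin_gen f \<alpha> (V a)) \<and>
     (\<forall>a. g_t f ` V a \<subseteq> V (a + 1)) \<and> (\<forall>a>0. g_t f ` V a = V (a + 1)) \<and>
     (\<forall>a. g_dt ` V a \<subseteq> V (a - 1)) \<and>
     (\<forall>a. \<exists>r. \<forall>b\<in>V a. (g_dtt f a ^^ r) b \<in> V_gt V a)"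

definition V_filtration ::
  "(complex ^ 'n \<Rightarrow> complex) \<Rightarrow> rat \<Rightarrow> rat \<Rightarrow> 'n graph_elt set" where
  "V_filtration f \<alpha> = (THE V. KM_filtration f \<alpha> V)"

text \<open>
  Subspaces of \<open>gr\<^sub>V\<^sup>a\<close> are represented by subspaces between \<open>V\<^sup>>\<^sup>a\<close> and \<open>V\<^sup>a\<close>. For a \<open>\<D>\<^sub>X\<close>-submodule \<open>P\<close>,
  the V-filtration of \<open>i\<^bsub>f+\<^esub>P\<close> is the induced one, and \<open>gr_V f \<alpha> a P\<close> represents \<open>gr\<^sub>V\<^sup>a(i\<^bsub>f+\<^esub>P)\<close> as a
  submodule of \<open>gr\<^sub>V\<^sup>a\<close> of the full module. For \<open>a = 1\<close> it is the unipotent nearby cycles module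
  \<open>\<psi>\<^bsub>f,1\<^esub>P\<close>, for \<open>a = 0\<close> the vanishing cycles module \<open>\<phi>\<^bsub>f,1\<^esub>P\<close>.
\<close>

definition gr_V ::
  "(complex ^ 'n \<Rightarrow> complex) \<Rightarrow> rat \<Rightarrow> rat \<Rightarrow> (complex ^ 'n \<Rightarrow> complex) set \<Rightarrow> 'n graph_elt set" where
  "gr_V f \<alpha> a P = (V_filtration f \<alpha> a \<inter> graph_module P) + V_gt (V_filtration f \<alpha>) a"


section \<open>Relative monodromy filtration\<close>

text \<open>
  Deligne's definition, on the quotient \<open>A / B\<close> of which all subobjects are represented by their preimages
  in \<open>A\<close>: \<open>T M\<^sub>i \<subseteq> M\<^bsub>i-2\<^esub>\<close>, and \<open>T\<^sup>k : gr\<^sup>M\<^bsub>l+k\<^esub> gr\<^sup>L\<^sub>l \<rightarrow> gr\<^sup>M\<^bsub>l-k\<^esub> gr\<^sup>L\<^sub>l\<close> is bijective for \<open>k \<ge> 1\<close>.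
  Here \<open>gr\<^sup>M\<^sub>p gr\<^sup>L\<^sub>q\<close> is \<open>(M\<^sub>p \<inter> L\<^sub>q) / R p q\<close>.
\<close>

definition rel_monodromy_filtration ::
  "('a::ab_group_add set \<Rightarrow> bool) \<Rightarrow> 'a set \<Rightarrow> 'a set \<Rightarrow> ('a \<Rightarrow> 'a) \<Rightarrow> (int \<Rightarrow> 'a set) \<Rightarrow>
   (int \<Rightarrow> 'a set) \<Rightarrow> bool" where
  "rel_monodromy_filtration subobject A B T L M \<longleftrightarrow>
     (\<forall>k. subobject (M k) \<and> B \<subseteq> M k \<and> M k \<subseteq> A) \<and> mono M \<and> (\<exists>k. M k = B) \<and> (\<exists>k. M k = A) \<and>
     (\<forall>k. T ` M k \<subseteq> M (k - 2)) \<and>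
     (let R = (\<lambda>p q. M (p - 1) \<inter> L q + M p \<inter> L (q - 1)) in
       \<forall>l. \<forall>k::nat. k \<ge> 1 \<longrightarrow>
         (\<forall>x \<in> M (l + int k) \<inter> L l. (T ^^ k) x \<in> R (l - int k) l \<longrightarrow> x \<in> R (l + int k) l) \<and>
         M (l - int k) \<inter> L l \<subseteq> (T ^^ k) ` (M (l + int k) \<inter> L l) + R (l - int k) l)"


section \<open>Hodge and weight filtration of the open direct image\<close>

text \<open>
  Let \<open>(FU, WU)\<close> be the Hodge and weight filtrations of a mixed Hodge module on \<open>U\<close> with underlying module
  \<open>\<O>\<^sub>U f\<^sup>-\<^sup>\<alpha>\<close>, given by sections over \<open>U\<close>. The definitions below are those of the two filtrations of its
  direct image under \<open>j : U \<rightarrow> X\<close> (M. Saito, Mixed Hodge modules; Sabbah--Schnell, The MHM project, localization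
  along a divisor). The Hodge filtration on \<open>N = i\<^bsub>f+\<^esub>j\<^sub>*\<O>\<^sub>U f\<^sup>-\<^sup>\<alpha>\<close> is
  \<open>F\<^sub>k N = \<Sum>\<^sub>i \<partial>\<^sub>t\<^sup>i (V\<^sup>0 N \<inter> j\<^sub>*F\<^bsub>k-i\<^esub>)\<close>, and on \<open>\<M>(f\<^sup>-\<^sup>\<alpha>)\<close> it is read off from
  \<open>F\<^sub>k N = \<Sum>\<^sub>j F\<^bsub>k-j\<^esub>\<M>(f\<^sup>-\<^sup>\<alpha>) \<otimes> \<partial>\<^sub>t\<^sup>j \<delta>\<close>.
\<close>

definition graph_F ::
  "(complex ^ 'n \<Rightarrow> complex) \<Rightarrow> (int \<Rightarrow> (complex ^ 'n \<Rightarrow> complex) set) \<Rightarrow> int \<Rightarrow> 'n graph_elt set" where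
  "graph_F f FU k = {b \<in> graph_module (localization f). \<forall>j. b j \<in> FU (k - int j)}"

definition direct_image_F ::
  "(complex ^ 'n \<Rightarrow> complex) \<Rightarrow> rat \<Rightarrow> (int \<Rightarrow> (complex ^ 'n \<Rightarrow> complex) set) \<Rightarrow>
   int \<Rightarrow> (complex ^ 'n \<Rightarrow> complex) set" where
  "direct_image_F f \<alpha> FU k = {m \<in> localization f.
     g_delta m \<in> add_span (\<Union>i::nat. (g_dt ^^ i) ` (V_filtration f \<alpha> 0 \<inter> graph_F f FU (k - int i)))}"

text \<open>
  The weight filtration of \<open>j\<^sub>*\<close> is the finite filtration by \<open>\<D>\<^sub>X\<close>-submodules that restricts to \<open>WU\<close> and for
  which \<open>var = t : \<phi>\<^bsub>f,1\<^esub> \<rightarrow> \<psi>\<^bsub>f,1\<^esub>(-1)\<close> is an isomorphism of filtered modules. Here \<open>\<psi>\<^bsub>f,1\<^esub>\<close> and \<open>\<phi>\<^bsub>f,1\<^esub>\<close> carry the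
  monodromy filtrations relative to \<open>\<psi>\<^bsub>f,1\<^esub>W\<^bsub>\<bullet>+1\<^esub>\<close> and \<open>\<phi>\<^bsub>f,1\<^esub>W\<^sub>\<bullet>\<close>, which admissibility requires to
  exist, and the Tate twist raises weights by \<open>2\<close>.
\<close>

definition direct_image_weights ::
  "(complex ^ 'n \<Rightarrow> complex) \<Rightarrow> rat \<Rightarrow> (int \<Rightarrow> (complex ^ 'n \<Rightarrow> complex) set) \<Rightarrow>
   (int \<Rightarrow> (complex ^ 'n \<Rightarrow> complex) set) \<Rightarrow> bool" where
  "direct_image_weights f \<alpha> WU W \<longleftrightarrow>
     (\<forall>k. DX_submodule f \<alpha> (W k)) \<and> mono W \<and> (\<exists>k. W k = {0}) \<and> (\<exists>k. W k = localization f) \<and>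
     (\<forall>k. {u \<in> localization f. \<exists>r::nat. f ^ r * u \<in> W k} = WU k) \<and>
     (\<exists>M\<psi> M\<phi>.
        rel_monodromy_filtration (V0D_submodule f \<alpha>)
          (V_filtration f \<alpha> 1) (V_gt (V_filtration f \<alpha>) 1) (g_dtt f 1)
          (\<lambda>k. gr_V f \<alpha> 1 (W (k + 1))) M\<psi> \<and>
        rel_monodromy_filtration (V0D_submodule f \<alpha>)
          (V_filtration f \<alpha> 0) (V_gt (V_filtration f \<alpha>) 0) (g_dtt f 0)
          (\<lambda>k. gr_V f \<alpha> 0 (W k)) M\<phi> \<and>
        (\<forall>k. \<forall>b \<in> V_filtration f \<alpha> 0. b \<in> M\<phi> k \<longleftrightarrow> g_t f b \<in> M\<psi> (k - 2)))"

definition direct_image_W ::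
  "(complex ^ 'n \<Rightarrow> complex) \<Rightarrow> rat \<Rightarrow> (int \<Rightarrow> (complex ^ 'n \<Rightarrow> complex) set) \<Rightarrow>
   int \<Rightarrow> (complex ^ 'n \<Rightarrow> complex) set" where
  "direct_image_W f \<alpha> WU = (THE W. direct_image_weights f \<alpha> WU W)"

text \<open>
  The pure Hodge module of weight \<open>n\<close> on \<open>U\<close> defined by \<open>\<O>\<^sub>U f\<^sup>-\<^sup>\<alpha>\<close>, and the filtrations of \<open>M(f\<^sup>-\<^sup>\<alpha>)\<close>.
\<close>

definition F_on_U :: "(complex ^ 'n \<Rightarrow> complex) \<Rightarrow> int \<Rightarrow> (complex ^ 'n \<Rightarrow> complex) set" where
  "F_on_U f k = (if k \<ge> 0 then localization f else {0})"

definition W_on_U :: "(complex ^ 'n \<Rightarrow> complex) \<Rightarrow> int \<Rightarrow> (complex ^ 'n \<Rightarrow> complex) set" where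
  "W_on_U f k = (if k \<ge> int CARD('n) then localization f else {0})"

definition hodge_F ::
  "(complex ^ 'n \<Rightarrow> complex) \<Rightarrow> rat \<Rightarrow> int \<Rightarrow> (complex ^ 'n \<Rightarrow> complex) set" where
  "hodge_F f \<alpha> = direct_image_F f \<alpha> (F_on_U f)"

definition weight_W ::
  "(complex ^ 'n \<Rightarrow> complex) \<Rightarrow> rat \<Rightarrow> int \<Rightarrow> (complex ^ 'n \<Rightarrow> complex) set" where
  "weight_W f \<alpha> = direct_image_W f \<alpha> (W_on_U f)"

end

theory Submission
  imports Defs "HOL-Library.Poly_Mapping" "HOL-Computational_Algebra.Fundamental_Theorem_Algebra"
begin

text \<open>
  Let \<open>\<alpha>' = \<alpha> + e \<in> (0, 1]\<close> with \<open>e \<in> {0, 1}\<close>. The elements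
  \<open>c\<^sub>j = \<Sum>\<^sub>i (j choose i) (\<alpha>')\<^bsub>j-i\<^esub> f\<^bsup>-(j-i)-e\<^esup> \<partial>\<^sub>t\<^sup>i \<delta>\<close> of the graph module satisfy
  \<open>\<partial>\<^sub>i c\<^sub>j = - f\<^sub>i c\<^sub>j\<^sub>+\<^sub>1\<close>, where \<open>f\<^sub>i = \<partial>\<^sub>i f\<close>. By Euler's identity, \<open>x\<^sup>\<gamma> c\<^sub>j\<close> is an eigenvector of
  \<open>\<partial>\<^sub>t t\<close>, with eigenvalue \<open>\<kappa> = w \<cdot> \<gamma> + |w| - j - \<alpha>'\<close>, up to terms of higher weight. Hence for \<open>a\<close> in
  \<open>(-\<alpha>', 1 - \<alpha>']\<close> the \<open>\<D>\<^sub>X\<close>-module generated by the \<open>x\<^sup>\<gamma> c\<^sub>j\<close> with \<open>\<kappa> \<ge> a\<close> is \<open>V\<^sup>a\<close>, and the other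
  steps are obtained by powers of \<open>t\<close>. Finite generation holds because the Jacobian ideal is primary to the
  origin.

  As \<open>(\<partial>\<^sub>t t)\<^sup>2 = 0\<close> on \<open>gr\<^sub>V\<^sup>0\<close>, the weight filtration is given by the image and the kernel of \<open>\<partial>\<^sub>t t\<close> there,
  and in both cases \<open>V\<^sup>0\<close> of the submodule in question consists of the part \<open>\<kappa> > 0\<close>. The
  Hodge filtration of the submodule is obtained from the elements of this part of bounded order in
  \<open>\<partial>\<^sub>t\<close>, so it has to be shown that these have generators of bounded order. The top coefficient of a
  combination of the \<open>\<partial>\<^sup>\<beta> x\<^sup>\<gamma> c\<^sub>j\<close> is a polynomial in \<open>x\<close> and \<open>Y\<close>, evaluated at \<open>Y = - grad f\<close>. If it vanishes,
  the polynomial is \<open>\<Sum>\<^sub>i (Y\<^sub>i + f\<^sub>i) H\<^sub>i\<close>, with control of the weights because the first Koszul homology of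
  the \<open>f\<^sub>i\<close> is zero, and the relation \<open>\<partial>\<^sub>i c\<^sub>j = - f\<^sub>i c\<^sub>j\<^sub>+\<^sub>1\<close> lowers the order.
\<close>

section \<open>Polynomials\<close>

text \<open>Formally \<open>c\<^sub>j\<close> is \<open>t\<close> to the power -\<alpha>' times
  \<open>\<partial>\<^sub>t\<^sup>j \<delta>\<close>: commuting that power past
  \<open>\<partial>\<^sub>t\<^sup>j\<close> produces the binomial coefficients and rising
  factorials. The rules for \<open>c\<^sub>j\<close> are those for
  \<open>\<partial>\<^sub>t\<^sup>j \<delta>\<close> over the structure sheaf, twisted. In
  particular \<open>\<partial>\<^sub>t t - (1 - \<alpha>')\<close> maps \<open>c\<^sub>j\<close> to
  \<open>t c\<^sub>j\<^sub>+\<^sub>1\<close>, trading weight for a power of \<open>t\<close>. This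
  singles out the half-open window of length one ending at 1 - \<alpha>': inside it one factor
  \<open>\<partial>\<^sub>t t - a\<close> reaches the next step of V, at its upper end a second
  factor is used. For \<alpha> in (0,1) the index 0 is inside and
  \<open>\<partial>\<^sub>t t\<close> vanishes on \<open>gr\<^sub>V\<^sup>0\<close>; for \<alpha> =
  0 it is the upper end. Hence the two cases of the theorem. Orders are strict for the same indices:
  a Koszul correction of maximal order would violate the weight bound. The V-filtration and the
  weight filtration are defined by unique existence, so uniqueness has to be derived from the
  axioms. A submodule is determined by its part in \<open>V\<^sup>0\<close>, which turns weights
  into a computation on \<open>gr\<^sub>V\<^sup>0\<close>.\<close>

type_synonym 'v mpol = "('v \<Rightarrow> nat) \<Rightarrow>\<^sub>0 complex"

abbreviation "coef \<equiv> Poly_Mapping.lookup"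
abbreviation "mon \<equiv> Poly_Mapping.single"
abbreviation "supp \<equiv> Poly_Mapping.keys"

text \<open>Additive extension from monomials. Evaluation, differentiation, the embedding
  \<open>emb\<close> and the later lift of symbols are all given in this form.\<close>

definition lin_ext :: "('k \<Rightarrow> 'b \<Rightarrow> 'a::comm_monoid_add) \<Rightarrow> ('k \<Rightarrow>\<^sub>0 'b::zero) \<Rightarrow> 'a" where
  "lin_ext \<phi> p = (\<Sum>k\<in>supp p. \<phi> k (coef p k))"

lemma lin_ext_superset:
  assumes "finite K" "supp p \<subseteq> K" "\<And>k. \<phi> k 0 = 0"
  shows "lin_ext \<phi> p = (\<Sum>k\<in>K. \<phi> k (coef p k))"
  unfolding lin_ext_def
  by (rule sum.mono_neutral_left) (use assms in \<open>auto simp: in_keys_iff\<close>)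

lemma lin_ext_zero [simp]: "lin_ext \<phi> 0 = 0"
  by (simp add: lin_ext_def)

lemma lin_ext_single: "(\<And>k. \<phi> k 0 = 0) \<Longrightarrow> lin_ext \<phi> (mon k c) = \<phi> k c"
  by (simp add: lin_ext_def)

lemma lin_ext_add:
  fixes p q :: "'k \<Rightarrow>\<^sub>0 'b::monoid_add"
  assumes "\<And>k. \<phi> k 0 = 0" "\<And>k a b. \<phi> k (a + b) = \<phi> k a + \<phi> k b"
  shows "lin_ext \<phi> (p + q) = lin_ext \<phi> p + lin_ext \<phi> q"
proof -
  let ?K = "supp p \<union> supp q"
  have "lin_ext \<phi> r = (\<Sum>k\<in>?K. \<phi> k (coef r k))" if "supp r \<subseteq> ?K" for r
    by (rule lin_ext_superset) (use that assms in auto)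
  then show ?thesis
    by (simp add: keys_add lookup_add assms sum.distrib)
qed

lemma mpol_sum_mon:
  fixes p :: "'k \<Rightarrow>\<^sub>0 'b::comm_monoid_add"
  shows "p = (\<Sum>k\<in>supp p. mon k (coef p k))"
  by (rule poly_mapping_eqI)
     (simp add: lookup_sum lookup_single when_def in_keys_iff)

text \<open>A condition on the exponents is kept through the induction; bounds on weights and
  degrees of whole polynomials are exploited in this way.\<close>

lemma mpol_induct_supp [consumes 1, case_names zero mon add]:
  fixes p :: "'k \<Rightarrow>\<^sub>0 'b::comm_monoid_add"
  assumes "supp p \<subseteq> K" "P 0" "\<And>k c. k \<in> K \<Longrightarrow> P (mon k c)"
    and "\<And>p q. P p \<Longrightarrow> P q \<Longrightarrow> P (p + q)"
  shows "P p"
proof -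
  have "P (\<Sum>k\<in>A. mon k (coef p k))" if "finite A" "A \<subseteq> K" for A
    using that by (induction A rule: finite_induct) (auto intro: assms)
  from this[of "supp p"] show ?thesis
    using assms(1) mpol_sum_mon[of p] by simp
qed

lemmas mpol_induct [case_names zero mon add] = mpol_induct_supp[OF subset_UNIV, simplified]

section \<open>Evaluation, and polynomial functions as evaluated polynomials\<close>

definition ev :: "('v::finite \<Rightarrow> complex) \<Rightarrow> 'v mpol \<Rightarrow> complex" where
  "ev x = lin_ext (\<lambda>\<kappa> c. c * (\<Prod>i\<in>UNIV. x i ^ \<kappa> i))"

lemma ev_add [simp]: "ev x (p + q) = ev x p + ev x q"
  unfolding ev_def by (rule lin_ext_add) (auto simp: algebra_simps)

lemma ev_zero [simp]: "ev x 0 = 0"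
  by (simp add: ev_def)

lemma ev_single: "ev x (mon k c) = c * (\<Prod>i\<in>UNIV. x i ^ k i)"
  by (simp add: ev_def lin_ext_single)

lemma ev_mult [simp]: "ev x (p * q) = ev x p * ev x q"
proof (induction p rule: mpol_induct)
  case (mon k c)
  show ?case
  proof (induction q rule: mpol_induct)
    case (mon l d)
    show ?case
      by (simp add: mult_single ev_single power_add prod.distrib)
  qed (auto simp: algebra_simps)
qed (auto simp: algebra_simps)

lemma ev_uminus [simp]: "ev x (- p) = - ev x p"
  using ev_add[of x p "- p"] by (simp add: add_eq_0_iff)

lemma ev_diff [simp]: "ev x (p - q) = ev x p - ev x q"
  using ev_add[of x p "- q"] by simp

lemma ev_sum [simp]: "ev x (\<Sum>a\<in>A. g a) = (\<Sum>a\<in>A. ev x (g a))"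
  by (induction A rule: infinite_finite_induct) auto

lemma ev_one [simp]: "ev x 1 = 1"
  using ev_single[of x 0 1] by simp

lemma ev_power [simp]: "ev x (p ^ m) = ev x p ^ m"
  by (induction m) auto

lemma ev_const [simp]: "ev x (mon 0 c) = c"
  by (simp add: ev_single)

lemma ev_const' [simp]: "ev x (mon (\<lambda>_. 0) c) = c"
  using ev_const[of x c] by (simp only: zero_fun_def)

definition unit :: "'v \<Rightarrow> 'v \<Rightarrow> nat" where
  "unit i = (\<lambda>j. if j = i then 1 else 0)"

lemma unit_apply: "unit i j = (if j = i then 1 else 0)"
  by (simp add: unit_def)

definition var :: "'v \<Rightarrow> 'v mpol" where
  "var i = mon (unit i) 1"

lemma prod_unit: "(\<Prod>j\<in>UNIV. x j ^ unit i j) = (x (i::'v::finite)::complex)"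
proof -
  have "(\<Prod>j\<in>UNIV. x j ^ unit i j) = (\<Prod>j\<in>UNIV. if j = i then x j else 1)"
    by (rule prod.cong) (auto simp: unit_def)
  then show ?thesis by simp
qed

lemma ev_var [simp]: "ev x (var i) = x i"
  by (simp add: var_def ev_single prod_unit)

definition peval :: "'v::finite mpol \<Rightarrow> complex ^ 'v \<Rightarrow> complex" where
  "peval p = (\<lambda>z. ev (\<lambda>i. z $ i) p)"

lemma peval_simps:
  "peval (p + q) = peval p + peval q" "peval (p * q) = peval p * peval q"
  "peval (p - q) = peval p - peval q" "peval (- p) = - peval p"
  "peval 0 = 0" "peval 1 = 1" "peval (mon 0 c) = (\<lambda>x. c)" "peval (var i) = (\<lambda>x. x $ i)"
  by (auto simp: peval_def fun_eq_iff)

lemma peval_sum: "peval (\<Sum>a\<in>A. g a) = (\<Sum>a\<in>A. peval (g a))"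
  by (induction A rule: infinite_finite_induct) (auto simp: peval_simps)

lemma polyfun_add: "p \<in> polyfun \<Longrightarrow> q \<in> polyfun \<Longrightarrow> p + q \<in> polyfun"
  by (auto simp: plus_fun_def intro: polyfun.add)

lemma polyfun_mult: "p \<in> polyfun \<Longrightarrow> q \<in> polyfun \<Longrightarrow> p * q \<in> polyfun"
  by (auto simp: times_fun_def intro: polyfun.mult)

lemma polyfun_const: "(\<lambda>x. c) \<in> polyfun" "0 \<in> polyfun" "1 \<in> polyfun"
  by (auto simp: zero_fun_def one_fun_def intro: polyfun.const)

lemma polyfun_uminus: "p \<in> polyfun \<Longrightarrow> - p \<in> polyfun"
  using polyfun_mult[OF polyfun_const(1)[of "-1"], of p] by (simp add: times_fun_def fun_Compl_def)

lemma polyfun_diff: "p \<in> polyfun \<Longrightarrow> q \<in> polyfun \<Longrightarrow> p - q \<in> polyfun"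
  using polyfun_add[of p "- q"] polyfun_uminus[of q] by simp

lemma polyfun_power: "p \<in> polyfun \<Longrightarrow> p ^ k \<in> polyfun"
  by (induction k) (auto intro: polyfun_const polyfun_mult)

lemma polyfun_prod: "(\<And>a. a \<in> A \<Longrightarrow> g a \<in> polyfun) \<Longrightarrow> (\<lambda>x. \<Prod>a\<in>A. g a x) \<in> polyfun"
  by (induction A rule: infinite_finite_induct) (auto intro: polyfun.intros)

lemma polyfun_power': "p \<in> polyfun \<Longrightarrow> (\<lambda>x. p x ^ k) \<in> polyfun"
  by (induction k) (auto intro: polyfun.intros)

lemma peval_polyfun: "peval p \<in> polyfun"
proof (induction p rule: mpol_induct)
  case (mon k c)
  show ?case unfolding peval_def ev_single
    by (intro polyfun.mult polyfun.const polyfun_prod polyfun_power' polyfun.coord)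
qed (auto simp only: peval_simps intro: polyfun_const polyfun_add)

lemma polyfun_iff_peval: "g \<in> polyfun \<longleftrightarrow> (\<exists>p. g = peval p)"
proof
  assume "g \<in> polyfun"
  then show "\<exists>p. g = peval p"
  proof induction
    case (add p q)
    then obtain a b where "p = peval a" "q = peval b" by auto
    then have "(\<lambda>x. p x + q x) = peval (a + b)" by (auto simp: peval_simps)
    then show ?case by blast
  next
    case (mult p q)
    then obtain a b where "p = peval a" "q = peval b" by auto
    then have "(\<lambda>x. p x * q x) = peval (a * b)" by (auto simp: peval_simps)
    then show ?case by blast
  qed (metis peval_simps(7), metis peval_simps(8))
qed (auto intro: peval_polyfun)

section \<open>Partial derivatives of functions and of polynomials\<close>

lemma polyfun_has_pd:
  assumes "g \<in> polyfun"
  shows "((\<lambda>z. g (x + axis i z)) has_field_derivative pd i g x) (at 0)"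
proof -
  have "(\<lambda>z. g (x + axis i z)) field_differentiable at 0"
    using assms
  proof induction
    case (coord j)
    have "(\<lambda>z. (x + axis i z) $ j) = (\<lambda>z. x $ j + (if j = i then z else 0))"
      by (auto simp: axis_def)
    then show ?case
      by (cases "j = i") (auto intro!: derivative_intros field_differentiable_add)
  qed (auto intro: field_differentiable_add field_differentiable_mult)
  then show ?thesis
    unfolding pd_def by (simp add: DERIV_deriv_iff_field_differentiable)
qed

lemma axis_zero [simp]: "axis i 0 = (0 :: complex ^ 'n)"
  by (simp add: vec_eq_iff axis_def)

lemma pd_eqI: "((\<lambda>z. g (x + axis i z)) has_field_derivative D) (at 0) \<Longrightarrow> pd i g x = D"
  unfolding pd_def by (rule DERIV_imp_deriv)

lemma pd_const [simp]: "pd i (\<lambda>x. c) = (\<lambda>x. 0)"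
  by (rule ext, rule pd_eqI) auto

lemma pd_zero [simp]: "pd i 0 = 0"
  by (simp add: zero_fun_def)

lemma pd_coord: "pd i (\<lambda>x. x $ j) = (\<lambda>x. if i = j then 1 else 0)"
proof (rule ext, rule pd_eqI)
  fix x :: "complex ^ 'a"
  have "(\<lambda>z. (x + axis i z) $ j) = (\<lambda>z. x $ j + (if i = j then z else 0))"
    by (auto simp: axis_def)
  then show "((\<lambda>z. (x + axis i z) $ j) has_field_derivative (if i = j then 1 else 0)) (at 0)"
    by (auto intro!: derivative_eq_intros)
qed

lemma pd_add:
  assumes "g \<in> polyfun" "h \<in> polyfun"
  shows "pd i (g + h) = pd i g + pd i h"
  by (rule ext, rule pd_eqI)
     (auto intro!: derivative_eq_intros polyfun_has_pd assms)

lemma pd_mult: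
  assumes "g \<in> polyfun" "h \<in> polyfun"
  shows "pd i (g * h) = pd i g * h + g * pd i h"
  by (rule ext, rule pd_eqI)
     (auto intro!: derivative_eq_intros polyfun_has_pd assms)

lemma pd_polyfun:
  assumes "g \<in> polyfun"
  shows "pd i g \<in> polyfun"
  using assms
proof induction
  case (add p q)
  then show ?case using pd_add[of p q i] by (simp add: plus_fun_def polyfun.add)
next
  case (mult p q)
  have "pd i (p * q) \<in> polyfun"
    unfolding pd_mult[OF mult(1,2)] by (intro polyfun_add polyfun_mult mult)
  then show ?case by (simp add: times_fun_def)
qed (auto simp: pd_coord intro: polyfun.const)

lemma pd_commute:
  assumes "g \<in> polyfun"
  shows "pd i (pd j g) = pd j (pd i g)"
  using assms
proof induction
  case (add p q)
  have "pd i (pd j (p + q)) = pd j (pd i (p + q))"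
    by (simp add: pd_add add pd_polyfun)
  then show ?case by (simp add: plus_fun_def)
next
  case (mult p q)
  have "pd i (pd j (p * q)) = pd j (pd i (p * q))"
    by (simp add: pd_mult pd_add mult pd_polyfun polyfun_mult algebra_simps)
  then show ?case by (simp add: times_fun_def)
qed (auto simp: pd_coord)

lemma pd_uminus: "g \<in> polyfun \<Longrightarrow> pd i (- g) = - pd i g"
  using pd_add[of g "- g" i] by (simp add: polyfun_uminus eq_neg_iff_add_eq_0 add.commute)

definition dv :: "'v \<Rightarrow> 'v mpol \<Rightarrow> 'v mpol" where
  "dv i = lin_ext (\<lambda>\<kappa> c. mon (\<kappa> - unit i) (of_nat (\<kappa> i) * c))"

lemma dv_zero [simp]: "dv i 0 = 0"
  by (simp add: dv_def)

lemma dv_add: "dv i (p + q) = dv i p + dv i q"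
  unfolding dv_def by (rule lin_ext_add) (auto simp: single_add distrib_left)

lemma dv_single: "dv i (mon \<kappa> c) = mon (\<kappa> - unit i) (of_nat (\<kappa> i) * c)"
  unfolding dv_def by (rule lin_ext_single) auto

lemma coef_dv: "coef (dv i p) \<kappa> = of_nat (Suc (\<kappa> i)) * coef p (\<kappa> + unit i)"
proof (induction p rule: mpol_induct)
  case (mon k c)
  \<comment> \<open>Subtraction of exponents is truncated, so the shift by \<open>unit i\<close> can
    be inverted only if \<open>k i \<noteq> 0\<close>; otherwise the factor
    \<open>of_nat (k i)\<close> is zero.\<close>
  have "k - unit i = \<kappa> \<longleftrightarrow> k = \<kappa> + unit i" if "k i \<noteq> 0"
  proof
    assume "k - unit i = \<kappa>"
    then have "\<forall>j. \<kappa> j = k j - unit i j" by auto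
    then show "k = \<kappa> + unit i" using that
      by (auto simp: fun_eq_iff unit_def)
  qed (auto simp: fun_eq_iff)
  moreover have "k = \<kappa> + unit i \<Longrightarrow> k i = Suc (\<kappa> i)"
    by (simp add: unit_def)
  ultimately have "k i \<noteq> 0 \<and> k - unit i = \<kappa> \<longleftrightarrow> k = \<kappa> + unit i" "k = \<kappa> + unit i \<Longrightarrow> k i = Suc (\<kappa> i)"
    by auto
  then show ?case
    unfolding dv_single lookup_single when_def by (smt (verit) mult_zero_left mult_zero_right of_nat_0)
qed (auto simp: dv_add lookup_add distrib_left)

lemma pd_peval: "pd i (peval p) = peval (dv i p)"
proof (induction p rule: mpol_induct)
  case zero
  then show ?case by (simp add: peval_simps)
next
  case (add p q)
  then show ?case by (simp only: peval_simps dv_add pd_add peval_polyfun)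
next
  case (mon k c)
  show ?case
  proof (rule ext, rule pd_eqI)
    fix x :: "complex ^ 'a"
    let ?r = "\<Prod>j\<in>UNIV - {i}. x $ j ^ k j"
    have *: "peval (mon k c) (x + axis i z) = c * ((x $ i + z) ^ k i * ?r)" for z
    proof -
      have "(\<Prod>j\<in>UNIV. (x + axis i z) $ j ^ k j)
          = (x + axis i z) $ i ^ k i * (\<Prod>j\<in>UNIV - {i}. (x + axis i z) $ j ^ k j)"
        by (rule prod.remove) auto
      also have "(\<Prod>j\<in>UNIV - {i}. (x + axis i z) $ j ^ k j) = ?r"
        by (rule prod.cong) (auto simp: axis_def)
      finally show ?thesis by (simp add: peval_def ev_single axis_def)
    qed
    have **: "peval (dv i (mon k c)) x = c * (of_nat (k i) * x $ i ^ (k i - 1) * ?r)"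
    proof -
      have "(\<Prod>j\<in>UNIV. x $ j ^ (k - unit i) j)
          = x $ i ^ (k - unit i) i * (\<Prod>j\<in>UNIV - {i}. x $ j ^ (k - unit i) j)"
        by (rule prod.remove) auto
      also have "(\<Prod>j\<in>UNIV - {i}. x $ j ^ (k - unit i) j) = ?r"
        by (rule prod.cong) (auto simp: unit_def)
      finally show ?thesis by (simp add: peval_def ev_single dv_single unit_def)
    qed
    show "((\<lambda>z. peval (mon k c) (x + axis i z)) has_field_derivative
        peval (dv i (mon k c)) x) (at 0)"
      unfolding * ** by (auto intro!: derivative_eq_intros)
  qed
qed

text \<open>Induction on a bound for the total degree: the derivatives of a vanishing function
  vanish, hence are zero polynomials, and in characteristic zero this leaves a constant.\<close>

lemma peval_eq_0:
  fixes p :: "'v::finite mpol"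
  assumes "peval p = 0"
  shows "p = 0"
proof -
  have "\<forall>p :: 'v mpol. (\<forall>\<kappa>\<in>supp p. sum \<kappa> UNIV \<le> d) \<longrightarrow> peval p = 0 \<longrightarrow> p = 0" for d
  proof (induction d)
    case 0
    show ?case
    proof safe
      fix p :: "'v mpol" assume k: "\<forall>\<kappa>\<in>supp p. sum \<kappa> UNIV \<le> 0" and e: "peval p = 0"
      have "supp p \<subseteq> {0}" using k by (auto simp: fun_eq_iff)
      then have "p = mon 0 (coef p 0)"
        by (intro poly_mapping_eqI) (auto simp: lookup_single when_def in_keys_iff)
      moreover from this have "coef p 0 = 0"
        using e by (metis peval_simps(7) zero_fun_apply)
      ultimately show "p = 0" by simp
    qed
  next
    case (Suc d)
    show ?case
    proof safe
      fix p :: "'v mpol" assume k: "\<forall>\<kappa>\<in>supp p. sum \<kappa> UNIV \<le> Suc d" and e: "peval p = 0"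
      have dv0: "dv i p = 0" for i
      proof -
        have "peval (dv i p) = 0" using e by (simp flip: pd_peval)
        moreover have "\<forall>\<kappa>\<in>supp (dv i p). sum \<kappa> UNIV \<le> d"
        proof
          fix \<kappa> assume "\<kappa> \<in> supp (dv i p)"
          then have "\<kappa> + unit i \<in> supp p" by (simp add: in_keys_iff coef_dv)
          then have "sum (\<kappa> + unit i) UNIV \<le> Suc d" using k by auto
          moreover have "sum (\<kappa> + unit i) UNIV = sum \<kappa> UNIV + 1"
            by (simp add: sum.distrib unit_def)
          ultimately show "sum \<kappa> UNIV \<le> d" by simp
        qed
        ultimately show ?thesis using Suc by blast
      qed
      have "\<kappa> = 0" if "\<kappa> \<in> supp p" for \<kappa>
      proof (rule ccontr)
        assume "\<kappa> \<noteq> 0"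
        then obtain i where i: "\<kappa> i \<noteq> 0" by (auto simp: fun_eq_iff)
        have "\<kappa> = (\<kappa> - unit i) + unit i" using i by (auto simp: fun_eq_iff unit_def)
        then have "coef (dv i p) (\<kappa> - unit i) \<noteq> 0"
          using that by (metis coef_dv in_keys_iff mult_eq_0_iff of_nat_eq_0_iff nat.distinct(1))
        then show False using dv0 by simp
      qed
      then have "supp p \<subseteq> {0}" by auto
      then have "p = mon 0 (coef p 0)"
        by (intro poly_mapping_eqI) (auto simp: lookup_single when_def in_keys_iff)
      moreover from this have "coef p 0 = 0"
        using e by (metis peval_simps(7) zero_fun_apply)
      ultimately show "p = 0" by simp
    qed
  qed
  from this[of "\<Sum>\<kappa>\<in>supp p. sum \<kappa> UNIV"] show ?thesis
    using assms by (meson finite_keys member_le_sum zero_le)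
qed

lemma peval_inj: "peval p = peval q \<Longrightarrow> p = q"
  using peval_eq_0[of "p - q"] by (simp add: peval_simps)

section \<open>Homogeneous parts by restriction of the support\<close>

lemma supp_diff: "supp (p - q :: 'a \<Rightarrow>\<^sub>0 'b::ab_group_add) \<subseteq> supp p \<union> supp q"
  by (auto simp: in_keys_iff lookup_minus)

lemma supp_sum: "supp (\<Sum>a\<in>A. g a :: 'a \<Rightarrow>\<^sub>0 'b::ab_group_add) \<subseteq> (\<Union>a\<in>A. supp (g a))"
proof (induction A rule: infinite_finite_induct)
  case (insert a A)
  then show ?case using keys_add[of "g a" "\<Sum>a\<in>A. g a"] by auto
qed auto

definition restr :: "('k \<Rightarrow> bool) \<Rightarrow> ('k \<Rightarrow>\<^sub>0 'b::comm_monoid_add) \<Rightarrow> 'k \<Rightarrow>\<^sub>0 'b" where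
  "restr Q p = (\<Sum>k\<in>{k \<in> supp p. Q k}. mon k (coef p k))"

lemma coef_restr: "coef (restr Q p) k = (if Q k then coef p k else 0)"
  unfolding restr_def by (auto simp: lookup_sum lookup_single when_def in_keys_iff)

lemma supp_restr: "supp (restr Q p) = {k \<in> supp p. Q k}"
  by (auto simp: in_keys_iff coef_restr split: if_splits)

lemma restr_add: "restr Q (p + q) = restr Q p + restr Q q"
  by (rule poly_mapping_eqI) (auto simp: coef_restr lookup_add)

lemma restr_sum: "restr Q (\<Sum>a\<in>A. g a) = (\<Sum>a\<in>A. restr Q (g a))"
  by (rule poly_mapping_eqI) (auto simp: coef_restr lookup_sum)

lemma restr_split: "p = restr Q p + restr (\<lambda>k. \<not> Q k) p"
  by (rule poly_mapping_eqI) (auto simp: coef_restr lookup_add)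

lemma restr_id: "(\<And>k. k \<in> supp p \<Longrightarrow> Q k) \<Longrightarrow> restr Q p = p"
  by (rule poly_mapping_eqI) (auto simp: coef_restr in_keys_iff)

lemma restr_0: "(\<And>k. k \<in> supp p \<Longrightarrow> \<not> Q k) \<Longrightarrow> restr Q p = 0"
  by (rule poly_mapping_eqI) (auto simp: coef_restr in_keys_iff)

lemma restr_mult_homogeneous:
  fixes p q :: "'v mpol" and \<omega> :: "('v \<Rightarrow> nat) \<Rightarrow> int"
  assumes \<omega>: "\<And>\<kappa> \<mu>. \<omega> (\<kappa> + \<mu>) = \<omega> \<kappa> + \<omega> \<mu>" and p: "\<And>\<kappa>. \<kappa> \<in> supp p \<Longrightarrow> \<omega> \<kappa> = s"
  shows "restr (\<lambda>\<kappa>. \<omega> \<kappa> = s + r) (p * q) = p * restr (\<lambda>\<kappa>. \<omega> \<kappa> = r) q"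
proof -
  let ?q1 = "restr (\<lambda>\<kappa>. \<omega> \<kappa> = r) q" and ?q2 = "restr (\<lambda>\<kappa>. \<omega> \<kappa> \<noteq> r) q"
  have "p * q = p * ?q1 + p * ?q2"
    by (metis restr_split distrib_left)
  moreover have "restr (\<lambda>\<kappa>. \<omega> \<kappa> = s + r) (p * ?q1) = p * ?q1"
    by (rule restr_id) (use keys_mult[of p ?q1] p in \<open>auto simp: \<omega> supp_restr\<close>)
  moreover have "restr (\<lambda>\<kappa>. \<omega> \<kappa> = s + r) (p * ?q2) = 0"
    by (rule restr_0) (use keys_mult[of p ?q2] p in \<open>auto simp: \<omega> supp_restr\<close>)
  ultimately show ?thesis by (simp add: restr_add)
qed

section \<open>A Nullstellensatz\<close>

text \<open>Gaussian elimination: a member of \<open>S\<close> with nonzero coordinate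
  \<open>k\<close> serves as pivot and is removed together with \<open>k\<close>.\<close>

lemma exists_linear_relation:
  fixes u :: "'a \<Rightarrow> 'k \<Rightarrow> complex"
  assumes "finite K" "finite S" "card S > card K"
  shows "\<exists>lam. (\<exists>c\<in>S. lam c \<noteq> 0) \<and> (\<forall>k\<in>K. (\<Sum>c\<in>S. lam c * u c k) = 0)"
  using assms
proof (induction K arbitrary: S u rule: finite_induct)
  case empty
  then obtain c where "c \<in> S" by fastforce
  then show ?case by (intro exI[of _ "\<lambda>_. 1"]) auto
next
  case (insert k K)
  show ?case
  proof (cases "\<forall>c\<in>S. u c k = 0")
    case True
    obtain lam where "\<exists>c\<in>S. lam c \<noteq> 0" "\<forall>k\<in>K. (\<Sum>c\<in>S. lam c * u c k) = 0"
      using insert.IH[of S u] insert.prems insert.hyps by auto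
    then show ?thesis using True by (intro exI[of _ lam]) auto
  next
    case False
    then obtain c0 where c0: "c0 \<in> S" "u c0 k \<noteq> 0" by auto
    define u' where "u' c l = u c l - u c k / u c0 k * u c0 l" for c l
    have "card (S - {c0}) > card K"
      using insert.prems insert.hyps c0 by simp
    then obtain lam where l: "\<exists>c\<in>S - {c0}. lam c \<noteq> 0" "\<forall>k\<in>K. (\<Sum>c\<in>S - {c0}. lam c * u' c k) = 0"
      using insert.IH[of "S - {c0}" u'] insert.prems by auto
    define \<mu> where "\<mu> = lam(c0 := - (\<Sum>c\<in>S - {c0}. lam c * (u c k / u c0 k)))"
    have eq: "(\<Sum>c\<in>S. \<mu> c * u c l) = (\<Sum>c\<in>S - {c0}. lam c * u' c l)" for l
    proof -
      have "(\<Sum>c\<in>S. \<mu> c * u c l) = \<mu> c0 * u c0 l + (\<Sum>c\<in>S - {c0}. \<mu> c * u c l)"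
        using c0 insert.prems by (simp add: sum.remove)
      also have "(\<Sum>c\<in>S - {c0}. \<mu> c * u c l) = (\<Sum>c\<in>S - {c0}. lam c * u c l)"
        by (rule sum.cong) (auto simp: \<mu>_def)
      finally show ?thesis
        by (simp add: \<mu>_def u'_def right_diff_distrib sum_subtractf sum_distrib_right mult.assoc)
    qed
    have "\<exists>c\<in>S. \<mu> c \<noteq> 0" using l(1) by (auto simp: \<mu>_def)
    moreover have "u' c k = 0" for c using c0 by (simp add: u'_def)
    ultimately show ?thesis using l(2) by (intro exI[of _ \<mu>]) (auto simp: eq)
  qed
qed

definition is_ideal :: "'a::comm_ring_1 set \<Rightarrow> bool" where
  "is_ideal I \<longleftrightarrow> 0 \<in> I \<and> (\<forall>a\<in>I. \<forall>b\<in>I. a + b \<in> I) \<and> (\<forall>a\<in>I. \<forall>r. r * a \<in> I)"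

lemma is_ideal_0: "is_ideal I \<Longrightarrow> 0 \<in> I"
  and is_ideal_add: "is_ideal I \<Longrightarrow> a \<in> I \<Longrightarrow> b \<in> I \<Longrightarrow> a + b \<in> I"
  and is_ideal_mult: "is_ideal I \<Longrightarrow> a \<in> I \<Longrightarrow> r * a \<in> I"
  by (auto simp: is_ideal_def)

lemma is_ideal_mult': "is_ideal I \<Longrightarrow> a \<in> I \<Longrightarrow> a * r \<in> I"
  using is_ideal_mult[of I a r] by (simp add: mult.commute)

lemma is_ideal_uminus: "is_ideal I \<Longrightarrow> a \<in> I \<Longrightarrow> - a \<in> I"
  using is_ideal_mult[of I a "- 1"] by simp

lemma is_ideal_diff: "is_ideal I \<Longrightarrow> a \<in> I \<Longrightarrow> b \<in> I \<Longrightarrow> a - b \<in> I"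
  using is_ideal_add[of I a "- b"] is_ideal_uminus[of I b] by simp

lemma is_ideal_sum: "is_ideal I \<Longrightarrow> (\<And>a. a \<in> A \<Longrightarrow> g a \<in> I) \<Longrightarrow> (\<Sum>a\<in>A. g a) \<in> I"
  by (induction A rule: infinite_finite_induct) (auto intro: is_ideal_0 is_ideal_add)

text \<open>An ideal maximal among those that contain the \<open>F j\<close> but no power of the
  variable \<open>i\<close> is prime. As \<complex> is uncountable while polynomials have countably
  many supports, every variable is constant modulo this ideal. The constants are the coordinates of
  a common zero of the \<open>F j\<close>; there the coordinate \<open>i\<close> is 0, so the
  variable itself lies in the ideal.\<close>

lemma nullstellensatz_var:
  fixes F :: "'i::finite \<Rightarrow> 'v::finite mpol"
  assumes zero: "\<And>x. (\<forall>j. ev x (F j) = 0) \<Longrightarrow> x i = 0"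
  shows "\<exists>N a. var i ^ N = (\<Sum>j\<in>UNIV. a j * F j)"
proof (rule ccontr)
  assume contr: "\<not> ?thesis"
  define J where "J = {p. \<exists>a. p = (\<Sum>j\<in>UNIV. a j * F j)}"
  have idJ: "is_ideal J"
    unfolding is_ideal_def
  proof (intro conjI ballI allI)
    show "0 \<in> J" unfolding J_def by (intro CollectI exI[of _ "\<lambda>_. 0"]) simp
  next
    fix p q assume "p \<in> J" "q \<in> J"
    then obtain a b where "p = (\<Sum>j\<in>UNIV. a j * F j)" "q = (\<Sum>j\<in>UNIV. b j * F j)"
      by (auto simp: J_def)
    then have "p + q = (\<Sum>j\<in>UNIV. (a j + b j) * F j)"
      by (simp add: distrib_right sum.distrib)
    then show "p + q \<in> J" unfolding J_def by (intro CollectI exI[of _ "\<lambda>j. a j + b j"])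
  next
    fix p r assume "p \<in> J"
    then obtain a where "p = (\<Sum>j\<in>UNIV. a j * F j)" by (auto simp: J_def)
    then have "r * p = (\<Sum>j\<in>UNIV. (r * a j) * F j)"
      by (simp add: sum_distrib_left mult.assoc)
    then show "r * p \<in> J" unfolding J_def by (intro CollectI exI[of _ "\<lambda>j. r * a j"])
  qed
  define \<S> where "\<S> = {I. is_ideal I \<and> J \<subseteq> I \<and> (\<forall>N. var i ^ N \<notin> I)}"
  have "J \<in> \<S>" using idJ contr by (auto simp: \<S>_def J_def)
  have "\<exists>M\<in>\<S>. \<forall>X\<in>\<S>. M \<subseteq> X \<longrightarrow> X = M"
  proof (rule subset_Zorn_nonempty)
    show "\<S> \<noteq> {}" using \<open>J \<in> \<S>\<close> by auto
  next
    fix C assume C: "C \<noteq> {}" "subset.chain \<S> C"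
    then have CS: "C \<subseteq> \<S>" and ch: "\<And>X Y. X \<in> C \<Longrightarrow> Y \<in> C \<Longrightarrow> X \<subseteq> Y \<or> Y \<subseteq> X"
      by (auto simp: subset_chain_def)
    have "is_ideal (\<Union>C)"
      unfolding is_ideal_def
    proof (intro conjI ballI allI)
      show "0 \<in> \<Union>C" using C CS by (auto simp: \<S>_def is_ideal_def)
    next
      fix p q assume "p \<in> \<Union>C" "q \<in> \<Union>C"
      then obtain X Y where "X \<in> C" "Y \<in> C" "p \<in> X" "q \<in> Y" by auto
      then obtain Z where "Z \<in> C" "p \<in> Z" "q \<in> Z" using ch by blast
      moreover have "is_ideal Z" using CS \<open>Z \<in> C\<close> by (auto simp: \<S>_def)
      ultimately show "p + q \<in> \<Union>C" using is_ideal_add[of Z p q] by blast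
    next
      fix p r assume "p \<in> \<Union>C"
      then obtain X where "X \<in> C" "p \<in> X" by auto
      moreover have "is_ideal X" using CS \<open>X \<in> C\<close> by (auto simp: \<S>_def)
      ultimately show "r * p \<in> \<Union>C" using is_ideal_mult[of X p r] by blast
    qed
    then show "\<Union>C \<in> \<S>" using C CS by (auto simp: \<S>_def)
  qed
  then obtain M where "M \<in> \<S>" and max: "\<And>X. X \<in> \<S> \<Longrightarrow> M \<subseteq> X \<Longrightarrow> X = M" by blast
  then have idM: "is_ideal M" and JM: "J \<subseteq> M" and NM: "\<And>N. var i ^ N \<notin> M"
    by (auto simp: \<S>_def)
  \<comment> \<open>Maximality: adjoining \<open>z\<close> produces a power of the variable.\<close>
  have outside: "\<exists>N r. var i ^ N - r * z \<in> M" if "z \<notin> M" for z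
  proof (rule ccontr)
    assume *: "\<not> ?thesis"
    define X where "X = {p. \<exists>r. p - r * z \<in> M}"
    have "is_ideal X"
      unfolding is_ideal_def
    proof (intro conjI ballI allI)
      show "0 \<in> X" unfolding X_def by (intro CollectI exI[of _ 0]) (simp add: is_ideal_0 idM)
    next
      fix p q assume "p \<in> X" "q \<in> X"
      then obtain r s where "p - r * z \<in> M" "q - s * z \<in> M" by (auto simp: X_def)
      then have "(p - r * z) + (q - s * z) \<in> M" by (rule is_ideal_add[OF idM])
      then show "p + q \<in> X" unfolding X_def
        by (intro CollectI exI[of _ "r + s"]) (simp add: algebra_simps)
    next
      fix p t assume "p \<in> X"
      then obtain r where "p - r * z \<in> M" by (auto simp: X_def)
      then have "t * (p - r * z) \<in> M" by (rule is_ideal_mult[OF idM])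
      then show "t * p \<in> X" unfolding X_def
        by (intro CollectI exI[of _ "t * r"]) (simp add: algebra_simps)
    qed
    moreover have "M \<subseteq> X" unfolding X_def by (auto intro: exI[of _ 0])
    moreover have "var i ^ N \<notin> X" for N using * by (auto simp: X_def)
    ultimately have "X = M" using JM by (intro max) (auto simp: \<S>_def)
    moreover have "z \<in> X" unfolding X_def
      by (intro CollectI exI[of _ 1]) (simp add: is_ideal_0 idM)
    ultimately show False using that by simp
  qed
  have prime: "z * z' \<notin> M" if zn: "z \<notin> M" "z' \<notin> M" for z z'
  proof
    assume zz: "z * z' \<in> M"
    obtain N r where 1: "var i ^ N - r * z \<in> M" using outside[OF zn(1)] by blast
    obtain N' r' where 2: "var i ^ N' - r' * z' \<in> M" using outside[OF zn(2)] by blast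
    have "var i ^ N' * (var i ^ N - r * z) + (r * z) * (var i ^ N' - r' * z') + (r * r') * (z * z') \<in> M"
      by (intro is_ideal_add is_ideal_mult idM 1 2 zz)
    moreover have "var i ^ N' * (var i ^ N - r * z) + (r * z) * (var i ^ N' - r' * z')
        + (r * r') * (z * z') = var i ^ (N + N')"
      by (simp add: algebra_simps power_add)
    ultimately show False using NM by simp
  qed
  have const_M: "mon 0 c \<notin> M" if "c \<noteq> 0" for c :: complex
  proof
    assume "mon 0 c \<in> M"
    then have "mon 0 (1 / c) * mon 0 c \<in> M" by (rule is_ideal_mult[OF idM])
    then show False using that NM[of 0] by (simp add: mult_single flip: single_one)
  qed
  have "\<exists>c. var j - mon 0 c \<in> M" for j
  proof (rule ccontr)
    assume none: "\<nexists>c. var j - mon 0 c \<in> M"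
    then have "\<forall>c. \<exists>N r. var i ^ N - r * (var j - mon 0 c) \<in> M" using outside by blast
    then obtain N u where Nu: "\<And>c. var i ^ N c - u c * (var j - mon 0 c) \<in> M" by metis
    \<comment> \<open>There are countably many pairs of an exponent and a finite support but
      uncountably many \<open>c\<close>, so one pair occurs infinitely often. Choosing one more
      \<open>c\<close> than the support has elements makes the cofactors \<open>u c\<close> linearly
      dependent.\<close>
    define h where "h c = (N c, supp (u c))" for c
    have "countable (range h)"
    proof (rule countable_subset)
      show "range h \<subseteq> UNIV \<times> {K. finite K}" by (auto simp: h_def)
      show "countable ((UNIV :: nat set) \<times> {K :: ('v \<Rightarrow> nat) set. finite K})"
        by (intro countable_SIGMA countable_Collect_finite) auto
    qed
    moreover have "(UNIV :: complex set) = (\<Union>y\<in>range h. h -` {y})" by auto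
    ultimately obtain y where y: "infinite (h -` {y})"
      using uncountable_UNIV_complex countable_UN[of "range h" "\<lambda>y. h -` {y}"]
      by (metis countable_finite)
    obtain N0 K where y_eq: "y = (N0, K)" by force
    obtain c1 where "c1 \<in> h -` {y}" using y by (metis ex_in_conv finite.emptyI)
    then have "finite K" by (auto simp: h_def y_eq)
    obtain S where S: "S \<subseteq> h -` {y}" "finite S" "card S = Suc (card K)"
      using infinite_arbitrarily_large[OF y, of "Suc (card K)"] by blast
    have hS: "N c = N0 \<and> supp (u c) = K" if "c \<in> S" for c
    proof -
      have "h c = (N0, K)" using S(1) that y_eq by auto
      then show ?thesis by (simp add: h_def)
    qed
    obtain lam where nz: "\<exists>c\<in>S. lam c \<noteq> 0"
      and rel: "\<forall>k\<in>K. (\<Sum>c\<in>S. lam c * coef (u c) k) = 0"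
      using exists_linear_relation[of K S "\<lambda>c. coef (u c)"] \<open>finite K\<close> S by auto
    have rel0: "(\<Sum>c\<in>S. mon 0 (lam c) * u c) = 0"
    proof (rule poly_mapping_eqI)
      fix k
      have coef_scal: "coef (mon 0 a * p) k = a * coef p k" for a :: complex and p :: "'v mpol"
        unfolding mult_map_scale_conv_mult[symmetric] by (simp add: Poly_Mapping.map.rep_eq when_def)
      show "coef (\<Sum>c\<in>S. mon 0 (lam c) * u c) k = coef 0 k"
      proof (cases "k \<in> K")
        case True
        then show ?thesis using rel by (simp add: lookup_sum coef_scal)
      next
        case False
        have "coef (u c) k = 0" if "c \<in> S" for c
          using hS[OF that] False by (metis in_keys_iff)
        then show ?thesis by (simp add: lookup_sum coef_scal)
      qed
    qed
    define P where "P T = (\<Prod>c\<in>T. var j - mon 0 c)" for T :: "complex set"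
    have PS: "P S = (var j - mon 0 c) * P (S - {c})" if "c \<in> S" for c
      using that S by (simp add: P_def prod.remove)
    \<comment> \<open>Multiplying the congruence for \<open>c\<close> by the remaining linear
      factors turns its second term into \<open>u c * P S\<close>; in the weighted sum these terms
      cancel by the linear relation.\<close>
    have "(\<Sum>c\<in>S. mon 0 (lam c) * (var i ^ N0 * P (S - {c}))) =
        (\<Sum>c\<in>S. mon 0 (lam c) * (var i ^ N0 - u c * (var j - mon 0 c)) * P (S - {c}))
        + (\<Sum>c\<in>S. mon 0 (lam c) * u c) * P S"
      unfolding sum_distrib_right sum.distrib[symmetric]
      by (rule sum.cong) (auto simp: PS algebra_simps)
    also have "\<dots> = (\<Sum>c\<in>S. mon 0 (lam c) * (var i ^ N0 - u c * (var j - mon 0 c)) * P (S - {c}))"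
      by (simp add: rel0)
    also have "\<dots> \<in> M"
    proof (rule is_ideal_sum[OF idM])
      fix c assume "c \<in> S"
      then have "var i ^ N0 - u c * (var j - mon 0 c) \<in> M"
        using Nu[of c] hS[of c] by simp
      then show "mon 0 (lam c) * (var i ^ N0 - u c * (var j - mon 0 c)) * P (S - {c}) \<in> M"
        by (intro is_ideal_mult'[OF idM] is_ideal_mult[OF idM])
    qed
    finally have "var i ^ N0 * (\<Sum>c\<in>S. mon 0 (lam c) * P (S - {c})) \<in> M"
      by (simp add: sum_distrib_left mult.left_commute)
    then have inM: "(\<Sum>c\<in>S. mon 0 (lam c) * P (S - {c})) \<in> M"
      using prime NM by blast
    \<comment> \<open>The univariate form of the polynomial just found in \<open>M\<close>. It is
      nonzero because only the summand of \<open>c0\<close> survives at \<open>c0\<close>; so it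
      splits into linear factors, one of which would have to lie in the prime ideal.\<close>
    define q where "q = (\<Sum>c\<in>S. smult (lam c) (\<Prod>c'\<in>S - {c}. [:- c', 1:]))"
    obtain c0 where c0: "c0 \<in> S" "lam c0 \<noteq> 0" using nz by auto
    have "poly q c0 = (\<Sum>c\<in>S. lam c * (\<Prod>c'\<in>S - {c}. c0 - c'))"
      by (simp add: q_def poly_sum poly_prod)
    also have "\<dots> = lam c0 * (\<Prod>c'\<in>S - {c0}. c0 - c')
        + (\<Sum>c\<in>S - {c0}. lam c * (\<Prod>c'\<in>S - {c}. c0 - c'))"
      using c0 S by (simp add: sum.remove)
    also have "(\<Sum>c\<in>S - {c0}. lam c * (\<Prod>c'\<in>S - {c}. c0 - c')) = 0"
      using c0 S by (intro sum.neutral ballI) (auto simp: prod_zero_iff)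
    finally have "poly q c0 \<noteq> 0" using c0 S by (auto simp: prod_zero_iff)
    then have "q \<noteq> 0" by auto
    obtain as where as: "smult (lead_coeff q) (\<Prod>a\<in>#as. [:- a, 1:]) = q"
      using alg_closed_imp_factorization[OF \<open>q \<noteq> 0\<close>] by metis
    have polyq: "poly q x = lead_coeff q * (\<Prod>a\<in>#as. x - a)" for x
    proof -
      have "poly (\<Prod>a\<in>#as. [:- a, 1:]) x = (\<Prod>a\<in>#as. x - a)"
        by (induction as) (auto simp: algebra_simps)
      then show ?thesis by (subst as[symmetric]) simp
    qed
    have evl: "ev x (\<Prod>a\<in>#as. var j - mon 0 a) = (\<Prod>a\<in>#as. x j - a)" for x
      by (induction as) auto
    have evP: "ev x (P T) = (\<Prod>c\<in>T. x j - c)" for x T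
      unfolding P_def by (induction T rule: infinite_finite_induct) auto
    have "(\<Sum>c\<in>S. mon 0 (lam c) * P (S - {c})) = mon 0 (lead_coeff q) * (\<Prod>a\<in>#as. var j - mon 0 a)"
    proof (rule peval_inj, rule ext)
      fix z
      have "peval (\<Sum>c\<in>S. mon 0 (lam c) * P (S - {c})) z = poly q (z $ j)"
        by (simp add: peval_def evP q_def poly_sum poly_prod)
      also have "\<dots> = peval (mon 0 (lead_coeff q) * (\<Prod>a\<in>#as. var j - mon 0 a)) z"
        by (simp add: peval_def evl polyq)
      finally show "peval (\<Sum>c\<in>S. mon 0 (lam c) * P (S - {c})) z =
          peval (mon 0 (lead_coeff q) * (\<Prod>a\<in>#as. var j - mon 0 a)) z" .
    qed
    moreover have "(\<Prod>a\<in>#as. var j - mon 0 a) \<notin> M"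
    proof (induction as)
      case empty
      show ?case using NM[of 0] by simp
    next
      case (add a as)
      have "var j - mon 0 a \<notin> M" using none by blast
      from prime[OF this add] show ?case by (simp only: image_mset_add_mset prod_mset.add_mset not_False_eq_True)
    qed
    ultimately show False
      using inM prime const_M \<open>q \<noteq> 0\<close> by (metis leading_coeff_neq_0)
  qed
  then obtain x where x: "\<And>j. var j - mon 0 (x j) \<in> M" by metis
  \<comment> \<open>The polynomials congruent modulo \<open>M\<close> to their value at
    \<open>x\<close>. They are closed under sums and products and contain the constants and the
    variables.\<close>
  define E where "E = {p. p - mon 0 (ev x p) \<in> M}"
  have E_add: "p + q \<in> E" if "p \<in> E" "q \<in> E" for p q
    using is_ideal_add[OF idM, of "p - mon 0 (ev x p)" "q - mon 0 (ev x q)"] that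
    by (simp add: E_def single_add algebra_simps)
  have E_mult: "p * q \<in> E" if "p \<in> E" "q \<in> E" for p q
  proof -
    have "q * (p - mon 0 (ev x p)) + mon 0 (ev x p) * (q - mon 0 (ev x q)) \<in> M"
      using that by (intro is_ideal_add is_ideal_mult idM) (auto simp: E_def)
    then show ?thesis by (simp add: E_def algebra_simps mult_single)
  qed
  have E_const: "mon 0 c \<in> E" for c by (simp add: E_def is_ideal_0 idM)
  have E_1: "1 \<in> E" using E_const[of 1] by simp
  have E_var: "var j \<in> E" for j using x by (simp add: E_def)
  have E_pow: "var j ^ m \<in> E" for j m by (induction m) (auto intro: E_1 E_mult E_var)
  have E_prod: "(\<Prod>j\<in>A. var j ^ k j) \<in> E" for A k
    by (induction A rule: infinite_finite_induct) (auto intro: E_1 E_mult E_pow)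
  have E_all: "p \<in> E" for p
  proof (induction p rule: mpol_induct)
    case (mon k c)
    have "mon k c = mon 0 c * (\<Prod>j\<in>UNIV. var j ^ k j)"
    proof (rule peval_inj, rule ext)
      fix z
      have "ev (($) z) (\<Prod>j\<in>A. var j ^ k j) = (\<Prod>j\<in>A. z $ j ^ k j)" for A
        by (induction A rule: infinite_finite_induct) auto
      then show "peval (mon k c) z = peval (mon 0 c * (\<Prod>j\<in>UNIV. var j ^ k j)) z"
        by (simp add: peval_def ev_single)
    qed
    then show ?case using E_mult[OF E_const E_prod] by simp
  qed (use E_const[of 0] E_add in auto)
  have "ev x (F k) = 0" for k
  proof (rule ccontr)
    assume nz: "ev x (F k) \<noteq> 0"
    have "F k = (\<Sum>j\<in>UNIV. (if j = k then 1 else 0) * F j)"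
      by (subst sum.cong[OF refl, of _ _ "\<lambda>j. if j = k then F j else 0"]) auto
    then have "F k \<in> J" unfolding J_def by (intro CollectI exI[of _ "\<lambda>j. if j = k then 1 else 0"])
    then have "F k \<in> M" using JM by blast
    moreover have "F k - mon 0 (ev x (F k)) \<in> M" using E_all[of "F k"] by (simp add: E_def)
    ultimately have "F k - (F k - mon 0 (ev x (F k))) \<in> M" by (rule is_ideal_diff[OF idM])
    then show False using const_M[OF nz] by simp
  qed
  then have "x i = 0" using zero by blast
  then show False using x[of i] NM[of 1] by simp
qed

lemma nullstellensatz_origin:
  fixes F :: "'i::finite \<Rightarrow> 'v::finite mpol"
  assumes zero: "\<And>x. (\<forall>j. ev x (F j) = 0) \<Longrightarrow> \<forall>i. x i = 0"
  shows "\<exists>N a. \<forall>i. var i ^ N = (\<Sum>j\<in>UNIV. a i j * F j)"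
proof -
  have "\<forall>i. \<exists>N a. var i ^ N = (\<Sum>j\<in>UNIV. a j * F j)"
    using nullstellensatz_var[of F] zero by blast
  then obtain N a where Na: "\<And>i. var i ^ N i = (\<Sum>j\<in>UNIV. a i j * F j)" by metis
  define K where "K = (\<Sum>i\<in>UNIV. N i)"
  have "var i ^ K = (\<Sum>j\<in>UNIV. (var i ^ (K - N i) * a i j) * F j)" for i
  proof -
    have "N i \<le> K" unfolding K_def by (rule member_le_sum) auto
    then have "var i ^ K = var i ^ (K - N i) * var i ^ N i" by (simp flip: power_add)
    then show ?thesis by (simp add: Na sum_distrib_left mult.assoc)
  qed
  then show ?thesis
    by (intro exI[of _ K] exI[of _ "\<lambda>i j. var i ^ (K - N i) * a i j"]) auto
qed

section \<open>First Koszul homology\<close>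

text \<open>Serves to show that a sum antisymmetric in two indices vanishes, since such a sum equals
  its own negative.\<close>

lemma mpol_double_0: "x + x = 0 \<Longrightarrow> x = 0" for x :: "'v mpol"
proof (rule poly_mapping_eqI)
  fix k assume "x + x = 0"
  then have "coef (x + x) k = 0" by simp
  then have "coef x k + coef x k = 0" by (simp only: lookup_add lookup_zero)
  then show "coef x k = coef 0 k" by simp
qed

text \<open>
  Koszul chains are functions on subsets of the index set; \<open>idx\<close> is an arbitrary numbering of the
  indices, needed only for the signs.
\<close>

locale koszul =
  fixes idx :: "'i::finite \<Rightarrow> nat" and F :: "'i \<Rightarrow> 'v mpol"
  assumes inj_idx: "inj idx"
begin

definition sg :: "'i \<Rightarrow> 'i set \<Rightarrow> 'v mpol" where
  "sg i S = (- 1) ^ card {j \<in> S. idx j < idx i}"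

text \<open>Contraction with the \<open>F i\<close>, the Koszul differential; a chain of degree
  \<open>k\<close> is supported on the sets with \<open>k\<close> elements.\<close>

definition dK :: "('i set \<Rightarrow> 'v mpol) \<Rightarrow> 'i set \<Rightarrow> 'v mpol" where
  "dK \<omega> S = (\<Sum>i\<in>- S. F i * sg i S * \<omega> (insert i S))"

text \<open>Exterior multiplication by the vector \<open>a\<close>.\<close>

definition hK :: "('i \<Rightarrow> 'v mpol) \<Rightarrow> ('i set \<Rightarrow> 'v mpol) \<Rightarrow> 'i set \<Rightarrow> 'v mpol" where
  "hK a \<omega> S = (\<Sum>i\<in>S. a i * sg i S * \<omega> (S - {i}))"

lemma sg_sq: "sg i S * sg i S = 1"
  by (simp add: sg_def flip: power_add mult_2)

lemma sg_insert_self: "sg i (insert i S) = sg i S"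
  unfolding sg_def by (rule arg_cong[where f="\<lambda>X. (- 1) ^ card X"]) auto

lemma sg_insert:
  assumes "i \<notin> S"
  shows "sg j (insert i S) = (if idx i < idx j then - sg j S else sg j S)"
proof (cases "idx i < idx j")
  case True
  have "{k \<in> insert i S. idx k < idx j} = insert i {k \<in> S. idx k < idx j}"
    using True by auto
  then show ?thesis using True assms by (simp add: sg_def)
next
  case False
  then have "{k \<in> insert i S. idx k < idx j} = {k \<in> S. idx k < idx j}" by auto
  then show ?thesis using False by (simp add: sg_def)
qed

lemma sg_swap:
  assumes "i \<notin> S" "j \<notin> S" "i \<noteq> j"
  shows "sg i S * sg j (insert i S) = - (sg j S * sg i (insert j S))"
proof -
  have "idx i \<noteq> idx j" using inj_idx assms by (auto dest: injD)
  then show ?thesis by (auto simp: sg_insert assms)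
qed

lemma sg_swap':
  assumes "i \<notin> S" "j \<in> S"
  shows "sg i S * sg j (insert i S) = - (sg j S * sg i (S - {j}))"
proof -
  define T where "T = S - {j}"
  have S: "S = insert j T" "j \<notin> T" "i \<notin> T" "i \<noteq> j" using assms by (auto simp: T_def)
  have "idx i \<noteq> idx j" using inj_idx S by (auto dest: injD)
  moreover have "insert i (insert j T) = insert j (insert i T)" by auto
  ultimately show ?thesis
    unfolding S(1) using S by (auto simp: sg_insert sg_insert_self)
qed

text \<open>The terms are indexed by ordered pairs outside \<open>S\<close>, and exchanging the two
  indices changes the sign by \<open>sg_swap\<close>.\<close>

lemma dK_dK: "dK (dK \<omega>) S = 0"
proof (rule mpol_double_0)
  let ?P = "{(i, j). i \<notin> S \<and> j \<notin> S \<and> i \<noteq> j}"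
  define T where "T i j = F i * sg i S * (F j * sg j (insert i S) * \<omega> (insert j (insert i S)))" for i j
  have "dK (dK \<omega>) S = (\<Sum>i\<in>- S. \<Sum>j\<in>- insert i S. T i j)"
    unfolding dK_def T_def by (simp add: sum_distrib_left)
  also have "\<dots> = (\<Sum>(i, j)\<in>(SIGMA i:- S. - insert i S). T i j)"
    by (rule sum.Sigma) auto
  also have "(SIGMA i:- S. - insert i S) = ?P" by auto
  finally have 1: "dK (dK \<omega>) S = (\<Sum>(i, j)\<in>?P. T i j)" .
  have 2: "(\<Sum>(i, j)\<in>?P. T i j) = (\<Sum>(i, j)\<in>?P. T j i)"
    by (rule sum.reindex_bij_witness[of _ prod.swap prod.swap]) auto
  have T_anti: "T j i = - T i j" if "i \<notin> S" "j \<notin> S" "i \<noteq> j" for i j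
  proof -
    have "T i j = F i * F j * \<omega> (insert j (insert i S)) * (sg i S * sg j (insert i S))"
      by (simp add: T_def mult_ac)
    also have "\<dots> = - (F j * F i * \<omega> (insert i (insert j S)) * (sg j S * sg i (insert j S)))"
      by (subst sg_swap) (use that in \<open>auto simp: insert_commute mult_ac\<close>)
    also have "\<dots> = - T j i" by (simp add: T_def mult_ac)
    finally show ?thesis by simp
  qed
  have "(\<Sum>(i, j)\<in>?P. T j i) = (\<Sum>(i, j)\<in>?P. - T i j)"
    by (intro sum.cong refl, clarify, rule T_anti)
  also have "\<dots> = - (\<Sum>(i, j)\<in>?P. T i j)"
    by (simp add: sum_negf case_prod_unfold)
  finally show "dK (dK \<omega>) S + dK (dK \<omega>) S = 0"
    using 1 2 by (metis add.right_inverse)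
qed

text \<open>The Cartan formula for contraction and exterior multiplication: terms with one index
  added and another removed cancel by \<open>sg_swap'\<close>, and the pairing of \<open>a\<close>
  with \<open>F\<close> remains.\<close>

lemma dK_hK: "dK (hK a \<omega>) S + hK a (dK \<omega>) S = (\<Sum>i\<in>UNIV. a i * F i) * \<omega> S"
proof -
  define X where "X i j = F i * a j * \<omega> (insert i (S - {j}))" for i j
  have "dK (hK a \<omega>) S = (\<Sum>i\<in>- S. F i * a i * \<omega> S + (\<Sum>j\<in>S. sg i S * sg j (insert i S) * X i j))"
    unfolding dK_def
  proof (rule sum.cong[OF refl])
    fix i assume i: "i \<in> - S"
    have "hK a \<omega> (insert i S) = a i * sg i (insert i S) * \<omega> (insert i S - {i})
        + (\<Sum>j\<in>S. a j * sg j (insert i S) * \<omega> (insert i S - {j}))"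
      unfolding hK_def using i by (simp add: sum.insert)
    moreover have "insert i S - {i} = S" using i by auto
    moreover have "(\<Sum>j\<in>S. a j * sg j (insert i S) * \<omega> (insert i S - {j}))
        = (\<Sum>j\<in>S. a j * sg j (insert i S) * \<omega> (insert i (S - {j})))"
    proof (rule sum.cong[OF refl])
      fix j assume "j \<in> S"
      then have "insert i S - {j} = insert i (S - {j})" using i by auto
      then show "a j * sg j (insert i S) * \<omega> (insert i S - {j})
          = a j * sg j (insert i S) * \<omega> (insert i (S - {j}))" by simp
    qed
    ultimately have "F i * sg i S * hK a \<omega> (insert i S) = F i * a i * (sg i S * sg i S) * \<omega> S
        + (\<Sum>j\<in>S. sg i S * sg j (insert i S) * X i j)"
      by (simp add: sg_insert_self algebra_simps sum_distrib_left X_def)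
    then show "F i * sg i S * hK a \<omega> (insert i S) = F i * a i * \<omega> S
        + (\<Sum>j\<in>S. sg i S * sg j (insert i S) * X i j)"
      by (simp add: sg_sq)
  qed
  also have "\<dots> = (\<Sum>i\<in>- S. F i * a i) * \<omega> S
      + (\<Sum>i\<in>- S. \<Sum>j\<in>S. sg i S * sg j (insert i S) * X i j)"
    by (simp add: sum.distrib sum_distrib_right)
  finally have 1: "dK (hK a \<omega>) S = (\<Sum>i\<in>- S. F i * a i) * \<omega> S
      + (\<Sum>i\<in>- S. \<Sum>j\<in>S. sg i S * sg j (insert i S) * X i j)" .
  have "hK a (dK \<omega>) S = (\<Sum>j\<in>S. F j * a j * \<omega> S + (\<Sum>i\<in>- S. sg j S * sg i (S - {j}) * X i j))"
    unfolding hK_def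
  proof (rule sum.cong[OF refl])
    fix j assume j: "j \<in> S"
    have "- (S - {j}) = insert j (- S)" using j by auto
    then have "dK \<omega> (S - {j}) = F j * sg j (S - {j}) * \<omega> (insert j (S - {j}))
        + (\<Sum>i\<in>- S. F i * sg i (S - {j}) * \<omega> (insert i (S - {j})))"
      unfolding dK_def using j by (simp add: sum.insert)
    moreover have "insert j (S - {j}) = S" using j by auto
    moreover have "sg j (S - {j}) = sg j S" using sg_insert_self[of j "S - {j}"] j
      by (simp add: insert_absorb)
    ultimately have "a j * sg j S * dK \<omega> (S - {j}) = F j * a j * (sg j S * sg j S) * \<omega> S
        + (\<Sum>i\<in>- S. sg j S * sg i (S - {j}) * X i j)"
      by (simp add: algebra_simps sum_distrib_left X_def)
    then show "a j * sg j S * dK \<omega> (S - {j}) = F j * a j * \<omega> S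
        + (\<Sum>i\<in>- S. sg j S * sg i (S - {j}) * X i j)"
      by (simp add: sg_sq)
  qed
  also have "\<dots> = (\<Sum>i\<in>S. F i * a i) * \<omega> S
      + (\<Sum>j\<in>S. \<Sum>i\<in>- S. sg j S * sg i (S - {j}) * X i j)"
    by (simp add: sum.distrib sum_distrib_right)
  also have "(\<Sum>j\<in>S. \<Sum>i\<in>- S. sg j S * sg i (S - {j}) * X i j)
      = (\<Sum>i\<in>- S. \<Sum>j\<in>S. sg j S * sg i (S - {j}) * X i j)"
    by (rule sum.swap)
  also have "\<dots> = (\<Sum>i\<in>- S. \<Sum>j\<in>S. - (sg i S * sg j (insert i S) * X i j))"
    by (intro sum.cong refl) (simp add: sg_swap')
  finally have 2: "hK a (dK \<omega>) S = (\<Sum>i\<in>S. F i * a i) * \<omega> S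
      - (\<Sum>i\<in>- S. \<Sum>j\<in>S. sg i S * sg j (insert i S) * X i j)"
    by (simp add: sum_negf)
  have "(\<Sum>i\<in>UNIV. a i * F i) = (\<Sum>i\<in>- S. F i * a i) + (\<Sum>i\<in>S. F i * a i)"
    using sum.union_disjoint[of "- S" S "\<lambda>i. F i * a i"] by (simp add: mult.commute Compl_partition2)
  then show ?thesis unfolding 1 2 by (simp add: algebra_simps)
qed

lemma dK_diff: "dK (\<lambda>S. \<omega> S - \<eta> S) S = dK \<omega> S - dK \<eta> S"
  by (simp add: dK_def algebra_simps sum_subtractf)

lemma dK_scale: "dK (\<lambda>S. g * \<omega> S) S = g * dK \<omega> S"
  by (simp add: dK_def algebra_simps sum_distrib_left)

lemma dK_ideal: "is_ideal I \<Longrightarrow> (\<And>S. \<omega> S \<in> I) \<Longrightarrow> dK \<omega> S \<in> I"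
  unfolding dK_def by (intro is_ideal_sum is_ideal_mult)

lemma hK_ideal: "is_ideal I \<Longrightarrow> (\<And>S. \<omega> S \<in> I) \<Longrightarrow> hK a \<omega> S \<in> I"
  unfolding hK_def by (intro is_ideal_sum is_ideal_mult)

text \<open>Vanishing of Koszul homology in degree \<open>k\<close> over the quotient by
  \<open>I\<close>, stated on representatives.\<close>

definition exact_mod :: "nat \<Rightarrow> 'v mpol set \<Rightarrow> bool" where
  "exact_mod k I \<longleftrightarrow> (\<forall>\<omega>. (\<forall>S. card S \<noteq> k \<longrightarrow> \<omega> S = 0) \<longrightarrow> (\<forall>S. dK \<omega> S \<in> I) \<longrightarrow>
     (\<exists>\<theta>. \<forall>S. \<omega> S - dK \<theta> S \<in> I))"

text \<open>
  The element \<open>g\<close> of the ideal of the \<open>F i\<close> acts on Koszul chains as zero up to the homotopy \<open>hK a\<close>;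
  as \<open>g\<close> is regular modulo \<open>I\<close>, exactness in degree \<open>k + 1\<close> modulo \<open>(I, g)\<close> descends to exactness in
  degree \<open>k\<close> modulo \<open>I\<close>.
\<close>

lemma exact_mod_step:
  assumes I: "is_ideal I" and g: "g = (\<Sum>i\<in>UNIV. a i * F i)"
    and reg: "\<And>v. g * v \<in> I \<Longrightarrow> v \<in> I"
    and ex: "exact_mod (Suc k) {x. \<exists>v. x - g * v \<in> I}"
  shows "exact_mod k I"
  unfolding exact_mod_def
proof (intro allI impI)
  fix \<omega> assume supp: "\<forall>S. card S \<noteq> k \<longrightarrow> \<omega> S = 0" and cyc: "\<forall>S. dK \<omega> S \<in> I"
  have "hK a \<omega> S = 0" if "card S \<noteq> Suc k" for S
  proof -
    have "\<omega> (S - {i}) = 0" if "i \<in> S" for i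
    proof -
      have "card (S - {i}) \<noteq> k" using that \<open>card S \<noteq> Suc k\<close>
        by (metis card_Suc_Diff1 finite)
      then show ?thesis using supp by blast
    qed
    then show ?thesis unfolding hK_def by (intro sum.neutral ballI) simp
  qed
  moreover have "\<exists>v. dK (hK a \<omega>) S - g * v \<in> I" for S
  proof -
    have "dK (hK a \<omega>) S - g * \<omega> S = - hK a (dK \<omega>) S"
      using dK_hK[of a \<omega> S] by (simp add: g algebra_simps)
    moreover have "- hK a (dK \<omega>) S \<in> I"
      using cyc by (intro is_ideal_uminus[OF I] hK_ideal[OF I]) auto
    ultimately show ?thesis by metis
  qed
  ultimately obtain \<eta> where "\<forall>S. \<exists>v. hK a \<omega> S - dK \<eta> S - g * v \<in> I"
    using ex unfolding exact_mod_def by blast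
  then obtain \<theta> where \<theta>: "\<And>S. hK a \<omega> S - dK \<eta> S - g * \<theta> S \<in> I" by metis
  have "\<omega> S - dK \<theta> S \<in> I" for S
  proof (rule reg)
    \<comment> \<open>Applying \<open>dK\<close> to the relation that defines
      \<open>\<theta>\<close> removes \<open>\<eta>\<close>; with the homotopy formula this is the
      claim multiplied by \<open>g\<close>.\<close>
    have "dK (\<lambda>S. hK a \<omega> S - dK \<eta> S - g * \<theta> S) S \<in> I"
      by (rule dK_ideal[OF I \<theta>])
    then have "dK (hK a \<omega>) S - g * dK \<theta> S \<in> I"
      by (simp add: dK_diff dK_scale dK_dK)
    moreover have "hK a (dK \<omega>) S \<in> I" using cyc by (intro hK_ideal[OF I]) auto
    ultimately have "(dK (hK a \<omega>) S - g * dK \<theta> S) + hK a (dK \<omega>) S \<in> I"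
      by (rule is_ideal_add[OF I])
    moreover have "(dK (hK a \<omega>) S - g * dK \<theta> S) + hK a (dK \<omega>) S = g * (\<omega> S - dK \<theta> S)"
      using dK_hK[of a \<omega> S] by (simp add: g algebra_simps)
    ultimately show "g * (\<omega> S - dK \<theta> S) \<in> I" by simp
  qed
  then show "\<exists>\<theta>. \<forall>S. \<omega> S - dK \<theta> S \<in> I" by blast
qed

text \<open>Descending induction along the sequence: in degrees above the number of indices there
  are no chains, and each regular element lowers both the degree and the ideal by one step.\<close>

lemma exact_mod_regular_sequence:
  assumes ideal: "\<And>m. is_ideal (I m)" and I0: "I 0 = {0}"
    and g: "\<And>m. m < CARD('i) \<Longrightarrow> \<exists>a. g m = (\<Sum>i\<in>UNIV. a i * F i)"
    and reg: "\<And>m v. m < CARD('i) \<Longrightarrow> g m * v \<in> I m \<Longrightarrow> v \<in> I m"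
    and Suc: "\<And>m. m < CARD('i) \<Longrightarrow> I (Suc m) = {x. \<exists>v. x - g m * v \<in> I m}"
  shows "exact_mod 1 {0}"
proof -
  have "exact_mod (Suc (CARD('i) - d)) (I (CARD('i) - d))" for d
  proof (induction d)
    case 0
    show ?case unfolding exact_mod_def
    proof (intro allI impI)
      fix \<omega> :: "'i set \<Rightarrow> 'v mpol"
      assume "\<forall>S. card S \<noteq> Suc (CARD('i) - 0) \<longrightarrow> \<omega> S = 0"
      moreover have "card S \<noteq> Suc (CARD('i) - 0)" for S :: "'i set"
        using card_mono[of UNIV S] by simp
      ultimately have "\<omega> S = 0" for S by blast
      then show "\<exists>\<theta>. \<forall>S. \<omega> S - dK \<theta> S \<in> I (CARD('i) - 0)"
        by (intro exI[of _ "\<lambda>_. 0"]) (simp add: dK_def is_ideal_0 ideal)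
    qed
  next
    case (Suc d)
    show ?case
    proof (cases "d < CARD('i)")
      case True
      define m where "m = CARD('i) - Suc d"
      have m: "m < CARD('i)" "CARD('i) - d = Suc m" using True by (auto simp: m_def)
      obtain a where a: "g m = (\<Sum>i\<in>UNIV. a i * F i)" using g[OF m(1)] by blast
      have "exact_mod (Suc m) (I m)"
      proof (rule exact_mod_step[OF ideal a reg[OF m(1)]])
        show "exact_mod (Suc (Suc m)) {x. \<exists>v. x - g m * v \<in> I m}"
          using Suc.IH m assms(5)[OF m(1)] by simp
      qed
      then show ?thesis by (simp add: m_def)
    next
      case False
      then show ?thesis using Suc.IH by simp
    qed
  qed
  from this[of "CARD('i)"] show ?thesis using I0 by simp
qed

text \<open>A syzygy is a cycle in degree one; the values of a bounding chain on two-element sets,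
  with signs, form the antisymmetric matrix.\<close>

lemma syzygy_trivial:
  assumes ex: "exact_mod 1 {0}" and syz: "(\<Sum>i\<in>UNIV. F i * h i) = 0"
  shows "\<exists>A. (\<forall>i j. A i j = - A j i) \<and> (\<forall>i. h i = (\<Sum>j\<in>UNIV. F j * A i j))"
proof -
  define \<omega> where "\<omega> S = (\<Sum>i\<in>UNIV. if S = {i} then h i else 0)" for S
  have \<omega>1: "\<omega> {i} = h i" for i unfolding \<omega>_def by simp
  have \<omega>0: "\<omega> S = 0" if "card S \<noteq> 1" for S
    unfolding \<omega>_def using that by (intro sum.neutral) auto
  have "dK \<omega> S = 0" for S
  proof (cases "S = {}")
    case True
    then show ?thesis using syz by (simp add: dK_def \<omega>1 sg_def)
  next
    case False
    have "card (insert i S) \<noteq> 1" if "i \<notin> S" for i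
      using that False by (simp add: card_insert_if)
    then show ?thesis unfolding dK_def by (intro sum.neutral ballI) (simp add: \<omega>0)
  qed
  then obtain \<theta> where "\<forall>S. \<omega> S - dK \<theta> S = 0"
    using ex \<omega>0 unfolding exact_mod_def by (metis singleton_iff)
  then have \<theta>: "h i = dK \<theta> {i}" for i by (metis \<omega>1 eq_iff_diff_eq_0)
  define A where "A i j = (if i = j then 0 else sg j {i} * \<theta> {i, j})" for i j
  have "A i j = - A j i" for i j
  proof (cases "i = j")
    case False
    have "sg j {i} = - sg i {j}"
      using sg_swap[of i "{}" j] False by (simp add: sg_def)
    then show ?thesis using False by (simp add: A_def insert_commute)
  qed (simp add: A_def)
  moreover have "h i = (\<Sum>j\<in>UNIV. F j * A i j)" for i
  proof -
    have "(\<Sum>j\<in>UNIV. F j * A i j) = (\<Sum>j\<in>- {i}. F j * A i j)"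
      by (rule sum.mono_neutral_right) (auto simp: A_def)
    also have "\<dots> = dK \<theta> {i}"
      unfolding dK_def by (rule sum.cong) (auto simp: A_def insert_commute mult_ac)
    finally show ?thesis by (simp add: \<theta>)
  qed
  ultimately show ?thesis by blast
qed

end

section \<open>Powers of variables as a regular sequence\<close>

lemma mon_mult: "mon \<mu> c * p = lin_ext (\<lambda>\<kappa> d. mon (\<mu> + \<kappa>) (c * d)) (p :: 'v mpol)"
proof -
  have "mon \<mu> c * p = mon \<mu> c * (\<Sum>k\<in>supp p. mon k (coef p k))"
    by (simp flip: mpol_sum_mon)
  then show ?thesis by (simp add: lin_ext_def sum_distrib_left mult_single)
qed

lemma coef_mon_mult: "coef (mon \<mu> c * p) (\<mu> + \<kappa>) = c * coef (p :: 'v mpol) \<kappa>"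
proof -
  have "coef (mon \<mu> c * p) (\<mu> + \<kappa>) = (\<Sum>k\<in>supp p. if k = \<kappa> then c * coef p k else 0)"
    unfolding mon_mult lin_ext_def lookup_sum
    by (rule sum.cong) (auto simp: lookup_single when_def)
  then show ?thesis by (auto simp: in_keys_iff)
qed

text \<open>The ideal generated by the \<open>N\<close>-th powers of the variables in
  \<open>X\<close>, described by exponents.\<close>

definition mono_ideal :: "'v set \<Rightarrow> nat \<Rightarrow> 'v mpol set" where
  "mono_ideal X N = {p. \<forall>\<kappa>\<in>supp p. \<exists>v\<in>X. N \<le> \<kappa> v}"

lemma is_ideal_mono_ideal: "is_ideal (mono_ideal X N)"
  unfolding is_ideal_def
proof (intro conjI ballI allI)
  fix a b assume "a \<in> mono_ideal X N" "b \<in> mono_ideal X N"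
  then show "a + b \<in> mono_ideal X N"
    using keys_add[of a b] by (fastforce simp: mono_ideal_def)
next
  fix a r assume "a \<in> mono_ideal X N"
  then show "r * a \<in> mono_ideal X N"
    using keys_mult[of r a] by (fastforce simp: mono_ideal_def intro: trans_le_add2)
qed (simp add: mono_ideal_def)

lemma var_power: "var v ^ N = mon (\<lambda>j. if j = v then N else 0) 1"
proof (induction N)
  case 0
  then show ?case by (simp add: zero_fun_def[symmetric])
next
  case (Suc N)
  have "unit v + (\<lambda>j. if j = v then N else 0) = (\<lambda>j. if j = v then Suc N else 0)"
    by (auto simp: unit_def)
  then show ?case using Suc by (simp add: var_def mult_single)
qed

lemma mono_ideal_regular:
  assumes "v \<notin> X" "var v ^ N * q \<in> mono_ideal X N"
  shows "q \<in> mono_ideal X N"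
  unfolding mono_ideal_def
proof (intro CollectI ballI)
  fix \<kappa> assume "\<kappa> \<in> supp q"
  let ?\<mu> = "\<lambda>j. if j = v then N else 0"
  have "?\<mu> + \<kappa> \<in> supp (var v ^ N * q)"
    using \<open>\<kappa> \<in> supp q\<close> by (simp add: var_power in_keys_iff coef_mon_mult)
  then obtain u where "u \<in> X" "N \<le> (?\<mu> + \<kappa>) u" using assms(2) by (auto simp: mono_ideal_def)
  then show "\<exists>v\<in>X. N \<le> \<kappa> v" using assms(1) by (intro bexI[of _ u]) (auto split: if_splits)
qed

lemma mono_ideal_insert:
  "mono_ideal (insert v X) N = {x. \<exists>q. x - var v ^ N * q \<in> mono_ideal X N}"
proof (intro equalityI subsetI)
  fix x assume "x \<in> mono_ideal (insert v X) N"
  then have x: "\<And>\<kappa>. \<kappa> \<in> supp x \<Longrightarrow> \<exists>u\<in>insert v X. N \<le> \<kappa> u" by (auto simp: mono_ideal_def)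
  let ?\<mu> = "\<lambda>j. if j = v then N else 0"
  let ?Q = "\<lambda>\<kappa>. N \<le> \<kappa> v"
  define q where "q = (\<Sum>\<kappa>\<in>{\<kappa> \<in> supp x. ?Q \<kappa>}. mon (\<kappa> - ?\<mu>) (coef x \<kappa>))"
  have "var v ^ N * q = restr ?Q x"
    unfolding q_def restr_def var_power sum_distrib_left mult_single
  proof (rule sum.cong[OF refl])
    fix \<kappa> assume "\<kappa> \<in> {\<kappa> \<in> supp x. N \<le> \<kappa> v}"
    then have "?\<mu> + (\<kappa> - ?\<mu>) = \<kappa>" by (auto simp: fun_eq_iff)
    then show "mon (?\<mu> + (\<kappa> - ?\<mu>)) (1 * coef x \<kappa>) = mon \<kappa> (coef x \<kappa>)" by simp
  qed
  then have "x - var v ^ N * q = restr (\<lambda>\<kappa>. \<not> ?Q \<kappa>) x"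
    using restr_split[of x ?Q] by (simp add: algebra_simps)
  also have "\<dots> \<in> mono_ideal X N" using x by (auto simp: mono_ideal_def supp_restr)
  finally show "x \<in> {x. \<exists>q. x - var v ^ N * q \<in> mono_ideal X N}" by blast
next
  fix x assume "x \<in> {x. \<exists>q. x - var v ^ N * q \<in> mono_ideal X N}"
  then obtain q where q: "x - var v ^ N * q \<in> mono_ideal X N" by blast
  then have "x - var v ^ N * q \<in> mono_ideal (insert v X) N" by (auto simp: mono_ideal_def)
  moreover have "var v ^ N * q \<in> mono_ideal (insert v X) N"
    using keys_mult[of "var v ^ N" q] by (fastforce simp: mono_ideal_def var_power)
  ultimately have "(x - var v ^ N * q) + var v ^ N * q \<in> mono_ideal (insert v X) N"
    by (intro is_ideal_add[OF is_ideal_mono_ideal])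
  then show "x \<in> mono_ideal (insert v X) N" by simp
qed

text \<open>The powers of the variables \<open>vs i\<close> form a regular sequence inside the ideal
  of the \<open>F i\<close>, of the same length as the family \<open>F\<close>, which suffices for
  first Koszul homology to vanish. The ring may contain further variables, as it will once symbols
  \<open>Y\<close> are adjoined.\<close>

theorem syzygies_trivial_of_var_powers:
  fixes F :: "'i::finite \<Rightarrow> 'v mpol" and vs :: "'i \<Rightarrow> 'v"
  assumes "inj vs" and pow: "\<And>i. \<exists>a. var (vs i) ^ N = (\<Sum>j\<in>UNIV. a j * F j)"
    and syz: "(\<Sum>i\<in>UNIV. F i * h i) = 0"
  shows "\<exists>A. (\<forall>i j. A i j = - A j i) \<and> (\<forall>i. h i = (\<Sum>j\<in>UNIV. F j * A i j))"
proof -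
  obtain idx :: "'i \<Rightarrow> nat" where idx: "bij_betw idx UNIV {0..<CARD('i)}"
    using ex_bij_betw_finite_nat[of "UNIV :: 'i set"] by auto
  interpret koszul idx F
    using idx by unfold_locales (simp add: bij_betw_def)
  define el where "el m = inv idx m" for m
  have el: "idx (el m) = m" if "m < CARD('i)" for m
    using idx that by (simp add: el_def bij_betw_inv_into_right[of idx UNIV "{0..<CARD('i)}"])
  define I where "I m = mono_ideal (vs ` {i. idx i < m}) N" for m
  have "exact_mod 1 {0}"
  proof (rule exact_mod_regular_sequence[where I = I and g = "\<lambda>m. var (vs (el m)) ^ N"])
    show "is_ideal (I m)" for m by (simp add: I_def is_ideal_mono_ideal)
    show "I 0 = {0}" by (auto simp: I_def mono_ideal_def)
    show "\<exists>a. var (vs (el m)) ^ N = (\<Sum>i\<in>UNIV. a i * F i)" for m using pow by blast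
  next
    fix m v assume m: "m < CARD('i)" and v: "var (vs (el m)) ^ N * v \<in> I m"
    have "vs (el m) \<notin> vs ` {i. idx i < m}"
      using el[OF m] \<open>inj vs\<close> by (auto dest: injD)
    then show "v \<in> I m" using v unfolding I_def by (rule mono_ideal_regular)
  next
    fix m assume m: "m < CARD('i)"
    have "{i. idx i < Suc m} = insert (el m) {i. idx i < m}"
      using el[OF m] inj_idx by (auto simp: less_Suc_eq dest: injD)
    then show "I (Suc m) = {x. \<exists>v. x - var (vs (el m)) ^ N * v \<in> I m}"
      by (simp add: I_def mono_ideal_insert)
  qed
  then show ?thesis by (rule syzygy_trivial[OF _ syz])
qed

section \<open>Weighted homogeneous polynomials\<close>

lemma restr_mult:
  fixes p q :: "'v mpol"
  assumes "\<And>\<mu> \<kappa>. \<mu> \<in> supp p \<Longrightarrow> Q' (\<mu> + \<kappa>) \<longleftrightarrow> Q \<kappa>"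
  shows "restr Q' (p * q) = p * restr Q q"
proof -
  let ?q1 = "restr Q q" and ?q2 = "restr (\<lambda>\<kappa>. \<not> Q \<kappa>) q"
  have "p * q = p * ?q1 + p * ?q2"
    by (metis restr_split distrib_left)
  moreover have "restr Q' (p * ?q1) = p * ?q1"
    by (rule restr_id) (use keys_mult[of p ?q1] assms in \<open>auto simp: supp_restr\<close>)
  moreover have "restr Q' (p * ?q2) = 0"
    by (rule restr_0) (use keys_mult[of p ?q2] assms in \<open>auto simp: supp_restr\<close>)
  ultimately show ?thesis by (simp add: restr_add)
qed

lemma supp_mult_cases:
  assumes "\<kappa> \<in> supp (p * q :: 'v mpol)"
  obtains \<mu> \<nu> where "\<mu> \<in> supp p" "\<nu> \<in> supp q" "\<kappa> = \<mu> + \<nu>"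
  using assms keys_mult[of p q] by auto

lemma supp_var: "supp (var i) = {unit i}"
  by (simp add: var_def)

lemma antisymmetric_sum_0:
  fixes A :: "'i::finite \<Rightarrow> 'i \<Rightarrow> 'v mpol"
  assumes "\<And>i j. A i j = - A j i"
  shows "(\<Sum>i\<in>UNIV. B i * (\<Sum>j\<in>UNIV. B j * A i j)) = 0"
proof (rule mpol_double_0)
  let ?X = "\<Sum>i\<in>UNIV. \<Sum>j\<in>UNIV. B i * (B j * A i j)"
  have "?X = (\<Sum>j\<in>UNIV. \<Sum>i\<in>UNIV. B i * (B j * A i j))" by (rule sum.swap)
  also have "\<dots> = (\<Sum>j\<in>UNIV. \<Sum>i\<in>UNIV. - (B j * (B i * A j i)))"
  proof (intro sum.cong refl)
    fix i j
    show "B i * (B j * A i j) = - (B j * (B i * A j i))"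
      by (subst assms[of i j]) (simp add: mult.left_commute)
  qed
  also have "\<dots> = - ?X" by (simp add: sum_negf)
  finally have "?X + ?X = 0" by (rule iffD1[OF eq_neg_iff_add_eq_0])
  then show "(\<Sum>i\<in>UNIV. B i * (\<Sum>j\<in>UNIV. B j * A i j)) + (\<Sum>i\<in>UNIV. B i * (\<Sum>j\<in>UNIV. B j * A i j)) = 0"
    by (simp add: sum_distrib_left)
qed

section \<open>Polynomials in the coordinates (\<open>Inl\<close>) and in the symbols
  \<open>Y\<close> of the derivatives (\<open>Inr\<close>)\<close>

definition emb :: "'n mpol \<Rightarrow> ('n + 'n) mpol" where
  "emb = lin_ext (\<lambda>\<kappa> c. mon (case_sum \<kappa> (\<lambda>_. 0)) c)"

lemma emb_add: "emb (p + q) = emb p + emb q"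
  unfolding emb_def by (rule lin_ext_add) (auto simp: single_add)

lemma emb_single: "emb (mon k c) = mon (case_sum k (\<lambda>_. 0)) c"
  unfolding emb_def by (rule lin_ext_single) auto

lemma emb_zero [simp]: "emb 0 = 0" by (simp add: emb_def)

lemma prod_UNIV_sum:
  "(\<Prod>i\<in>UNIV. g i) = (\<Prod>i\<in>UNIV. g (Inl i)) * (\<Prod>i\<in>UNIV. g (Inr i :: 'a::finite + 'b::finite))"
  for g :: "_ \<Rightarrow> 'c::comm_monoid_mult"
proof -
  have "(\<Prod>i\<in>UNIV. g i) = (\<Prod>i\<in>range Inl \<union> range Inr. g i)"
    by (simp flip: UNIV_sum)
  also have "\<dots> = (\<Prod>i\<in>range Inl. g i) * (\<Prod>i\<in>range Inr. g i)"
    by (rule prod.union_disjoint) auto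
  finally show ?thesis by (simp add: prod.reindex)
qed

lemma ev_emb: "ev x (emb p) = ev (\<lambda>i. x (Inl i)) (p :: 'n::finite mpol)"
proof (induction p rule: mpol_induct)
  case (mon k c)
  show ?case by (simp add: emb_single ev_single prod_UNIV_sum)
qed (auto simp: emb_add)

lemma mpol_eqI_ev: "(\<And>x. ev x p = ev x q) \<Longrightarrow> p = q"
  by (rule peval_inj) (auto simp: peval_def)

lemma emb_mult: "emb (p * q) = emb p * emb (q :: 'n::finite mpol)"
  by (rule mpol_eqI_ev) (simp add: ev_emb)

lemma emb_sum: "emb (\<Sum>a\<in>A. g a) = (\<Sum>a\<in>A. emb (g a))"
  by (induction A rule: infinite_finite_induct) (auto simp: emb_add)

lemma emb_power_var: "emb (var i ^ N) = var (Inl i :: 'n::finite + 'n) ^ N"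
  by (rule mpol_eqI_ev) (simp add: ev_emb)

lemma supp_emb: "supp (emb p) \<subseteq> (\<lambda>\<kappa>. case_sum \<kappa> (\<lambda>_. 0)) ` supp p"
  unfolding emb_def lin_ext_def by (rule order_trans[OF supp_sum]) auto

definition degY :: "('n::finite + 'n \<Rightarrow> nat) \<Rightarrow> nat" where
  "degY \<kappa> = (\<Sum>i\<in>UNIV. \<kappa> (Inr i))"

lemma degY_add [simp]: "degY (\<kappa> + \<mu>) = degY \<kappa> + degY \<mu>"
  by (simp add: degY_def sum.distrib)

lemma sum_unit: "(\<Sum>j\<in>UNIV. g j * unit i j) = (g (i :: 'v::finite) :: nat)"
proof -
  have "(\<Sum>j\<in>UNIV. g j * unit i j) = (\<Sum>j\<in>UNIV. if j = i then g j else 0)"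
    by (rule sum.cong) (auto simp: unit_def)
  then show ?thesis by simp
qed

lemma degY_unit [simp]: "degY (unit (Inr i)) = 1" "degY (unit (Inl i)) = 0"
proof -
  have "degY (unit (Inr i)) = (\<Sum>j\<in>UNIV. 1 * unit i j)"
    unfolding degY_def by (rule sum.cong) (auto simp: unit_def)
  then show "degY (unit (Inr i)) = 1" by (simp only: sum_unit)
qed (simp add: degY_def unit_def)

lemma degY_emb: "\<kappa> \<in> supp (emb p) \<Longrightarrow> degY \<kappa> = 0"
  using supp_emb[of p] by (auto simp: degY_def)

text \<open>The weights are scaled by a common denominator \<open>l\<close>, so \<open>f\<close> has
  weight \<open>l\<close> and weights can be raised in integer steps of size one.\<close>

locale weighted_poly =
  fixes W :: "'n::finite \<Rightarrow> nat" and l :: nat and P :: "'n mpol"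
  assumes W_pos: "0 < W i" and l_pos: "0 < l"
    and homogeneous: "\<kappa> \<in> supp P \<Longrightarrow> (\<Sum>i\<in>UNIV. W i * \<kappa> i) = l"
    and critical: "(\<And>i. ev x (dv i P) = 0) \<Longrightarrow> x j = 0"
begin

definition wt :: "('n \<Rightarrow> nat) \<Rightarrow> nat" where
  "wt \<kappa> = (\<Sum>i\<in>UNIV. W i * \<kappa> i)"

abbreviation "Wsum \<equiv> \<Sum>i\<in>UNIV. W i"

text \<open>\<open>Y\<^sub>i\<close> has weight \<open>l\<close> because in
  \<open>\<partial>\<^sup>\<beta> x\<^sup>\<gamma> c\<^sub>j\<close> of fixed order
  \<open>|\<beta>| + j\<close> a further derivative lowers \<open>j\<close> by one, which raises the
  eigenvalue of \<open>\<partial>\<^sub>t t\<close> by one.\<close>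

definition om :: "('n + 'n \<Rightarrow> nat) \<Rightarrow> int" where
  "om \<kappa> = int (wt (\<lambda>i. \<kappa> (Inl i))) + int l * int (degY \<kappa>)"

lemma wt_add [simp]: "wt (\<kappa> + \<mu>) = wt \<kappa> + wt \<mu>"
  by (simp add: wt_def sum.distrib distrib_left)

lemma wt_unit [simp]: "wt (unit i) = W i"
  by (simp add: wt_def sum_unit)

lemma om_add [simp]: "om (\<kappa> + \<mu>) = om \<kappa> + om \<mu>"
proof -
  have "(\<lambda>i. (\<kappa> + \<mu>) (Inl i)) = (\<lambda>i. \<kappa> (Inl i)) + (\<lambda>i. \<mu> (Inl i))" by auto
  then show ?thesis by (simp only: om_def wt_add degY_add) (simp add: distrib_left)
qed

lemma om_unit_Inr [simp]: "om (unit (Inr i)) = int l"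
  by (simp add: om_def wt_def unit_apply)

lemma om_ge_degY: "om \<kappa> \<ge> int l * int (degY \<kappa>)"
  by (simp add: om_def)

lemma om_nonneg: "0 \<le> om \<kappa>"
  by (simp add: om_def)

lemma supp_dv: "\<kappa> \<in> supp (dv i P) \<Longrightarrow> wt \<kappa> + W i = l"
proof -
  assume "\<kappa> \<in> supp (dv i P)"
  then have "\<kappa> + unit i \<in> supp P" by (simp add: in_keys_iff coef_dv)
  then have "wt (\<kappa> + unit i) = l" unfolding wt_def by (rule homogeneous)
  then show ?thesis by simp
qed

definition Fx :: "'n \<Rightarrow> ('n + 'n) mpol" where
  "Fx i = emb (dv i P)"

lemma supp_Fx:
  assumes "\<kappa> \<in> supp (Fx i)"
  shows "om \<kappa> = int l - int (W i)" "degY \<kappa> = 0"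
proof -
  obtain \<mu> where \<mu>: "\<mu> \<in> supp (dv i P)" "\<kappa> = case_sum \<mu> (\<lambda>_. 0)"
    using assms supp_emb[of "dv i P"] by (auto simp: Fx_def)
  show "degY \<kappa> = 0" using assms degY_emb by (auto simp: Fx_def)
  then show "om \<kappa> = int l - int (W i)"
    using supp_dv[OF \<mu>(1)] \<mu>(2) by (simp add: om_def)
qed

lemma var_power_in_jacobian: "\<exists>N a. \<forall>i. var i ^ N = (\<Sum>j\<in>UNIV. a i j * dv j P)"
proof (rule nullstellensatz_origin[of "\<lambda>j. dv j P"], rule allI)
  fix x i assume "\<forall>j. ev x (dv j P) = 0"
  then have "ev x (dv j P) = 0" for j by blast
  then show "x i = 0" by (rule critical)
qed

text \<open>There are as many \<open>Fx i\<close> as \<open>x\<close>-variables, and the powers of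
  these variables remain a regular sequence after adjoining the free variables
  \<open>Y\<close>.\<close>

lemma syzygies_Fx:
  assumes "(\<Sum>i\<in>UNIV. Fx i * h i) = 0"
  shows "\<exists>A. (\<forall>i j. A i j = - A j i) \<and> (\<forall>i. h i = (\<Sum>j\<in>UNIV. Fx j * A i j))"
proof -
  obtain N a where Na: "\<And>i. var i ^ N = (\<Sum>j\<in>UNIV. a i j * dv j P)"
    using var_power_in_jacobian by blast
  have "var (Inl i) ^ N = (\<Sum>j\<in>UNIV. emb (a i j) * Fx j)" for i
    by (simp add: Na emb_sum emb_mult Fx_def flip: emb_power_var)
  then have "\<exists>b. var (Inl i) ^ N = (\<Sum>j\<in>UNIV. b j * Fx j)" for i
    by (intro exI[of _ "\<lambda>j. emb (a i j)"])
  then show ?thesis by (rule syzygies_trivial_of_var_powers[OF inj_Inl _ assms])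
qed

section \<open>Division by \<open>Y\<^sub>i + f\<^sub>i\<close> with control of the weights\<close>

abbreviation YF :: "'n \<Rightarrow> ('n + 'n) mpol" where
  "YF i \<equiv> var (Inr i) + Fx i"

text \<open>Replacing \<open>Y\<^sub>i\<close> by \<open>- f\<^sub>i\<close> one factor at a time
  lowers the degree in \<open>Y\<close>. Only this degree is controlled here; the weights are
  repaired by \<open>raise_weight\<close>.\<close>

lemma divide_YF:
  assumes "\<And>\<kappa>. \<kappa> \<in> supp G \<Longrightarrow> degY \<kappa> \<le> m"
  shows "\<exists>H R. G = (\<Sum>i\<in>UNIV. YF i * H i) + R \<and> (\<forall>i. \<forall>\<kappa>\<in>supp (H i). Suc (degY \<kappa>) \<le> m)
    \<and> (\<forall>\<kappa>\<in>supp R. degY \<kappa> = 0)"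
  using assms
proof (induction m arbitrary: G)
  case 0
  then show ?case by (intro exI[of _ "\<lambda>_. 0"] exI[of _ G]) auto
next
  case (Suc m)
  have "supp G \<subseteq> {\<kappa>. degY \<kappa> \<le> Suc m}" using Suc.prems by auto
  then show ?case
  proof (induction G rule: mpol_induct_supp)
    case zero
    show ?case by (intro exI[of _ "\<lambda>_. 0"] exI[of _ 0]) auto
  next
    case (add p q)
    then obtain H R H' R' where *: "p = (\<Sum>i\<in>UNIV. YF i * H i) + R"
      "q = (\<Sum>i\<in>UNIV. YF i * H' i) + R'"
      "\<forall>i. \<forall>\<kappa>\<in>supp (H i). Suc (degY \<kappa>) \<le> Suc m" "\<forall>i. \<forall>\<kappa>\<in>supp (H' i). Suc (degY \<kappa>) \<le> Suc m"
      "\<forall>\<kappa>\<in>supp R. degY \<kappa> = 0" "\<forall>\<kappa>\<in>supp R'. degY \<kappa> = 0"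
      by auto
    have "p + q = (\<Sum>i\<in>UNIV. YF i * (H i + H' i)) + (R + R')"
      unfolding *(1,2) by (simp add: distrib_left sum.distrib)
    moreover have "\<forall>\<kappa>\<in>supp (H i + H' i). Suc (degY \<kappa>) \<le> Suc m" for i
      using keys_add[of "H i" "H' i"] *(3,4) by blast
    moreover have "\<forall>\<kappa>\<in>supp (R + R'). degY \<kappa> = 0"
      using keys_add[of R R'] *(5,6) by blast
    ultimately show ?case by (intro exI[of _ "\<lambda>i. H i + H' i"] exI[of _ "R + R'"]) blast
  next
    case (mon \<kappa> c)
    show ?case
    proof (cases "degY \<kappa> = 0")
      case True
      then show ?thesis by (intro exI[of _ "\<lambda>_. 0"] exI[of _ "mon \<kappa> c"]) auto
    next
      case False
      then obtain i where i: "\<kappa> (Inr i) \<noteq> 0" by (auto simp: degY_def)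
      define \<mu> where "\<mu> = \<kappa> - unit (Inr i)"
      have \<kappa>: "\<kappa> = unit (Inr i) + \<mu>" using i by (auto simp: \<mu>_def fun_eq_iff unit_def)
      have deg: "degY \<mu> \<le> m" using mon by (simp add: \<kappa>)
      let ?G = "- Fx i * mon \<mu> c"
      have "degY \<nu> \<le> m" if "\<nu> \<in> supp ?G" for \<nu>
        using that deg by (elim supp_mult_cases) (auto simp: supp_Fx split: if_splits)
      then obtain H R where *: "?G = (\<Sum>i\<in>UNIV. YF i * H i) + R"
        "\<forall>i. \<forall>\<kappa>\<in>supp (H i). Suc (degY \<kappa>) \<le> m" "\<forall>\<kappa>\<in>supp R. degY \<kappa> = 0"
        using Suc.IH[of ?G] by blast
      define H' where "H' j = H j + (if j = i then mon \<mu> c else 0)" for j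
      have "mon \<kappa> c = YF i * mon \<mu> c + ?G"
        by (simp add: \<kappa> var_def mult_single distrib_right)
      also have "\<dots> = (\<Sum>j\<in>UNIV. YF j * H' j) + R"
      proof -
        have "(\<Sum>j\<in>UNIV. YF j * H' j) = (\<Sum>j\<in>UNIV. YF j * H j + (if j = i then YF i * mon \<mu> c else 0))"
          by (rule sum.cong) (auto simp: H'_def distrib_left)
        then show ?thesis unfolding *(1) by (simp add: sum.distrib)
      qed
      finally have "mon \<kappa> c = (\<Sum>j\<in>UNIV. YF j * H' j) + R" .
      moreover have "\<forall>\<kappa>\<in>supp (H' j). Suc (degY \<kappa>) \<le> Suc m" for j
        using keys_add[of "H j" "if j = i then mon \<mu> c else 0"] *(2) deg
        unfolding H'_def by (fastforce split: if_splits)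
      ultimately show ?thesis using *(3) by (intro exI[of _ H'] exI[of _ R]) blast
    qed
  qed
qed

lemma ev_degY_0:
  assumes "\<And>\<kappa>. \<kappa> \<in> supp R \<Longrightarrow> degY \<kappa> = 0"
  shows "ev x R = ev (case_sum (\<lambda>i. x (Inl i)) y) R"
proof -
  have "supp R \<subseteq> {\<kappa>. degY \<kappa> = 0}" using assms by auto
  then show ?thesis
    by (induction R rule: mpol_induct_supp) (auto simp: ev_single prod_UNIV_sum degY_def)
qed

text \<open>
  If the part of \<open>H\<close> of lowest weight \<open>e\<close> lies below the weights of \<open>\<Sum>i. YF i * H i\<close>, it is a syzygy of
  the partial derivatives, hence a Koszul syzygy \<open>\<Sum>j. Fx j * A i j\<close>; then subtracting
  \<open>\<Sum>j. YF j * A i j\<close> raises the weight. The bound on \<open>r\<close> makes the part of \<open>A\<close> of top degree in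
  \<open>Y\<close> vanish for weight reasons.
\<close>

lemma raise_weight:
  assumes G: "G = (\<Sum>i\<in>UNIV. YF i * H i)" "\<And>\<kappa>. \<kappa> \<in> supp G \<Longrightarrow> r \<le> om \<kappa>"
    and H: "\<And>i \<kappa>. \<kappa> \<in> supp (H i) \<Longrightarrow> Suc (degY \<kappa>) \<le> m \<and> e + int (W i) \<le> om \<kappa>"
    and r: "r \<le> int l * int m + int l - int Wsum" and e: "e < r - int l"
  shows "\<exists>H'. G = (\<Sum>i\<in>UNIV. YF i * H' i) \<and>
    (\<forall>i. \<forall>\<kappa>\<in>supp (H' i). Suc (degY \<kappa>) \<le> m \<and> e + 1 + int (W i) \<le> om \<kappa>)"
proof -
  define L where "L i = restr (\<lambda>\<kappa>. om \<kappa> = e + int (W i)) (H i)" for i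
  have "0 = restr (\<lambda>\<kappa>. om \<kappa> = e + int l) G"
    using G(2) e by (intro restr_0[symmetric]) force
  also have "\<dots> = (\<Sum>i\<in>UNIV. restr (\<lambda>\<kappa>. om \<kappa> = e + int l) (YF i * H i))"
    by (simp add: G(1) restr_sum)
  also have "\<dots> = (\<Sum>i\<in>UNIV. Fx i * L i)"
  proof (rule sum.cong[OF refl])
    fix i
    have "restr (\<lambda>\<kappa>. om \<kappa> = e + int l) (var (Inr i) * H i) = 0"
    proof (rule restr_0)
      fix \<kappa> assume "\<kappa> \<in> supp (var (Inr i) * H i)"
      then obtain \<nu> where "\<nu> \<in> supp (H i)" "\<kappa> = unit (Inr i) + \<nu>"
        by (elim supp_mult_cases) (auto simp: supp_var)
      then show "om \<kappa> \<noteq> e + int l" using H[of \<nu> i] W_pos[of i] by force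
    qed
    moreover have "restr (\<lambda>\<kappa>. om \<kappa> = e + int l) (Fx i * H i) = Fx i * L i"
      unfolding L_def by (rule restr_mult) (auto simp: supp_Fx)
    ultimately show "restr (\<lambda>\<kappa>. om \<kappa> = e + int l) (YF i * H i) = Fx i * L i"
      by (simp add: distrib_right restr_add)
  qed
  finally have "(\<Sum>i\<in>UNIV. Fx i * L i) = 0" by (rule sym)
  from syzygies_Fx[OF this]
  obtain A0 where A0: "\<And>i j. A0 i j = - A0 j i" "\<And>i. L i = (\<Sum>j\<in>UNIV. Fx j * A0 i j)"
    by blast
  \<comment> \<open>The \<open>Fx j\<close> are homogeneous in weight and free of \<open>Y\<close>,
    so the matrix may be cut to the matching weight and to the allowed degree in \<open>Y\<close>.
    The condition is symmetric in \<open>i\<close> and \<open>j\<close>, which keeps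
    antisymmetry.\<close>
  define A where "A i j = restr (\<lambda>\<kappa>. om \<kappa> = e + int (W i) + int (W j) - int l \<and> Suc (degY \<kappa>) \<le> m) (A0 i j)"
    for i j
  have A_anti: "A i j = - A j i" for i j
    unfolding A_def A0(1)[of i j]
    by (rule poly_mapping_eqI) (auto simp: coef_restr add.commute)
  have L_eq: "L i = (\<Sum>j\<in>UNIV. Fx j * A i j)" for i
  proof -
    let ?Q = "\<lambda>\<kappa>. om \<kappa> = e + int (W i) \<and> Suc (degY \<kappa>) \<le> m"
    have "L i = restr ?Q (L i)"
      using H[of _ i] by (intro restr_id[symmetric]) (auto simp: L_def supp_restr)
    also have "\<dots> = (\<Sum>j\<in>UNIV. restr ?Q (Fx j * A0 i j))"
      unfolding A0(2)[of i] by (rule restr_sum)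
    also have "\<dots> = (\<Sum>j\<in>UNIV. Fx j * A i j)"
      unfolding A_def by (intro sum.cong refl restr_mult) (auto simp: supp_Fx)
    finally show ?thesis .
  qed
  have A_supp: "Suc (Suc (degY \<kappa>)) \<le> m \<and> om \<kappa> = e + int (W i) + int (W j) - int l"
    if \<kappa>: "\<kappa> \<in> supp (A i j)" for i j \<kappa>
  proof -
    have "i \<noteq> j"
    proof
      assume "i = j"
      then have "A i j + A i j = 0" using A_anti[of i i] by (simp add: eq_neg_iff_add_eq_0)
      then show False using \<kappa> mpol_double_0 by force
    qed
    have "W i + W j = sum W {i, j}" using \<open>i \<noteq> j\<close> by simp
    also have "\<dots> \<le> Wsum" by (rule sum_mono2) auto
    finally have WW: "W i + W j \<le> Wsum" .
    have om: "om \<kappa> = e + int (W i) + int (W j) - int l" and d: "Suc (degY \<kappa>) \<le> m"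
      using \<kappa> by (auto simp: A_def supp_restr)
    \<comment> \<open>In degree \<open>m - 1\<close> in \<open>Y\<close> the weight would be at
      least \<open>l (m - 1)\<close>, while \<open>W i + W j \<le> Wsum\<close> and the bounds on
      \<open>e\<close> and \<open>r\<close> keep it below.\<close>
    have "Suc (degY \<kappa>) \<noteq> m"
    proof
      assume "Suc (degY \<kappa>) = m"
      then have "int l * int (degY \<kappa>) = int l * int m - int l"
        by (metis add_diff_cancel_left' int_ops(4) mult.right_neutral of_nat_Suc right_diff_distrib add.commute)
      then show False using om_ge_degY[of \<kappa>] om WW r e by linarith
    qed
    then show ?thesis using d om by linarith
  qed
  \<comment> \<open>Subtracting a Koszul syzygy of the \<open>YF j\<close> leaves the sum unchanged.
    Its \<open>Fx\<close> part cancels the lowest weight of \<open>H i\<close>, and its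
    \<open>var (Inr j)\<close> part has higher weight.\<close>
  define H' where "H' i = H i - (\<Sum>j\<in>UNIV. YF j * A i j)" for i
  have H'_eq: "H' i = (H i - L i) - (\<Sum>j\<in>UNIV. var (Inr j) * A i j)" for i
    by (simp add: H'_def L_eq distrib_right sum.distrib)
  have "(\<Sum>i\<in>UNIV. YF i * H' i) = G - (\<Sum>i\<in>UNIV. YF i * (\<Sum>j\<in>UNIV. YF j * A i j))"
    unfolding H'_def G(1) right_diff_distrib sum_subtractf ..
  then have "G = (\<Sum>i\<in>UNIV. YF i * H' i)"
    by (simp only: antisymmetric_sum_0[OF A_anti] diff_zero)
  moreover have "Suc (degY \<kappa>) \<le> m \<and> e + 1 + int (W i) \<le> om \<kappa>" if "\<kappa> \<in> supp (H' i)" for i \<kappa>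
  proof -
    have "\<kappa> \<in> supp (H i - L i) \<or> \<kappa> \<in> (\<Union>j. supp (var (Inr j) * A i j))"
      using that supp_diff[of "H i - L i"] supp_sum[of "\<lambda>j. var (Inr j) * A i j" UNIV]
      unfolding H'_eq by blast
    then show ?thesis
    proof
      assume "\<kappa> \<in> supp (H i - L i)"
      then have "\<kappa> \<in> supp (H i)" "om \<kappa> \<noteq> e + int (W i)"
        by (auto simp: in_keys_iff L_def lookup_minus coef_restr split: if_splits)
      then show ?thesis using H[of \<kappa> i] by force
    next
      assume "\<kappa> \<in> (\<Union>j. supp (var (Inr j) * A i j))"
      then obtain j \<nu> where \<nu>: "\<nu> \<in> supp (A i j)" "\<kappa> = unit (Inr j) + \<nu>"
        by (auto elim!: supp_mult_cases simp: supp_var)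
      then show ?thesis using A_supp[OF \<nu>(1)] W_pos[of j] by simp
    qed
  qed
  ultimately show ?thesis by blast
qed

theorem divide_YF_weighted:
  assumes G: "\<And>\<kappa>. \<kappa> \<in> supp G \<Longrightarrow> degY \<kappa> \<le> m \<and> r \<le> om \<kappa>"
    and zero: "\<And>z. ev (case_sum z (\<lambda>i. - ev z (dv i P))) G = 0"
    and r: "r \<le> int l * int m + int l - int Wsum"
  shows "\<exists>H. G = (\<Sum>i\<in>UNIV. YF i * H i) \<and>
    (\<forall>i. \<forall>\<kappa>\<in>supp (H i). Suc (degY \<kappa>) \<le> m \<and> r - int l + int (W i) \<le> om \<kappa>)"
proof -
  have "\<And>\<kappa>. \<kappa> \<in> supp G \<Longrightarrow> degY \<kappa> \<le> m" using G by blast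
  from divide_YF[OF this]
  obtain H0 R where H0: "G = (\<Sum>i\<in>UNIV. YF i * H0 i) + R"
    "\<forall>i. \<forall>\<kappa>\<in>supp (H0 i). Suc (degY \<kappa>) \<le> m" and R: "\<forall>\<kappa>\<in>supp R. degY \<kappa> = 0"
    by blast
  \<comment> \<open>\<open>R\<close> does not involve \<open>Y\<close>, so its value may be computed
    at \<open>Y = - grad f\<close>, where \<open>G\<close> and all \<open>YF i\<close>
    vanish.\<close>
  have "ev x R = 0" for x
  proof -
    let ?z = "\<lambda>i. x (Inl i)"
    let ?x = "case_sum ?z (\<lambda>i. - ev ?z (dv i P))"
    have "ev x R = ev ?x R" by (rule ev_degY_0) (use R in auto)
    also have "\<dots> = ev ?x G - (\<Sum>i\<in>UNIV. ev ?x (YF i) * ev ?x (H0 i))"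
      by (simp add: H0(1))
    also have "\<dots> = 0" using zero[of ?z] by (simp add: Fx_def ev_emb)
    finally show ?thesis .
  qed
  then have "R = 0" by (intro mpol_eqI_ev) simp
  \<comment> \<open>From here on the weights are raised by one at a time up to \<open>r - l\<close>;
    at this starting value the condition holds since weights are nonnegative and
    \<open>W i \<le> Wsum\<close>.\<close>
  define e0 where "e0 = - int Wsum"
  have Wle: "int (W i) \<le> int Wsum" for i by (intro of_nat_mono member_le_sum) auto
  have "\<exists>H. G = (\<Sum>i\<in>UNIV. YF i * H i) \<and>
      (\<forall>i. \<forall>\<kappa>\<in>supp (H i). Suc (degY \<kappa>) \<le> m \<and> e0 + int k + int (W i) \<le> om \<kappa>)"
    if "e0 + int k \<le> max e0 (r - int l)" for k
    using that
  proof (induction k)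
    case 0
    have "e0 + int (W i) \<le> om \<kappa>" for i \<kappa> using om_nonneg[of \<kappa>] Wle[of i] by (simp add: e0_def)
    then show ?case using H0 \<open>R = 0\<close> by (intro exI[of _ H0]) auto
  next
    case (Suc k)
    have "e0 + int k \<le> max e0 (r - int l)" using Suc.prems by linarith
    from Suc.IH[OF this] obtain H where H: "G = (\<Sum>i\<in>UNIV. YF i * H i)"
      "\<forall>i. \<forall>\<kappa>\<in>supp (H i). Suc (degY \<kappa>) \<le> m \<and> e0 + int k + int (W i) \<le> om \<kappa>"
      by blast
    have lt: "e0 + int k < r - int l" using Suc.prems by simp
    have "\<exists>H'. G = (\<Sum>i\<in>UNIV. YF i * H' i) \<and>
      (\<forall>i. \<forall>\<kappa>\<in>supp (H' i). Suc (degY \<kappa>) \<le> m \<and> e0 + int k + 1 + int (W i) \<le> om \<kappa>)"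
      by (rule raise_weight[OF H(1) _ _ r lt]) (use G H(2) in blast)+
    then show ?case by (simp add: algebra_simps)
  qed
  note ex = this
  have max: "e0 + int (nat (max e0 (r - int l) - e0)) = max e0 (r - int l)" by simp
  from ex[of "nat (max e0 (r - int l) - e0)", unfolded max] obtain H where H: "G = (\<Sum>i\<in>UNIV. YF i * H i)"
      "\<forall>i. \<forall>\<kappa>\<in>supp (H i). Suc (degY \<kappa>) \<le> m \<and> max e0 (r - int l) + int (W i) \<le> om \<kappa>"
    by blast
  have "r - int l + int (W i) \<le> om \<kappa>" if "\<kappa> \<in> supp (H i)" for i \<kappa>
    using H(2) that by fastforce
  then show ?thesis using H by blast
qed

text \<open>A monomial of large weight is divisible by some \<open>x\<^sub>i\<^sup>N\<close> from
  the Jacobian ideal. Taking homogeneous parts of the cofactors fixes their weights, as the finite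
  generation of the V-filtration demands.\<close>

lemma monomial_in_jacobian:
  "\<exists>B. \<forall>\<kappa>. B \<le> wt \<kappa> \<longrightarrow> (\<exists>h. mon \<kappa> 1 = (\<Sum>j\<in>UNIV. dv j P * h j) \<and>
     (\<forall>j. \<forall>\<mu>\<in>supp (h j). wt \<mu> + l = wt \<kappa> + W j))"
proof -
  obtain N a where Na: "\<And>i. var i ^ N = (\<Sum>j\<in>UNIV. a i j * dv j P)"
    using var_power_in_jacobian by blast
  show ?thesis
  proof (intro exI[of _ "Suc (\<Sum>i\<in>UNIV. W i * N)"] allI impI)
    fix \<kappa> assume \<kappa>: "Suc (\<Sum>i\<in>UNIV. W i * N) \<le> wt \<kappa>"
    have "\<exists>i. N \<le> \<kappa> i"
    proof (rule ccontr)
      assume "\<not> ?thesis"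
      then have "wt \<kappa> \<le> (\<Sum>i\<in>UNIV. W i * N)"
        unfolding wt_def by (intro sum_mono mult_le_mono) (auto simp: not_le less_imp_le)
      then show False using \<kappa> by simp
    qed
    then obtain i where i: "N \<le> \<kappa> i" ..
    define \<nu> where "\<nu> = (\<lambda>j. if j = i then \<kappa> j - N else \<kappa> j)"
    have "mon \<kappa> 1 = var i ^ N * mon \<nu> 1"
    proof -
      have "(\<lambda>j. if j = i then N else 0) + \<nu> = \<kappa>" using i by (auto simp: \<nu>_def)
      then show ?thesis by (simp add: var_power mult_single)
    qed
    also have "\<dots> = (\<Sum>j\<in>UNIV. dv j P * (a i j * mon \<nu> 1))"
      unfolding Na sum_distrib_right by (intro sum.cong refl) (simp only: mult_ac)
    finally have 1: "mon \<kappa> 1 = (\<Sum>j\<in>UNIV. dv j P * (a i j * mon \<nu> 1))" .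
    define h where "h j = restr (\<lambda>\<mu>. wt \<mu> + l = wt \<kappa> + W j) (a i j * mon \<nu> 1)" for j
    have "mon \<kappa> 1 = restr (\<lambda>\<mu>. wt \<mu> = wt \<kappa>) (mon \<kappa> (1 :: complex))"
      by (rule restr_id[symmetric]) auto
    also have "\<dots> = restr (\<lambda>\<mu>. wt \<mu> = wt \<kappa>) (\<Sum>j\<in>UNIV. dv j P * (a i j * mon \<nu> 1))"
      by (rule arg_cong[OF 1])
    also have "\<dots> = (\<Sum>j\<in>UNIV. restr (\<lambda>\<mu>. wt \<mu> = wt \<kappa>) (dv j P * (a i j * mon \<nu> 1)))"
      by (rule restr_sum)
    also have "\<dots> = (\<Sum>j\<in>UNIV. dv j P * h j)"
    proof (intro sum.cong refl)
      fix j
      show "restr (\<lambda>\<mu>. wt \<mu> = wt \<kappa>) (dv j P * (a i j * mon \<nu> 1)) = dv j P * h j"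
        unfolding h_def
      proof (rule restr_mult)
        fix \<mu> \<kappa>' assume "\<mu> \<in> supp (dv j P)"
        then show "wt (\<mu> + \<kappa>') = wt \<kappa> \<longleftrightarrow> wt \<kappa>' + l = wt \<kappa> + W j"
          using supp_dv[of \<mu> j] by auto
      qed
    qed
    finally show "\<exists>h. mon \<kappa> 1 = (\<Sum>j\<in>UNIV. dv j P * h j) \<and>
       (\<forall>j. \<forall>\<mu>\<in>supp (h j). wt \<mu> + l = wt \<kappa> + W j)"
      by (intro exI[of _ h]) (auto simp: h_def supp_restr)
  qed
qed

end

section \<open>Operators on the graph module\<close>

lemma fold_zero_fun [simp]: "(\<lambda>_. 0) = 0"
  by (simp add: zero_fun_def)

lemma graph_moduleI: "(\<And>j. b j \<in> S) \<Longrightarrow> (\<And>j. m \<le> j \<Longrightarrow> b j = 0) \<Longrightarrow> b \<in> graph_module S"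
  unfolding graph_module_def by (auto intro!: finite_subset[of _ "{..<m}"] simp: not_le[symmetric])

lemma graph_moduleE:
  assumes "b \<in> graph_module S"
  obtains m where "\<And>j. m \<le> j \<Longrightarrow> b j = 0" "\<And>j. b j \<in> S"
proof -
  have "finite {j. b j \<noteq> 0}" using assms by (simp add: graph_module_def)
  then obtain m where "\<forall>j\<in>{j. b j \<noteq> 0}. j < m"
    by (auto simp: finite_nat_set_iff_bounded)
  then have "b j = 0" if "m \<le> j" for j using that by (auto simp: not_less[symmetric])
  moreover have "b j \<in> S" for j using assms by (simp add: graph_module_def)
  ultimately show ?thesis by (rule that)
qed

lemma graph_module_mem: "b \<in> graph_module S \<Longrightarrow> b j \<in> S"
  by (simp add: graph_module_def)

lemma graph_module_mono: "S \<subseteq> T \<Longrightarrow> graph_module S \<subseteq> graph_module T"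
  by (auto simp: graph_module_def)

lemma g_t_eq: "g_t f b = (\<lambda>j. f * b j - of_nat (Suc j) * b (Suc j))"
  by (simp add: g_t_def fun_eq_iff)

lemma g_t_add: "g_t f (b + c) = g_t f b + g_t f c"
  by (simp add: g_t_def fun_eq_iff algebra_simps)

lemma g_dt_add: "g_dt (b + c) = g_dt b + g_dt c"
  by (simp add: g_dt_def fun_eq_iff split: nat.split)

lemma g_mul_add: "g_mul g (b + c) = g_mul g b + g_mul g c"
  by (simp add: g_mul_def fun_eq_iff algebra_simps)

lemma g_mul_add_left: "g_mul (g + h) b = g_mul g b + g_mul h b"
  by (simp add: g_mul_def fun_eq_iff algebra_simps)

lemma g_mul_mult: "g_mul g (g_mul h b) = g_mul (g * h) b"
  by (simp add: g_mul_def fun_eq_iff algebra_simps)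

lemma g_mul_commute: "g_mul g (g_mul h b) = g_mul h (g_mul g b)"
  by (simp add: g_mul_def fun_eq_iff algebra_simps)

lemma g_mul_const_mult: "g_mul (\<lambda>_. c) (g_mul (\<lambda>_. d) b) = g_mul (\<lambda>_. c * d) b"
  by (simp add: g_mul_def fun_eq_iff algebra_simps)

lemma g_mul_const_add: "g_mul (\<lambda>_. c + d) b = g_mul (\<lambda>_. c) b + g_mul (\<lambda>_. d) b"
  by (simp add: g_mul_def fun_eq_iff algebra_simps)

lemma g_mul_one [simp]: "g_mul 1 b = b" "g_mul (\<lambda>_. 1) b = b"
  by (simp_all add: g_mul_def fun_eq_iff)

lemma g_mul_zero [simp]: "g_mul 0 b = 0" "g_mul (\<lambda>_. 0) b = 0" "g_mul g 0 = 0"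
  by (simp_all add: g_mul_def fun_eq_iff)

lemma g_mul_minus_one: "g_mul (\<lambda>_. - 1) b = - b"
  by (simp add: g_mul_def fun_eq_iff)

lemma g_t_zero [simp]: "g_t f 0 = 0"
  by (simp add: g_t_def fun_eq_iff)

lemma g_dt_zero [simp]: "g_dt 0 = 0"
  by (simp add: g_dt_def fun_eq_iff split: nat.split)

lemma g_t_diff: "g_t f (b - c) = g_t f b - g_t f c"
  by (simp add: g_t_def fun_eq_iff algebra_simps)

lemma g_dt_diff: "g_dt (b - c) = g_dt b - g_dt c"
  by (simp add: g_dt_def fun_eq_iff split: nat.split)

lemma g_mul_diff: "g_mul g (b - c) = g_mul g b - g_mul g c"
  by (simp add: g_mul_def fun_eq_iff algebra_simps)

lemma g_t_mul: "g_t f (g_mul g b) = g_mul g (g_t f b)"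
  by (simp add: g_t_def g_mul_def fun_eq_iff algebra_simps)

lemma g_dt_mul: "g_dt (g_mul g b) = g_mul g (g_dt b)"
  by (simp add: g_dt_def g_mul_def fun_eq_iff split: nat.split)

lemma g_dt_t: "g_dt (g_t f b) = g_t f (g_dt b) + b"
  by (simp add: g_dt_def g_t_def fun_eq_iff algebra_simps split: nat.split)

lemma g_t_delta: "g_t f (g_delta u) = g_delta (f * u)"
  by (simp add: g_t_def g_delta_def fun_eq_iff)

lemma g_mul_delta: "g_mul g (g_delta u) = g_delta (g * u)"
  by (simp add: g_mul_def g_delta_def fun_eq_iff)

lemma g_delta_add: "g_delta (u + v) = g_delta u + g_delta v"
  by (simp add: g_delta_def fun_eq_iff)

lemma g_delta_zero [simp]: "g_delta 0 = 0"
  by (simp add: g_delta_def fun_eq_iff)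

lemma g_delta_0 [simp]: "g_delta u 0 = u"
  by (simp add: g_delta_def)

lemma g_delta_shift: "b = g_delta (b 0) + g_dt (\<lambda>j. b (Suc j))"
  by (simp add: g_delta_def g_dt_def fun_eq_iff split: nat.split)

lemma g_t_minus_f: "g_t f b - g_mul f b = (\<lambda>j. - (of_nat (Suc j) * b (Suc j)))"
  by (simp add: g_t_def g_mul_def fun_eq_iff)

lemma graph_module_induct [consumes 1, case_names delta dt add]:
  assumes "b \<in> graph_module S"
    and "\<And>u. u \<in> S \<Longrightarrow> Q (g_delta u)"
    and "\<And>b. b \<in> graph_module S \<Longrightarrow> Q b \<Longrightarrow> Q (g_dt b)"
    and "\<And>b c. Q b \<Longrightarrow> Q c \<Longrightarrow> Q (b + c)"
  shows "Q b"
proof -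
  obtain m where m: "\<And>j. m \<le> j \<Longrightarrow> b j = 0" "\<And>j. b j \<in> S"
    using assms(1) by (rule graph_moduleE) blast
  then show ?thesis
  proof (induction m arbitrary: b)
    case 0
    then have "b = g_delta (b 0)" by (auto simp: fun_eq_iff g_delta_def)
    then show ?case using assms(2) 0 by metis
  next
    case (Suc m)
    let ?c = "\<lambda>j. b (Suc j)"
    have "?c \<in> graph_module S" using Suc.prems by (intro graph_moduleI[of _ _ m]) auto
    moreover have "Q ?c" using Suc by auto
    ultimately have "Q (g_delta (b 0) + g_dt ?c)" using assms Suc.prems by blast
    then show ?case by (simp flip: g_delta_shift)
  qed
qed

text \<open>
  \<open>t - f\<close> is \<open>- d/d\<partial>\<^sub>t\<close>; together with \<open>\<partial>\<^sub>t\<close> it recovers the coefficients of an element of the graph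
  module.
\<close>

lemma graph_coefficients:
  fixes Z :: "int \<Rightarrow> 'n::finite graph_elt set"
  assumes zero: "\<And>k. 0 \<in> Z k" and add: "\<And>k b c. b \<in> Z k \<Longrightarrow> c \<in> Z k \<Longrightarrow> b + c \<in> Z k"
    and sc: "\<And>k b c. b \<in> Z k \<Longrightarrow> g_mul (\<lambda>_. c) b \<in> Z k"
    and dt: "\<And>k b. b \<in> Z k \<Longrightarrow> g_dt b \<in> Z (k + 1)"
    and lower: "\<And>k b. b \<in> Z k \<Longrightarrow> g_t f b - g_mul f b \<in> Z (k - 1)"
    and b: "b \<in> Z k" "\<And>j. m \<le> j \<Longrightarrow> b j = 0"
  shows "g_delta (b j) \<in> Z (k - int j)"
proof -
  \<comment> \<open>Conversely, an element is put together from its coefficients, each multiplied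
    back by its power of \<open>\<partial>\<^sub>t\<close>. This serves below to split off the
    coefficient at 0.\<close>
  have assemble: "c \<in> Z k" if "\<And>j. m \<le> j \<Longrightarrow> c j = 0" "\<And>j. g_delta (c j) \<in> Z (k - int j)" for c k m
    using that
  proof (induction m arbitrary: c k)
    case 0
    then have "c = 0" by (auto simp: fun_eq_iff)
    then show ?case using zero by (simp only:)
  next
    case (Suc m)
    have "(\<lambda>j. c (Suc j)) \<in> Z (k - 1)"
    proof (rule Suc.IH)
      show "c (Suc j) = 0" if "m \<le> j" for j using Suc.prems(1)[of "Suc j"] that by simp
      show "g_delta (c (Suc j)) \<in> Z (k - 1 - int j)" for j
        using Suc.prems(2)[of "Suc j"] by (simp add: algebra_simps)
    qed
    then have "g_delta (c 0) + g_dt (\<lambda>j. c (Suc j)) \<in> Z k"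
      using dt[of "\<lambda>j. c (Suc j)" "k - 1"] Suc.prems(2)[of 0] by (intro add) auto
    then show ?case by (simp flip: g_delta_shift)
  qed
  from b show ?thesis
  proof (induction m arbitrary: b k j)
    case 0
    then show ?case using zero by simp
  next
    case (Suc m)
    \<comment> \<open>The coefficients of \<open>(t - f) b\<close> are those of \<open>b\<close>
      shifted down by one and multiplied by nonzero integers, so the bound \<open>m\<close> drops
      and the induction hypothesis applies.\<close>
    have S: "g_delta (b (Suc j)) \<in> Z (k - int (Suc j))" for j
    proof -
      let ?L = "g_t f b - g_mul f b"
      have "g_delta (?L j) \<in> Z (k - 1 - int j)"
      proof (rule Suc.IH)
        show "?L \<in> Z (k - 1)" by (rule lower[OF Suc.prems(1)])
        show "?L j = 0" if "m \<le> j" for j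
          using Suc.prems(2)[of "Suc j"] that by (simp add: g_t_minus_f)
      qed
      then have "g_mul (\<lambda>_. - 1 / of_nat (Suc j)) (g_delta (?L j)) \<in> Z (k - 1 - int j)"
        by (rule sc)
      moreover have "g_mul (\<lambda>_. - 1 / of_nat (Suc j)) (g_delta (?L j)) = g_delta (b (Suc j))"
        unfolding g_t_minus_f by (simp add: g_mul_def g_delta_def fun_eq_iff del: of_nat_Suc)
      ultimately show ?thesis by (simp add: algebra_simps)
    qed
    show ?case
    proof (cases j)
      case (Suc j')
      then show ?thesis using S by simp
    next
      case 0
      have "(\<lambda>j. b (Suc j)) \<in> Z (k - 1)"
      proof (rule assemble)
        show "b (Suc j) = 0" if "m \<le> j" for j using Suc.prems(2)[of "Suc j"] that by simp
        show "g_delta (b (Suc j)) \<in> Z (k - 1 - int j)" for j using S[of j] by (simp add: algebra_simps)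
      qed
      then have "g_mul (\<lambda>_. - 1) (g_dt (\<lambda>j. b (Suc j))) \<in> Z k"
        using dt[of "\<lambda>j. b (Suc j)" "k - 1"] by (intro sc) simp
      then have "b + g_mul (\<lambda>_. - 1) (g_dt (\<lambda>j. b (Suc j))) \<in> Z k"
        using Suc.prems(1) by (intro add)
      moreover have "b + g_mul (\<lambda>_. - 1) (g_dt (\<lambda>j. b (Suc j))) = g_delta (b 0)"
        by (subst (1) g_delta_shift[of b]) (simp add: g_mul_minus_one)
      ultimately show ?thesis using 0 by simp
    qed
  qed
qed

section \<open>The localization at \<open>f\<close>, its connection, and the graph module over
  it\<close>

locale loc_module =
  fixes f :: "complex ^ 'n::finite \<Rightarrow> complex" and \<alpha> :: rat
  assumes f_poly: "f \<in> polyfun" and f_nz: "\<exists>x. f x \<noteq> 0"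
begin

abbreviation "Loc \<equiv> localization f"
abbreviation "N \<equiv> graph_module (localization f)"
abbreviation "t \<equiv> g_t f"
abbreviation "dx \<equiv> g_dx f \<alpha>"
abbreviation "Dt b \<equiv> g_dt (g_t f b)"
abbreviation "sc c \<equiv> g_mul (\<lambda>_. c)"

lemma LocI: "g \<in> polyfun \<Longrightarrow> loc_elt f g k \<in> Loc"
  by (auto simp: localization_def)

lemma LocE:
  assumes "u \<in> Loc" obtains g k where "g \<in> polyfun" "u = loc_elt f g k"
  using assms by (auto simp: localization_def)

lemma Loc_vanish: "u \<in> Loc \<Longrightarrow> f x = 0 \<Longrightarrow> u x = 0"
  by (auto simp: localization_def loc_elt_def)

lemma Loc_zero: "0 \<in> Loc"
proof -
  have "loc_elt f 0 0 = 0" by (auto simp: loc_elt_def)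
  then show ?thesis using LocI[OF polyfun_const(2), of 0] by simp
qed

lemma Loc_add: "u \<in> Loc \<Longrightarrow> v \<in> Loc \<Longrightarrow> u + v \<in> Loc"
proof -
  assume "u \<in> Loc" "v \<in> Loc"
  then obtain g k h m where *: "g \<in> polyfun" "u = loc_elt f g k" "h \<in> polyfun" "v = loc_elt f h m"
    by (metis LocE)
  have "u + v = loc_elt f (g * (\<lambda>x. f x ^ m) + h * (\<lambda>x. f x ^ k)) (k + m)"
    unfolding * by (auto simp: loc_elt_def fun_eq_iff power_add field_simps)
  also have "\<dots> \<in> Loc"
    by (intro LocI polyfun_add polyfun_mult polyfun_power' * f_poly)
  finally show ?thesis .
qed

lemma Loc_mult: "g \<in> polyfun \<Longrightarrow> u \<in> Loc \<Longrightarrow> g * u \<in> Loc"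
proof -
  assume g: "g \<in> polyfun" and "u \<in> Loc"
  then obtain h k where *: "h \<in> polyfun" "u = loc_elt f h k" by (metis LocE)
  have "g * u = loc_elt f (g * h) k"
    unfolding * by (auto simp: loc_elt_def fun_eq_iff)
  then show ?thesis by (simp add: LocI polyfun_mult g *)
qed

lemma Loc_uminus: "u \<in> Loc \<Longrightarrow> - u \<in> Loc"
  using Loc_mult[OF polyfun_const(1)[of "- 1"], of u] by (simp add: times_fun_def fun_Compl_def)

lemma Loc_diff: "u \<in> Loc \<Longrightarrow> v \<in> Loc \<Longrightarrow> u - v \<in> Loc"
  using Loc_add[of u "- v"] Loc_uminus[of v] by simp

text \<open>Division by zero yields 0, in agreement with the extension of elements of
  \<open>Loc\<close> by zero to the zero set of \<open>f\<close>.\<close>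

lemma Loc_div_f: "u \<in> Loc \<Longrightarrow> (\<lambda>x. u x / f x) \<in> Loc"
proof -
  assume "u \<in> Loc"
  then obtain h k where *: "h \<in> polyfun" "u = loc_elt f h k" by (metis LocE)
  have "(\<lambda>x. u x / f x) = loc_elt f h (Suc k)"
    unfolding * by (auto simp: loc_elt_def fun_eq_iff)
  then show ?thesis by (simp add: LocI *)
qed

lemma f_times_div: "u \<in> Loc \<Longrightarrow> f * (\<lambda>x. u x / f x) = u"
  by (auto simp: fun_eq_iff Loc_vanish)

lemma Loc_f_cancel: "u \<in> Loc \<Longrightarrow> f * u = 0 \<Longrightarrow> u = 0"
  using Loc_vanish by (fastforce simp: fun_eq_iff)

lemma loc_elt_has_pd:
  assumes "g \<in> polyfun" "f x \<noteq> 0"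
  shows "((\<lambda>z. loc_elt f g k (x + axis i z)) has_field_derivative
    (pd i g x * f x - of_nat k * g x * pd i f x) / f x ^ Suc k) (at 0)"
proof -
  have df: "((\<lambda>z. f (x + axis i z)) has_field_derivative pd i f x) (at 0)"
    by (rule polyfun_has_pd[OF f_poly])
  have dg: "((\<lambda>z. g (x + axis i z)) has_field_derivative pd i g x) (at 0)"
    by (rule polyfun_has_pd[OF assms(1)])
  have "isCont (\<lambda>z. f (x + axis i z)) 0" using df by (rule DERIV_isCont)
  then have "((\<lambda>z. f (x + axis i z)) \<longlongrightarrow> f x) (at 0)" by (simp add: isCont_def)
  then have "\<forall>\<^sub>F z in at 0. f (x + axis i z) \<noteq> 0"
    using assms(2) by (rule tendsto_imp_eventually_ne)
  then have "\<forall>\<^sub>F z in nhds 0. f (x + axis i z) \<noteq> 0"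
    using assms(2) by (simp add: eventually_nhds_conv_at)
  then have ev: "\<forall>\<^sub>F z in nhds 0. g (x + axis i z) / f (x + axis i z) ^ k = loc_elt f g k (x + axis i z)"
    by eventually_elim (simp add: loc_elt_def)
  have "((\<lambda>z. g (x + axis i z) / f (x + axis i z) ^ k) has_field_derivative
    (pd i g x * f x - of_nat k * g x * pd i f x) / f x ^ Suc k) (at 0)"
  proof (rule derivative_eq_intros df dg refl)+
    show "f (x + axis i 0) ^ k \<noteq> 0" using assms by simp
    show "(pd i g x * f (x + axis i 0) ^ k - g (x + axis i 0) * (of_nat k * (pd i f x * f (x + axis i 0) ^ (k - Suc 0)))) /
      (f (x + axis i 0) ^ k * f (x + axis i 0) ^ k) = (pd i g x * f x - of_nat k * g x * pd i f x) / f x ^ Suc k"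
      using assms by (cases k) (auto simp: field_simps)
  qed
  then show ?thesis by (rule DERIV_cong_ev[OF refl ev refl, THEN iffD1])
qed

lemma conn_loc_elt:
  assumes "g \<in> polyfun"
  shows "conn f \<alpha> i (loc_elt f g k)
    = loc_elt f (f * pd i g - (\<lambda>_. of_nat k + of_rat \<alpha>) * g * pd i f) (Suc k)"
proof
  fix x
  show "conn f \<alpha> i (loc_elt f g k) x
    = loc_elt f (f * pd i g - (\<lambda>_. of_nat k + of_rat \<alpha>) * g * pd i f) (Suc k) x"
  proof (cases "f x = 0")
    case False
    then have "pd i (loc_elt f g k) x = (pd i g x * f x - of_nat k * g x * pd i f x) / f x ^ Suc k"
      by (intro pd_eqI loc_elt_has_pd assms)
    then show ?thesis using False
      by (simp add: conn_def loc_elt_def field_simps)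
  qed (simp add: conn_def loc_elt_def)
qed

lemma conn_Loc: "u \<in> Loc \<Longrightarrow> conn f \<alpha> i u \<in> Loc"
  by (elim LocE) (auto simp: conn_loc_elt intro!: LocI polyfun_diff polyfun_mult pd_polyfun f_poly polyfun_const)

lemma Loc_has_pd:
  assumes "u \<in> Loc" "f x \<noteq> 0"
  shows "((\<lambda>z. u (x + axis i z)) has_field_derivative pd i u x) (at 0)"
proof -
  obtain g k where "g \<in> polyfun" "u = loc_elt f g k" using assms by (metis LocE)
  then show ?thesis using loc_elt_has_pd[of g x k i] assms(2) by (simp add: pd_eqI)
qed

lemma conn_add:
  assumes "u \<in> Loc" "v \<in> Loc"
  shows "conn f \<alpha> i (u + v) = conn f \<alpha> i u + conn f \<alpha> i v"
proof
  fix x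
  show "conn f \<alpha> i (u + v) x = (conn f \<alpha> i u + conn f \<alpha> i v) x"
  proof (cases "f x = 0")
    case False
    then have "pd i (u + v) x = pd i u x + pd i v x"
      by (intro pd_eqI) (auto intro!: derivative_eq_intros Loc_has_pd assms)
    then show ?thesis using False by (simp add: conn_def field_simps)
  qed (simp add: conn_def)
qed

lemma conn_mult:
  assumes "g \<in> polyfun" "u \<in> Loc"
  shows "conn f \<alpha> i (g * u) = pd i g * u + g * conn f \<alpha> i u"
proof
  fix x
  show "conn f \<alpha> i (g * u) x = (pd i g * u + g * conn f \<alpha> i u) x"
  proof (cases "f x = 0")
    case False
    then have "pd i (g * u) x = pd i g x * u x + g x * pd i u x"
      by (intro pd_eqI) (auto intro!: derivative_eq_intros Loc_has_pd polyfun_has_pd assms)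
    then show ?thesis using False by (simp add: conn_def field_simps)
  qed (simp add: conn_def Loc_vanish[OF assms(2)])
qed

lemma conn_zero [simp]: "conn f \<alpha> i 0 = 0"
  using conn_add[OF Loc_zero Loc_zero] by simp

lemma conn_const_mult:
  assumes "u \<in> Loc"
  shows "conn f \<alpha> i ((\<lambda>_. c) * u) = (\<lambda>_. c) * conn f \<alpha> i u"
  using conn_mult[OF polyfun_const(1) assms, of i c] by simp

lemma conn_uminus: "u \<in> Loc \<Longrightarrow> conn f \<alpha> i (- u) = - conn f \<alpha> i u"
  using conn_add[of u "- u" i] Loc_uminus[of u] by (simp add: eq_neg_iff_add_eq_0 add.commute)

lemma conn_diff: "u \<in> Loc \<Longrightarrow> v \<in> Loc \<Longrightarrow> conn f \<alpha> i (u - v) = conn f \<alpha> i u - conn f \<alpha> i v"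
  using conn_add[of u "- v" i] conn_uminus[of v i] Loc_uminus[of v] by simp

lemma conn_of_nat_mult: "u \<in> Loc \<Longrightarrow> conn f \<alpha> i (of_nat m * u) = of_nat m * conn f \<alpha> i u"
  using conn_const_mult[of u i "of_nat m"] by (simp add: of_nat_fun)

lemma conn_commute:
  assumes "u \<in> Loc"
  shows "conn f \<alpha> i (conn f \<alpha> j u) = conn f \<alpha> j (conn f \<alpha> i u)"
proof -
  obtain g k where g: "g \<in> polyfun" "u = loc_elt f g k" using assms by (metis LocE)
  have c: "pd i (\<lambda>_. a) = 0" for i :: 'n and a by simp
  have pf: "pd j g \<in> polyfun" "pd j f \<in> polyfun" "(\<lambda>_. of_nat k + of_rat \<alpha>) * g * pd j f \<in> polyfun"
    "(\<lambda>_. of_nat k + of_rat \<alpha>) * g \<in> polyfun" "f * pd j g \<in> polyfun"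
    "f * pd j g - (\<lambda>_. of_nat k + of_rat \<alpha>) * g * pd j f \<in> polyfun" for j
    by (intro polyfun_diff polyfun_mult pd_polyfun f_poly g polyfun_const)+
  have pdd: "pd i (p - q) = pd i p - pd i q" if "p \<in> polyfun" "q \<in> polyfun" for i p q
    using pd_add[of p "- q" i] pd_uminus[of q i] polyfun_uminus[of q] that by simp
  show ?thesis
    unfolding g(2) conn_loc_elt[OF g(1)] conn_loc_elt[OF pf(6)]
    unfolding pdd[OF pf(5) pf(3)] pd_mult[OF f_poly pf(1)] pd_mult[OF pf(4) pf(2)]
      pd_mult[OF polyfun_const(1) g(1)] c
    unfolding pd_commute[OF g(1), of i j] pd_commute[OF f_poly, of i j]
    by (rule arg_cong[where f="\<lambda>h. loc_elt f h (Suc (Suc k))"])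
       (simp add: fun_eq_iff algebra_simps)
qed

lemma N_zero: "0 \<in> N"
  by (rule graph_moduleI) (auto simp: Loc_zero)

lemma N_add: "b \<in> N \<Longrightarrow> c \<in> N \<Longrightarrow> b + c \<in> N"
proof -
  assume "b \<in> N" "c \<in> N"
  then obtain m m' where "\<And>j. m \<le> j \<Longrightarrow> b j = 0" "\<And>j. b j \<in> Loc" "\<And>j. m' \<le> j \<Longrightarrow> c j = 0" "\<And>j. c j \<in> Loc"
    by (metis graph_moduleE)
  then show ?thesis by (intro graph_moduleI[of _ _ "max m m'"]) (auto simp: Loc_add)
qed

lemma N_mul: "g \<in> polyfun \<Longrightarrow> b \<in> N \<Longrightarrow> g_mul g b \<in> N"
proof (elim graph_moduleE)
  fix m assume "g \<in> polyfun" "\<And>j. m \<le> j \<Longrightarrow> b j = 0" "\<And>j. b j \<in> Loc"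
  then show ?thesis by (intro graph_moduleI[of _ _ m]) (auto simp: g_mul_def Loc_mult)
qed

lemma N_sc: "b \<in> N \<Longrightarrow> sc c b \<in> N"
  by (rule N_mul[OF polyfun_const(1)])

lemma N_uminus: "b \<in> N \<Longrightarrow> - b \<in> N"
  using N_sc[of b "- 1"] by (simp add: g_mul_minus_one)

lemma N_diff: "b \<in> N \<Longrightarrow> c \<in> N \<Longrightarrow> b - c \<in> N"
  using N_add[of b "- c"] N_uminus[of c] by simp

lemma N_delta: "u \<in> Loc \<Longrightarrow> g_delta u \<in> N"
  by (rule graph_moduleI[of _ _ 1]) (auto simp: g_delta_def Loc_zero)

lemma N_t: "b \<in> N \<Longrightarrow> t b \<in> N"
proof (elim graph_moduleE, rule graph_moduleI)
  fix m j assume b: "\<And>j. m \<le> j \<Longrightarrow> b j = 0" "\<And>j. b j \<in> Loc"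
  have *: "of_nat (Suc j) * b (Suc j) \<in> Loc"
    using Loc_mult[OF polyfun_const(1)[of "of_nat (Suc j)"] b(2)[of "Suc j"]] by (simp only: of_nat_fun)
  then show "t b j \<in> Loc" unfolding g_t_eq using b(2) by (intro Loc_diff[OF _ *] Loc_mult f_poly)
  show "m \<le> j \<Longrightarrow> t b j = 0" using b(1)[of j] b(1)[of "Suc j"] by (simp add: g_t_eq)
qed

lemma N_dt: "b \<in> N \<Longrightarrow> g_dt b \<in> N"
proof (elim graph_moduleE)
  fix m assume b: "\<And>j. m \<le> j \<Longrightarrow> b j = 0" "\<And>j. b j \<in> Loc"
  then show ?thesis
    by (intro graph_moduleI[of _ _ "Suc m"]) (auto simp: g_dt_def Loc_zero split: nat.split)
qed

lemma N_dx: "b \<in> N \<Longrightarrow> dx i b \<in> N"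
proof (elim graph_moduleE)
  fix m assume b: "\<And>j. m \<le> j \<Longrightarrow> b j = 0" "\<And>j. b j \<in> Loc"
  then show ?thesis
    by (intro graph_moduleI[of _ _ "Suc m"])
       (auto simp: g_dx_def Loc_zero conn_Loc Loc_diff Loc_mult pd_polyfun f_poly split: nat.split)
qed

lemma dx_add:
  assumes "b \<in> N" "c \<in> N" shows "dx i (b + c) = dx i b + dx i c"
  by (rule ext) (use assms in \<open>auto simp: g_dx_def conn_add graph_module_mem algebra_simps split: nat.split\<close>)

lemma dx_mul:
  assumes "g \<in> polyfun" "b \<in> N" shows "dx i (g_mul g b) = g_mul (pd i g) b + g_mul g (dx i b)"
  by (rule ext) (use assms in \<open>auto simp: g_dx_def g_mul_def conn_mult graph_module_mem algebra_simps split: nat.split\<close>)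

lemma dx_sc: "b \<in> N \<Longrightarrow> dx i (sc c b) = sc c (dx i b)"
  using dx_mul[OF polyfun_const(1), of b i c] by simp

lemma dx_zero [simp]: "dx i 0 = 0"
  using dx_add[OF N_zero N_zero] by simp

lemma dx_uminus: "b \<in> N \<Longrightarrow> dx i (- b) = - dx i b"
  using dx_sc[of b i "- 1"] by (simp add: g_mul_minus_one)

lemma dx_diff: "b \<in> N \<Longrightarrow> c \<in> N \<Longrightarrow> dx i (b - c) = dx i b - dx i c"
  using dx_add[of b "- c" i] dx_uminus[of c i] N_uminus[of c] by simp

lemma dx_dt: "b \<in> N \<Longrightarrow> dx i (g_dt b) = g_dt (dx i b)"
  by (rule ext) (auto simp: g_dx_def g_dt_def split: nat.split)

lemma dx_t:
  assumes "b \<in> N" shows "dx i (t b) = t (dx i b)"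
proof
  fix j
  have L: "b j \<in> Loc" "b (Suc j) \<in> Loc" "f * b j \<in> Loc" for j
    using assms by (auto simp: graph_module_mem Loc_mult f_poly)
  have L': "of_nat (Suc j) * b (Suc j) \<in> Loc"
    using Loc_mult[OF polyfun_const(1)[of "of_nat (Suc j)"] L(2)] by (simp only: of_nat_fun)
  show "dx i (t b) j = t (dx i b) j"
    unfolding g_dx_def g_t_eq conn_diff[OF L(3) L'] conn_mult[OF f_poly L(1)] conn_of_nat_mult[OF L(2)]
    by (cases j) (auto simp: algebra_simps)
qed

lemma dx_Dt: "b \<in> N \<Longrightarrow> dx i (Dt b) = Dt (dx i b)"
  by (simp add: dx_t dx_dt N_t)

lemma dx_commute:
  assumes "b \<in> N" shows "dx i (dx j b) = dx j (dx i b)"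
proof
  fix k
  have L: "b k \<in> Loc" "conn f \<alpha> i (b k) \<in> Loc" "pd i f * b k \<in> Loc" for k i
    using assms by (auto simp: graph_module_mem conn_Loc Loc_mult pd_polyfun f_poly)
  show "dx i (dx j b) k = dx j (dx i b) k"
  proof (cases k)
    case 0
    then show ?thesis by (simp add: g_dx_def conn_commute L)
  next
    case (Suc k')
    have *: "conn f \<alpha> i (conn f \<alpha> j (b k) - pd j f * b k') =
      conn f \<alpha> i (conn f \<alpha> j (b k)) - (pd i (pd j f) * b k' + pd j f * conn f \<alpha> i (b k'))" for i j
      unfolding conn_diff[OF L(2) L(3)] conn_mult[OF pd_polyfun[OF f_poly] L(1)] ..
    show ?thesis
      unfolding g_dx_def Suc nat.case
      unfolding *[unfolded Suc] conn_commute[OF L(1), of i j] pd_commute[OF f_poly, of i j]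
      by (cases k') (auto simp: algebra_simps)
  qed
qed

lemma Dt_mul: "Dt (g_mul g b) = g_mul g (Dt b)"
  by (simp add: g_t_mul g_dt_mul)

lemma Dt_add: "Dt (b + c) = Dt b + Dt c"
  by (simp add: g_t_add g_dt_add)

lemma Dt_diff: "Dt (b - c) = Dt b - Dt c"
  by (simp add: g_t_diff g_dt_diff)

lemma Dt_t: "Dt (t b) = t (Dt b) + t b"
  using g_dt_t[of f "t b"] g_dt_t[of f b] by (simp add: g_t_add)

lemma t_dt: "t (g_dt b) = Dt b - b"
  by (simp add: g_dt_t)

text \<open>On the highest coefficient \<open>t\<close> acts as multiplication by \<open>f\<close>,
  which is injective on \<open>Loc\<close>.\<close>

lemma t_inj: "b \<in> N \<Longrightarrow> t b = 0 \<Longrightarrow> b = 0"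
proof (elim graph_moduleE)
  fix m assume b: "\<And>j. m \<le> j \<Longrightarrow> b j = 0" "\<And>j. b j \<in> Loc" and tb: "t b = 0"
  have "\<forall>j. m - k \<le> j \<longrightarrow> b j = 0" for k
  proof (induction k)
    case (Suc k)
    show ?case
    proof safe
      fix j assume j: "m - Suc k \<le> j"
      have "t b j = 0" using tb by simp
      moreover have "b (Suc j) = 0" using Suc j by auto
      ultimately have "f * b j = 0" by (simp add: g_t_eq)
      then show "b j = 0" using b(2) Loc_f_cancel by blast
    qed
  qed (use b in auto)
  from this[of m] show ?thesis by (auto simp: fun_eq_iff)
qed

text \<open>Dividing the top coefficient by \<open>f\<close> solves the equation in highest order;
  lower orders follow by induction, and the order is not raised.\<close>

lemma t_surj_order:
  assumes "b \<in> N" "\<And>j. m \<le> j \<Longrightarrow> b j = 0"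
  shows "\<exists>c\<in>N. (\<forall>j\<ge>m. c j = 0) \<and> t c = b"
  using assms
proof (induction m arbitrary: b)
  case 0
  then have "b = 0" by (auto simp: fun_eq_iff)
  then show ?case by (intro bexI[of _ 0]) (auto simp: N_zero)
next
  case (Suc m)
  define c where "c = (\<lambda>j. if j = m then (\<lambda>x. b m x / f x) else 0)"
  have bm: "b m \<in> Loc" using Suc.prems by (simp add: graph_module_mem)
  have cN: "c \<in> N"
    by (rule graph_moduleI[of _ _ "Suc m"]) (auto simp: c_def Loc_zero Loc_div_f bm)
  have "t c m = b m" using f_times_div[OF bm] by (simp add: g_t_eq c_def)
  then have "(b - t c) j = 0" if "m \<le> j" for j
    using Suc.prems(2)[of j] that by (cases "j = m") (auto simp: g_t_eq c_def)
  then obtain c' where c': "c' \<in> N" "\<forall>j\<ge>m. c' j = 0" "t c' = b - t c"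
    using Suc.IH[of "b - t c"] Suc.prems(1) cN by (metis N_diff N_t)
  show ?case
  proof (intro bexI[of _ "c + c'"] conjI allI impI)
    show "c + c' \<in> N" using cN c' by (rule_tac N_add)
    show "t (c + c') = b" using c' by (simp add: g_t_add)
    fix j assume "Suc m \<le> j"
    then show "(c + c') j = 0" using c' by (simp add: c_def)
  qed
qed

lemma t_bij: "bij_betw t N N"
  unfolding bij_betw_def
proof
  show "inj_on t N"
  proof (rule inj_onI)
    fix b c assume "b \<in> N" "c \<in> N" "t b = t c"
    then have "t (b - c) = 0" "b - c \<in> N" by (auto simp: g_t_diff N_diff)
    then have "b - c = 0" by (rule_tac t_inj)
    then show "b = c" by simp
  qed
  show "t ` N = N"
  proof (intro equalityI subsetI)
    fix b assume b: "b \<in> N"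
    then obtain m where "\<And>j. m \<le> j \<Longrightarrow> b j = 0" by (rule graph_moduleE) blast
    with b show "b \<in> t ` N" using t_surj_order[of b m] by blast
  qed (auto simp: N_t)
qed

end

section \<open>Additive spans and relative monodromy filtrations\<close>

lemma add_span_base: "x \<in> S \<Longrightarrow> x \<in> add_span S"
  unfolding add_span_def by (auto intro!: exI[of _ "[x]"])

lemma add_span_zero: "0 \<in> add_span S"
  unfolding add_span_def by (auto intro!: exI[of _ "[]"])

lemma add_span_add: "x \<in> add_span S \<Longrightarrow> y \<in> add_span S \<Longrightarrow> x + y \<in> add_span S"
proof -
  assume "x \<in> add_span S" "y \<in> add_span S"
  then obtain xs ys where "x = sum_list xs" "y = sum_list ys" "set xs \<subseteq> S" "set ys \<subseteq> S"
    by (auto simp: add_span_def)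
  then have "x + y = sum_list (xs @ ys) \<and> set (xs @ ys) \<subseteq> S" by simp
  then show ?thesis unfolding add_span_def by blast
qed

lemma add_span_induct [consumes 1, case_names zero base add]:
  assumes "x \<in> add_span S" "Q 0" "\<And>x. x \<in> S \<Longrightarrow> Q x"
    "\<And>x y. x \<in> add_span S \<Longrightarrow> y \<in> add_span S \<Longrightarrow> Q x \<Longrightarrow> Q y \<Longrightarrow> Q (x + y)"
  shows "Q x"
proof -
  have "sum_list xs \<in> add_span S \<and> Q (sum_list xs)" if "set xs \<subseteq> S" for xs
    using that by (induction xs) (auto intro: assms add_span_zero add_span_add add_span_base)
  then show ?thesis using assms(1) by (auto simp: add_span_def)
qed

lemma add_span_least:
  assumes "S \<subseteq> T" "0 \<in> T" "\<And>x y. x \<in> T \<Longrightarrow> y \<in> T \<Longrightarrow> x + y \<in> T"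
  shows "add_span S \<subseteq> T"
proof
  fix x assume "x \<in> add_span S"
  then show "x \<in> T" by (induction rule: add_span_induct) (use assms in auto)
qed

lemma add_span_mono: "S \<subseteq> T \<Longrightarrow> add_span S \<subseteq> add_span T"
  by (rule add_span_least) (auto intro: add_span_base add_span_zero add_span_add)

lemma set_plus_absorb:
  fixes X Y :: "'a::comm_monoid_add set"
  assumes "Y \<subseteq> X" "0 \<in> Y" "\<And>x y. x \<in> X \<Longrightarrow> y \<in> X \<Longrightarrow> x + y \<in> X"
  shows "X + Y = X"
proof
  show "X + Y \<subseteq> X" using assms by (auto simp: set_plus_def)
  show "X \<subseteq> X + Y"
  proof
    fix x assume "x \<in> X"
    then have "x + 0 \<in> X + Y" using assms(2) by (rule set_plus_intro)
    then show "x \<in> X + Y" by simp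
  qed
qed

lemma rel_monodromyI:
  assumes "\<And>k. subobject (M k)" "\<And>k. B \<subseteq> M k" "\<And>k. M k \<subseteq> A" "mono M"
    "M k1 = B" "M k2 = A" "\<And>k x. x \<in> M k \<Longrightarrow> T x \<in> M (k - 2)"
    and inj: "\<And>l (k :: nat) x. 1 \<le> k \<Longrightarrow> x \<in> M (l + int k) \<Longrightarrow> x \<in> L l \<Longrightarrow>
      (T ^^ k) x \<in> M (l - int k - 1) \<inter> L l + M (l - int k) \<inter> L (l - 1) \<Longrightarrow>
      \<exists>y z. x = y + z \<and> y \<in> M (l + int k - 1) \<inter> L l \<and> z \<in> M (l + int k) \<inter> L (l - 1)"
    and surj: "\<And>l (k :: nat) x. 1 \<le> k \<Longrightarrow> x \<in> M (l - int k) \<Longrightarrow> x \<in> L l \<Longrightarrow>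
      \<exists>u y z. x = (T ^^ k) u + (y + z) \<and> u \<in> M (l + int k) \<inter> L l \<and> y \<in> M (l - int k - 1) \<inter> L l
        \<and> z \<in> M (l - int k) \<inter> L (l - 1)"
  shows "rel_monodromy_filtration subobject A B T L M"
proof -
  have "(\<forall>k. subobject (M k) \<and> B \<subseteq> M k \<and> M k \<subseteq> A) \<and> mono M \<and> (\<exists>k. M k = B) \<and> (\<exists>k. M k = A) \<and>
     (\<forall>k. T ` M k \<subseteq> M (k - 2))"
    using assms(1-4,7) assms(5)[symmetric] assms(6)[symmetric] by blast
  moreover have "x \<in> M (l + int k - 1) \<inter> L l + M (l + int k) \<inter> L (l - 1)"
    if "1 \<le> k" "x \<in> M (l + int k) \<inter> L l"
      "(T ^^ k) x \<in> M (l - int k - 1) \<inter> L l + M (l - int k) \<inter> L (l - 1)" for k l x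
  proof -
    have "\<exists>y z. x = y + z \<and> y \<in> M (l + int k - 1) \<inter> L l \<and> z \<in> M (l + int k) \<inter> L (l - 1)"
      using that by (intro inj) auto
    then show ?thesis unfolding set_plus_def by blast
  qed
  moreover have "x \<in> (T ^^ k) ` (M (l + int k) \<inter> L l) + (M (l - int k - 1) \<inter> L l + M (l - int k) \<inter> L (l - 1))"
    if "1 \<le> k" "x \<in> M (l - int k) \<inter> L l" for k l x
  proof -
    have "\<exists>u y z. x = (T ^^ k) u + (y + z) \<and> u \<in> M (l + int k) \<inter> L l \<and> y \<in> M (l - int k - 1) \<inter> L l
        \<and> z \<in> M (l - int k) \<inter> L (l - 1)"
      using that by (intro surj) auto
    then show ?thesis unfolding set_plus_def by blast
  qed
  ultimately show ?thesis
    unfolding rel_monodromy_filtration_def Let_def by blast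
qed

lemma rel_monodromyD:
  assumes "rel_monodromy_filtration subobject A B T L M"
  shows "subobject (M k)" "B \<subseteq> M k" "M k \<subseteq> A" "mono M" "\<exists>k. M k = B" "\<exists>k. M k = A"
    "x \<in> M k \<Longrightarrow> T x \<in> M (k - 2)"
  using assms unfolding rel_monodromy_filtration_def Let_def by blast+

lemma rel_monodromy_inj:
  assumes "rel_monodromy_filtration subobject A B T L M"
    and "1 \<le> k" "x \<in> M (l + int k)" "x \<in> L l" "(T ^^ k) x = y + z"
    "y \<in> M (l - int k - 1)" "y \<in> L l" "z \<in> M (l - int k)" "z \<in> L (l - 1)"
  shows "\<exists>y z. x = y + z \<and> y \<in> M (l + int k - 1) \<and> y \<in> L l \<and> z \<in> M (l + int k) \<and> z \<in> L (l - 1)"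
proof -
  have "(T ^^ k) x \<in> M (l - int k - 1) \<inter> L l + M (l - int k) \<inter> L (l - 1)"
    unfolding assms(5) by (rule set_plus_intro) (use assms in auto)
  moreover have "x \<in> M (l + int k) \<inter> L l" using assms by auto
  ultimately have "x \<in> M (l + int k - 1) \<inter> L l + M (l + int k) \<inter> L (l - 1)"
    using assms(1,2) unfolding rel_monodromy_filtration_def Let_def by blast
  then show ?thesis unfolding set_plus_def by blast
qed

lemma rel_monodromy_surj:
  assumes "rel_monodromy_filtration subobject A B T L M"
    and "1 \<le> k" "x \<in> M (l - int k)" "x \<in> L l"
  shows "\<exists>u y z. x = (T ^^ k) u + (y + z) \<and> u \<in> M (l + int k) \<and> u \<in> L l \<and>
    y \<in> M (l - int k - 1) \<and> y \<in> L l \<and> z \<in> M (l - int k) \<and> z \<in> L (l - 1)"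
proof -
  have "x \<in> (T ^^ k) ` (M (l + int k) \<inter> L l) + (M (l - int k - 1) \<inter> L l + M (l - int k) \<inter> L (l - 1))"
    using assms unfolding rel_monodromy_filtration_def Let_def by blast
  then show ?thesis unfolding set_plus_def by blast
qed

section \<open>The monodromy filtration of an operator of square zero\<close>

definition img_mod :: "'a::ab_group_add set \<Rightarrow> 'a set \<Rightarrow> ('a \<Rightarrow> 'a) \<Rightarrow> 'a set" where
  "img_mod A B T = T ` A + B"

definition ker_mod :: "'a set \<Rightarrow> 'a set \<Rightarrow> ('a \<Rightarrow> 'a) \<Rightarrow> 'a set" where
  "ker_mod A B T = {x \<in> A. T x \<in> B}"

text \<open>\<open>T\<close> is considered on the quotient of \<open>A\<close> by \<open>B\<close>;
  \<open>img_mod\<close> and \<open>ker_mod\<close> are the preimages in \<open>A\<close> of its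
  image and kernel there.\<close>

locale square_zero =
  fixes A B :: "'a::ab_group_add set" and T :: "'a \<Rightarrow> 'a"
  assumes B_0: "0 \<in> B" and B_A: "B \<subseteq> A"
    and A_add: "x \<in> A \<Longrightarrow> y \<in> A \<Longrightarrow> x + y \<in> A" and B_add: "x \<in> B \<Longrightarrow> y \<in> B \<Longrightarrow> x + y \<in> B"
    and T_add: "T (x + y) = T x + T y"
    and T_A: "x \<in> A \<Longrightarrow> T x \<in> A" and T_B: "x \<in> B \<Longrightarrow> T x \<in> B"
    and T_T: "x \<in> A \<Longrightarrow> T (T x) \<in> B"
begin

abbreviation "ImT \<equiv> img_mod A B T"
abbreviation "KerT \<equiv> ker_mod A B T"

text \<open>The monodromy filtration centred at \<open>c\<close>: since \<open>T\<close> has square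
  zero, its graded pieces are in the degrees \<open>c - 1\<close>, \<open>c\<close> and
  \<open>c + 1\<close>.\<close>

definition mfil :: "int \<Rightarrow> int \<Rightarrow> 'a set" where
  "mfil c k = (if k < c - 1 then B else if k = c - 1 then ImT else if k = c then KerT else A)"

lemma T_0: "T 0 = 0"
  using T_add[of 0 0] by simp

lemma T_pow_0: "(T ^^ k) 0 = 0"
  by (induction k) (auto simp: T_0)

lemma ImI: "x \<in> A \<Longrightarrow> y \<in> B \<Longrightarrow> T x + y \<in> ImT"
  unfolding img_mod_def by (rule set_plus_intro) auto

lemma ImE: "z \<in> ImT \<Longrightarrow> (\<And>x y. z = T x + y \<Longrightarrow> x \<in> A \<Longrightarrow> y \<in> B \<Longrightarrow> thesis) \<Longrightarrow> thesis"
  unfolding img_mod_def by (elim set_plus_elim imageE) auto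

lemma B_Im: "B \<subseteq> ImT"
  using ImI[of 0] T_0 B_0 B_A by auto

lemma T_Im: "x \<in> A \<Longrightarrow> T x \<in> ImT"
  using ImI[of x 0] B_0 by simp

lemma Im_Ker: "ImT \<subseteq> KerT"
proof
  fix z assume "z \<in> ImT"
  then obtain x y where *: "z = T x + y" "x \<in> A" "y \<in> B" by (rule ImE)
  then have "T (T x) + T y \<in> B" using T_T T_B by (intro B_add) auto
  then show "z \<in> KerT" using * B_A by (auto simp: ker_mod_def T_add intro!: A_add T_A)
qed

lemma Ker_A: "KerT \<subseteq> A"
  by (auto simp: ker_mod_def)

lemma T_Ker: "x \<in> KerT \<Longrightarrow> T x \<in> B"
  by (simp add: ker_mod_def)

lemma T_pow_ge2: "x \<in> A \<Longrightarrow> (T ^^ Suc (Suc k)) x \<in> B"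
  by (induction k) (auto simp: T_T T_B)

lemma T_pow_A: "x \<in> A \<Longrightarrow> (T ^^ k) x \<in> A"
  by (induction k) (auto simp: T_A)

lemma T_pow_ge1: "x \<in> A \<Longrightarrow> 1 \<le> k \<Longrightarrow> (T ^^ k) x \<in> ImT"
  by (cases k) (auto simp: T_pow_A T_Im)

lemma mfil_mono: "mono (mfil c)"
proof (rule monoI)
  fix k l :: int assume "k \<le> l"
  then show "mfil c k \<subseteq> mfil c l"
    using B_Im Im_Ker Ker_A by (auto simp: mfil_def)
qed

lemma mfil_bounds: "B \<subseteq> mfil c k" "mfil c k \<subseteq> A"
  using B_Im Im_Ker Ker_A by (auto simp: mfil_def)

lemma T_mfil: "x \<in> mfil c k \<Longrightarrow> T x \<in> mfil c (k - 2)"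
  using T_Ker[of x] T_Im[of x] Im_Ker T_A[of x] T_B[of x] B_Im B_A
  by (auto simp: mfil_def split: if_splits)

lemma mfil_0: "0 \<in> mfil c k"
  using mfil_bounds B_0 by blast

text \<open>When both filtrations coincide, \<open>gr\<^sup>M\<^sub>p gr\<^sup>L\<^sub>q\<close>
  vanishes for \<open>p \<noteq> q\<close>, so bijectivity for \<open>k \<ge> 1\<close> is between
  zero objects.\<close>

lemma rel_monodromy_self:
  assumes "subobject A" "subobject B" "subobject ImT" "subobject KerT"
  shows "rel_monodromy_filtration subobject A B T (mfil c) (mfil c)"
proof (rule rel_monodromyI)
  show "subobject (mfil c k)" for k using assms by (simp add: mfil_def)
  show "mfil c (c - 2) = B" "mfil c (c + 1) = A" by (simp_all add: mfil_def)
  fix l :: int and k :: nat and x assume k: "1 \<le> k"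
  { assume "x \<in> mfil c (l + int k)" "x \<in> mfil c l"
    then show "\<exists>y z. x = y + z \<and> y \<in> mfil c (l + int k - 1) \<inter> mfil c l
        \<and> z \<in> mfil c (l + int k) \<inter> mfil c (l - 1)"
      using monoD[OF mfil_mono, of l "l + int k - 1" c] k mfil_0
      by (intro exI[of _ x] exI[of _ 0]) auto }
  { assume "x \<in> mfil c (l - int k)" "x \<in> mfil c l"
    then show "\<exists>u y z. x = (T ^^ k) u + (y + z) \<and> u \<in> mfil c (l + int k) \<inter> mfil c l
        \<and> y \<in> mfil c (l - int k - 1) \<inter> mfil c l \<and> z \<in> mfil c (l - int k) \<inter> mfil c (l - 1)"
      using monoD[OF mfil_mono, of "l - int k" "l - 1" c] k mfil_0
      by (intro exI[of _ 0] exI[of _ x]) (auto simp: T_pow_0) }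
qed (use mfil_mono mfil_bounds T_mfil in auto)

text \<open>\<open>L\<close> jumps only at \<open>c\<close>, so only \<open>l = c\<close> matters
  and the relative filtration is the ordinary monodromy filtration.\<close>

lemma rel_monodromy_pure:
  assumes "subobject A" "subobject B" "subobject ImT" "subobject KerT"
  shows "rel_monodromy_filtration subobject A B T (\<lambda>k. if c \<le> k then A else B) (mfil c)"
proof (rule rel_monodromyI)
  show "subobject (mfil c k)" for k using assms by (simp add: mfil_def)
  show "mfil c (c - 2) = B" "mfil c (c + 1) = A" by (simp_all add: mfil_def)
  let ?L = "\<lambda>k. if c \<le> k then A else B"
  fix l :: int and k :: nat and x assume k: "1 \<le> k"
  { assume x: "x \<in> mfil c (l + int k)" "x \<in> ?L l"
      and T: "(T ^^ k) x \<in> mfil c (l - int k - 1) \<inter> ?L l + mfil c (l - int k) \<inter> ?L (l - 1)"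
    show "\<exists>y z. x = y + z \<and> y \<in> mfil c (l + int k - 1) \<inter> ?L l \<and> z \<in> mfil c (l + int k) \<inter> ?L (l - 1)"
    proof (cases "l = c")
      case False
      then have "x \<in> ?L (l - 1)" using x by auto
      then show ?thesis using x mfil_0 B_0 B_A by (intro exI[of _ 0] exI[of _ x]) auto
    next
      case True
      have "x \<in> mfil c (l + int k - 1)"
      proof (cases "k = 1")
        case False
        then show ?thesis using x True k by (auto simp: mfil_def)
      next
        case k1: True
        from T obtain y z where "T x = y + z" "y \<in> mfil c (c - 2)" "z \<in> B"
          using True k1 by (auto elim!: set_plus_elim)
        then have "T x \<in> B" by (auto simp: mfil_def intro: B_add)
        then show ?thesis using x True k1 by (auto simp: mfil_def ker_mod_def)
      qed
      then show ?thesis using x True mfil_0 B_0 by (intro exI[of _ x] exI[of _ 0]) auto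
    qed }
  { assume x: "x \<in> mfil c (l - int k)" "x \<in> ?L l"
    show "\<exists>u y z. x = (T ^^ k) u + (y + z) \<and> u \<in> mfil c (l + int k) \<inter> ?L l
        \<and> y \<in> mfil c (l - int k - 1) \<inter> ?L l \<and> z \<in> mfil c (l - int k) \<inter> ?L (l - 1)"
    proof (cases "l = c \<and> k = 1")
      case True
      then have "x \<in> ImT" using x by (simp add: mfil_def)
      then obtain u z where "x = T u + z" "u \<in> A" "z \<in> B" by (rule ImE)
      then have "x = (T ^^ k) u + (0 + z) \<and> u \<in> mfil c (l + int k) \<inter> ?L l
          \<and> 0 \<in> mfil c (l - int k - 1) \<inter> ?L l \<and> z \<in> mfil c (l - int k) \<inter> ?L (l - 1)"
        using True mfil_0[of c "c - 2"] B_0 B_A B_Im by (auto simp: mfil_def)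
      then show ?thesis by blast
    next
      case False
      then have "x \<in> ?L (l - 1)" using x k by (auto simp: mfil_def)
      then show ?thesis using x mfil_0 B_0 B_A
        by (intro exI[of _ 0] exI[of _ x]) (auto simp: T_pow_0)
    qed }
qed (use mfil_mono mfil_bounds T_mfil in auto)

text \<open>For \<open>k \<ge> 2\<close> the map \<open>T\<^sup>k\<close> is zero on the quotient,
  so its bijectivity removes the graded pieces in the degrees \<open>c + k\<close> and
  \<open>c - k\<close>; then \<open>k = 1\<close> identifies the remaining steps with image and
  kernel.\<close>

lemma rel_monodromy_pure_unique:
  assumes "rel_monodromy_filtration subobject A B T (\<lambda>k. if c \<le> k then A else B) M"
    and sub: "\<And>X x y. subobject X \<Longrightarrow> x \<in> X \<Longrightarrow> y \<in> X \<Longrightarrow> x + y \<in> X"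
  shows "M = mfil c"
proof -
  note rm = assms(1)
  note M_sub = rel_monodromyD(1)[OF rm] and M_B = rel_monodromyD(2)[OF rm]
    and M_A = rel_monodromyD(3)[OF rm] and M_mono = rel_monodromyD(4)[OF rm]
    and M_T = rel_monodromyD(7)[OF rm]
  have M_add: "x + y \<in> M k" if "x \<in> M k" "y \<in> M k" for x y k by (rule sub[OF M_sub that])
  have M0: "0 \<in> M k" for k using M_B B_0 by blast
  have inj: "\<exists>y z. x = y + z \<and> y \<in> M (c + int k - 1) \<and> z \<in> B"
    if "1 \<le> k" "x \<in> M (c + int k)" "(T ^^ k) x \<in> B" for k x
  proof -
    have "x \<in> A" "(T ^^ k) x \<in> M (c - int k)" using that M_A M_B by auto
    then show ?thesis
      using rel_monodromy_inj[OF rm that(1,2), of 0 "(T ^^ k) x"] that(3) M0 B_0 B_A by auto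
  qed
  have surj: "\<exists>u y z. x = (T ^^ k) u + (y + z) \<and> u \<in> A \<and> y \<in> M (c - int k - 1) \<and> z \<in> B"
    if "1 \<le> k" "x \<in> M (c - int k)" for k x
  proof -
    have "x \<in> A" using that M_A by auto
    then show ?thesis using rel_monodromy_surj[OF rm that] by auto
  qed
  have up: "M (c + int k) \<subseteq> M (c + int k - 1)" if k2: "2 \<le> k" for k
  proof
    fix x assume x: "x \<in> M (c + int k)"
    then have "x \<in> A" using M_A by blast
    then have "(T ^^ k) x \<in> B" using T_pow_ge2[of x "k - 2"] k2 by (simp add: numeral_2_eq_2 Suc_diff_Suc)
    then obtain y z where "x = y + z" "y \<in> M (c + int k - 1)" "z \<in> B"
      using inj[of k x] k2 x by auto
    then show "x \<in> M (c + int k - 1)" using M_B M_add by blast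
  qed
  have "M k \<subseteq> M (c + 1)" for k
  proof -
    have "M (c + 1 + int d) \<subseteq> M (c + 1)" for d
    proof (induction d)
      case (Suc d)
      have "M (c + int (d + 2)) \<subseteq> M (c + int (d + 2) - 1)" by (rule up) simp
      then show ?case using Suc by (simp add: algebra_simps)
    qed simp
    from this[of "nat (k - c - 1)"] show ?thesis
      using monoD[OF M_mono, of k "c + 1"] by (cases "k \<le> c + 1") auto
  qed
  then have top: "M k = A" if "c + 1 \<le> k" for k
    using rel_monodromyD(6)[OF rm] monoD[OF M_mono that] M_A[of k] by blast
  have down: "M (c - int k) \<subseteq> M (c - int k - 1)" if k2: "2 \<le> k" for k
  proof
    fix x assume x: "x \<in> M (c - int k)"
    then have "x \<in> A" using M_A by blast
    then obtain u y z where *: "x = (T ^^ k) u + (y + z)" "u \<in> A" "y \<in> M (c - int k - 1)" "z \<in> B"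
      using surj[of k x] k2 x by auto
    have "(T ^^ k) u \<in> B" using *(2) T_pow_ge2[of u "k - 2"] k2 by (simp add: numeral_2_eq_2 Suc_diff_Suc)
    then show "x \<in> M (c - int k - 1)" using * M_B by (auto intro!: M_add)
  qed
  have "M (c - 2) \<subseteq> M k" for k
  proof -
    have "M (c - 2) \<subseteq> M (c - 2 - int d)" for d
    proof (induction d)
      case (Suc d)
      have "M (c - int (d + 2)) \<subseteq> M (c - int (d + 2) - 1)" by (rule down) simp
      then show ?case using Suc by (simp add: algebra_simps)
    qed simp
    from this[of "nat (c - 2 - k)"] show ?thesis
      using monoD[OF M_mono, of "c - 2" k] by (cases "c - 2 \<le> k") auto
  qed
  then have bot: "M k = B" if "k \<le> c - 2" for k
    using rel_monodromyD(5)[OF rm] monoD[OF M_mono that] M_B[of k] by blast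
  have "M (c - 1) = ImT"
  proof (intro equalityI subsetI)
    fix x assume x: "x \<in> M (c - 1)"
    then have "x \<in> A" using M_A by blast
    then obtain u y z where *: "x = (T ^^ 1) u + (y + z)" "u \<in> A" "y \<in> M (c - 1 - 1)" "z \<in> B"
      using surj[of 1 x] x by auto
    then have "y \<in> B" using bot[of "c - 1 - 1"] by simp
    then have "y + z \<in> B" using * by (intro B_add)
    then show "x \<in> ImT" using * by (auto intro: ImI)
  next
    fix x assume "x \<in> ImT"
    then obtain u y where *: "x = T u + y" "u \<in> A" "y \<in> B" by (rule ImE)
    then have "T u \<in> M (c - 1)" using M_T[of u "c + 1"] top[of "c + 1"] by simp
    then show "x \<in> M (c - 1)" using * M_B M_add by blast
  qed
  moreover have "M c = KerT"
  proof (intro equalityI subsetI)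
    fix x assume "x \<in> M c"
    then show "x \<in> KerT" using M_T[of x c] bot[of "c - 2"] M_A by (auto simp: ker_mod_def)
  next
    fix x assume "x \<in> KerT"
    then have x: "x \<in> A" "T x \<in> B" by (auto simp: ker_mod_def)
    then obtain y z where "x = y + z" "y \<in> M c" "z \<in> B"
      using inj[of 1 x] top[of "c + 1"] by auto
    then show "x \<in> M c" using M_B M_add by blast
  qed
  ultimately have "M k = mfil c k" for k
    using top[of k] bot[of k] unfolding mfil_def by (smt (verit, best))
  then show ?thesis by blast
qed

text \<open>
  \<open>ImT \<subseteq> L k\<close> for \<open>k \<ge> c - 1\<close> expresses that \<open>L\<close> comes from \<open>\<D>\<close>-submodules: without it, \<open>L\<close> would not be
  determined by its relative monodromy filtration.
\<close>

lemma rel_monodromy_self_unique: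
  assumes rm: "rel_monodromy_filtration subobject A B T L (mfil c)"
    and L_add: "\<And>k x y. x \<in> L k \<Longrightarrow> y \<in> L k \<Longrightarrow> x + y \<in> L k"
    and L_B: "\<And>k. B \<subseteq> L k" and L_A: "\<And>k. L k \<subseteq> A" and L_mono: "mono L" and L_top: "L k1 = A"
    and L_low: "\<And>k. k < c - 1 \<Longrightarrow> L k = B" and L_Im: "\<And>k. c - 1 \<le> k \<Longrightarrow> ImT \<subseteq> L k"
  shows "L = mfil c"
proof -
  have m: "mfil c (c - 1) = ImT" "mfil c (c - 2) = B" "mfil c c = KerT" "mfil c (c + 1) = A" "mfil c (c - 3) = B"
    by (auto simp: mfil_def)
  \<comment> \<open>\<open>T\<^sup>2\<close> is zero, so injectivity for \<open>k = 2\<close> puts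
    \<open>x\<close> into the kernel; then injectivity for \<open>k = 1\<close> puts it into the
    image.\<close>
  have Lc1: "L (c - 1) \<subseteq> ImT"
  proof
    fix x assume x: "x \<in> L (c - 1)"
    then have "x \<in> A" using L_A by blast
    have "(T ^^ 2) x \<in> B" using T_pow_ge2[of x 0] \<open>x \<in> A\<close> by (simp add: numeral_2_eq_2)
    then have "\<exists>y z. x = y + z \<and> y \<in> mfil c (c - 1 + int 2 - 1) \<and> y \<in> L (c - 1) \<and>
        z \<in> mfil c (c - 1 + int 2) \<and> z \<in> L (c - 1 - 1)"
      by (intro rel_monodromy_inj[OF rm, where y = 0 and z = "(T ^^ 2) x"])
         (use x \<open>x \<in> A\<close> B_0 L_B in \<open>auto simp: mfil_def\<close>)
    then obtain y z where yz: "x = y + z" "y \<in> mfil c (c - 1 + int 2 - 1)" "z \<in> L (c - 1 - 1)"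
      by blast
    have "y \<in> KerT" using yz by (simp add: m)
    moreover have "z \<in> KerT" using yz L_low[of "c - 1 - 1"] B_Im Im_Ker by auto
    ultimately have "T x \<in> B" using yz T_Ker by (auto simp: T_add intro: B_add)
    then have "x \<in> KerT" using \<open>x \<in> A\<close> by (simp add: ker_mod_def)
    then have "\<exists>y z. x = y + z \<and> y \<in> mfil c (c - 1 + int 1 - 1) \<and> y \<in> L (c - 1) \<and>
        z \<in> mfil c (c - 1 + int 1) \<and> z \<in> L (c - 1 - 1)"
      by (intro rel_monodromy_inj[OF rm, where y = 0 and z = "T x"])
         (use x \<open>T x \<in> B\<close> B_0 L_B in \<open>auto simp: mfil_def\<close>)
    then obtain y z where yz: "x = y + z" "y \<in> mfil c (c - 1 + int 1 - 1)" "z \<in> L (c - 1 - 1)"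
      by blast
    have "y \<in> ImT" using yz by (simp add: m)
    then obtain u v where "y = T u + v" "u \<in> A" "v \<in> B" by (rule ImE)
    moreover have "z \<in> B" using yz L_low[of "c - 1 - 1"] by simp
    ultimately have "x = T u + (v + z)" "v + z \<in> B" "u \<in> A"
      using yz by (auto simp: add.assoc intro: B_add)
    then show "x \<in> ImT" by (auto intro: ImI)
  qed
  then have L1: "L (c - 1) = ImT" using L_Im[of "c - 1"] by auto
  \<comment> \<open>\<open>T x\<close> lies in the image, which is \<open>L (c - 1)\<close>, so
    injectivity for \<open>l = c\<close> and \<open>k = 1\<close> applies.\<close>
  have Lc: "L c \<subseteq> KerT"
  proof
    fix x assume x: "x \<in> L c"
    then have "x \<in> A" using L_A by blast
    then have "\<exists>y z. x = y + z \<and> y \<in> mfil c (c + int 1 - 1) \<and> y \<in> L c \<and>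
        z \<in> mfil c (c + int 1) \<and> z \<in> L (c - 1)"
      by (intro rel_monodromy_inj[OF rm, where y = 0 and z = "T x"])
         (use x T_Im[of x] L1 B_0 L_B in \<open>auto simp: mfil_def\<close>)
    then obtain y z where yz: "x = y + z" "y \<in> mfil c (c + int 1 - 1)" "z \<in> L (c - 1)"
      by blast
    then have "y \<in> KerT" "z \<in> KerT" using L1 Im_Ker by (auto simp: m)
    then have "T x \<in> B" using yz T_Ker by (auto simp: T_add intro: B_add)
    then show "x \<in> KerT" using \<open>x \<in> A\<close> by (simp add: ker_mod_def)
  qed
  \<comment> \<open>Surjectivity in degree \<open>c\<close> for \<open>l = c + k\<close>: the image
    is contained in every step of \<open>L\<close> from \<open>c - 1\<close> on, so the kernel can
    be pushed down from the top of \<open>L\<close> to \<open>L c\<close>.\<close>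
  have step1: "KerT \<inter> L (c + int k) \<subseteq> L (c + int k - 1)" if k1: "1 \<le> k" for k
  proof
    fix x assume x: "x \<in> KerT \<inter> L (c + int k)"
    then obtain u y z where *: "x = (T ^^ k) u + (y + z)" "u \<in> L (c + int k)"
        "y \<in> mfil c (c + int k - int k - 1)" "z \<in> L (c + int k - 1)"
      using rel_monodromy_surj[OF rm k1, of x "c + int k"] by (auto simp: m)
    have "(T ^^ k) u \<in> ImT" using *(2) L_A k1 by (intro T_pow_ge1) blast+
    moreover have "y \<in> ImT" using * by (simp add: m)
    moreover have "ImT \<subseteq> L (c + int k - 1)" using k1 by (intro L_Im) simp
    ultimately show "x \<in> L (c + int k - 1)" using * by (auto intro!: L_add)
  qed
  have top: "A \<subseteq> L k" if "k1 \<le> k" for k using monoD[OF L_mono that] L_top by simp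
  have "KerT \<subseteq> L (c + int (d0 - d))" if "k1 \<le> c + int d0" for d d0 :: nat
  proof (induction d)
    case 0
    then show ?case using top[OF that] Ker_A by simp
  next
    case (Suc d)
    show ?case
    proof (cases "d < d0")
      case True
      then have "1 \<le> d0 - d" by simp
      then have "KerT \<subseteq> L (c + int (d0 - d) - 1)" using step1[of "d0 - d"] Suc.IH by blast
      then show ?thesis using True by (simp add: of_nat_diff algebra_simps)
    qed (use Suc in simp)
  qed
  from this[of "nat (k1 - c)" "nat (k1 - c)"] have "KerT \<subseteq> L c" by simp
  then have L2: "L c = KerT" using Lc by auto
  \<comment> \<open>The same descent in degree \<open>c + 1\<close>, now for all of
    \<open>A\<close>, ends at \<open>L (c + 1)\<close>.\<close>
  have step2: "L (c + 1 + int k) \<subseteq> L (c + 1 + int k - 1)" if k1: "1 \<le> k" for k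
  proof
    fix x assume x: "x \<in> L (c + 1 + int k)"
    then have "x \<in> mfil c (c + 1 + int k - int k)" using L_A by (auto simp: m)
    then obtain u y z where *: "x = (T ^^ k) u + (y + z)" "u \<in> L (c + 1 + int k)"
        "y \<in> mfil c (c + 1 + int k - int k - 1)" "z \<in> L (c + 1 + int k - 1)"
      using rel_monodromy_surj[OF rm k1, of x "c + 1 + int k"] x by blast
    have "(T ^^ k) u \<in> ImT" using *(2) L_A k1 by (intro T_pow_ge1) blast+
    moreover have "y \<in> KerT" using * by (simp add: m)
    moreover have "KerT \<subseteq> L (c + 1 + int k - 1)" using L2 monoD[OF L_mono, of c "c + 1 + int k - 1"] by simp
    ultimately show "x \<in> L (c + 1 + int k - 1)" using * Im_Ker by (auto intro!: L_add)
  qed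
  have "A \<subseteq> L (c + 1 + int (d0 - d))" if "k1 \<le> c + 1 + int d0" for d d0 :: nat
  proof (induction d)
    case 0
    then show ?case using top[OF that] by simp
  next
    case (Suc d)
    show ?case
    proof (cases "d < d0")
      case True
      then have "1 \<le> d0 - d" by simp
      then have "A \<subseteq> L (c + 1 + int (d0 - d) - 1)" using step2[of "d0 - d"] Suc.IH by blast
      then show ?thesis using True by (simp add: of_nat_diff algebra_simps)
    qed (use Suc in simp)
  qed
  from this[of "nat (k1 - c - 1)" "nat (k1 - c - 1)"] have "A \<subseteq> L (c + 1)" by simp
  then have L3: "L k = A" if "c + 1 \<le> k" for k
    using monoD[OF L_mono that] L_A[of k] by auto
  have "L k = mfil c k" for k
    using L1 L2 L3[of k] L_low[of k] unfolding mfil_def by (smt (verit, best))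
  then show ?thesis by blast
qed

end

text \<open>These rules would make the simplifier eta-expand elements of the graph module, which are functions.\<close>

declare plus_fun_apply [simp del] zero_fun_apply [simp del] times_fun_apply [simp del]
  one_fun_apply [simp del] minus_apply [simp del] uminus_apply [simp del]
  of_nat_fun_apply [simp del]

section \<open>The Kashiwara--Malgrange filtration\<close>

context loc_module
begin

abbreviation "V0D \<equiv> V0D_submodule f \<alpha>"
abbreviation "dtt \<equiv> g_dtt f"

section \<open>Submodules over \<open>V\<^sup>0\<D>\<close> and the calculus of
  \<open>\<partial>\<^sub>t t\<close>\<close>

lemma V0D_D:
  assumes "V0D P"
  shows "P \<subseteq> N" "0 \<in> P" "\<And>b c. b \<in> P \<Longrightarrow> c \<in> P \<Longrightarrow> b + c \<in> P"
    "\<And>g b. g \<in> polyfun \<Longrightarrow> b \<in> P \<Longrightarrow> g_mul g b \<in> P" "\<And>i b. b \<in> P \<Longrightarrow> dx i b \<in> P"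
    "\<And>b. b \<in> P \<Longrightarrow> t b \<in> P" "\<And>b. b \<in> P \<Longrightarrow> Dt b \<in> P"
  using assms by (auto simp: V0D_submodule_def)

lemma V0D_I:
  assumes "\<And>b. b \<in> P \<Longrightarrow> b \<in> N" "0 \<in> P" "\<And>b c. b \<in> P \<Longrightarrow> c \<in> P \<Longrightarrow> b + c \<in> P"
    "\<And>g b. g \<in> polyfun \<Longrightarrow> b \<in> P \<Longrightarrow> g_mul g b \<in> P" "\<And>i b. b \<in> P \<Longrightarrow> dx i b \<in> P"
    "\<And>b. b \<in> P \<Longrightarrow> t b \<in> P" "\<And>b. b \<in> P \<Longrightarrow> Dt b \<in> P"
  shows "V0D P"
  using assms by (auto simp: V0D_submodule_def)

lemma V0D_sc: "V0D P \<Longrightarrow> b \<in> P \<Longrightarrow> sc c b \<in> P"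
  by (rule V0D_D(4)[OF _ polyfun_const(1)])

lemma V0D_uminus: "V0D P \<Longrightarrow> b \<in> P \<Longrightarrow> - b \<in> P"
  using V0D_sc[of P b "- 1"] by (simp add: g_mul_minus_one)

lemma V0D_diff: "V0D P \<Longrightarrow> b \<in> P \<Longrightarrow> c \<in> P \<Longrightarrow> b - c \<in> P"
  using V0D_D(3)[of P b "- c"] V0D_uminus[of P c] by simp

lemma V0D_dtt: "V0D P \<Longrightarrow> b \<in> P \<Longrightarrow> dtt a b \<in> P"
  unfolding g_dtt_def by (intro V0D_diff V0D_sc V0D_D(7))

lemma V0D_dtt_pow: "V0D P \<Longrightarrow> b \<in> P \<Longrightarrow> (dtt a ^^ r) b \<in> P"
  by (induction r) (auto intro: V0D_dtt)

lemma V0D_t_pow: "V0D P \<Longrightarrow> b \<in> P \<Longrightarrow> (t ^^ r) b \<in> P"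
  by (induction r) (auto intro: V0D_D(6))

lemma V0D_foldr_dtt: "V0D P \<Longrightarrow> b \<in> P \<Longrightarrow> foldr dtt ls b \<in> P"
  by (induction ls) (auto intro: V0D_dtt)

lemma V0D_N: "V0D N"
  by (rule V0D_I) (auto intro: N_zero N_add N_mul N_dx N_t N_dt)

lemma N_t_pow: "b \<in> N \<Longrightarrow> (t ^^ r) b \<in> N"
  by (rule V0D_t_pow[OF V0D_N])

lemma V0D_sc_cancel:
  assumes "V0D P" "sc c b \<in> P" "c \<noteq> 0"
  shows "b \<in> P"
proof -
  have "sc (1 / c) (sc c b) \<in> P" by (rule V0D_sc[OF assms(1,2)])
  then show ?thesis using assms(3) by (simp add: g_mul_const_mult)
qed

lemma dtt_add: "dtt a (b + c) = dtt a b + dtt a c"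
  by (simp add: g_dtt_def Dt_add g_mul_add)

lemma sc_add: "sc (a + c) b = sc a b + sc c b"
  by (rule g_mul_const_add)

lemma sc_diff: "sc (a - c) b = sc a b - sc c b"
  using sc_add[of "a - c" c b] by (simp add: algebra_simps)

lemma dtt_shift: "dtt a b = dtt c b + sc (of_rat (c - a)) b"
  by (simp add: g_dtt_def of_rat_diff sc_diff)

lemma dtt_commute: "dtt a (dtt c b) = dtt c (dtt a b)"
  unfolding g_dtt_def by (simp add: Dt_diff Dt_mul g_mul_diff g_mul_commute algebra_simps)

lemma dtt_0: "dtt 0 b = Dt b"
  by (simp add: g_dtt_def)

lemma dtt_dt: "dtt a (g_dt b) = g_dt (dtt (a + 1) b)"
  by (simp add: g_dtt_def g_dt_diff g_dt_mul g_dt_add t_dt of_rat_add sc_add algebra_simps)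

lemma dtt_t: "dtt a (t b) = t (dtt (a - 1) b)"
  by (simp add: g_dtt_def g_t_diff g_t_mul g_t_add Dt_t of_rat_diff sc_diff algebra_simps)

lemma t_dt': "t (g_dt b) = dtt 1 b"
  by (simp add: g_dtt_def t_dt)

lemma dtt_dt_pow: "dtt a ((g_dt ^^ r) b) = (g_dt ^^ r) (dtt (a + of_nat r) b)"
  by (induction r arbitrary: a) (simp_all add: dtt_dt add.assoc)

text \<open>The operator \<open>t\<^sup>r \<partial>\<^sub>t\<^sup>r\<close> is a polynomial in
  \<open>\<partial>\<^sub>t t\<close> with the roots 1, ..., \<open>r\<close>; it will be cancelled
  on quotients where these are not eigenvalues.\<close>

lemma t_pow_dt_pow: "(t ^^ r) ((g_dt ^^ r) b) = foldr dtt (map of_nat [1..<Suc r]) b"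
proof (induction r arbitrary: b)
  case (Suc r)
  have "(t ^^ Suc r) ((g_dt ^^ Suc r) b) = (t ^^ r) (t (g_dt ((g_dt ^^ r) b)))"
    by (simp add: funpow_swap1)
  also have "\<dots> = (t ^^ r) ((g_dt ^^ r) (dtt (of_nat (Suc r)) b))"
    by (simp add: t_dt' dtt_dt_pow)
  also have "\<dots> = foldr dtt (map of_nat [1..<Suc (Suc r)]) b"
    by (simp add: Suc.IH)
  finally show ?case .
qed simp

lemma t_pow_add: "(t ^^ r) (b + c) = (t ^^ r) b + (t ^^ r) c"
  by (induction r) (auto simp: g_t_add)

lemma t_pow_mul: "(t ^^ r) (g_mul g b) = g_mul g ((t ^^ r) b)"
  by (induction r) (auto simp: g_t_mul)

lemma t_pow_dx: "b \<in> N \<Longrightarrow> (t ^^ r) (dx i b) = dx i ((t ^^ r) b)"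
  by (induction r) (auto simp: dx_t N_t_pow)

lemma t_pow_delta: "(t ^^ r) (g_delta u) = g_delta (f ^ r * u)"
  by (induction r) (auto simp: g_t_delta mult.assoc)

lemma t_pow_dtt: "(t ^^ r) (dtt a b) = dtt (a + of_nat r) ((t ^^ r) b)"
  by (induction r arbitrary: a) (simp_all add: dtt_t algebra_simps)

lemma dt_pow_add: "(g_dt ^^ r) (b + c) = (g_dt ^^ r) b + (g_dt ^^ r) c"
  by (induction r) (auto simp: g_dt_add)

text \<open>The two polynomials in \<open>\<partial>\<^sub>t t\<close> are coprime: the difference
  of their linear factors is a nonzero scalar.\<close>

lemma cancel_coprime:
  assumes "V0D U" "(dtt c ^^ r) x \<in> U" "dtt a x \<in> U" "a \<noteq> c"
  shows "x \<in> U"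
  using assms(2,3)
proof (induction r arbitrary: x)
  case (Suc r)
  have "(dtt c ^^ r) (dtt c x) \<in> U" using Suc.prems(1) by (simp add: funpow_swap1)
  moreover have "dtt a (dtt c x) \<in> U"
    unfolding dtt_commute[of a] by (rule V0D_dtt[OF assms(1) Suc.prems(2)])
  ultimately have "dtt c x \<in> U" by (rule Suc.IH)
  then have "dtt a x - dtt c x \<in> U" using Suc.prems(2) by (intro V0D_diff assms(1))
  then have "sc (of_rat (c - a)) x \<in> U" using dtt_shift[of a x c] by simp
  then show ?case by (rule V0D_sc_cancel[OF assms(1)]) (use assms(4) in simp)
qed simp

abbreviation "KM \<equiv> KM_filtration f \<alpha>"

lemma KM_D:
  assumes "KM V"
  shows "antimono V" "(\<Union>a. V a) = N" "\<exists>l::nat. l > 0 \<and> (\<forall>a. V a = V (of_int \<lceil>of_nat l * a\<rceil> / of_nat l))"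
    "V0D_fin_gen f \<alpha> (V a)" "b \<in> V a \<Longrightarrow> t b \<in> V (a + 1)" "0 < a \<Longrightarrow> t ` V a = V (a + 1)"
    "b \<in> V a \<Longrightarrow> g_dt b \<in> V (a - 1)" "\<exists>r. \<forall>b\<in>V a. (dtt a ^^ r) b \<in> V_gt V a"
proof -
  have K: "antimono V" "(\<Union>a. V a) = N"
    "\<exists>l::nat. l > 0 \<and> (\<forall>a. V a = V (of_int \<lceil>of_nat l * a\<rceil> / of_nat l))"
    "\<forall>a. V0D_fin_gen f \<alpha> (V a)" "\<forall>a. t ` V a \<subseteq> V (a + 1)" "\<forall>a>0. t ` V a = V (a + 1)"
    "\<forall>a. g_dt ` V a \<subseteq> V (a - 1)" "\<forall>a. \<exists>r. \<forall>b\<in>V a. (dtt a ^^ r) b \<in> V_gt V a"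
    by (insert assms[unfolded KM_filtration_def], (elim conjE, assumption)+)
  show "antimono V" "(\<Union>a. V a) = N" by (fact K)+
  show "\<exists>l::nat. l > 0 \<and> (\<forall>a. V a = V (of_int \<lceil>of_nat l * a\<rceil> / of_nat l))" by (fact K)
  show "V0D_fin_gen f \<alpha> (V a)" using K(4) ..
  show "b \<in> V a \<Longrightarrow> t b \<in> V (a + 1)" using K(5)[rule_format, of a] by blast
  show "0 < a \<Longrightarrow> t ` V a = V (a + 1)" using K(6) by simp
  show "b \<in> V a \<Longrightarrow> g_dt b \<in> V (a - 1)" using K(7)[rule_format, of a] by blast
  show "\<exists>r. \<forall>b\<in>V a. (dtt a ^^ r) b \<in> V_gt V a" using K(8) ..
qed

lemma KM_V0D: "KM V \<Longrightarrow> V0D (V a)"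
  using KM_D(4)[of V a] by (simp add: V0D_fin_gen_def)

lemma KM_antimono: "KM V \<Longrightarrow> a \<le> b \<Longrightarrow> V b \<subseteq> V a"
  using KM_D(1)[of V] by (simp add: antimono_def)

lemma KM_N: "KM V \<Longrightarrow> V a \<subseteq> N"
  by (rule V0D_D(1)[OF KM_V0D])

lemma KM_t_pow: "KM V \<Longrightarrow> b \<in> V a \<Longrightarrow> (t ^^ r) b \<in> V (a + of_nat r)"
proof (induction r)
  case (Suc r)
  then have "t ((t ^^ r) b) \<in> V (a + of_nat r + 1)" by (intro KM_D(5)) auto
  then show ?case by (simp add: algebra_simps)
qed simp

lemma KM_dt_pow: "KM V \<Longrightarrow> b \<in> V a \<Longrightarrow> (g_dt ^^ r) b \<in> V (a - of_nat r)"
proof (induction r)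
  case (Suc r)
  then have "g_dt ((g_dt ^^ r) b) \<in> V (a - of_nat r - 1)" by (intro KM_D(7)) auto
  then show ?case by (simp add: algebra_simps)
qed simp

lemma KM_t_pow_surj:
  assumes "KM V" "0 < a" "b \<in> V (a + of_nat r)"
  shows "\<exists>c\<in>V a. b = (t ^^ r) c"
  using assms(3)
proof (induction r arbitrary: b)
  case (Suc r)
  have "t ` V (a + of_nat r) = V (a + of_nat r + 1)" using assms by (intro KM_D(6)) auto
  moreover have "b \<in> V (a + of_nat r + 1)" using Suc.prems by (simp add: algebra_simps)
  ultimately obtain b' where b': "b' \<in> V (a + of_nat r)" "b = t b'" by blast
  then obtain c where "c \<in> V a" "b' = (t ^^ r) c" using Suc.IH by blast
  then show ?case using b' by (intro bexI[of _ c]) auto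
qed auto

lemma KM_gt_grid:
  assumes "KM V" "l > 0" "\<forall>a. V a = V (of_int \<lceil>of_nat l * a\<rceil> / of_nat l)"
  shows "V_gt V a = V ((of_int \<lfloor>of_nat l * a\<rfloor> + 1) / of_nat l)"
proof
  show "V_gt V a \<subseteq> V ((of_int \<lfloor>of_nat l * a\<rfloor> + 1) / of_nat l)"
  proof
    fix x assume "x \<in> V_gt V a"
    then obtain b where b: "a < b" "x \<in> V b" by (auto simp: V_gt_def)
    have "of_nat l * a < of_nat l * b" using b assms(2) by simp
    then have "\<lfloor>of_nat l * a\<rfloor> + 1 \<le> \<lceil>of_nat l * b\<rceil>" by linarith
    then have "of_int (\<lfloor>of_nat l * a\<rfloor> + 1) / of_nat l \<le> (of_int \<lceil>of_nat l * b\<rceil> / of_nat l :: rat)"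
      by (intro divide_right_mono) (auto simp only: of_int_le_iff of_nat_0_le_iff)
    then have "V (of_int \<lceil>of_nat l * b\<rceil> / of_nat l) \<subseteq> V (of_int (\<lfloor>of_nat l * a\<rfloor> + 1) / of_nat l)"
      by (rule KM_antimono[OF assms(1)])
    moreover have "V b = V (of_int \<lceil>of_nat l * b\<rceil> / of_nat l)" using assms(3) by blast
    ultimately show "x \<in> V ((of_int \<lfloor>of_nat l * a\<rfloor> + 1) / of_nat l)" using b(2) by auto
  qed
  have "a < (of_int \<lfloor>of_nat l * a\<rfloor> + 1) / of_nat l"
    using assms(2) floor_correct[of "of_nat l * a"] by (simp add: field_simps)
  then show "V ((of_int \<lfloor>of_nat l * a\<rfloor> + 1) / of_nat l) \<subseteq> V_gt V a"
    by (auto simp: V_gt_def)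
qed

lemma KM_gt: "KM V \<Longrightarrow> \<exists>b>a. V_gt V a = V b"
proof -
  assume V: "KM V"
  then obtain l :: nat where l: "l > 0" "\<forall>a. V a = V (of_int \<lceil>of_nat l * a\<rceil> / of_nat l)"
    using KM_D(3) by blast
  have "a < (of_int \<lfloor>of_nat l * a\<rfloor> + 1) / of_nat l"
    using l(1) floor_correct[of "of_nat l * a"] by (simp add: field_simps)
  then show ?thesis using KM_gt_grid[OF V l] by blast
qed

lemma V_gt_subset: "KM V \<Longrightarrow> V_gt V a \<subseteq> V a"
  unfolding V_gt_def by (intro UN_least KM_antimono) auto

lemma V_gt_V0D: "KM V \<Longrightarrow> V0D (V_gt V a)"
  using KM_gt[of V a] KM_V0D[of V] by auto

lemma V_in_gt: "a < b \<Longrightarrow> V b \<subseteq> V_gt V a"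
  by (auto simp: V_gt_def)

text \<open>On \<open>gr\<^sub>V\<^sup>b\<close> the only eigenvalue of
  \<open>\<partial>\<^sub>t t\<close> is \<open>b\<close>, so
  \<open>\<partial>\<^sub>t t - a\<close> is injective there unless \<open>a = b\<close>. The
  interval is climbed one grid point at a time.\<close>

lemma KM_cancel_grid:
  assumes "KM V" "l > 0" "\<forall>a. V a = V (of_int \<lceil>of_nat l * a\<rceil> / of_nat l)"
    and "x \<in> V (of_int q / of_nat l)" "dtt a x \<in> V (of_int (q + int k) / of_nat l)"
    and "\<And>i. i < k \<Longrightarrow> a \<noteq> of_int (q + int i) / of_nat l"
  shows "x \<in> V (of_int (q + int k) / of_nat l)"
  using assms(4-6)
proof (induction k arbitrary: q)
  case (Suc k)
  have "x \<in> V (of_int (q + 1) / of_nat l)"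
  proof -
    obtain r where "\<forall>b\<in>V (of_int q / of_nat l). (dtt (of_int q / of_nat l) ^^ r) b \<in> V_gt V (of_int q / of_nat l)"
      using KM_D(8)[OF assms(1), of "of_int q / of_nat l"] by blast
    moreover have gt: "V_gt V (of_int q / of_nat l) = V (of_int (q + 1) / of_nat l)"
      using KM_gt_grid[OF assms(1-3), of "of_int q / of_nat l"] assms(2) by simp
    ultimately have "(dtt (of_int q / of_nat l) ^^ r) x \<in> V (of_int (q + 1) / of_nat l)"
      using Suc.prems(1) by auto
    moreover have "dtt a x \<in> V (of_int (q + 1) / of_nat l)"
      using Suc.prems(2) KM_antimono[OF assms(1), of "of_int (q + 1) / of_nat l" "of_int (q + int (Suc k)) / of_nat l"]
      by (auto simp: divide_right_mono)
    moreover have "a \<noteq> of_int q / of_nat l" using Suc.prems(3)[of 0] by simp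
    ultimately show ?thesis by (rule cancel_coprime[OF KM_V0D[OF assms(1)]])
  qed
  then have "x \<in> V (of_int (q + 1 + int k) / of_nat l)"
  proof (rule Suc.IH)
    show "dtt a x \<in> V (of_int (q + 1 + int k) / of_nat l)"
      using Suc.prems(2) by (simp add: algebra_simps)
    show "a \<noteq> of_int (q + 1 + int i) / of_nat l" if "i < k" for i
      using Suc.prems(3)[of "Suc i"] that by (simp add: algebra_simps)
  qed
  then show ?case by (simp add: algebra_simps)
qed simp

lemma KM_cancel:
  assumes "KM V" "x \<in> V c" "dtt a x \<in> V d" "\<not> (c \<le> a \<and> a < d)"
  shows "x \<in> V d"
proof (cases "d \<le> c")
  case True
  then show ?thesis using KM_antimono[OF assms(1) True] assms(2) by blast
next
  case False
  obtain l :: nat where l: "l > 0" "\<forall>a. V a = V (of_int \<lceil>of_nat l * a\<rceil> / of_nat l)"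
    using KM_D(3)[OF assms(1)] by blast
  define q where "q = \<lceil>of_nat l * c\<rceil>"
  define k where "k = nat (\<lceil>of_nat l * d\<rceil> - q)"
  have qk: "q + int k = \<lceil>of_nat l * d\<rceil>"
    using False l(1) by (simp add: k_def q_def ceiling_mono)
  have "x \<in> V (of_int (q + int k) / of_nat l)"
  proof (rule KM_cancel_grid[OF assms(1) l])
    show "x \<in> V (of_int q / of_nat l)" unfolding q_def using assms(2) l(2) by blast
    show "dtt a x \<in> V (of_int (q + int k) / of_nat l)" unfolding qk using assms(3) l(2) by blast
    fix i assume i: "i < k"
    show "a \<noteq> of_int (q + int i) / of_nat l"
    proof
      assume "a = of_int (q + int i) / of_nat l"
      then have a: "of_nat l * a = of_int (q + int i)" using l(1) by simp
      have "of_nat l * c \<le> of_int q" by (simp add: q_def)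
      also have "\<dots> \<le> of_nat l * a" unfolding a by simp
      finally have "c \<le> a" using l(1) by simp
      have "q + int i < \<lceil>of_nat l * d\<rceil>" using i qk by simp
      then have "of_nat l * a < of_nat l * d" unfolding a less_ceiling_iff .
      then have "a < d" using l(1) by simp
      then show False using \<open>c \<le> a\<close> assms(4) by simp
    qed
  qed
  then show ?thesis unfolding qk using l(2) by blast
qed

lemma KM_cancel_list:
  assumes "KM V" "x \<in> V c" "foldr dtt ls x \<in> V d" "\<And>a. a \<in> set ls \<Longrightarrow> \<not> (c \<le> a \<and> a < d)"
  shows "x \<in> V d"
  using assms(3,4)
proof (induction ls)
  case (Cons a ls)
  have "foldr dtt ls x \<in> V c" by (rule V0D_foldr_dtt[OF KM_V0D[OF assms(1)] assms(2)])
  moreover have "dtt a (foldr dtt ls x) \<in> V d" using Cons.prems(1) by simp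
  moreover have "\<not> (c \<le> a \<and> a < d)" using Cons.prems(2)[of a] by simp
  ultimately have "foldr dtt ls x \<in> V d" by (rule KM_cancel[OF assms(1)])
  then show ?case by (rule Cons.IH) (use Cons.prems(2) in simp)
qed simp

lemma foldr_dtt_replicate: "foldr dtt (replicate r a @ ls) x = (dtt a ^^ r) (foldr dtt ls x)"
  by (induction r) auto

text \<open>The list consists of the grid points from \<open>c\<close> up to \<open>d\<close>, each
  repeated by its nilpotency exponent.\<close>

lemma KM_annihilate:
  assumes "KM V" "c \<le> d"
  shows "\<exists>ls. (\<forall>a\<in>set ls. c \<le> a) \<and> (\<forall>x\<in>V c. foldr dtt ls x \<in> V d)"
proof -
  obtain l :: nat where l: "l > 0" "\<forall>a. V a = V (of_int \<lceil>of_nat l * a\<rceil> / of_nat l)"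
    using KM_D(3)[OF assms(1)] by blast
  define q where "q = \<lceil>of_nat l * c\<rceil>"
  have "\<exists>ls. (\<forall>a\<in>set ls. c \<le> a) \<and>
      (\<forall>x\<in>V c. foldr dtt ls x \<in> V (of_int (q + int k) / of_nat l))" for k
  proof (induction k)
    case 0
    have "V c = V (of_int \<lceil>of_nat l * c\<rceil> / of_nat l)" using l(2) by blast
    then have "V c = V (of_int (q + int 0) / of_nat l)" by (simp add: q_def)
    then show ?case by (intro exI[of _ "[]"]) auto
  next
    case (Suc k)
    then obtain ls where ls: "\<forall>a\<in>set ls. c \<le> a"
      "\<forall>x\<in>V c. foldr dtt ls x \<in> V (of_int (q + int k) / of_nat l)" by blast
    define e :: rat where "e = of_int (q + int k) / of_nat l"
    obtain r where r: "\<forall>b\<in>V e. (dtt e ^^ r) b \<in> V_gt V e"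
      using KM_D(8)[OF assms(1), of e] by blast
    have le: "of_nat l * e = of_int (q + int k)" using l(1) by (simp add: e_def)
    have gt: "V_gt V e = V (of_int (q + int (Suc k)) / of_nat l)"
      using KM_gt_grid[OF assms(1) l, of e] le by (simp add: algebra_simps)
    have "of_nat l * c \<le> of_int q" by (simp add: q_def)
    also have "\<dots> \<le> of_nat l * e" unfolding le by simp
    finally have ce: "c \<le> e" using l(1) by simp
    show ?case
    proof (intro exI[of _ "replicate r e @ ls"] conjI ballI)
      fix a assume "a \<in> set (replicate r e @ ls)"
      then have "a = e \<or> a \<in> set ls" by (auto split: if_splits)
      then show "c \<le> a" using ce ls(1) by auto
    next
      fix x assume "x \<in> V c"
      then have "foldr dtt ls x \<in> V e" using ls(2) by (simp add: e_def)
      then have "(dtt e ^^ r) (foldr dtt ls x) \<in> V_gt V e" using r by blast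
      then show "foldr dtt (replicate r e @ ls) x \<in> V (of_int (q + int (Suc k)) / of_nat l)"
        unfolding foldr_dtt_replicate gt .
    qed
  qed
  from this[of "nat (\<lceil>of_nat l * d\<rceil> - q)"]
  obtain ls where ls: "\<forall>a\<in>set ls. c \<le> a"
      "\<forall>x\<in>V c. foldr dtt ls x \<in> V (of_int (q + int (nat (\<lceil>of_nat l * d\<rceil> - q))) / of_nat l)"
    by blast
  have qd: "q \<le> \<lceil>of_nat l * d\<rceil>" unfolding q_def using assms(2) by (intro ceiling_mono mult_left_mono) auto
  then have *: "q + int (nat (\<lceil>of_nat l * d\<rceil> - q)) = \<lceil>of_nat l * d\<rceil>" by simp
  show ?thesis using ls l(2) unfolding * by blast
qed

end

section \<open>Uniqueness of the V-filtration\<close>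

context loc_module
begin

text \<open>By finite generation and \<open>t (V b) = V (b + 1)\<close> for positive
  \<open>b\<close>, a high step of \<open>V\<close> lies in \<open>V' a\<close>. A polynomial in
  \<open>\<partial>\<^sub>t t\<close> with roots at least \<open>a\<close> takes \<open>V a\<close>
  into that step, and it is injective on the quotient of any lower step of \<open>V'\<close> by
  \<open>V' a\<close>.\<close>

lemma KM_subset:
  assumes V: "KM V" and V': "KM V'"
  shows "V a \<subseteq> V' a"
proof
  fix x assume x: "x \<in> V a"
  have fg: "\<exists>b. V c \<subseteq> V' b" for c
  proof -
    obtain S where S: "S \<subseteq> V c" "finite S" "\<And>Q. V0D Q \<Longrightarrow> S \<subseteq> Q \<Longrightarrow> V c \<subseteq> Q"
      using KM_D(4)[OF V, of c] by (auto simp: V0D_fin_gen_def)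
    have "\<forall>s\<in>S. \<exists>b. s \<in> V' b"
      using S(1) KM_N[OF V, of c] KM_D(2)[OF V'] by blast
    then obtain \<beta> where \<beta>: "\<And>s. s \<in> S \<Longrightarrow> s \<in> V' (\<beta> s)" by metis
    define m where "m = Min (insert 0 (\<beta> ` S))"
    have "m \<le> \<beta> s" if "s \<in> S" for s
      unfolding m_def by (rule Min_le) (use S(2) that in auto)
    then have "S \<subseteq> V' m" using \<beta> KM_antimono[OF V'] by blast
    then show ?thesis using S(3)[OF KM_V0D[OF V']] by blast
  qed
  obtain b0 where b0: "V 1 \<subseteq> V' b0" using fg by blast
  obtain b1 where b1: "V a \<subseteq> V' b1" using fg by blast
  define b where "b = min a b1"
  have xb: "x \<in> V' b"
    using x b1 KM_antimono[OF V', of b b1] by (auto simp: b_def)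
  obtain k :: nat where k: "max (a - 1) (a - b0) \<le> of_nat k"
    using real_arch_simple by blast
  have large: "V (1 + of_nat k) \<subseteq> V' a"
  proof
    fix y assume "y \<in> V (1 + of_nat k)"
    then obtain c where c: "c \<in> V 1" "y = (t ^^ k) c"
      using KM_t_pow_surj[OF V, of 1 y k] by auto
    then have "y \<in> V' (b0 + of_nat k)" using b0 KM_t_pow[OF V', of c b0 k] by auto
    then show "y \<in> V' a" using KM_antimono[OF V', of a "b0 + of_nat k"] k by auto
  qed
  have "a \<le> 1 + of_nat k" using k by linarith
  then obtain ls where ls: "\<forall>c\<in>set ls. a \<le> c" "\<forall>x\<in>V a. foldr dtt ls x \<in> V (1 + of_nat k)"
    using KM_annihilate[OF V] by blast
  have "foldr dtt ls x \<in> V' a" using ls(2) x large by blast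
  then show "x \<in> V' a"
    by (rule KM_cancel_list[OF V' xb]) (use ls(1) in auto)
qed

lemma V_filtration_eq: "KM V \<Longrightarrow> V_filtration f \<alpha> = V"
  unfolding V_filtration_def
proof (rule the_equality)
  fix V' assume "KM V" "KM V'"
  then show "V' = V" using KM_subset[of V V'] KM_subset[of V' V] by (auto simp: fun_eq_iff)
qed

section \<open>Submodules over \<open>\<D>\<^sub>X\<close> and their graph modules\<close>

abbreviation "DXM \<equiv> DX_submodule f \<alpha>"

lemma DXM_D:
  assumes "DXM P"
  shows "P \<subseteq> Loc" "0 \<in> P" "u \<in> P \<Longrightarrow> v \<in> P \<Longrightarrow> u + v \<in> P"
    "g \<in> polyfun \<Longrightarrow> u \<in> P \<Longrightarrow> g * u \<in> P" "u \<in> P \<Longrightarrow> conn f \<alpha> i u \<in> P"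
  using assms by (auto simp: DX_submodule_def)

lemma DXM_Loc: "DXM Loc"
  by (auto simp: DX_submodule_def Loc_zero Loc_add Loc_mult conn_Loc)

lemma DXM_zero: "DXM {0}"
  by (auto simp: DX_submodule_def Loc_zero)

lemma DXM_diff: "DXM P \<Longrightarrow> u \<in> P \<Longrightarrow> v \<in> P \<Longrightarrow> u - v \<in> P"
proof -
  assume P: "DXM P" "u \<in> P" "v \<in> P"
  have "(\<lambda>_. - 1) * v \<in> P" by (rule DXM_D(4)[OF P(1) polyfun_const(1) P(3)])
  moreover have "(\<lambda>_. - 1) * v = - v" by (auto simp: times_fun_def fun_eq_iff uminus_apply)
  ultimately have "- v \<in> P" by metis
  then have "u + (- v) \<in> P" by (rule DXM_D(3)[OF P(1,2)])
  then show ?thesis by (simp only: diff_conv_add_uminus)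
qed

lemma graph_module_D:
  assumes P: "DXM P"
  shows "graph_module P \<subseteq> N" "0 \<in> graph_module P"
    "\<And>b c. b \<in> graph_module P \<Longrightarrow> c \<in> graph_module P \<Longrightarrow> b + c \<in> graph_module P"
    "\<And>g b. g \<in> polyfun \<Longrightarrow> b \<in> graph_module P \<Longrightarrow> g_mul g b \<in> graph_module P"
    "\<And>i b. b \<in> graph_module P \<Longrightarrow> dx i b \<in> graph_module P"
    "\<And>b. b \<in> graph_module P \<Longrightarrow> t b \<in> graph_module P"
    "\<And>b. b \<in> graph_module P \<Longrightarrow> g_dt b \<in> graph_module P"
proof -
  show "graph_module P \<subseteq> N" by (rule graph_module_mono[OF DXM_D(1)[OF P]])
  show "0 \<in> graph_module P" by (rule graph_moduleI) (auto simp: DXM_D(2)[OF P] zero_fun_apply)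
  fix b assume "b \<in> graph_module P"
  then obtain m where b: "\<And>j. m \<le> j \<Longrightarrow> b j = 0" "\<And>j. b j \<in> P" by (rule graph_moduleE) blast
  { fix c assume "c \<in> graph_module P"
    then obtain m' where c: "\<And>j. m' \<le> j \<Longrightarrow> c j = 0" "\<And>j. c j \<in> P" by (rule graph_moduleE) blast
    show "b + c \<in> graph_module P"
      using b c by (intro graph_moduleI[of _ _ "max m m'"]) (auto simp: DXM_D(3)[OF P] plus_fun_apply) }
  { fix g :: "complex ^ 'n \<Rightarrow> complex" assume "g \<in> polyfun"
    then show "g_mul g b \<in> graph_module P"
      using b by (intro graph_moduleI[of _ _ m]) (auto simp: DXM_D(4)[OF P] g_mul_def) }
  have pdf: "pd i f * b j \<in> P" for i j by (rule DXM_D(4)[OF P pd_polyfun[OF f_poly] b(2)])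
  { fix i
    show "dx i b \<in> graph_module P"
      using b DXM_D(2)[OF P] by (intro graph_moduleI[of _ _ "Suc m"])
        (auto simp: g_dx_def DXM_diff[OF P] DXM_D(5)[OF P] pdf split: nat.split) }
  show "t b \<in> graph_module P"
  proof (rule graph_moduleI[of _ _ m])
    fix j
    have "of_nat (Suc j) * b (Suc j) \<in> P"
      using DXM_D(4)[OF P polyfun_const(1)[of "of_nat (Suc j)"] b(2)] by (simp only: of_nat_fun)
    then show "t b j \<in> P" unfolding g_t_eq by (intro DXM_diff[OF P] DXM_D(4)[OF P f_poly] b(2))
    show "m \<le> j \<Longrightarrow> t b j = 0" using b(1)[of j] b(1)[of "Suc j"] by (simp add: g_t_eq)
  qed
  show "g_dt b \<in> graph_module P"
    using b DXM_D(2)[OF P] by (intro graph_moduleI[of _ _ "Suc m"]) (auto simp: g_dt_def split: nat.split)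
qed

lemma graph_module_V0D: "DXM P \<Longrightarrow> V0D (graph_module P)"
  using graph_module_D[of P] by (intro V0D_I) auto

lemma t_pow_dt: "(t ^^ Suc r) (g_dt b) = g_dt ((t ^^ Suc r) b) - sc (of_nat (Suc r)) ((t ^^ r) b)"
proof (induction r)
  case 0
  show ?case by (simp add: t_dt)
next
  case (Suc r)
  have "(t ^^ Suc (Suc r)) (g_dt b) = t (g_dt ((t ^^ Suc r) b)) - sc (of_nat (Suc r)) ((t ^^ Suc r) b)"
    using Suc.IH by (simp add: g_t_diff g_t_mul)
  also have "t (g_dt ((t ^^ Suc r) b)) = g_dt ((t ^^ Suc (Suc r)) b) - (t ^^ Suc r) b"
    by (simp add: t_dt)
  also have "sc (of_nat (Suc (Suc r))) ((t ^^ Suc r) b) = (t ^^ Suc r) b + sc (of_nat (Suc r)) ((t ^^ Suc r) b)"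
    unfolding of_nat_Suc[of "Suc r"] sc_add by simp
  ultimately show ?case by (simp add: algebra_simps)
qed

text \<open>Each \<open>\<partial>\<^sub>t\<close> costs one more power of \<open>t\<close>, by
  \<open>t_pow_dt\<close>; so torsion for \<open>f\<close> on the coefficients becomes torsion for
  \<open>t\<close> on the graph module.\<close>

lemma t_pow_torsion:
  assumes P: "DXM P" and full: "\<And>u. u \<in> Loc \<Longrightarrow> \<exists>r. f ^ r * u \<in> P" and "b \<in> N"
  shows "\<exists>r. (t ^^ r) b \<in> graph_module P"
  using assms(3)
proof (induction rule: graph_module_induct)
  case (delta u)
  then obtain r where "f ^ r * u \<in> P" using full by blast
  then have "g_delta (f ^ r * u) \<in> graph_module P"
    by (intro graph_moduleI[of _ _ 1]) (auto simp: g_delta_def DXM_D(2)[OF P])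
  then show ?case by (intro exI[of _ r]) (simp add: t_pow_delta)
next
  case (dt b)
  then obtain r where r: "(t ^^ r) b \<in> graph_module P" by blast
  then have "(t ^^ Suc r) b \<in> graph_module P" using graph_module_D(6)[OF P] by simp
  then have "(t ^^ Suc r) (g_dt b) \<in> graph_module P" unfolding t_pow_dt
    by (intro V0D_diff[OF graph_module_V0D[OF P]] graph_module_D[OF P] V0D_sc[OF graph_module_V0D[OF P]] r)
  then show ?case by blast
next
  case (add b c)
  then obtain r s where rs: "(t ^^ r) b \<in> graph_module P" "(t ^^ s) c \<in> graph_module P" by blast
  have "(t ^^ s) ((t ^^ r) b) \<in> graph_module P" "(t ^^ r) ((t ^^ s) c) \<in> graph_module P"
    using V0D_t_pow[OF graph_module_V0D[OF P]] rs by auto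
  then have "(t ^^ (r + s)) (b + c) \<in> graph_module P"
    unfolding t_pow_add by (intro graph_module_D(3)[OF P]) (simp_all add: funpow_add add.commute[of r s], metis funpow_add add.commute o_apply)
  then show ?case by blast
qed

text \<open>On \<open>t\<close>-torsion the operator \<open>\<partial>\<^sub>t t\<close> has no
  positive eigenvalues: with \<open>y = t\<^sup>k x\<close>, both
  \<open>\<partial>\<^sub>t t\<close> and \<open>\<partial>\<^sub>t t - (a + k)\<close> take
  \<open>y\<close> into the graph module, hence so does the nonzero scalar
  \<open>a + k\<close>.\<close>

lemma torsion_cancel:
  assumes P: "DXM P" and "x \<in> N" "(t ^^ k) x \<in> graph_module P" "dtt a x \<in> graph_module P" "0 < a"
  shows "x \<in> graph_module P"
  using assms(3)
proof (induction k)
  case (Suc k)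
  note VP = graph_module_V0D[OF P]
  let ?y = "(t ^^ k) x"
  have "(t ^^ k) (dtt a x) \<in> graph_module P" by (rule V0D_t_pow[OF VP assms(4)])
  then have 1: "dtt (a + of_nat k) ?y \<in> graph_module P" by (simp add: t_pow_dtt)
  have "g_dt (t ?y) \<in> graph_module P" using Suc.prems by (intro graph_module_D(7)[OF P]) simp
  then have "dtt 0 ?y \<in> graph_module P" by (simp add: dtt_0)
  then have "dtt 0 ?y - dtt (a + of_nat k) ?y \<in> graph_module P" using 1 by (rule V0D_diff[OF VP])
  then have "sc (of_rat (a + of_nat k)) ?y \<in> graph_module P"
    using dtt_shift[of 0 ?y "a + of_nat k"] by simp
  moreover have "of_rat (a + of_nat k) \<noteq> (0 :: complex)" using assms(5) by (simp add: add_pos_nonneg less_imp_neq[symmetric])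
  ultimately have "?y \<in> graph_module P" by (rule V0D_sc_cancel[OF VP])
  then show ?case by (rule Suc.IH)
qed simp

lemma torsion_cancel_list:
  assumes P: "DXM P" and full: "\<And>u. u \<in> Loc \<Longrightarrow> \<exists>r. f ^ r * u \<in> P"
    and "x \<in> N" "foldr dtt ls x \<in> graph_module P" "\<And>a. a \<in> set ls \<Longrightarrow> 0 < a"
  shows "x \<in> graph_module P"
  using assms(4,5)
proof (induction ls)
  case (Cons a ls)
  have y: "foldr dtt ls x \<in> N" by (rule V0D_foldr_dtt[OF V0D_N assms(3)])
  obtain k where "(t ^^ k) (foldr dtt ls x) \<in> graph_module P"
    using t_pow_torsion[OF P full y] by blast
  then have "foldr dtt ls x \<in> graph_module P"
    by (rule torsion_cancel[OF P y]) (use Cons.prems in auto)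
  then show ?case by (rule Cons.IH) (use Cons.prems in auto)
qed simp

text \<open>Some \<open>t\<^sup>r\<close> moves the finitely many generators of \<open>V c\<close>,
  hence \<open>V c\<close>, into the graph module, which therefore contains
  \<open>V (c + r)\<close>. A polynomial in \<open>\<partial>\<^sub>t t\<close> with positive roots
  maps \<open>V c\<close> there and can be cancelled on torsion.\<close>

lemma V_pos_subset:
  assumes V: "KM V" and P: "DXM P" and full: "\<And>u. u \<in> Loc \<Longrightarrow> \<exists>r. f ^ r * u \<in> P" and "0 < c"
  shows "V c \<subseteq> graph_module P"
proof
  fix x assume x: "x \<in> V c"
  note VP = graph_module_V0D[OF P]
  define Q where "Q r = {b \<in> N. (t ^^ r) b \<in> graph_module P}" for r
  have Q: "V0D (Q r)" for r
  proof (rule V0D_I)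
    fix b assume b: "b \<in> Q r"
    then have bN: "b \<in> N" and bP: "(t ^^ r) b \<in> graph_module P" by (auto simp: Q_def)
    { show "b \<in> N" by (rule bN) }
    { fix c assume "c \<in> Q r" then show "b + c \<in> Q r"
        using bN bP by (simp add: Q_def t_pow_add N_add V0D_D(3)[OF VP]) }
    { fix g :: "complex ^ 'n \<Rightarrow> complex" assume "g \<in> polyfun" then show "g_mul g b \<in> Q r"
        using bN bP by (simp add: Q_def t_pow_mul N_mul V0D_D(4)[OF VP]) }
    { fix i show "dx i b \<in> Q r" using bN bP by (simp add: Q_def t_pow_dx N_dx V0D_D(5)[OF VP]) }
    { show "t b \<in> Q r" using bN V0D_D(6)[OF VP bP] by (simp add: Q_def N_t flip: funpow_swap1) }
    { have "(t ^^ r) (dtt 0 b) \<in> graph_module P" using bP unfolding t_pow_dtt by (rule V0D_dtt[OF VP])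
      then show "Dt b \<in> Q r" using bN by (simp add: Q_def dtt_0 N_dt N_t) }
  next
    have "(t ^^ r) 0 = 0" by (induction r) auto
    then show "0 \<in> Q r" by (simp add: Q_def N_zero V0D_D(2)[OF VP])
  qed
  have Q_mono: "Q r \<subseteq> Q (r + s)" for r s
    using V0D_t_pow[OF VP, of _ s] by (auto simp: Q_def funpow_add add.commute[of r s])
  obtain S where S: "S \<subseteq> V c" "finite S" "\<And>Q. V0D Q \<Longrightarrow> S \<subseteq> Q \<Longrightarrow> V c \<subseteq> Q"
    using KM_D(4)[OF V, of c] by (auto simp: V0D_fin_gen_def)
  have "\<exists>r. S' \<subseteq> Q r" if "finite S'" "S' \<subseteq> N" for S'
    using that
  proof (induction S' rule: finite_induct)
    case (insert s S')
    then obtain r where r: "S' \<subseteq> Q r" by auto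
    obtain k where "(t ^^ k) s \<in> graph_module P"
      using t_pow_torsion[OF P full, of s] insert.prems by auto
    then have "s \<in> Q k" using insert.prems by (simp add: Q_def)
    then have "insert s S' \<subseteq> Q (r + k)" using r Q_mono[of r k] Q_mono[of k r] by (auto simp: add.commute)
    then show ?case ..
  qed simp
  then obtain r where "S \<subseteq> Q r" using S(1,2) KM_N[OF V, of c] by blast
  then have VQ: "V c \<subseteq> Q r" by (rule S(3)[OF Q])
  have sub: "V (c + of_nat r) \<subseteq> graph_module P"
  proof
    fix y assume "y \<in> V (c + of_nat r)"
    then obtain z where "z \<in> V c" "y = (t ^^ r) z"
      using KM_t_pow_surj[OF V \<open>0 < c\<close>] by blast
    then show "y \<in> graph_module P" using VQ by (auto simp: Q_def)
  qed
  obtain ls where ls: "\<forall>a\<in>set ls. c \<le> a" "\<forall>x\<in>V c. foldr dtt ls x \<in> V (c + of_nat r)"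
    using KM_annihilate[OF V, of c "c + of_nat r"] by auto
  show "x \<in> graph_module P"
  proof (rule torsion_cancel_list[OF P full])
    show "x \<in> N" using x KM_N[OF V] by blast
    show "foldr dtt ls x \<in> graph_module P" using ls(2) x sub by blast
    show "0 < a" if "a \<in> set ls" for a using ls(1) that \<open>0 < c\<close> by force
  qed
qed

section \<open>Generation by \<open>V\<^sup>0\<close> under powers of
  \<open>\<partial>\<^sub>t\<close>\<close>

definition Span :: "'n graph_elt set \<Rightarrow> 'n graph_elt set" where
  "Span L = add_span (\<Union>i. (g_dt ^^ i) ` L)"

lemma Span_base: "v \<in> L \<Longrightarrow> (g_dt ^^ i) v \<in> Span L"
  unfolding Span_def by (rule add_span_base) auto

lemma Span_sub: "L \<subseteq> Span L"
  using Span_base[of _ L 0] by auto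

lemma Span_add: "x \<in> Span L \<Longrightarrow> y \<in> Span L \<Longrightarrow> x + y \<in> Span L"
  unfolding Span_def by (rule add_span_add)

lemma Span_zero: "0 \<in> Span L"
  unfolding Span_def by (rule add_span_zero)

lemma Span_dt: "x \<in> Span L \<Longrightarrow> g_dt x \<in> Span L"
  unfolding Span_def
proof (induction rule: add_span_induct)
  case (base x)
  then obtain i v where "v \<in> L" "x = (g_dt ^^ i) v" by auto
  then show ?case using Span_base[of v L "Suc i"] by (simp add: Span_def)
qed (auto simp: g_dt_add add_span_zero intro: add_span_add)

lemma Span_closed:
  assumes "\<And>v i. v \<in> L \<Longrightarrow> h ((g_dt ^^ i) v) \<in> Span L" "h 0 = 0"
    and "\<And>x y. x \<in> Span L \<Longrightarrow> y \<in> Span L \<Longrightarrow> h (x + y) = h x + h y" and "x \<in> Span L"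
  shows "h x \<in> Span L"
  using assms(4) unfolding Span_def
proof (induction rule: add_span_induct)
  case (add x y)
  then show ?case using assms(3)[of x y] by (auto simp: Span_def intro: add_span_add)
qed (use assms(1,2) in \<open>auto simp: Span_def add_span_zero\<close>)

lemma dt_pow_sc: "(g_dt ^^ i) (g_mul g v) = g_mul g ((g_dt ^^ i) v)"
  by (induction i) (auto simp: g_dt_mul)

lemma N_dt_pow: "v \<in> N \<Longrightarrow> (g_dt ^^ i) v \<in> N"
  by (induction i) (auto intro: N_dt)

lemma dx_dt_pow: "v \<in> N \<Longrightarrow> dx j ((g_dt ^^ i) v) = (g_dt ^^ i) (dx j v)"
  by (induction i) (auto simp: dx_dt N_dt_pow)

lemma t_dt_pow: "t ((g_dt ^^ Suc i) v) = (g_dt ^^ Suc i) (t v) - sc (of_nat (Suc i)) ((g_dt ^^ i) v)"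
proof (induction i)
  case 0
  show ?case by (simp add: t_dt)
next
  case (Suc i)
  have "t ((g_dt ^^ Suc (Suc i)) v) = g_dt (t ((g_dt ^^ Suc i) v)) - (g_dt ^^ Suc i) v"
    by (simp add: t_dt)
  also have "\<dots> = (g_dt ^^ Suc (Suc i)) (t v) - sc (of_nat (Suc i)) ((g_dt ^^ Suc i) v) - (g_dt ^^ Suc i) v"
    unfolding Suc.IH by (simp add: g_dt_diff g_dt_mul)
  also have "\<dots> = (g_dt ^^ Suc (Suc i)) (t v) - sc (of_nat (Suc (Suc i))) ((g_dt ^^ Suc i) v)"
    unfolding of_nat_Suc[of "Suc i"] sc_add by (simp add: algebra_simps)
  finally show ?case .
qed

lemma Span_V0D:
  assumes L: "V0D L"
  shows "V0D (Span L)"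
proof (rule V0D_I)
  show SN: "b \<in> N" if "b \<in> Span L" for b
    using that unfolding Span_def
    by (induction rule: add_span_induct) (use V0D_D(1)[OF L] in \<open>auto intro: N_zero N_add N_dt_pow\<close>)
  show "0 \<in> Span L" by (rule Span_zero)
  show "b + c \<in> Span L" if "b \<in> Span L" "c \<in> Span L" for b c by (rule Span_add[OF that])
  show mul: "g_mul g b \<in> Span L" if "g \<in> polyfun" "b \<in> Span L" for g b
    by (rule Span_closed[OF _ _ _ that(2)])
      (use that V0D_D(4)[OF L] in \<open>auto simp: g_mul_add intro: Span_base simp flip: dt_pow_sc\<close>)
  show "dx i b \<in> Span L" if "b \<in> Span L" for i b
  proof (rule Span_closed[OF _ _ _ that])
    show "dx i ((g_dt ^^ j) v) \<in> Span L" if "v \<in> L" for v j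
    proof -
      have "v \<in> N" using that V0D_D(1)[OF L] by blast
      then show ?thesis using Span_base[OF V0D_D(5)[OF L that], of j i] by (simp add: dx_dt_pow)
    qed
    show "dx i (x + y) = dx i x + dx i y" if "x \<in> Span L" "y \<in> Span L" for x y
      using that SN by (simp add: dx_add)
  qed simp
  show t: "t b \<in> Span L" if "b \<in> Span L" for b
  proof (rule Span_closed[OF _ _ _ that])
    show "t ((g_dt ^^ j) v) \<in> Span L" if v: "v \<in> L" for v j
    proof (cases j)
      case 0
      then show ?thesis using V0D_D(6)[OF L v] Span_sub by auto
    next
      case (Suc i)
      have "(g_dt ^^ Suc i) (t v) \<in> Span L" by (rule Span_base[OF V0D_D(6)[OF L v]])
      moreover have "sc (- of_nat (Suc i)) ((g_dt ^^ i) v) \<in> Span L"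
        by (rule mul[OF polyfun_const(1) Span_base[OF v]])
      moreover have "sc (- of_nat (Suc i)) ((g_dt ^^ i) v) = - sc (of_nat (Suc i)) ((g_dt ^^ i) v)"
        using sc_diff[of 0 "of_nat (Suc i)" "(g_dt ^^ i) v"] by simp
      ultimately show ?thesis unfolding Suc t_dt_pow using Span_add by fastforce
    qed
  qed (auto simp: g_t_add)
  show "Dt b \<in> Span L" if "b \<in> Span L" for b by (rule Span_dt[OF t[OF that]])
qed

lemma Span_mono: "L \<subseteq> L' \<Longrightarrow> Span L \<subseteq> Span L'"
  unfolding Span_def by (rule add_span_mono) auto

text \<open>For a negative index \<open>e\<close> the identity
  \<open>e x = \<partial>\<^sub>t t x - (\<partial>\<^sub>t t - e) x\<close> recovers
  \<open>x\<close> from \<open>t x\<close>, which has index \<open>e + 1\<close>, and from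
  \<open>(\<partial>\<^sub>t t - e) x\<close>, which after finitely many repetitions has higher
  index. The induction descends along the grid.\<close>

lemma graph_module_subset_Span:
  assumes V: "KM V" and P: "DXM P"
  shows "graph_module P \<subseteq> Span (V 0 \<inter> graph_module P)"
proof
  let ?L = "V 0 \<inter> graph_module P"
  note VP = graph_module_V0D[OF P]
  have L: "V0D ?L"
    using KM_V0D[OF V, of 0] VP by (auto simp: V0D_submodule_def)
  note SL = Span_V0D[OF L]
  obtain l :: nat where l: "l > 0" "\<forall>a. V a = V (of_int \<lceil>of_nat l * a\<rceil> / of_nat l)"
    using KM_D(3)[OF V] by blast
  have claim: "V (- of_nat q / of_nat l) \<inter> graph_module P \<subseteq> Span ?L" for q
  proof (induction q rule: less_induct)
    case (less q)
    show ?case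
    proof (cases "q = 0")
      case True
      then show ?thesis using Span_sub[of ?L] by simp
    next
      case False
      define e :: rat where "e = - of_nat q / of_nat l"
      have le: "of_nat l * e = of_int (- int q)" using l(1) by (simp add: e_def)
      have e0: "e \<noteq> 0" using False l(1) by (simp add: e_def)
      have gt: "V_gt V e = V (- of_nat (q - 1) / of_nat l)"
        using KM_gt_grid[OF V l, of e] le False by (simp add: of_nat_diff algebra_simps)
      have above: "V (e + 1) \<inter> graph_module P \<subseteq> Span ?L"
      proof (cases "q \<le> l")
        case True
        then have "0 \<le> e + 1" using l(1) by (simp add: e_def field_simps)
        then show ?thesis using KM_antimono[OF V, of 0 "e + 1"] Span_sub[of ?L] by blast
      next
        case F: False
        then have "e + 1 = - of_nat (q - l) / of_nat l" using l(1) by (simp add: e_def field_simps of_nat_diff)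
        then show ?thesis using less[of "q - l"] F l(1) by simp
      qed
      have down: "x \<in> Span ?L" if "x \<in> V e \<inter> graph_module P" "(dtt e ^^ r) x \<in> Span ?L" for x r
        using that
      proof (induction r arbitrary: x)
        case (Suc r)
        have "dtt e x \<in> V e \<inter> graph_module P"
          using Suc.prems(1) V0D_dtt[OF KM_V0D[OF V]] V0D_dtt[OF VP] by blast
        moreover have "(dtt e ^^ r) (dtt e x) \<in> Span ?L" using Suc.prems(2) by (simp add: funpow_swap1)
        ultimately have 1: "dtt e x \<in> Span ?L" by (rule Suc.IH)
        have "t x \<in> Span ?L" using above Suc.prems(1) KM_D(5)[OF V] V0D_D(6)[OF VP] by blast
        then have "g_dt (t x) \<in> Span ?L" by (rule Span_dt)
        then have "dtt 0 x - dtt e x \<in> Span ?L" using 1 by (intro V0D_diff[OF SL]) (simp add: dtt_0)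
        then have "sc (of_rat e) x \<in> Span ?L" using dtt_shift[of 0 x e] by simp
        then show ?case by (rule V0D_sc_cancel[OF SL]) (simp add: e0)
      qed simp
      obtain r where r: "\<forall>b\<in>V e. (dtt e ^^ r) b \<in> V_gt V e" using KM_D(8)[OF V, of e] by blast
      show ?thesis
      proof
        fix x assume "x \<in> V (- of_nat q / of_nat l) \<inter> graph_module P"
        then have x: "x \<in> V e \<inter> graph_module P" by (simp add: e_def)
        then have "(dtt e ^^ r) x \<in> V (- of_nat (q - 1) / of_nat l) \<inter> graph_module P"
          using r V0D_dtt_pow[OF VP] unfolding gt by blast
        then have "(dtt e ^^ r) x \<in> Span ?L" using less[of "q - 1"] False by auto
        then show "x \<in> Span ?L" by (rule down[OF x])
      qed
    qed
  qed
  fix x assume x: "x \<in> graph_module P"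
  then have "x \<in> N" using graph_module_D(1)[OF P] by blast
  then obtain a where a: "x \<in> V a" using KM_D(2)[OF V] by blast
  define q where "q = nat (- \<lceil>of_nat l * a\<rceil>)"
  have "- of_nat q / of_nat l \<le> (of_int \<lceil>of_nat l * a\<rceil> / of_nat l :: rat)"
    by (rule divide_right_mono) (auto simp: q_def)
  moreover have "x \<in> V (of_int \<lceil>of_nat l * a\<rceil> / of_nat l)" using a l(2) by blast
  ultimately have "x \<in> V (- of_nat q / of_nat l)" using KM_antimono[OF V] by blast
  then show "x \<in> Span ?L" using x claim by blast
qed

text \<open>Inverse to intersecting the graph module of a \<open>\<D>\<^sub>X\<close>-module with
  \<open>V 0\<close>, see \<open>DXM_eq_PL\<close> and \<open>graph_module_PL\<close>.\<close>

definition PL :: "'n graph_elt set \<Rightarrow> (complex ^ 'n \<Rightarrow> complex) set" where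
  "PL L = {m \<in> Loc. g_delta m \<in> Span L}"

lemma DXM_eq_PL:
  assumes V: "KM V" and P: "DXM P"
  shows "P = PL (V 0 \<inter> graph_module P)"
proof -
  let ?L = "V 0 \<inter> graph_module P"
  have "Span ?L \<subseteq> graph_module P"
    unfolding Span_def
  proof (rule add_span_least)
    have "(g_dt ^^ i) v \<in> graph_module P" if "v \<in> graph_module P" for i v
      using that by (induction i) (auto intro: graph_module_D(7)[OF P])
    then show "(\<Union>i. (g_dt ^^ i) ` ?L) \<subseteq> graph_module P" by auto
  qed (use graph_module_D[OF P] in auto)
  moreover have "m \<in> P \<longleftrightarrow> g_delta m \<in> graph_module P" for m
  proof
    assume "m \<in> P"
    then show "g_delta m \<in> graph_module P"
      by (intro graph_moduleI[of _ _ 1]) (auto simp: g_delta_def DXM_D(2)[OF P])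
  next
    assume "g_delta m \<in> graph_module P"
    then show "m \<in> P" using graph_module_mem[of "g_delta m" P 0] by simp
  qed
  ultimately show ?thesis
    using graph_module_subset_Span[OF V P] DXM_D(1)[OF P] unfolding PL_def by blast
qed

end

section \<open>Hodge and weight filtration\<close>

lemma dt_sum_form:
  fixes L :: "nat \<Rightarrow> 'n::finite graph_elt set"
  assumes "x \<in> add_span (\<Union>i. (g_dt ^^ i) ` L i)" "\<And>i. 0 \<in> L i" "\<And>i u v. u \<in> L i \<Longrightarrow> v \<in> L i \<Longrightarrow> u + v \<in> L i"
  shows "\<exists>r v. (\<forall>i. v i \<in> L i) \<and> x = (\<Sum>i<r. (g_dt ^^ i) (v i))"
proof -
  have dt0: "(g_dt ^^ i) (0 :: 'n graph_elt) = 0" for i by (induction i) auto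
  have dtadd: "(g_dt ^^ i) (u + v) = (g_dt ^^ i) u + (g_dt ^^ i) (v :: 'n graph_elt)" for i u v
    by (induction i) (auto simp: g_dt_add)
  have "\<exists>r v. (\<forall>i. v i \<in> L i) \<and> (\<forall>i\<ge>r. v i = 0) \<and> x = (\<Sum>i<r. (g_dt ^^ i) (v i))"
    using assms(1)
  proof (induction rule: add_span_induct)
    case zero
    show ?case by (intro exI[of _ 0] exI[of _ "\<lambda>_. 0"]) (use assms in auto)
  next
    case (base x)
    then obtain i u where u: "u \<in> L i" "x = (g_dt ^^ i) u" by auto
    define v where "v = (\<lambda>j. if j = i then u else 0)"
    have "(\<Sum>j<Suc i. (g_dt ^^ j) (v j)) = (\<Sum>j<Suc i. if j = i then x else 0)"
      by (rule sum.cong) (auto simp: v_def u(2) dt0)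
    then have "x = (\<Sum>j<Suc i. (g_dt ^^ j) (v j))" by simp
    moreover have "\<forall>j. v j \<in> L j" "\<forall>j\<ge>Suc i. v j = 0" using u assms(2) by (auto simp: v_def)
    ultimately show ?case by blast
  next
    case (add x y)
    then obtain r v s w where *: "\<forall>i. v i \<in> L i" "\<forall>i\<ge>r. v i = 0" "x = (\<Sum>i<r. (g_dt ^^ i) (v i))"
      "\<forall>i. w i \<in> L i" "\<forall>i\<ge>s. w i = 0" "y = (\<Sum>i<s. (g_dt ^^ i) (w i))" by blast
    let ?m = "max r s"
    have "x = (\<Sum>i<?m. (g_dt ^^ i) (v i))" unfolding *(3)
      by (rule sum.mono_neutral_left) (use *(2) in \<open>auto simp: dt0\<close>)
    moreover have "y = (\<Sum>i<?m. (g_dt ^^ i) (w i))" unfolding *(6)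
      by (rule sum.mono_neutral_left) (use *(5) in \<open>auto simp: dt0\<close>)
    ultimately have "x + y = (\<Sum>i<?m. (g_dt ^^ i) (v i + w i))"
      by (simp add: dtadd sum.distrib)
    then show ?case using * assms(3)
      by (intro exI[of _ ?m] exI[of _ "\<lambda>i. v i + w i"]) auto
  qed
  then show ?thesis by blast
qed

context loc_module
begin

lemma V0D_sum: "V0D P \<Longrightarrow> (\<And>i. i \<in> A \<Longrightarrow> x i \<in> P) \<Longrightarrow> sum x A \<in> P"
  by (induction A rule: infinite_finite_induct) (auto intro: V0D_D(2,3))

lemma dx_dtt: "b \<in> N \<Longrightarrow> dx i (dtt a b) = dtt a (dx i b)"
  by (simp add: g_dtt_def dx_diff dx_Dt dx_sc N_dt N_t N_sc)

lemma dtt_mul: "dtt a (g_mul g b) = g_mul g (dtt a b)"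
  by (simp add: g_dtt_def Dt_mul g_mul_diff g_mul_commute)

lemma dtt_Dt: "dtt a (Dt b) = Dt (dtt a b)"
  using dtt_commute[of a 0 b] by (simp add: dtt_0)

end

text \<open>These properties of the V-filtration suffice to compute both filtrations.
  \<open>t_V0\<close> reflects that the module is an open direct image; \<open>Dt_Dt\<close> makes
  \<open>\<partial>\<^sub>t t\<close> an operator of square zero on
  \<open>gr\<^sub>V\<^sup>0\<close>.\<close>

locale km_setting = loc_module f \<alpha> for f :: "complex ^ 'n::finite \<Rightarrow> complex" and \<alpha> +
  fixes V :: "rat \<Rightarrow> 'n graph_elt set"
  assumes V: "KM_filtration f \<alpha> V" and t_V0: "g_t f ` V 0 = V 1"
    and Dt_Dt: "x \<in> V 0 \<Longrightarrow> Dt (Dt x) \<in> V_gt V 0"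
begin

abbreviation "Vp \<equiv> V_gt V 0"

lemma V_eq: "V_filtration f \<alpha> = V"
  by (rule V_filtration_eq[OF V])

lemma V1_Vp: "V 1 \<subseteq> Vp"
  by (rule V_in_gt) simp

lemma Vp_V0: "Vp \<subseteq> V 0"
  by (rule V_gt_subset[OF V])

lemma V0D_Vp: "V0D Vp"
  by (rule V_gt_V0D[OF V])

lemma V0D_V: "V0D (V a)"
  by (rule KM_V0D[OF V])

lemma Vgt1: "V_gt V 1 = t ` Vp"
proof
  show "V_gt V 1 \<subseteq> t ` Vp"
  proof
    fix x assume "x \<in> V_gt V 1"
    then obtain b where b: "1 < b" "x \<in> V b" by (auto simp: V_gt_def)
    have "t ` V (b - 1) = V (b - 1 + 1)" by (rule KM_D(6)[OF V]) (use b in simp)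
    then have "x \<in> t ` V (b - 1)" using b(2) by simp
    moreover have "V (b - 1) \<subseteq> Vp" using b by (intro V_in_gt) simp
    ultimately show "x \<in> t ` Vp" by blast
  qed
  show "t ` Vp \<subseteq> V_gt V 1"
  proof
    fix x assume "x \<in> t ` Vp"
    then obtain b y where b: "0 < b" "y \<in> V b" "x = t y" by (auto simp: V_gt_def)
    then have "x \<in> V (b + 1)" using KM_D(5)[OF V b(2)] by simp
    then show "x \<in> V_gt V 1" using b(1) V_in_gt[of 1 "b + 1" V] by auto
  qed
qed

text \<open>
  These are the \<open>V0D\<close>-submodules \<open>L\<close> that occur as \<open>V\<^sup>0 \<inter> i\<^bsub>f+\<^esub>P\<close> for a \<open>\<D>\<^sub>X\<close>-submodule \<open>P\<close> of full
  localization, namely for \<open>P = PL L\<close>.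
\<close>

definition adm :: "'n graph_elt set \<Rightarrow> bool" where
  "adm L \<longleftrightarrow> V0D L \<and> Vp \<subseteq> L \<and> L \<subseteq> V 0 \<and> g_dt ` V 1 \<subseteq> L"

lemma adm_D:
  assumes "adm L"
  shows "V0D L" "Vp \<subseteq> L" "L \<subseteq> V 0" "x \<in> V 1 \<Longrightarrow> g_dt x \<in> L" "V 1 \<subseteq> L"
  using assms V1_Vp by (auto simp: adm_def)

text \<open>The top summand lies in \<open>V (1 - r)\<close> since the others do. Multiplied by
  \<open>t\<^sup>r\<close> it becomes \<open>v r\<close> under a polynomial in
  \<open>\<partial>\<^sub>t t\<close> with the roots 1, ..., \<open>r\<close>, none of them in
  [0,1). So \<open>v r\<close> is in \<open>V 1\<close>, and \<open>g_dt (v r)\<close> lies in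
  \<open>L\<close> and is absorbed into the previous summand.\<close>

lemma span_sum_V0:
  assumes L: "adm L" and "\<And>i. v i \<in> L" "(\<Sum>i<r. (g_dt ^^ i) (v i)) \<in> V 0"
  shows "(\<Sum>i<r. (g_dt ^^ i) (v i)) \<in> L"
  using assms(2,3)
proof (induction r arbitrary: v)
  case 0
  then show ?case using V0D_D(2)[OF adm_D(1)[OF L]] by simp
next
  case (Suc r)
  show ?case
  proof (cases r)
    case 0
    then show ?thesis using Suc.prems(1)[of 0] by simp
  next
    case r: (Suc r')
    let ?S = "\<Sum>i<r. (g_dt ^^ i) (v i)"
    note V1r = V0D_V[of "1 - of_nat r"]
    have "(g_dt ^^ i) (v i) \<in> V (1 - of_nat r)" if "i < r" for i
    proof -
      have "(g_dt ^^ i) (v i) \<in> V (0 - of_nat i)"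
        by (rule KM_dt_pow[OF V]) (use Suc.prems(1) adm_D(3)[OF L] in blast)
      moreover have "1 - of_nat r \<le> (0 - of_nat i :: rat)"
        using that of_nat_mono[of "Suc i" r, where 'a=rat] by simp
      ultimately show ?thesis using KM_antimono[OF V] by blast
    qed
    then have S: "?S \<in> V (1 - of_nat r)"
      by (intro V0D_sum[OF V1r]) auto
    have "(\<Sum>i<Suc r. (g_dt ^^ i) (v i)) \<in> V (1 - of_nat r)"
      using Suc.prems(2) KM_antimono[OF V, of "1 - of_nat r" 0] r by auto
    then have "(\<Sum>i<Suc r. (g_dt ^^ i) (v i)) - ?S \<in> V (1 - of_nat r)" using S by (rule V0D_diff[OF V1r])
    then have "(g_dt ^^ r) (v r) \<in> V (1 - of_nat r)" by simp
    then have "(t ^^ r) ((g_dt ^^ r) (v r)) \<in> V (1 - of_nat r + of_nat r)" by (rule KM_t_pow[OF V])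
    then have "foldr dtt (map of_nat [1..<Suc r]) (v r) \<in> V 1" by (simp only: t_pow_dt_pow) simp
    moreover have "v r \<in> V 0" using Suc.prems(1) adm_D(3)[OF L] by blast
    ultimately have "v r \<in> V 1"
      by (rule_tac KM_cancel_list[OF V, of "v r" 0]) auto
    then have dtv: "g_dt (v r) \<in> L" by (rule adm_D(4)[OF L])
    define v' where "v' = v(r' := v r' + g_dt (v r))"
    have "(\<Sum>i<r. (g_dt ^^ i) (v' i)) = (\<Sum>i<r'. (g_dt ^^ i) (v i)) + (g_dt ^^ r') (v r' + g_dt (v r))"
      by (simp add: r v'_def)
    also have "\<dots> = (\<Sum>i<Suc r. (g_dt ^^ i) (v i))"
      by (simp add: r dt_pow_add funpow_swap1 add.assoc)
    finally have eq: "(\<Sum>i<r. (g_dt ^^ i) (v' i)) = (\<Sum>i<Suc r. (g_dt ^^ i) (v i))" .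
    have "v' i \<in> L" for i
      using Suc.prems(1) dtv V0D_D(3)[OF adm_D(1)[OF L]] by (simp add: v'_def)
    then have "(\<Sum>i<r. (g_dt ^^ i) (v' i)) \<in> L"
      using Suc.prems(2) by (intro Suc.IH) (simp_all only: eq)
    then show ?thesis by (simp only: eq)
  qed
qed

lemma Span_sum_form: "V0D L \<Longrightarrow> x \<in> Span L \<Longrightarrow> \<exists>r v. (\<forall>i. v i \<in> L) \<and> x = (\<Sum>i<r. (g_dt ^^ i) (v i))"
  unfolding Span_def by (rule dt_sum_form[of x "\<lambda>_. L"]) (auto intro: V0D_D(2,3))

lemma V0_inter_Span:
  assumes L: "adm L"
  shows "V 0 \<inter> Span L = L"
proof
  show "L \<subseteq> V 0 \<inter> Span L" using adm_D(3)[OF L] Span_sub by blast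
  show "V 0 \<inter> Span L \<subseteq> L"
  proof
    fix x assume x: "x \<in> V 0 \<inter> Span L"
    then obtain r v where "\<forall>i. v i \<in> L" "x = (\<Sum>i<r. (g_dt ^^ i) (v i))"
      using Span_sum_form[OF adm_D(1)[OF L]] by blast
    then show "x \<in> L" using span_sum_V0[OF L, of v r] x by blast
  qed
qed

text \<open>\<open>\<partial>\<^sub>t t\<close> maps \<open>V 0\<close> into \<open>L\<close>, so
  \<open>\<partial>\<^sub>t t - a\<close> is the scalar \<open>- a\<close> on the quotient.\<close>

lemma dtt_cancel_L:
  assumes L: "adm L" and y: "y \<in> V 0" "dtt a y \<in> L" "a \<noteq> 0"
  shows "y \<in> L"
proof -
  have "t y \<in> V 1" using KM_D(5)[OF V y(1)] by simp
  then have "dtt 0 y \<in> L" using adm_D(4)[OF L] by (simp add: dtt_0)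
  then have "dtt 0 y - dtt a y \<in> L" using y(2) by (rule V0D_diff[OF adm_D(1)[OF L]])
  then have "sc (of_rat a) y \<in> L" using dtt_shift[of 0 y a] by simp
  then show ?thesis by (rule V0D_sc_cancel[OF adm_D(1)[OF L]]) (simp add: y)
qed

lemma dtt_cancel_L_list:
  assumes L: "adm L" and y: "y \<in> V 0" "foldr dtt ls y \<in> L" "0 \<notin> set ls"
  shows "y \<in> L"
  using y(2,3)
proof (induction ls)
  case (Cons a ls)
  have "foldr dtt ls y \<in> L"
    by (rule dtt_cancel_L[OF L V0D_foldr_dtt[OF V0D_V y(1)], of a]) (use Cons.prems in auto)
  then show ?case by (rule Cons.IH) (use Cons.prems in auto)
qed simp

text \<open>After multiplication by \<open>t\<^sup>r\<close> the lower summands fall into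
  \<open>V 1\<close>, which is contained in \<open>L\<close>, and the top one becomes
  \<open>v r\<close> under a polynomial in \<open>\<partial>\<^sub>t t\<close> without the root 0,
  removed by \<open>dtt_cancel_L_list\<close>.\<close>

lemma span_coeff:
  assumes L: "adm L" and "\<And>i. v i \<in> V 0" "(\<Sum>i<r. (g_dt ^^ i) (v i)) \<in> Span L" "i < r"
  shows "v i \<in> L"
  using assms(3,4)
proof (induction r)
  case (Suc r)
  note SL = Span_V0D[OF adm_D(1)[OF L]]
  let ?S = "\<Sum>i<r. (g_dt ^^ i) (v i)"
  have fold0: "foldr dtt ls (v i) \<in> V 0" for ls i by (rule V0D_foldr_dtt[OF V0D_V assms(2)])
  have tpow: "(t ^^ r) (x + y) = (t ^^ r) x + (t ^^ r) y" for r x y by (rule t_pow_add)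
  have low: "(t ^^ r) ((g_dt ^^ i) (v i)) \<in> Span L" if "i < r" for i
  proof -
    have "(t ^^ r) ((g_dt ^^ i) (v i)) = (t ^^ (r - i)) ((t ^^ i) ((g_dt ^^ i) (v i)))"
      using that by (simp flip: funpow_add[THEN fun_cong, simplified o_apply])
    moreover have "(t ^^ i) ((g_dt ^^ i) (v i)) \<in> V 0" unfolding t_pow_dt_pow by (rule fold0)
    ultimately have "(t ^^ r) ((g_dt ^^ i) (v i)) \<in> V (0 + of_nat (r - i))" using KM_t_pow[OF V] by metis
    moreover have "(1 :: rat) \<le> 0 + of_nat (r - i)" using that of_nat_mono[of 1 "r - i", where 'a=rat] by simp
    ultimately have "(t ^^ r) ((g_dt ^^ i) (v i)) \<in> V 1" using KM_antimono[OF V] by blast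
    then show ?thesis using adm_D(5)[OF L] Span_sub by blast
  qed
  have tS: "(t ^^ r) (\<Sum>i<k. (g_dt ^^ i) (v i)) = (\<Sum>i<k. (t ^^ r) ((g_dt ^^ i) (v i)))" for k
  proof (induction k)
    case 0
    have "(t ^^ r) 0 = 0" by (induction r) auto
    then show ?case by simp
  qed (simp add: tpow)
  have "(t ^^ r) ?S \<in> Span L" unfolding tS by (intro V0D_sum[OF SL] low) simp
  moreover have "(t ^^ r) (?S + (g_dt ^^ r) (v r)) \<in> Span L"
    using V0D_t_pow[OF SL Suc.prems(1)] by simp
  ultimately have "(t ^^ r) (?S + (g_dt ^^ r) (v r)) - (t ^^ r) ?S \<in> Span L"
    by (intro V0D_diff[OF SL])
  then have "(t ^^ r) ((g_dt ^^ r) (v r)) \<in> Span L" by (simp add: tpow)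
  then have "foldr dtt (map of_nat [1..<Suc r]) (v r) \<in> Span L" by (simp only: t_pow_dt_pow)
  then have "foldr dtt (map of_nat [1..<Suc r]) (v r) \<in> L"
    using V0_inter_Span[OF L] fold0 by blast
  then have vr: "v r \<in> L" by (rule dtt_cancel_L_list[OF L assms(2)]) auto
  show ?case
  proof (cases "i = r")
    case False
    have "(?S + (g_dt ^^ r) (v r)) - (g_dt ^^ r) (v r) \<in> Span L"
      using Suc.prems(1) Span_base[OF vr, of r] by (intro V0D_diff[OF SL]) auto
    then have "?S \<in> Span L" by simp
    then show ?thesis using Suc.IH Suc.prems(2) False by simp
  qed (use vr in simp)
qed simp

lemma Loc_full: "adm L \<Longrightarrow> u \<in> Loc \<Longrightarrow> \<exists>r. f ^ r * u \<in> PL L"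
proof -
  assume L: "adm L" and u: "u \<in> Loc"
  obtain a where a: "g_delta u \<in> V a" using KM_D(2)[OF V] N_delta[OF u] by blast
  obtain r :: nat where r: "1 - a \<le> of_nat r" using real_arch_simple by blast
  have "(t ^^ r) (g_delta u) \<in> V (a + of_nat r)" by (rule KM_t_pow[OF V a])
  also have "\<dots> \<subseteq> V 1" by (rule KM_antimono[OF V]) (use r in linarith)
  also have "\<dots> \<subseteq> Span L" using adm_D(5)[OF L] Span_sub by blast
  finally have "g_delta (f ^ r * u) \<in> Span L" by (simp add: t_pow_delta)
  then show ?thesis using Loc_mult[OF polyfun_power[OF f_poly] u] by (auto simp: PL_def)
qed

lemma PL_DXM:
  assumes L: "adm L"
  shows "DXM (PL L)"
proof -
  note SL = Span_V0D[OF adm_D(1)[OF L]]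
  have conn: "g_delta (conn f \<alpha> i u) = dx i (g_delta u) + g_dt (g_mul (pd i f) (g_delta u))" for i u
    by (rule ext) (auto simp: g_delta_def g_dx_def g_dt_def g_mul_def plus_fun_apply split: nat.split)
  show ?thesis
    unfolding DX_submodule_def
  proof (intro conjI ballI allI)
    show "PL L \<subseteq> Loc" by (auto simp: PL_def)
    show "0 \<in> PL L" by (simp add: PL_def Loc_zero Span_zero)
  next
    fix u v assume "u \<in> PL L" "v \<in> PL L"
    then show "u + v \<in> PL L" by (auto simp: PL_def Loc_add g_delta_add Span_add)
  next
    fix g u :: "complex ^ 'n \<Rightarrow> complex" assume "g \<in> polyfun" "u \<in> PL L"
    then show "g * u \<in> PL L"
      using V0D_D(4)[OF SL, of g "g_delta u"] by (auto simp: PL_def Loc_mult g_mul_delta)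
  next
    fix i u assume "u \<in> PL L"
    then have "u \<in> Loc" "g_delta u \<in> Span L" by (auto simp: PL_def)
    then show "conn f \<alpha> i u \<in> PL L"
      by (auto simp: PL_def conn_Loc conn intro!: Span_add Span_dt V0D_D(4,5)[OF SL] pd_polyfun f_poly)
  qed
qed

lemma graph_module_PL:
  assumes L: "adm L"
  shows "graph_module (PL L) = Span L"
proof (intro equalityI subsetI)
  fix b assume "b \<in> graph_module (PL L)"
  then show "b \<in> Span L"
    by (induction rule: graph_module_induct) (auto simp: PL_def intro: Span_dt Span_add)
next
  note SL = Span_V0D[OF adm_D(1)[OF L]]
  fix b assume b: "b \<in> Span L"
  then have bN: "b \<in> N" using V0D_D(1)[OF SL] by blast
  then obtain m where m: "\<And>j. m \<le> j \<Longrightarrow> b j = 0" "\<And>j. b j \<in> Loc" by (rule graph_moduleE) blast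
  have "g_delta (b j) \<in> Span L" for j
    by (rule graph_coefficients[where Z = "\<lambda>_. Span L" and k = 0 and f = f and m = m and b = b])
       (use b m in \<open>auto intro: Span_zero Span_add Span_dt V0D_sc[OF SL] V0D_diff[OF SL] V0D_D(4,6)[OF SL] f_poly\<close>)
  then show "b \<in> graph_module (PL L)" using m by (intro graph_moduleI[of b _ m]) (auto simp: PL_def)
qed

lemma PL_V0: "PL (V 0) = Loc"
proof -
  have "V 0 \<inter> N = V 0" using KM_N[OF V] by blast
  then show ?thesis using DXM_eq_PL[OF V DXM_Loc] by simp
qed

lemma adm_V0: "adm (V 0)"
proof -
  have "g_dt x \<in> V 0" if "x \<in> V 1" for x using KM_D(7)[OF V that] by simp
  then show ?thesis using V0D_V Vp_V0 by (auto simp: adm_def)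
qed

abbreviation order_le :: "int \<Rightarrow> 'n graph_elt \<Rightarrow> bool" where
  "order_le k b \<equiv> (\<forall>j. k < int j \<longrightarrow> b j = 0)"

lemma graph_F_iff: "b \<in> graph_F f (F_on_U f) k \<longleftrightarrow> b \<in> N \<and> order_le k b"
  by (auto simp: graph_F_def F_on_U_def Loc_zero dest: graph_module_mem)

text \<open>If \<open>m \<delta>\<close> is a sum of terms
  \<open>\<partial>\<^sub>t\<^sup>i v\<^sub>i\<close> as in the definition of the Hodge filtration,
  then \<open>m\<close> is the coefficient of \<open>v\<^sub>0\<close> at 0, and
  \<open>span_coeff\<close> puts \<open>v\<^sub>0\<close> into \<open>L\<close>. Conversely, the
  Hodge filtration of the graph module is stable under extraction of coefficients, by
  \<open>graph_coefficients\<close>.\<close>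

lemma hodge_F_inter_PL:
  assumes L: "adm L"
  shows "hodge_F f \<alpha> k \<inter> PL L = {b 0 | b. b \<in> L \<and> order_le k b}"
proof -
  define Z where "Z k = add_span (\<Union>i::nat. (g_dt ^^ i) ` (V 0 \<inter> graph_F f (F_on_U f) (k - int i)))" for k
  have H: "hodge_F f \<alpha> k = {m \<in> Loc. g_delta m \<in> Z k}" for k
    by (simp add: hodge_F_def direct_image_F_def Z_def V_eq)
  let ?G = "\<lambda>k. V 0 \<inter> graph_F f (F_on_U f) k"
  have G0: "0 \<in> ?G k" for k using V0D_D(2)[OF V0D_V] by (simp add: graph_F_iff N_zero zero_fun_apply)
  have Gadd: "u + v \<in> ?G k" if "u \<in> ?G k" "v \<in> ?G k" for u v k
    using that V0D_D(3)[OF V0D_V] by (auto simp: graph_F_iff N_add plus_fun_apply)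
  have Gsc: "sc c u \<in> ?G k" if "u \<in> ?G k" for u c k
  proof -
    have "order_le k (sc c u)" using that by (auto simp: graph_F_iff g_mul_def)
    then show ?thesis using that V0D_sc[OF V0D_V] by (auto simp: graph_F_iff N_sc)
  qed
  show ?thesis
  proof (intro equalityI subsetI)
    fix m assume "m \<in> hodge_F f \<alpha> k \<inter> PL L"
    then have m: "g_delta m \<in> Z k" "g_delta m \<in> Span L" by (auto simp: H PL_def)
    obtain r v where v: "\<forall>i. v i \<in> ?G (k - int i)" "g_delta m = (\<Sum>i<r. (g_dt ^^ i) (v i))"
      using dt_sum_form[of "g_delta m" "\<lambda>i. ?G (k - int i)"] m(1) G0 Gadd unfolding Z_def by blast
    have comp: "(\<Sum>i<r. (g_dt ^^ i) (v i)) 0 = (if r = 0 then 0 else v 0 0)" for r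
    proof (induction r)
      case (Suc r)
      have "(g_dt ^^ Suc i) w 0 = 0" for i w by (simp add: g_dt_def)
      then have "(g_dt ^^ r) (v r) 0 = (if r = 0 then v 0 0 else 0)" by (cases r) auto
      then show ?case using Suc by (simp add: plus_fun_apply zero_fun_apply)
    qed (simp add: zero_fun_apply)
    show "m \<in> {b 0 | b. b \<in> L \<and> order_le k b}"
    proof (cases "r = 0")
      case True
      then have "g_delta m 0 = 0" using v(2) comp[of r] by simp
      then show ?thesis using V0D_D(2)[OF adm_D(1)[OF L]]
        by (intro CollectI exI[of _ 0]) (simp add: zero_fun_apply)
    next
      case False
      have "v 0 \<in> L"
        by (rule span_coeff[OF L, of v r]) (use v(1) m(2) False in \<open>auto simp flip: v(2)\<close>)
      moreover have "m = v 0 0" using v(2) comp[of r] False by (metis g_delta_0)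
      moreover have "order_le k (v 0)" using v(1)[rule_format, of 0] by (auto simp: graph_F_iff)
      ultimately show ?thesis by blast
    qed
  next
    fix m assume "m \<in> {b 0 | b. b \<in> L \<and> order_le k b}"
    then obtain b where b: "m = b 0" "b \<in> L" "order_le k b" by blast
    have "b \<in> Span L" using b Span_sub by blast
    then have "b 0 \<in> PL L" using graph_module_PL[OF L] graph_module_mem by blast
    moreover have "g_delta (b 0) \<in> Z (k - int 0)"
    proof (rule graph_coefficients[where f = f and m = "nat (k + 1)"])
      show "0 \<in> Z k" for k unfolding Z_def by (rule add_span_zero)
      show add: "x + y \<in> Z k" if "x \<in> Z k" "y \<in> Z k" for x y k
        using that unfolding Z_def by (rule add_span_add)
      have base: "(g_dt ^^ i) v \<in> Z k" if "v \<in> ?G (k - int i)" for i v k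
        unfolding Z_def by (rule add_span_base) (use that in auto)
      have Zind: "h x \<in> Z k'" if "x \<in> Z k" "\<And>i v. v \<in> ?G (k - int i) \<Longrightarrow> h ((g_dt ^^ i) v) \<in> Z k'"
        "h 0 = 0" "\<And>x y. h (x + y) = h x + h y" for h x k k'
        using that(1) unfolding Z_def[of k]
      proof (induction rule: add_span_induct)
        case zero
        then show ?case using that(3) by (simp add: Z_def add_span_zero)
      next
        case (base x)
        then show ?case using that(2) by auto
      next
        case (add x y)
        then show ?case unfolding that(4) Z_def by (intro add_span_add)
      qed
      show "sc c x \<in> Z k" if "x \<in> Z k" for x c k
        by (rule Zind[OF that]) (auto simp: g_mul_add simp flip: dt_pow_sc intro!: base Gsc)
      show "g_dt x \<in> Z (k + 1)" if "x \<in> Z k" for x k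
      proof (rule Zind[OF that])
        fix i v assume "v \<in> ?G (k - int i)"
        then show "g_dt ((g_dt ^^ i) v) \<in> Z (k + 1)" using base[of v "k + 1" "Suc i"] by simp
      qed (auto simp: g_dt_add)
      \<comment> \<open>\<open>t - f\<close> is minus differentiation with respect to
        \<open>\<partial>\<^sub>t\<close> and so lowers the order by one; on
        \<open>\<partial>\<^sub>t\<^sup>i v\<close> the product rule adds the term
        \<open>- i \<partial>\<^sub>t\<^sup>i\<^sup>-\<^sup>1 v\<close>.\<close>
      show "t x - g_mul f x \<in> Z (k - 1)" if "x \<in> Z k" for x k
      proof (rule Zind[OF that])
        fix i v assume v: "v \<in> ?G (k - int i)"
        let ?w = "t v - g_mul f v"
        have "?w \<in> V 0" using v V0D_D(4,6)[OF V0D_V] by (intro V0D_diff[OF V0D_V]) (auto intro: f_poly)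
        moreover have "?w \<in> N" using v KM_N[OF V, of 0] by (intro N_diff N_t N_mul f_poly) auto
        moreover have "order_le (k - 1 - int i) ?w" using v by (auto simp: g_t_minus_f graph_F_iff)
        ultimately have w: "?w \<in> ?G (k - 1 - int i)" by (simp add: graph_F_iff)
        show "t ((g_dt ^^ i) v) - g_mul f ((g_dt ^^ i) v) \<in> Z (k - 1)"
        proof (cases i)
          case 0
          then show ?thesis using base[of ?w "k - 1" 0] w by simp
        next
          case (Suc i')
          have "t ((g_dt ^^ i) v) - g_mul f ((g_dt ^^ i) v) =
            (g_dt ^^ i) ?w + (g_dt ^^ i') (sc (- of_nat i) v)"
          proof -
            have "(g_dt ^^ i) ?w + (g_dt ^^ i) (g_mul f v) = (g_dt ^^ i) (t v)"
              by (simp flip: dt_pow_add)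
            moreover have "sc (- of_nat i) ((g_dt ^^ i') v) = - sc (of_nat i) ((g_dt ^^ i') v)"
              using sc_diff[of 0 "of_nat i" "(g_dt ^^ i') v"] by simp
            ultimately show ?thesis
              unfolding Suc t_dt_pow dt_pow_sc by (simp add: dt_pow_sc algebra_simps)
          qed
          moreover have "(g_dt ^^ i') (sc (- of_nat i) v) \<in> Z (k - 1)"
          proof (intro base Gsc)
            have "k - int i = k - 1 - int i'" using Suc by simp
            then show "v \<in> ?G (k - 1 - int i')" using v by (simp only:)
          qed
          ultimately show ?thesis using base[OF w] add by simp
        qed
      qed (auto simp: g_t_add g_mul_add)
      have "b \<in> ?G (k - int 0)"
        using b adm_D(3)[OF L] KM_N[OF V, of 0] by (auto simp: graph_F_iff)
      then show "b \<in> Z k" using base[of b k 0] by simp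
      show "b j = 0" if "nat (k + 1) \<le> j" for j using b(3) that by auto
    qed
    ultimately show "m \<in> hodge_F f \<alpha> k \<inter> PL L" using b by (auto simp: H PL_def)
  qed
qed

section \<open>Nearby and vanishing cycles, and the weight filtration\<close>

lemma V0D_img:
  assumes A: "V0D A" and B: "V0D B" and BA: "B \<subseteq> A" and tA: "\<And>x. x \<in> A \<Longrightarrow> t x \<in> B"
  shows "V0D (img_mod A B (dtt a))"
proof -
  have mem: "dtt a x + y \<in> img_mod A B (dtt a)" if "x \<in> A" "y \<in> B" for x y
    unfolding img_mod_def by (rule set_plus_intro) (use that in auto)
  have A_N: "x \<in> N" if "x \<in> A" for x using that V0D_D(1)[OF A] by blast
  show ?thesis
  proof (rule V0D_I)
    have "dtt a 0 + 0 = 0" by (simp add: g_dtt_def)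
    then show "0 \<in> img_mod A B (dtt a)" using mem[of 0 0] V0D_D(2)[OF A] V0D_D(2)[OF B] by simp
    fix b assume "b \<in> img_mod A B (dtt a)"
    then obtain x y where b: "b = dtt a x + y" "x \<in> A" "y \<in> B"
      unfolding img_mod_def by (elim set_plus_elim imageE) auto
    have y: "y \<in> A" using b BA by blast
    show "b \<in> N" unfolding b(1) using A_N[OF V0D_D(3)[OF A V0D_dtt[OF A b(2)] y]] .
    { fix c assume "c \<in> img_mod A B (dtt a)"
      then obtain x' y' where c: "c = dtt a x' + y'" "x' \<in> A" "y' \<in> B"
        unfolding img_mod_def by (elim set_plus_elim imageE) auto
      have "b + c = dtt a (x + x') + (y + y')" unfolding b c dtt_add by (simp add: algebra_simps)
      then show "b + c \<in> img_mod A B (dtt a)"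
        using mem[OF V0D_D(3)[OF A b(2) c(2)] V0D_D(3)[OF B b(3) c(3)]] by simp }
    { fix g :: "complex ^ 'n \<Rightarrow> complex" assume g: "g \<in> polyfun"
      have "g_mul g b = dtt a (g_mul g x) + g_mul g y" unfolding b by (simp add: g_mul_add dtt_mul)
      then show "g_mul g b \<in> img_mod A B (dtt a)"
        using mem[OF V0D_D(4)[OF A g b(2)] V0D_D(4)[OF B g b(3)]] by simp }
    { fix i
      have "dx i b = dtt a (dx i x) + dx i y" unfolding b
        using A_N[OF b(2)] A_N[OF y] A_N[OF V0D_dtt[OF A b(2), of a]] by (simp add: dx_add dx_dtt)
      then show "dx i b \<in> img_mod A B (dtt a)"
        using mem[OF V0D_D(5)[OF A b(2)] V0D_D(5)[OF B b(3)]] by simp }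
    { have "t b = dtt a (t x) + (t y - t x)"
        unfolding b g_t_add dtt_t using dtt_shift[of "a - 1" x a] by (simp add: g_t_add g_t_mul)
      then show "t b \<in> img_mod A B (dtt a)"
        using mem[OF V0D_D(6)[OF A b(2)] V0D_diff[OF B V0D_D(6)[OF B b(3)] tA[OF b(2)]]] by simp }
    { have "Dt b = dtt a (Dt x) + Dt y" unfolding b by (simp add: Dt_add dtt_Dt)
      then show "Dt b \<in> img_mod A B (dtt a)"
        using mem[OF V0D_D(7)[OF A b(2)] V0D_D(7)[OF B b(3)]] by simp }
  qed
qed

lemma V0D_ker:
  assumes A: "V0D A" and B: "V0D B" and BA: "B \<subseteq> A" and tA: "\<And>x. x \<in> A \<Longrightarrow> t x \<in> B"
  shows "V0D (ker_mod A B (dtt a))"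
proof (rule V0D_I)
  have "dtt a 0 = 0" by (simp add: g_dtt_def)
  then show "0 \<in> ker_mod A B (dtt a)" using V0D_D(2)[OF A] V0D_D(2)[OF B] by (simp add: ker_mod_def)
  fix b assume "b \<in> ker_mod A B (dtt a)"
  then have b: "b \<in> A" "dtt a b \<in> B" by (auto simp: ker_mod_def)
  show bN: "b \<in> N" using b V0D_D(1)[OF A] by blast
  show "b + c \<in> ker_mod A B (dtt a)" if "c \<in> ker_mod A B (dtt a)" for c
    using that b V0D_D(3)[OF A] V0D_D(3)[OF B] by (simp add: ker_mod_def dtt_add)
  show "g_mul g b \<in> ker_mod A B (dtt a)" if "g \<in> polyfun" for g
    using that b V0D_D(4)[OF A] V0D_D(4)[OF B] by (simp add: ker_mod_def dtt_mul)
  show "dx i b \<in> ker_mod A B (dtt a)" for i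
    using b V0D_D(5)[OF A] V0D_D(5)[OF B b(2)] bN by (simp add: ker_mod_def flip: dx_dtt)
  show "Dt b \<in> ker_mod A B (dtt a)"
    using b V0D_D(7)[OF A] V0D_D(7)[OF B] by (simp add: ker_mod_def dtt_Dt)
  have "dtt a (t b) = t (dtt a b) + t b"
    unfolding dtt_t using dtt_shift[of "a - 1" b a] by (simp add: g_t_add)
  then show "t b \<in> ker_mod A B (dtt a)"
    using V0D_D(6)[OF A b(1)] V0D_D(3)[OF B V0D_D(6)[OF B b(2)] tA[OF b(1)]] by (simp add: ker_mod_def)
qed

sublocale phi: square_zero "V 0" Vp "dtt 0"
proof
  show "0 \<in> Vp" by (rule V0D_D(2)[OF V0D_Vp])
  show "Vp \<subseteq> V 0" by (rule Vp_V0)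
  show "dtt 0 (dtt 0 x) \<in> Vp" if "x \<in> V 0" for x using Dt_Dt[OF that] by (simp add: dtt_0)
qed (auto simp: dtt_add intro: V0D_D(3)[OF V0D_V] V0D_D(3)[OF V0D_Vp] V0D_dtt[OF V0D_V] V0D_dtt[OF V0D_Vp])

sublocale psi: square_zero "V 1" "V_gt V 1" "dtt 1"
proof
  note G = V_gt_V0D[OF V, of 1]
  show "0 \<in> V_gt V 1" by (rule V0D_D(2)[OF G])
  show "V_gt V 1 \<subseteq> V 1" by (rule V_gt_subset[OF V])
  show "dtt 1 (dtt 1 x) \<in> V_gt V 1" if "x \<in> V 1" for x
  proof -
    from \<open>x \<in> V 1\<close> obtain y where y: "y \<in> V 0" "x = t y" unfolding t_V0[symmetric] by blast
    then have "dtt 1 (dtt 1 x) = t (dtt 0 (dtt 0 y))" by (simp add: dtt_t)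
    then show ?thesis unfolding Vgt1 using phi.T_T[OF y(1)] by blast
  qed
qed (auto simp: dtt_add intro: V0D_D(3)[OF V0D_V] V0D_D(3)[OF V_gt_V0D[OF V]] V0D_dtt[OF V0D_V] V0D_dtt[OF V_gt_V0D[OF V]])

lemma t_V0_Vp: "x \<in> V 0 \<Longrightarrow> t x \<in> Vp"
  using KM_D(5)[OF V, of x 0] V1_Vp by auto

lemma t_V1_gt: "x \<in> V 1 \<Longrightarrow> t x \<in> V_gt V 1"
  using V1_Vp unfolding Vgt1 by blast

lemma V0D_phi: "V0D phi.ImT" "V0D phi.KerT"
  by (intro V0D_img V0D_ker V0D_V V0D_Vp Vp_V0 t_V0_Vp; assumption)+

lemma V0D_psi: "V0D psi.ImT" "V0D psi.KerT"
  by (intro V0D_img V0D_ker V0D_V V_gt_V0D[OF V] V_gt_subset[OF V] t_V1_gt; assumption)+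

lemma dt_V1_Im: "x \<in> V 1 \<Longrightarrow> g_dt x \<in> phi.ImT"
proof -
  assume "x \<in> V 1"
  then obtain y where "y \<in> V 0" "x = t y" using t_V0 by blast
  then show ?thesis using phi.T_Im[of y] by (simp add: dtt_0)
qed

lemma adm_phi: "adm phi.ImT" "adm phi.KerT"
proof -
  show "adm phi.ImT" unfolding adm_def
    using V0D_phi phi.B_Im phi.Im_Ker phi.Ker_A dt_V1_Im by auto
  show "adm phi.KerT" unfolding adm_def
    using V0D_phi phi.B_Im phi.Im_Ker phi.Ker_A dt_V1_Im by auto
qed

lemma adm_mfil: "int CARD('n) \<le> k \<Longrightarrow> adm (phi.mfil (int CARD('n) + 1) k)"
  using adm_phi adm_V0 by (auto simp: phi.mfil_def)

text \<open>The module on \<open>U\<close> is pure of weight \<open>n\<close>, so nearby cycles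
  carry the monodromy filtration centred at \<open>n - 1\<close>; the Tate twist moves the centre to
  \<open>n + 1\<close> on vanishing cycles. Below \<open>n\<close> a step has to vanish on
  \<open>U\<close> and is therefore zero.\<close>

definition WW :: "int \<Rightarrow> (complex ^ 'n \<Rightarrow> complex) set" where
  "WW k = (if k < int CARD('n) then {0} else PL (phi.mfil (int CARD('n) + 1) k))"

lemma graph_module_zero: "graph_module {0} = {0 :: 'n graph_elt}"
proof -
  have "b = 0" if "\<And>j. b j = 0" for b :: "'n graph_elt"
    by (rule ext) (simp add: that zero_fun_apply)
  then show ?thesis by (auto simp: graph_module_def zero_fun_apply)
qed

lemma gr_V_0:
  assumes "DXM P" "\<And>u. u \<in> Loc \<Longrightarrow> \<exists>r. f ^ r * u \<in> P"
  shows "gr_V f \<alpha> 0 P = V 0 \<inter> graph_module P"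
  unfolding gr_V_def V_eq
proof (rule set_plus_absorb)
  show "Vp \<subseteq> V 0 \<inter> graph_module P"
    using Vp_V0 V_pos_subset[OF V assms] by (auto simp: V_gt_def)
  show "0 \<in> Vp" by (rule phi.B_0)
qed (use V0D_D(3)[OF V0D_V] graph_module_D(3)[OF assms(1)] in auto)

lemma gr_V_1:
  assumes "DXM P" "\<And>u. u \<in> Loc \<Longrightarrow> \<exists>r. f ^ r * u \<in> P"
  shows "gr_V f \<alpha> 1 P = V 1"
proof -
  have "V 1 \<inter> graph_module P = V 1" using V_pos_subset[OF V assms, of 1] by auto
  then show ?thesis
    unfolding gr_V_def V_eq
    by (simp add: set_plus_absorb[OF psi.B_A psi.B_0 psi.A_add])
qed

lemma gr_V_zero: "gr_V f \<alpha> 0 {0} = Vp" "gr_V f \<alpha> 1 {0} = V_gt V 1"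
  using V0D_D(2)[OF V0D_V] unfolding gr_V_def V_eq graph_module_zero
  by (auto simp: set_plus_def)

lemma t_mem_iff: "x \<in> V 0 \<Longrightarrow> S \<subseteq> V 0 \<Longrightarrow> t x \<in> t ` S \<longleftrightarrow> x \<in> S"
  using t_bij KM_N[OF V, of 0] unfolding bij_betw_def by (meson inj_on_image_mem_iff subset_trans subsetD)

lemma psi_ImT: "psi.ImT = t ` phi.ImT"
proof (intro equalityI subsetI)
  fix x assume "x \<in> psi.ImT"
  then obtain y z where x: "x = dtt 1 y + z" "y \<in> V 1" "z \<in> V_gt V 1" by (rule psi.ImE)
  obtain y' where y': "y' \<in> V 0" "y = t y'" using x(2) t_V0 by blast
  obtain z' where z': "z' \<in> Vp" "z = t z'" using x(3) unfolding Vgt1 by blast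
  have "x = t (dtt 0 y' + z')" unfolding x y' z' by (simp add: dtt_t g_t_add)
  then show "x \<in> t ` phi.ImT" using phi.ImI[OF y'(1) z'(1)] by blast
next
  fix x assume "x \<in> t ` phi.ImT"
  then obtain w where w: "w \<in> phi.ImT" "x = t w" by blast
  then obtain y z where yz: "w = dtt 0 y + z" "y \<in> V 0" "z \<in> Vp" by (elim phi.ImE)
  have "x = dtt 1 (t y) + t z" unfolding w yz by (simp add: dtt_t g_t_add)
  moreover have "t y \<in> V 1" using t_V0 yz by blast
  moreover have "t z \<in> V_gt V 1" unfolding Vgt1 using yz by blast
  ultimately show "x \<in> psi.ImT" using psi.ImI by simp
qed

lemma mfil_t:
  assumes b: "b \<in> V 0"
  shows "b \<in> phi.mfil (int CARD('n) + 1) k \<longleftrightarrow> t b \<in> psi.mfil (int CARD('n) - 1) (k - 2)"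
proof -
  have 1: "t b \<in> V_gt V 1 \<longleftrightarrow> b \<in> Vp" unfolding Vgt1 by (rule t_mem_iff[OF b Vp_V0])
  have 2: "t b \<in> psi.ImT \<longleftrightarrow> b \<in> phi.ImT"
    unfolding psi_ImT by (rule t_mem_iff[OF b]) (use phi.Im_Ker phi.Ker_A in blast)
  have 3: "t b \<in> V 1" using b t_V0 by blast
  have 4: "t b \<in> psi.KerT \<longleftrightarrow> b \<in> phi.KerT"
  proof -
    have "dtt 1 (t b) = t (dtt 0 b)" by (simp add: dtt_t)
    moreover have "t (dtt 0 b) \<in> V_gt V 1 \<longleftrightarrow> dtt 0 b \<in> Vp"
      unfolding Vgt1 by (rule t_mem_iff[OF phi.T_A[OF b] Vp_V0])
    ultimately show ?thesis using b 3 by (simp add: ker_mod_def)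
  qed
  show ?thesis unfolding phi.mfil_def psi.mfil_def using 1 2 3 4 b by auto
qed

lemma WW_DXM: "DXM (WW k)"
  using DXM_zero PL_DXM[OF adm_mfil, of k] by (auto simp: WW_def)

lemma WW_full: "int CARD('n) \<le> k \<Longrightarrow> u \<in> Loc \<Longrightarrow> \<exists>r. f ^ r * u \<in> WW k"
  using Loc_full[OF adm_mfil, of k u] by (auto simp: WW_def)

lemma WW_gr_0: "gr_V f \<alpha> 0 (WW k) = phi.mfil (int CARD('n) + 1) k"
proof (cases "k < int CARD('n)")
  case True
  then show ?thesis by (simp add: WW_def gr_V_zero phi.mfil_def)
next
  case False
  have "gr_V f \<alpha> 0 (WW k) = V 0 \<inter> graph_module (WW k)"
    using WW_DXM WW_full False by (intro gr_V_0) auto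
  also have "\<dots> = phi.mfil (int CARD('n) + 1) k"
    using False graph_module_PL[OF adm_mfil, of k] V0_inter_Span[OF adm_mfil, of k] by (simp add: WW_def)
  finally show ?thesis .
qed

lemma gr_V_1_pure:
  assumes "\<And>k. DXM (W k)" "\<And>k. k < int CARD('n) \<Longrightarrow> W k = {0}" "\<And>k u. int CARD('n) \<le> k \<Longrightarrow> u \<in> Loc \<Longrightarrow> \<exists>r. f ^ r * u \<in> W k"
  shows "(\<lambda>k. gr_V f \<alpha> 1 (W (k + 1))) = (\<lambda>k. if int CARD('n) - 1 \<le> k then V 1 else V_gt V 1)"
proof
  fix k
  show "gr_V f \<alpha> 1 (W (k + 1)) = (if int CARD('n) - 1 \<le> k then V 1 else V_gt V 1)"
  proof (cases "int CARD('n) - 1 \<le> k")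
    case True
    then have "gr_V f \<alpha> 1 (W (k + 1)) = V 1" using assms by (intro gr_V_1) auto
    then show ?thesis using True by simp
  next
    case False
    then show ?thesis using assms(2)[of "k + 1"] by (simp add: gr_V_zero)
  qed
qed

lemma W_on_U_cond:
  "(\<forall>k. {u \<in> Loc. \<exists>r::nat. f ^ r * u \<in> W k} = W_on_U f k) \<longleftrightarrow>
   (\<forall>k. if int CARD('n) \<le> k then \<forall>u\<in>Loc. \<exists>r. f ^ r * u \<in> W k else {u \<in> Loc. \<exists>r::nat. f ^ r * u \<in> W k} = {0})"
  unfolding W_on_U_def by (intro all_cong1) auto

text \<open>On vanishing cycles \<open>WW\<close> induces \<open>phi.mfil\<close> itself, which is
  then its own relative monodromy filtration by \<open>rel_monodromy_self\<close>; on nearby cycles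
  only the jump at weight \<open>n\<close> is visible.\<close>

lemma WW_weights: "direct_image_weights f \<alpha> (W_on_U f) WW"
  unfolding direct_image_weights_def V_eq
proof (intro conjI)
  show "\<forall>k. DXM (WW k)" using WW_DXM by blast
  show "mono WW"
  proof (rule monoI)
    fix k l :: int assume "k \<le> l"
    then have "phi.mfil (int CARD('n) + 1) k \<subseteq> phi.mfil (int CARD('n) + 1) l" using phi.mfil_mono by (rule_tac monoD)
    then have "PL (phi.mfil (int CARD('n) + 1) k) \<subseteq> PL (phi.mfil (int CARD('n) + 1) l)" using Span_mono by (auto simp: PL_def)
    moreover have "{0} \<subseteq> WW l" using DXM_D(2)[OF WW_DXM] by simp
    ultimately show "WW k \<subseteq> WW l" using \<open>k \<le> l\<close> by (auto simp: WW_def)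
  qed
  show "\<exists>k. WW k = {0}" by (intro exI[of _ "int CARD('n) - 1"]) (simp add: WW_def)
  show "\<exists>k. WW k = Loc" by (intro exI[of _ "int CARD('n) + 2"]) (simp add: WW_def phi.mfil_def PL_V0)
  show "\<forall>k. {u \<in> Loc. \<exists>r::nat. f ^ r * u \<in> WW k} = W_on_U f k"
    unfolding W_on_U_cond
  proof
    fix k
    have "u = 0" if "u \<in> Loc" "f ^ r * u = 0" for u r
      using that
    proof (induction r)
      case (Suc r)
      have "f ^ r * u \<in> Loc" by (rule Loc_mult[OF polyfun_power[OF f_poly] Suc.prems(1)])
      moreover have "f * (f ^ r * u) = 0" using Suc.prems(2) by (simp only: power_Suc mult.assoc)
      ultimately have "f ^ r * u = 0" by (rule Loc_f_cancel)
      then show ?case by (rule Suc.IH[OF Suc.prems(1)])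
    qed simp
    then have "{u \<in> Loc. \<exists>r::nat. f ^ r * u \<in> WW k} = {0}" if "\<not> int CARD('n) \<le> k"
      using that Loc_zero by (auto simp: WW_def)
    then show "if int CARD('n) \<le> k then \<forall>u\<in>Loc. \<exists>r. f ^ r * u \<in> WW k
        else {u \<in> Loc. \<exists>r::nat. f ^ r * u \<in> WW k} = {0}"
      using WW_full[of k] by simp
  qed
  have gr1: "(\<lambda>k. gr_V f \<alpha> 1 (WW (k + 1))) = (\<lambda>k. if int CARD('n) - 1 \<le> k then V 1 else V_gt V 1)"
    by (rule gr_V_1_pure) (use WW_DXM WW_full in \<open>auto simp: WW_def\<close>)
  show "\<exists>M\<psi> M\<phi>.
       rel_monodromy_filtration V0D (V 1) (V_gt V 1) (dtt 1) (\<lambda>k. gr_V f \<alpha> 1 (WW (k + 1))) M\<psi> \<and>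
       rel_monodromy_filtration V0D (V 0) Vp (dtt 0) (\<lambda>k. gr_V f \<alpha> 0 (WW k)) M\<phi> \<and>
       (\<forall>k. \<forall>b\<in>V 0. (b \<in> M\<phi> k) = (t b \<in> M\<psi> (k - 2)))"
    unfolding gr1 WW_gr_0
  proof (intro exI conjI)
    show "rel_monodromy_filtration V0D (V 1) (V_gt V 1) (dtt 1)
        (\<lambda>k. if int CARD('n) - 1 \<le> k then V 1 else V_gt V 1) (psi.mfil (int CARD('n) - 1))"
      by (rule psi.rel_monodromy_pure[OF V0D_V V_gt_V0D[OF V] V0D_psi])
    show "rel_monodromy_filtration V0D (V 0) Vp (dtt 0) (phi.mfil (int CARD('n) + 1)) (phi.mfil (int CARD('n) + 1))"
      by (rule phi.rel_monodromy_self[OF V0D_V V0D_Vp V0D_phi])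
    show "\<forall>k. \<forall>b\<in>V 0. (b \<in> phi.mfil (int CARD('n) + 1) k) = (t b \<in> psi.mfil (int CARD('n) - 1) (k - 2))"
      using mfil_t by blast
  qed
qed

text \<open>Nearby cycles see only the weight on \<open>U\<close>, which fixes
  \<open>M\<psi>\<close>; the isomorphism \<open>t\<close> transports it to \<open>M\<phi>\<close>.
  This determines the filtration induced on \<open>gr\<^sub>V\<^sup>0\<close>, and
  \<open>DXM_eq_PL\<close> recovers the submodules from it.\<close>

lemma weights_unique:
  assumes "direct_image_weights f \<alpha> (W_on_U f) W"
  shows "W = WW"
proof -
  note W = assms[unfolded direct_image_weights_def V_eq]
  have DX: "DXM (W k)" for k using W[THEN conjunct1] by blast
  have W_mono: "mono W" using W[THEN conjunct2, THEN conjunct1] .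
  have W_top: "\<exists>k. W k = Loc" using W[THEN conjunct2, THEN conjunct2, THEN conjunct2, THEN conjunct1] .
  have U: "\<forall>k. {u \<in> Loc. \<exists>r::nat. f ^ r * u \<in> W k} = W_on_U f k"
    using W[THEN conjunct2, THEN conjunct2, THEN conjunct2, THEN conjunct2, THEN conjunct1] .
  obtain M\<psi> M\<phi> where
    psi: "rel_monodromy_filtration V0D (V 1) (V_gt V 1) (dtt 1) (\<lambda>k. gr_V f \<alpha> 1 (W (k + 1))) M\<psi>"
    and phi: "rel_monodromy_filtration V0D (V 0) Vp (dtt 0) (\<lambda>k. gr_V f \<alpha> 0 (W k)) M\<phi>"
    and comp: "\<And>k b. b \<in> V 0 \<Longrightarrow> (b \<in> M\<phi> k) = (t b \<in> M\<psi> (k - 2))"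
    using W[THEN conjunct2, THEN conjunct2, THEN conjunct2, THEN conjunct2, THEN conjunct2] by blast
  have Uk: "if int CARD('n) \<le> k then \<forall>u\<in>Loc. \<exists>r. f ^ r * u \<in> W k
      else {u \<in> Loc. \<exists>r::nat. f ^ r * u \<in> W k} = {0}" for k
    using U unfolding W_on_U_cond by (rule spec)
  have full: "\<exists>r. f ^ r * u \<in> W k" if "int CARD('n) \<le> k" "u \<in> Loc" for k u
    using Uk[of k] that by simp
  have low: "W k = {0}" if "k < int CARD('n)" for k
  proof -
    have *: "{u \<in> Loc. \<exists>r::nat. f ^ r * u \<in> W k} = {0}"
      using Uk[of k] that by simp
    have "u \<in> {u \<in> Loc. \<exists>r::nat. f ^ r * u \<in> W k}" if "u \<in> W k" for u
      using that DXM_D(1)[OF DX] by (auto intro!: exI[of _ 0])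
    then show ?thesis using * DXM_D(2)[OF DX, of k] by auto
  qed
  have sub: "x + y \<in> X" if "V0D X" "x \<in> X" "y \<in> X" for X x y by (rule V0D_D(3)[OF that])
  have gr1: "(\<lambda>k. gr_V f \<alpha> 1 (W (k + 1))) = (\<lambda>k. if int CARD('n) - 1 \<le> k then V 1 else V_gt V 1)"
    by (rule gr_V_1_pure[OF DX low full])
  have "M\<psi> = psi.mfil (int CARD('n) - 1)"
    by (rule psi.rel_monodromy_pure_unique[OF psi[unfolded gr1] sub])
  then have "b \<in> M\<phi> k \<longleftrightarrow> b \<in> phi.mfil (int CARD('n) + 1) k" if "b \<in> V 0" for b k
    using comp[OF that] mfil_t[OF that] by simp
  then have M\<phi>: "M\<phi> = phi.mfil (int CARD('n) + 1)"
    using rel_monodromyD(3)[OF phi] phi.mfil_bounds(2) by (intro ext) blast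
  have L_eq: "gr_V f \<alpha> 0 (W k) = (if int CARD('n) \<le> k then V 0 \<inter> graph_module (W k) else Vp)" for k
    using gr_V_0[OF DX[of k] full[of k]] low[of k] gr_V_zero(1) by auto
  have Vp_gr: "Vp \<subseteq> graph_module (W k)" if "int CARD('n) \<le> k" for k
    using V_pos_subset[OF V DX full[OF that]] by (auto simp: V_gt_def)
  obtain k1 where k1: "W k1 = Loc" using W_top by blast
  have n_k1: "int CARD('n) \<le> k1"
  proof (rule ccontr)
    assume "\<not> ?thesis"
    then have "Loc = {0}" using low[of k1] k1 by simp
    moreover have "loc_elt f 1 0 \<in> Loc" by (rule LocI[OF polyfun_const(3)])
    ultimately have "loc_elt f 1 0 x = 0" for x by (simp add: zero_fun_apply)
    then show False using f_nz by (metis loc_elt_def one_fun_apply one_neq_zero power_0 div_by_1)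
  qed
  have "(\<lambda>k. gr_V f \<alpha> 0 (W k)) = phi.mfil (int CARD('n) + 1)"
  proof (rule phi.rel_monodromy_self_unique[where ?k1.0 = k1])
    show "rel_monodromy_filtration V0D (V 0) Vp (dtt 0) (\<lambda>k. gr_V f \<alpha> 0 (W k)) (phi.mfil (int CARD('n) + 1))"
      using phi unfolding M\<phi> .
    show "x + y \<in> gr_V f \<alpha> 0 (W k)" if "x \<in> gr_V f \<alpha> 0 (W k)" "y \<in> gr_V f \<alpha> 0 (W k)" for k x y
      using that graph_module_D(3)[OF DX, of x k y] phi.A_add phi.B_add unfolding L_eq by (auto split: if_splits)
    show "Vp \<subseteq> gr_V f \<alpha> 0 (W k)" for k unfolding L_eq using Vp_V0 Vp_gr[of k] by auto
    show "gr_V f \<alpha> 0 (W k) \<subseteq> V 0" for k unfolding L_eq using Vp_V0 by auto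
    show "mono (\<lambda>k. gr_V f \<alpha> 0 (W k))"
    proof (rule monoI)
      fix k l :: int assume kl: "k \<le> l"
      then have "graph_module (W k) \<subseteq> graph_module (W l)"
        using W_mono by (intro graph_module_mono) (rule monoD)
      then show "gr_V f \<alpha> 0 (W k) \<subseteq> gr_V f \<alpha> 0 (W l)"
        unfolding L_eq using Vp_V0 Vp_gr[of l] kl by auto
    qed
    show "gr_V f \<alpha> 0 (W k) = Vp" if "k < int CARD('n) + 1 - 1" for k using that unfolding L_eq by simp
    \<comment> \<open>Here it enters that the steps come from \<open>\<D>\<^sub>X\<close>-modules:
      the graph module of \<open>W k\<close> contains \<open>V 1\<close> and is stable under
      \<open>\<partial>\<^sub>t\<close>.\<close>
    show "phi.ImT \<subseteq> gr_V f \<alpha> 0 (W k)" if "int CARD('n) + 1 - 1 \<le> k" for k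
    proof
      fix x assume "x \<in> phi.ImT"
      then obtain y z where x: "x = dtt 0 y + z" "y \<in> V 0" "z \<in> Vp" by (rule phi.ImE)
      have k: "int CARD('n) \<le> k" using that by simp
      have "t y \<in> graph_module (W k)" using t_V0_Vp[OF x(2)] Vp_gr[OF k] by blast
      then have "dtt 0 y \<in> graph_module (W k)" using graph_module_D(7)[OF DX] by (simp add: dtt_0)
      then have "x \<in> graph_module (W k)" using x Vp_gr[OF k] graph_module_D(3)[OF DX] by blast
      moreover have "x \<in> V 0" using \<open>x \<in> phi.ImT\<close> phi.Im_Ker phi.Ker_A by blast
      ultimately show "x \<in> gr_V f \<alpha> 0 (W k)" using k unfolding L_eq by simp
    qed
    show "gr_V f \<alpha> 0 (W k1) = V 0"
      using L_eq[of k1] KM_N[OF V, of 0] k1 n_k1 by (simp add: Int_absorb2)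
  qed
  then have gr: "gr_V f \<alpha> 0 (W k) = phi.mfil (int CARD('n) + 1) k" for k by (rule fun_cong)
  show ?thesis
  proof
    fix k
    show "W k = WW k"
    proof (cases "k < int CARD('n)")
      case True
      then show ?thesis using low by (simp add: WW_def)
    next
      case False
      then have "V 0 \<inter> graph_module (W k) = phi.mfil (int CARD('n) + 1) k" using gr[of k] unfolding L_eq by simp
      then show ?thesis using DXM_eq_PL[OF V DX, of k] False by (simp add: WW_def)
    qed
  qed
qed

theorem weight_W_eq: "weight_W f \<alpha> = WW"
  unfolding weight_W_def direct_image_W_def
  by (rule the_equality[where P = "direct_image_weights f \<alpha> (W_on_U f)", OF WW_weights])
    (rule weights_unique)

end

section \<open>The V-filtration of a weighted homogeneous polynomial\<close>

text \<open>
  \<open>e = 1\<close> for \<open>\<alpha> = 0\<close> and \<open>e = 0\<close> otherwise, so that \<open>A / l = \<alpha> + e\<close> lies in \<open>(0, 1]\<close>.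
\<close>

locale weighted_module = weighted_poly W l P + loc_module "peval P" \<alpha>
  for W :: "'n::finite \<Rightarrow> nat" and l :: nat and P :: "'n mpol" and \<alpha> :: rat +
  fixes e :: nat and A :: int
  assumes A_eq: "of_int A = of_nat l * (\<alpha> + of_nat e)" and A_pos: "0 < A" and A_le: "A \<le> int l"
begin

abbreviation "f \<equiv> peval P"
abbreviation "\<alpha>' \<equiv> complex_of_rat (\<alpha> + of_nat e)"

lemma \<alpha>'_l: "of_nat l * \<alpha>' = of_int A"
  by (metis A_eq of_rat_mult of_rat_of_int_eq of_rat_of_nat_eq)

lemma euler_f: "(\<Sum>i\<in>UNIV. (\<lambda>_. of_nat (W i)) * ((\<lambda>x. x $ i) * pd i f)) = (\<lambda>_. of_nat l) * f"
proof -
  have eu: "(\<Sum>i\<in>UNIV. mon 0 (of_nat (W i)) * (var i * dv i (mon \<kappa> a))) = mon 0 (of_nat (wt \<kappa>)) * mon \<kappa> a"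
    for \<kappa> a
  proof -
    have "mon 0 (of_nat (W i)) * (var i * dv i (mon \<kappa> a)) = mon \<kappa> (of_nat (W i * \<kappa> i) * a)" for i
    proof (cases "\<kappa> i = 0")
      case False
      then have "unit i + (\<kappa> - unit i) = \<kappa>" by (auto simp: fun_eq_iff unit_def plus_fun_apply minus_apply)
      then show ?thesis by (simp add: var_def dv_single mult_single mult_ac del: single_of_nat)
    qed (simp add: dv_single)
    then have "(\<Sum>i\<in>UNIV. mon 0 (of_nat (W i)) * (var i * dv i (mon \<kappa> a))) = (\<Sum>i\<in>UNIV. mon \<kappa> (of_nat (W i * \<kappa> i) * a))"
      by (simp del: single_of_nat)
    also have "\<dots> = mon \<kappa> (\<Sum>i\<in>UNIV. of_nat (W i * \<kappa> i) * a)"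
      by (rule poly_mapping_eqI) (simp add: lookup_sum lookup_single when_def)
    also have "\<dots> = mon 0 (of_nat (wt \<kappa>)) * mon \<kappa> a"
      by (simp add: mult_single wt_def sum_distrib_right del: single_of_nat)
    finally show ?thesis .
  qed
  have "supp P \<subseteq> {\<kappa>. wt \<kappa> = l}" using homogeneous by (auto simp: wt_def)
  then have "(\<Sum>i\<in>UNIV. mon 0 (of_nat (W i)) * (var i * dv i P)) = mon 0 (of_nat l) * P"
  proof (induction P rule: mpol_induct_supp)
    case (mon \<kappa> a)
    then show ?case using eu[of \<kappa> a] by (simp del: single_of_nat)
  qed (simp_all add: dv_add distrib_left sum.distrib del: single_of_nat)
  from arg_cong[OF this, of peval] show ?thesis
    by (simp add: peval_sum peval_simps pd_peval del: single_of_nat)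
qed

section \<open>The elements \<open>c\<^sub>j\<close>\<close>

definition cf :: "nat \<Rightarrow> nat \<Rightarrow> complex" where
  "cf j i = of_nat (j choose i) * pochhammer \<alpha>' (j - i)"

lemma cf_Suc:
  assumes "Suc i \<le> j"
  shows "cf (Suc j) (Suc i) = cf j (Suc i) * (\<alpha>' + of_nat (j - Suc i)) + cf j i"
proof -
  have j: "j - i = Suc (j - Suc i)" using assms by simp
  have p: "pochhammer \<alpha>' (j - i) = pochhammer \<alpha>' (j - Suc i) * (\<alpha>' + of_nat (j - Suc i))"
    unfolding j pochhammer_Suc ..
  show ?thesis unfolding cf_def diff_Suc_Suc p binomial_Suc_Suc of_nat_add by (simp only: algebra_simps)
qed

lemma cf_0: "cf (Suc j) 0 = cf j 0 * (\<alpha>' + of_nat j)"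
  by (simp add: cf_def pochhammer_Suc)

lemma cf_pred:
  assumes "Suc i \<le> j"
  shows "of_nat j * cf (j - 1) i = of_nat (Suc i) * cf j (Suc i)"
proof -
  obtain j' where j: "j = Suc j'" using assms by (cases j) auto
  have "of_nat (Suc i) * of_nat (j choose Suc i) = (of_nat j * of_nat (j' choose i) :: complex)"
    unfolding j of_nat_mult[symmetric] Suc_times_binomial ..
  then show ?thesis unfolding cf_def j by (simp only: mult.assoc[symmetric] diff_Suc_Suc diff_Suc_1)
qed

lemma cf_above: "j < i \<Longrightarrow> cf j i = 0"
  by (simp add: cf_def)

definition cc :: "nat \<Rightarrow> 'n graph_elt" where
  "cc j = (\<lambda>i. (\<lambda>_. cf j i) * loc_elt f 1 (j - i + e))"

lemma cc_apply: "cc j i x = (if f x = 0 then 0 else cf j i / f x ^ (j - i + e))"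
  by (simp add: cc_def times_fun_apply loc_elt_def one_fun_apply)

lemma cc_above: "j < i \<Longrightarrow> cc j i = 0"
  by (auto simp: fun_eq_iff cc_apply zero_fun_apply cf_above)

lemma cc_N: "cc j \<in> N"
proof (rule graph_moduleI[of _ _ "Suc j"])
  show "cc j i \<in> Loc" for i
    unfolding cc_def by (intro Loc_mult LocI polyfun_const)
qed (simp add: cc_above)

lemma conn_cc: "conn f \<alpha> i (cc j k) x
  = (if f x = 0 then 0 else - (cf j k * (\<alpha>' + of_nat (j - k))) * pd i f x / f x ^ Suc (j - k + e))"
proof -
  have g: "(\<lambda>_. cf j k) \<in> polyfun" by (rule polyfun_const)
  have c: "cc j k = loc_elt f (\<lambda>_. cf j k) (j - k + e)"
    by (auto simp: fun_eq_iff cc_apply loc_elt_def)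
  have r: "\<alpha>' = of_rat \<alpha> + of_nat e" by (simp add: of_rat_add)
  have s: "(of_nat (j - k + e) + of_rat \<alpha> :: complex) = \<alpha>' + of_nat (j - k)" unfolding r by simp
  show ?thesis
    unfolding c conn_loc_elt[OF g] s
    by (simp add: loc_elt_def times_fun_apply minus_apply zero_fun_apply uminus_apply del: power_Suc)
qed

text \<open>The formal twist by a power of \<open>t\<close> commutes with
  \<open>\<partial>\<^sub>i\<close>, so only \<open>\<delta>\<close> is differentiated; on
  coefficients this is the recursion \<open>cf_Suc\<close>.\<close>

lemma dx_cc: "dx i (cc j) = - g_mul (pd i f) (cc (Suc j))"
proof (intro ext)
  fix k x
  show "dx i (cc j) k x = (- g_mul (pd i f) (cc (Suc j))) k x"
  proof (cases "f x = 0")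
    case True
    then show ?thesis
      by (auto simp: g_dx_def g_mul_def uminus_apply minus_apply times_fun_apply cc_apply conn_cc zero_fun_apply split: nat.split)
  next
    case nz: False
    show ?thesis
    proof (cases k)
      case 0
      then show ?thesis using nz
        by (simp add: g_dx_def conn_cc g_mul_def uminus_apply minus_apply times_fun_apply cc_apply cf_0 zero_fun_apply)
    next
      case (Suc i')
      consider "k \<le> j" | "k = Suc j" | "Suc j < k" by linarith
      then show ?thesis
      proof cases
        case 1
        then have j: "Suc (j - Suc i' + e) = j - i' + e" "Suc i' \<le> j" using Suc by auto
        show ?thesis
          unfolding Suc g_dx_def g_mul_def uminus_apply minus_apply times_fun_apply nat.case conn_cc cc_apply
            cf_Suc[OF j(2)] j(1) diff_Suc_Suc
          using nz by (simp add: add_divide_distrib diff_divide_distrib algebra_simps)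
      next
        case 2
        then show ?thesis using nz Suc
          by (simp add: g_dx_def g_mul_def uminus_apply minus_apply times_fun_apply conn_cc cc_apply cf_def)
      next
        case 3
        then show ?thesis using nz Suc
          by (simp add: g_dx_def g_mul_def uminus_apply minus_apply times_fun_apply conn_cc cc_apply cf_above)
      qed
    qed
  qed
qed

lemma t_cc: "t (cc j) = g_mul f (cc j) - sc (of_nat j) (cc (j - 1))"
proof (intro ext)
  fix k x
  show "t (cc j) k x = (g_mul f (cc j) - sc (of_nat j) (cc (j - 1))) k x"
  proof (cases "Suc k \<le> j \<and> f x \<noteq> 0")
    case True
    then have "j - 1 - k = j - Suc k" by simp
    then show ?thesis using cf_pred[of k j] True
      by (simp add: g_t_def g_mul_def minus_apply times_fun_apply cc_apply del: of_nat_Suc)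
  next
    case False
    then show ?thesis
      by (cases j) (auto simp: g_t_def g_mul_def minus_apply times_fun_apply cc_apply cf_above)
  qed
qed

lemma Dt_cc: "Dt (cc j) = g_mul f (cc (Suc j)) - sc (of_nat j + \<alpha>') (cc j)"
proof (intro ext)
  fix k x
  show "Dt (cc j) k x = (g_mul f (cc (Suc j)) - sc (of_nat j + \<alpha>') (cc j)) k x"
  proof (cases "f x = 0")
    case True
    then show ?thesis
      by (auto simp: t_cc g_dt_def g_mul_def minus_apply times_fun_apply cc_apply zero_fun_apply split: nat.split)
  next
    case nz: False
    show ?thesis
    proof (cases k)
      case 0
      then show ?thesis using nz
        by (simp add: t_cc g_dt_def g_mul_def minus_apply times_fun_apply cc_apply zero_fun_apply cf_0 field_simps)
    next
      case (Suc i)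
      consider "k \<le> j" | "k = Suc j" | "Suc j < k" by linarith
      then show ?thesis
      proof cases
        case 1
        then have j: "j - i + e = Suc (j - Suc i + e)" "j - 1 - i = j - Suc i" "Suc i \<le> j" using Suc by auto
        have n: "(of_nat (j - Suc i) :: complex) = of_nat j - of_nat (Suc i)" using j(3) by (rule of_nat_diff)
        have "cf j i - of_nat j * cf (j - 1) i = cf (Suc j) (Suc i) - (of_nat j + \<alpha>') * cf j (Suc i)"
          unfolding cf_Suc[OF j(3)] cf_pred[OF j(3)] n by (simp add: algebra_simps)
        moreover have "Dt (cc j) k x = (cf j i - of_nat j * cf (j - 1) i) / f x ^ (j - Suc i + e)"
          unfolding t_cc g_dt_def Suc nat.case g_mul_def minus_apply times_fun_apply cc_apply j(1,2)
          using nz by (simp add: diff_divide_distrib)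
        moreover have "(g_mul f (cc (Suc j)) - sc (of_nat j + \<alpha>') (cc j)) k x =
            (cf (Suc j) (Suc i) - (of_nat j + \<alpha>') * cf j (Suc i)) / f x ^ (j - Suc i + e)"
          unfolding Suc g_mul_def minus_apply times_fun_apply cc_apply diff_Suc_Suc j(1)
          using nz by (simp add: diff_divide_distrib)
        ultimately show ?thesis by (simp only:)
      next
        case 2
        then show ?thesis using nz Suc
          by (cases j) (simp_all add: t_cc g_dt_def g_mul_def minus_apply times_fun_apply cc_apply cf_def binomial_eq_0)
      next
        case 3
        then show ?thesis using nz Suc
          by (simp add: t_cc g_dt_def g_mul_def minus_apply times_fun_apply cc_apply cf_above)
      qed
    qed
  qed
qed

text \<open>The scalar comes from differentiating \<open>t\<close> to the power 1 - \<alpha>'. This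
  eigenvalue is the upper end of the window of indices.\<close>

lemma Dt_cc': "Dt (cc j) = t (cc (Suc j)) + sc (1 - \<alpha>') (cc j)"
  unfolding Dt_cc t_cc[of "Suc j"] by (simp add: sc_diff sc_add algebra_simps)

end

lemma power_fun_apply: "(g ^ k) x = (g x :: 'a :: monoid_mult) ^ k"
  by (induction k) (simp_all add: times_fun_apply one_fun_apply)

section \<open>Integer powers of \<open>t\<close>\<close>

context loc_module
begin

definition tz :: "int \<Rightarrow> 'n graph_elt \<Rightarrow> 'n graph_elt" where
  "tz k = (if 0 \<le> k then t ^^ nat k else inv_into N t ^^ nat (- k))"

lemma tz_0 [simp]: "tz 0 b = b"
  by (simp add: tz_def)

lemma inv_t: "b \<in> N \<Longrightarrow> inv_into N t b \<in> N" "b \<in> N \<Longrightarrow> t (inv_into N t b) = b"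
  using bij_betw_imp_surj_on[OF t_bij] inv_into_into[of b t N] f_inv_into_f[of b t N] by simp_all

lemma tz_N: "b \<in> N \<Longrightarrow> tz k b \<in> N"
proof -
  assume b: "b \<in> N"
  have "(inv_into N t ^^ m) b \<in> N" for m by (induction m) (simp_all add: b inv_t)
  then show ?thesis using b by (simp add: tz_def N_t_pow)
qed

lemma t_tz: "b \<in> N \<Longrightarrow> t (tz k b) = tz (k + 1) b"
proof -
  assume b: "b \<in> N"
  have i: "(inv_into N t ^^ m) b \<in> N" for m by (induction m) (simp_all add: b inv_t)
  consider "0 \<le> k" | "k = -1" | "k < -1" by linarith
  then show ?thesis
  proof cases
    case 1
    then have "nat (k + 1) = Suc (nat k)" by simp
    then show ?thesis using 1 by (simp add: tz_def)
  next
    case 2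
    then show ?thesis using b by (simp add: tz_def inv_t)
  next
    case 3
    then have "nat (- k) = Suc (nat (- (k + 1)))" by simp
    then show ?thesis using 3 i by (simp add: tz_def inv_t)
  qed
qed

lemma t_cancel: "b \<in> N \<Longrightarrow> c \<in> N \<Longrightarrow> t b = t c \<Longrightarrow> b = c"
  using t_bij by (auto simp: bij_betw_def inj_on_def)

text \<open>A family shifted by the injective \<open>t\<close> is determined by its member at 0; the
  commutation rules of \<open>tz k\<close> follow by exhibiting such families.\<close>

lemma tz_unique:
  assumes "\<And>k. h k \<in> N" "\<And>k. t (h k) = h (k + 1)"
  shows "tz k (h 0) = h k"
proof (induction k rule: int_induct[where k = 0])
  case (step1 i)
  have "tz (i + 1) (h 0) = t (tz i (h 0))" by (simp add: t_tz assms(1))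
  then show ?case using step1 by (simp add: assms(2))
next
  case (step2 i)
  have "t (tz (i - 1) (h 0)) = t (h (i - 1))" using step2 by (simp add: t_tz assms)
  then show ?case by (rule t_cancel[rotated 2]) (simp_all add: assms tz_N)
qed simp

lemma tz_tz: "b \<in> N \<Longrightarrow> tz k (tz j b) = tz (k + j) b"
  using tz_unique[of "\<lambda>k. tz (k + j) b" k] by (simp add: tz_N t_tz algebra_simps)

lemma tz_commute:
  assumes "\<And>b. b \<in> N \<Longrightarrow> F b \<in> N" "\<And>b. b \<in> N \<Longrightarrow> t (F b) = F (t b)" "b \<in> N"
  shows "tz k (F b) = F (tz k b)"
  using tz_unique[of "\<lambda>k. F (tz k b)" k] assms by (simp add: tz_N t_tz)

lemma t_mul: "t (g_mul g b) = g_mul g (t b)"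
  using t_pow_mul[of 1] by simp

lemma tz_mul: "g \<in> polyfun \<Longrightarrow> b \<in> N \<Longrightarrow> tz k (g_mul g b) = g_mul g (tz k b)"
  by (rule tz_commute) (auto intro: N_mul simp: t_mul)

lemma tz_dx: "b \<in> N \<Longrightarrow> tz k (dx i b) = dx i (tz k b)"
  by (rule tz_commute) (auto intro: N_dx simp: dx_t)

lemma tz_t: "b \<in> N \<Longrightarrow> tz k (t b) = t (tz k b)"
  by (rule tz_commute) (auto intro: N_t)

lemma tz_add: "b \<in> N \<Longrightarrow> c \<in> N \<Longrightarrow> tz k (b + c) = tz k b + tz k c"
  using tz_unique[of "\<lambda>k. tz k b + tz k c" k] by (simp add: tz_N t_tz g_t_add N_add)

lemma tz_zero [simp]: "tz k 0 = 0"
  using tz_add[OF N_zero N_zero, of k] by simp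

lemma N_dtt: "b \<in> N \<Longrightarrow> dtt a b \<in> N"
  by (rule V0D_dtt[OF V0D_N])

lemma dtt_zero [simp]: "dtt a 0 = 0"
  by (simp add: g_dtt_def)

lemma tz_dtt: "b \<in> N \<Longrightarrow> tz k (dtt a b) = dtt (a + of_int k) (tz k b)"
  using tz_unique[of "\<lambda>k. dtt (a + of_int k) (tz k b)" k]
  by (simp add: tz_N N_dtt dtt_t t_tz[symmetric] add.assoc[symmetric])

lemma V0D_tz:
  assumes "V0D P"
  shows "V0D (tz k ` P)"
proof -
  have N: "b \<in> P \<Longrightarrow> b \<in> N" for b using V0D_D(1)[OF assms] by blast
  show ?thesis
  proof (rule V0D_I)
    show "b \<in> N" if "b \<in> tz k ` P" for b using that N by (auto intro: tz_N)
    show "0 \<in> tz k ` P" using V0D_D(2)[OF assms] by (auto intro: image_eqI[of _ _ 0])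
    show "b + c \<in> tz k ` P" if "b \<in> tz k ` P" "c \<in> tz k ` P" for b c
      using that N V0D_D(3)[OF assms] by (auto simp flip: tz_add)
    show "g_mul g b \<in> tz k ` P" if "g \<in> polyfun" "b \<in> tz k ` P" for g b
      using that N V0D_D(4)[OF assms] by (auto simp flip: tz_mul)
    show "dx i b \<in> tz k ` P" if "b \<in> tz k ` P" for i b
      using that N V0D_D(5)[OF assms] by (auto simp flip: tz_dx)
    show "t b \<in> tz k ` P" if "b \<in> tz k ` P" for b
      using that N V0D_D(6)[OF assms] by (auto simp flip: tz_t)
    show "Dt b \<in> tz k ` P" if "b \<in> tz k ` P" for b
    proof -
      \<comment> \<open>Moving \<open>\<partial>\<^sub>t t\<close> past \<open>t\<^sup>k\<close>
        shifts it by \<open>k\<close>.\<close>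
      obtain c where c: "c \<in> P" "b = tz k c" using \<open>b \<in> tz k ` P\<close> by blast
      have "tz k (dtt (- of_int k) c) = dtt 0 b" using tz_dtt[of c k "- of_int k"] c N by simp
      then show ?thesis using V0D_dtt[OF assms c(1)] by (metis dtt_0 imageI)
    qed
  qed
qed

lemma V0D_fin_gen_tz:
  assumes "V0D_fin_gen f \<alpha> P"
  shows "V0D_fin_gen f \<alpha> (tz k ` P)"
proof -
  have P: "V0D P" using assms by (simp add: V0D_fin_gen_def)
  have "\<exists>S\<subseteq>P. finite S \<and> (\<forall>Q. V0D Q \<longrightarrow> S \<subseteq> Q \<longrightarrow> P \<subseteq> Q)"
    using assms unfolding V0D_fin_gen_def by (rule conjunct2)
  then obtain S where S: "S \<subseteq> P" "finite S" "\<forall>Q. V0D Q \<longrightarrow> S \<subseteq> Q \<longrightarrow> P \<subseteq> Q"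
    by (elim exE conjE) (rule that)
  have inv: "tz (- k) (tz k b) = b" "tz k (tz (- k) b) = b" if "b \<in> N" for b
    using tz_tz[OF that, of "- k" k] tz_tz[OF that, of k "- k"] by simp_all
  have "tz k ` P \<subseteq> Q" if Q: "V0D Q" "tz k ` S \<subseteq> Q" for Q
  proof -
    have "S \<subseteq> tz (- k) ` Q"
    proof
      fix b assume "b \<in> S"
      moreover have "b \<in> N" using \<open>b \<in> S\<close> S(1) V0D_D(1)[OF P] by blast
      ultimately show "b \<in> tz (- k) ` Q" using Q(2) inv(1) by (metis imageI subsetD)
    qed
    then have P: "P \<subseteq> tz (- k) ` Q" using S(3) V0D_tz[OF Q(1), of "- k"] by (simp only:)
    show ?thesis
    proof
      fix x assume "x \<in> tz k ` P"
      then obtain c where c: "c \<in> Q" "x = tz k (tz (- k) c)" using P by fast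
      have "c \<in> N" using c(1) V0D_D(1)[OF Q(1)] by (rule rev_subsetD)
      then show "x \<in> Q" using c inv(2) by simp
    qed
  qed
  then show ?thesis unfolding V0D_fin_gen_def
    using S(1,2) by (intro conjI V0D_tz[OF P] exI[of _ "tz k ` S"] image_mono finite_imageI) simp_all
qed

end

section \<open>The filtration by weight and order\<close>

context weighted_module
begin

text \<open>
  \<open>kap \<gamma> j / l\<close> is the eigenvalue of \<open>\<partial>\<^sub>t t\<close> on \<open>x\<^sup>\<gamma> c\<^sub>j\<close> up to terms of higher weight. \<open>Fil q m\<close> is spanned by
  the \<open>\<partial>\<^sup>\<beta> x\<^sup>\<gamma> c\<^sub>j\<close> with \<open>|\<beta>| + j < m\<close> and \<open>q \<le> kap \<gamma> j\<close>.
\<close>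

definition kap :: "('n \<Rightarrow> nat) \<Rightarrow> nat \<Rightarrow> int" where
  "kap \<gamma> j = int (wt \<gamma>) + int Wsum - int l * int j - A"

inductive fil :: "int \<Rightarrow> nat \<Rightarrow> 'n graph_elt \<Rightarrow> bool" for q :: int where
  gen: "j < m \<Longrightarrow> q \<le> kap \<gamma> j \<Longrightarrow> fil q m (g_mul (peval (mon \<gamma> a)) (cc j))"
| zero: "fil q m 0"
| add: "fil q m b \<Longrightarrow> fil q m c \<Longrightarrow> fil q m (b + c)"
| dx: "fil q m b \<Longrightarrow> fil q (Suc m) (dx i b)"

definition Fil :: "int \<Rightarrow> nat \<Rightarrow> 'n graph_elt set" where
  "Fil q m = {b. fil q m b}"

lemma Fil_gen: "j < m \<Longrightarrow> q \<le> kap \<gamma> j \<Longrightarrow> g_mul (peval (mon \<gamma> a)) (cc j) \<in> Fil q m"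
  and Fil_zero: "0 \<in> Fil q m"
  and Fil_add: "b \<in> Fil q m \<Longrightarrow> c \<in> Fil q m \<Longrightarrow> b + c \<in> Fil q m"
  and Fil_dx: "b \<in> Fil q m \<Longrightarrow> dx i b \<in> Fil q (Suc m)"
  unfolding Fil_def by (auto intro: fil.intros)

lemmas Fil_intros = Fil_gen Fil_zero Fil_add Fil_dx

lemma Fil_induct [consumes 1, case_names gen zero add dx]:
  assumes "b \<in> Fil q m"
    and "\<And>j m \<gamma> a. j < m \<Longrightarrow> q \<le> kap \<gamma> j \<Longrightarrow> Q m (g_mul (peval (mon \<gamma> a)) (cc j))"
    and "\<And>m. Q m 0"
    and "\<And>m b c. b \<in> Fil q m \<Longrightarrow> Q m b \<Longrightarrow> c \<in> Fil q m \<Longrightarrow> Q m c \<Longrightarrow> Q m (b + c)"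
    and "\<And>m b i. b \<in> Fil q m \<Longrightarrow> Q m b \<Longrightarrow> Q (Suc m) (dx i b)"
  shows "Q m b"
  using assms unfolding Fil_def mem_Collect_eq by (rule fil.induct)

lemma Fil_N: "b \<in> Fil q m \<Longrightarrow> b \<in> N"
  by (induction rule: Fil_induct) (auto intro: N_mul N_zero N_add N_dx cc_N peval_polyfun)

lemma Fil_mono: "b \<in> Fil q m \<Longrightarrow> q' \<le> q \<Longrightarrow> m \<le> m' \<Longrightarrow> b \<in> Fil q' m'"
proof (induction arbitrary: m' rule: Fil_induct)
  case (dx m b i)
  then obtain m'' where "m' = Suc m''" "m \<le> m''" by (cases m') auto
  then show ?case using dx by (auto intro: Fil_dx)
qed (auto intro: Fil_intros)

lemma Fil_poly:
  assumes "\<And>\<gamma>. \<gamma> \<in> supp G \<Longrightarrow> q \<le> kap \<gamma> j" "j < m"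
  shows "g_mul (peval G) (cc j) \<in> Fil q m"
proof -
  have "supp G \<subseteq> {\<gamma>. q \<le> kap \<gamma> j}" using assms(1) by blast
  then show ?thesis
    by (induction G rule: mpol_induct_supp)
      (auto simp: g_mul_add_left peval_simps assms(2) intro: Fil_intros)
qed

lemma Fil_mul: "b \<in> Fil q m \<Longrightarrow> g \<in> polyfun \<Longrightarrow> g_mul g b \<in> Fil q m"
proof (induction arbitrary: g rule: Fil_induct)
  case (gen j m \<gamma> a)
  obtain G where G: "g = peval G" using gen by (auto simp: polyfun_iff_peval)
  have "g_mul (peval (G * mon \<gamma> a)) (cc j) \<in> Fil q m"
  proof (rule Fil_poly[OF _ gen(1)])
    fix \<mu> assume "\<mu> \<in> supp (G * mon \<gamma> a)"
    then obtain \<kappa> \<gamma>' where "\<mu> = \<kappa> + \<gamma>'" "\<gamma>' \<in> supp (mon \<gamma> a)" by (metis supp_mult_cases)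
    then have "wt \<gamma> \<le> wt \<mu>" by (auto simp: wt_def plus_fun_apply split: if_splits intro!: sum_mono)
    then show "q \<le> kap \<mu> j" using gen(2) by (simp add: kap_def)
  qed
  then show ?case unfolding G by (simp add: g_mul_mult peval_simps)
next
  case (dx m b i)
  have "dx i (g_mul g b) - g_mul (pd i g) b \<in> Fil q (Suc m)"
  proof -
    have "dx i (g_mul g b) \<in> Fil q (Suc m)" using dx by (intro Fil_dx)
    moreover have "g_mul (pd i g) b \<in> Fil q m" "g_mul (- pd i g) b \<in> Fil q m"
      using dx by (auto intro: pd_polyfun polyfun_uminus)
    moreover have "g_mul (- pd i g) b = - g_mul (pd i g) b"
      by (simp add: g_mul_def fun_eq_iff uminus_apply times_fun_apply)
    ultimately show ?thesis using Fil_mono[of _ q m q "Suc m"] Fil_add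
      by (metis Suc_n_not_le_n linorder_le_cases order_refl uminus_add_conv_diff add.commute)
  qed
  then show ?case using dx_mul[OF dx.prems Fil_N[OF dx.hyps], of i] by (simp add: algebra_simps)
qed (auto simp: g_mul_add intro: Fil_intros)

lemma Fil_sc: "b \<in> Fil q m \<Longrightarrow> sc c b \<in> Fil q m"
  by (rule Fil_mul[OF _ polyfun_const(1)])

lemma Fil_uminus: "b \<in> Fil q m \<Longrightarrow> - b \<in> Fil q m"
  using Fil_sc[of b q m "- 1"] by (simp add: g_mul_minus_one)

lemma Fil_diff: "b \<in> Fil q m \<Longrightarrow> c \<in> Fil q m \<Longrightarrow> b - c \<in> Fil q m"
  using Fil_add[of b q m "- c"] Fil_uminus[of c] by simp

lemma Fil_sum: "(\<And>i. i \<in> I \<Longrightarrow> b i \<in> Fil q m) \<Longrightarrow> (\<Sum>i\<in>I. b i) \<in> Fil q m"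
  by (induction I rule: infinite_finite_induct) (auto intro: Fil_intros)

lemma supp_P_mult:
  assumes "\<mu> \<in> supp (P * mon \<gamma> a)"
  shows "wt \<mu> = l + wt \<gamma>"
proof -
  obtain \<kappa> \<gamma>' where "\<mu> = \<kappa> + \<gamma>'" "\<kappa> \<in> supp P" "\<gamma>' \<in> supp (mon \<gamma> a)"
    using assms by (metis supp_mult_cases)
  then show ?thesis
    using homogeneous by (auto simp: wt_def plus_fun_apply distrib_left sum.distrib split: if_splits)
qed

text \<open>In \<open>t c\<^sub>j = f c\<^sub>j - j c\<^sub>j\<^sub>-\<^sub>1\<close> the factor
  \<open>f\<close> adds \<open>l\<close> to the weight, and so does lowering \<open>j\<close> by
  one.\<close>

lemma Fil_t: "b \<in> Fil q m \<Longrightarrow> t b \<in> Fil (q + int l) m"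
proof (induction rule: Fil_induct)
  case (gen j m \<gamma> a)
  have "g_mul (peval (P * mon \<gamma> a)) (cc j) \<in> Fil (q + int l) m"
    using gen by (intro Fil_poly) (auto simp: kap_def dest: supp_P_mult)
  moreover have "g_mul (peval (mon \<gamma> a)) (sc (of_nat j) (cc (j - 1))) \<in> Fil (q + int l) m"
  proof (cases j)
    case (Suc j')
    then have "g_mul (peval (mon \<gamma> a)) (cc j') \<in> Fil (q + int l) m"
      using gen by (intro Fil_gen) (auto simp: kap_def algebra_simps)
    then show ?thesis using Suc by (simp add: g_mul_commute[of _ "\<lambda>_. of_nat _"] Fil_sc del: of_nat_Suc)
  qed (simp add: Fil_zero)
  moreover have "t (g_mul (peval (mon \<gamma> a)) (cc j))
    = g_mul (peval (P * mon \<gamma> a)) (cc j) - g_mul (peval (mon \<gamma> a)) (sc (of_nat j) (cc (j - 1)))"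
    by (simp add: t_mul t_cc g_mul_diff g_mul_mult peval_simps mult.commute)
  ultimately show ?case by (simp add: Fil_diff)
next
  case (dx m b i)
  then show ?case by (simp add: dx_t[symmetric] Fil_N Fil_dx)
qed (auto simp: g_t_add intro: Fil_intros)

lemma Dt_gen: "Dt (g_mul (peval (mon \<gamma> a)) (cc j))
    = g_mul (peval (P * mon \<gamma> a)) (cc (Suc j)) - sc (of_nat j + \<alpha>') (g_mul (peval (mon \<gamma> a)) (cc j))"
  by (simp add: Dt_mul Dt_cc g_mul_diff g_mul_mult peval_simps mult.commute)

lemma Fil_Dt: "b \<in> Fil q m \<Longrightarrow> Dt b \<in> Fil q (Suc m)"
proof (induction rule: Fil_induct)
  case (gen j m \<gamma> a)
  have "g_mul (peval (P * mon \<gamma> a)) (cc (Suc j)) \<in> Fil q (Suc m)"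
    using gen by (intro Fil_poly) (auto simp: kap_def algebra_simps dest: supp_P_mult)
  moreover have "g_mul (peval (mon \<gamma> a)) (cc j) \<in> Fil q (Suc m)" using gen by (intro Fil_gen) auto
  ultimately show ?case unfolding Dt_gen by (intro Fil_diff Fil_sc)
next
  case (dx m b i)
  then show ?case by (simp add: dx_Dt[symmetric] Fil_N Fil_dx)
qed (auto simp: Dt_add intro: Fil_intros)

lemma Fil_dtt: "b \<in> Fil q m \<Longrightarrow> dtt a b \<in> Fil q (Suc m)"
  unfolding g_dtt_def by (intro Fil_diff Fil_sc Fil_Dt) (auto intro: Fil_mono)

lemma g_mul_sum_left: "(\<Sum>i\<in>I. g_mul (h i) c) = g_mul (\<Sum>i\<in>I. h i) c"
  by (induction I rule: infinite_finite_induct) (simp_all add: g_mul_add_left)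

text \<open>Through Euler's identity the operator
  \<open>\<Sum> W\<^sub>i \<partial>\<^sub>i x\<^sub>i\<close> produces the term with
  \<open>f c\<^sub>j\<^sub>+\<^sub>1\<close>, and so does \<open>\<partial>\<^sub>t t\<close>.
  Eliminating it leaves the eigenvalue and corrections with a factor
  \<open>x\<^sub>i\<close>.\<close>

lemma euler_gen:
  assumes b: "b = g_mul (peval (mon \<gamma> a)) (cc j)"
  shows "sc (of_nat l) (Dt b)
    = sc (of_int (kap \<gamma> j)) b - (\<Sum>i\<in>UNIV. sc (of_nat (W i)) (dx i (g_mul (peval (var i)) b)))"
proof -
  define g where "g = peval (mon \<gamma> a)"
  have g: "g \<in> polyfun" by (simp add: g_def peval_polyfun)
  have X: "peval (var i) * g \<in> polyfun" for i by (intro polyfun_mult g peval_polyfun)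
  have p1: "(\<Sum>i\<in>UNIV. (\<lambda>_. of_nat (W i)) * pd i (peval (var i) * g)) = (\<lambda>_. of_nat (Wsum + wt \<gamma>)) * g"
  proof -
    have "mon 0 (of_nat (W i)) * dv i (var i * mon \<gamma> a) = mon \<gamma> (of_nat (W i + W i * \<gamma> i) * a)" for i
      by (simp add: var_def mult_single dv_single add_ac plus_fun_apply unit_def algebra_simps del: single_of_nat)
    then have "(\<Sum>i\<in>UNIV. mon 0 (of_nat (W i)) * dv i (var i * mon \<gamma> a))
        = (\<Sum>i\<in>UNIV. mon \<gamma> (of_nat (W i + W i * \<gamma> i) * a))" by (simp del: single_of_nat)
    also have "\<dots> = mon \<gamma> (\<Sum>i\<in>UNIV. of_nat (W i + W i * \<gamma> i) * a)"
      by (rule poly_mapping_eqI) (simp add: lookup_sum lookup_single when_def)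
    also have "\<dots> = mon 0 (of_nat (Wsum + wt \<gamma>)) * mon \<gamma> a"
      by (simp add: mult_single wt_def sum_distrib_right sum_distrib_left sum.distrib algebra_simps del: single_of_nat)
    finally have "peval (\<Sum>i\<in>UNIV. mon 0 (of_nat (W i)) * dv i (var i * mon \<gamma> a))
      = peval (mon 0 (of_nat (Wsum + wt \<gamma>)) * mon \<gamma> a)" by (rule arg_cong)
    moreover have "pd i (peval (var i) * g) = peval (dv i (var i * mon \<gamma> a))" for i
      unfolding g_def peval_simps(2)[symmetric] by (rule pd_peval)
    ultimately show ?thesis
      unfolding g_def by (simp only: peval_sum peval_simps)
  qed
  have d: "dx i (g_mul (peval (var i)) b)
      = g_mul (pd i (peval (var i) * g)) (cc j) - g_mul (peval (var i) * pd i f) (g_mul g (cc (Suc j)))" for i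
  proof -
    have "dx i (g_mul (peval (var i)) b) = dx i (g_mul (peval (var i) * g) (cc j))"
      by (simp add: b g_def g_mul_mult)
    also have "\<dots> = g_mul (pd i (peval (var i) * g)) (cc j) + g_mul (peval (var i) * g) (dx i (cc j))"
      by (rule dx_mul[OF X cc_N])
    finally show ?thesis
      by (simp add: dx_cc g_mul_def fun_eq_iff uminus_apply minus_apply plus_fun_apply times_fun_apply algebra_simps)
  qed
  have eul: "(\<Sum>i\<in>UNIV. (\<lambda>_. of_nat (W i)) * (peval (var i) * pd i f)) = (\<lambda>_. of_nat l) * f"
    using euler_f by (simp only: peval_simps)
  have "(\<Sum>i\<in>UNIV. sc (of_nat (W i)) (dx i (g_mul (peval (var i)) b)))
    = (\<Sum>i\<in>UNIV. g_mul ((\<lambda>_. of_nat (W i)) * pd i (peval (var i) * g)) (cc j))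
      - (\<Sum>i\<in>UNIV. g_mul ((\<lambda>_. of_nat (W i)) * (peval (var i) * pd i f)) (g_mul g (cc (Suc j))))"
    unfolding d by (simp only: g_mul_diff g_mul_mult sum_subtractf mult.assoc)
  also have "\<dots> = g_mul ((\<lambda>_. of_nat (Wsum + wt \<gamma>)) * g) (cc j) - g_mul ((\<lambda>_. of_nat l) * f) (g_mul g (cc (Suc j)))"
    unfolding g_mul_sum_left p1 eul ..
  finally have S: "(\<Sum>i\<in>UNIV. sc (of_nat (W i)) (dx i (g_mul (peval (var i)) b)))
    = g_mul ((\<lambda>_. of_nat (Wsum + wt \<gamma>)) * g) (cc j) - g_mul ((\<lambda>_. of_nat l) * f) (g_mul g (cc (Suc j)))" .
  have k: "of_int (kap \<gamma> j) = (of_nat (Wsum + wt \<gamma>) - of_nat l * (of_nat j + \<alpha>') :: complex)"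
    by (simp add: kap_def distrib_left \<alpha>'_l del: of_nat_sum)
  have D: "Dt b = g_mul f (g_mul g (cc (Suc j))) - sc (of_nat j + \<alpha>') (g_mul g (cc j))"
    by (simp add: b g_def Dt_mul Dt_cc g_mul_diff g_mul_commute[of "peval (mon \<gamma> a)"])
  have bg: "b = g_mul g (cc j)" by (simp add: b g_def)
  show ?thesis
    unfolding S k D unfolding bg
    by (simp add: g_mul_def fun_eq_iff minus_apply plus_fun_apply times_fun_apply algebra_simps del: of_nat_sum of_nat_add)
qed

lemma Fil_sc_cancel: "sc c b \<in> Fil q m \<Longrightarrow> c \<noteq> 0 \<Longrightarrow> b \<in> Fil q m"
  using Fil_sc[of "sc c b" q m "1 / c"] by (simp add: g_mul_const_mult)

text \<open>The corrections in \<open>euler_gen\<close> carry a factor \<open>x\<^sub>i\<close> of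
  positive weight; generators with larger \<open>kap\<close> are already in the next step.\<close>

lemma Fil_euler: "b \<in> Fil q m \<Longrightarrow> dtt (of_int q / of_nat l) b \<in> Fil (q + 1) (Suc m)"
proof (induction rule: Fil_induct)
  case (gen j m \<gamma> a)
  let ?b = "g_mul (peval (mon \<gamma> a)) (cc j)"
  show ?case
  proof (cases "q = kap \<gamma> j")
    case True
    have "g_mul (peval (var i)) ?b \<in> Fil (q + 1) m" for i
    proof -
      have "g_mul (peval (var i * mon \<gamma> a)) (cc j) \<in> Fil (q + 1) m"
      proof (rule Fil_poly[OF _ gen(1)])
        fix \<mu> assume "\<mu> \<in> supp (var i * mon \<gamma> a)"
        then have "\<mu> = unit i + \<gamma>" by (auto simp: var_def mult_single split: if_splits)
        moreover have "wt (unit i + \<gamma>) = W i + wt \<gamma>"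
        proof -
          have "W k * (unit i + \<gamma>) k = (if k = i then W i else 0) + W k * \<gamma> k" for k
            by (simp add: plus_fun_apply unit_def distrib_left)
          then show ?thesis by (simp add: wt_def sum.distrib)
        qed
        ultimately show "q + 1 \<le> kap \<mu> j" using W_pos[of i] True by (simp add: kap_def)
      qed
      then show ?thesis by (simp add: g_mul_mult peval_simps)
    qed
    then have "(\<Sum>i\<in>UNIV. sc (of_nat (W i)) (dx i (g_mul (peval (var i)) ?b))) \<in> Fil (q + 1) (Suc m)"
      by (intro Fil_sum Fil_sc Fil_dx)
    then have "- (\<Sum>i\<in>UNIV. sc (of_nat (W i)) (dx i (g_mul (peval (var i)) ?b))) \<in> Fil (q + 1) (Suc m)"
      by (rule Fil_uminus)
    moreover have "sc (of_nat l) (dtt (of_int q / of_nat l) ?b)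
        = - (\<Sum>i\<in>UNIV. sc (of_nat (W i)) (dx i (g_mul (peval (var i)) ?b)))"
      using l_pos by (simp add: g_dtt_def g_mul_diff euler_gen[OF refl] True g_mul_const_mult of_rat_divide)
    ultimately have "sc (of_nat l) (dtt (of_int q / of_nat l) ?b) \<in> Fil (q + 1) (Suc m)" by (simp only:)
    then show ?thesis by (rule Fil_sc_cancel) (use l_pos in simp)
  next
    case False
    then show ?thesis using gen by (intro Fil_dtt Fil_gen) auto
  qed
next
  case (add m b c)
  then show ?case by (simp add: dtt_add Fil_add)
next
  case (dx m b i)
  then show ?case by (simp add: dx_dtt[symmetric] Fil_N Fil_dx)
qed (simp add: Fil_zero)

text \<open>At the eigenvalue 1 - \<alpha>' the operator raises \<open>j\<close> and splits off
  \<open>t\<close>. For \<open>q\<close> one above the window the result is \<open>t\<close> times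
  an element of the lower end of the window.\<close>

lemma Fil_top:
  "b \<in> Fil q m \<Longrightarrow> \<exists>c\<in>Fil (q - int l) (Suc m). dtt (of_int (int l - A) / of_nat l) b = t c"
proof (induction rule: Fil_induct)
  case (gen j m \<gamma> a)
  have "complex_of_rat (of_int (int l - A) / of_nat l) = 1 - \<alpha>'"
    using \<alpha>'_l l_pos by (simp add: of_rat_divide of_rat_diff field_simps)
  then have "dtt (of_int (int l - A) / of_nat l) (cc j) = t (cc (Suc j))"
    unfolding g_dtt_def Dt_cc' by simp
  then have "dtt (of_int (int l - A) / of_nat l) (g_mul (peval (mon \<gamma> a)) (cc j))
      = t (g_mul (peval (mon \<gamma> a)) (cc (Suc j)))"
    by (simp only: dtt_mul t_mul)
  moreover have "g_mul (peval (mon \<gamma> a)) (cc (Suc j)) \<in> Fil (q - int l) (Suc m)"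
    using gen by (intro Fil_gen) (auto simp: kap_def algebra_simps)
  ultimately show ?case by blast
next
  case (zero m)
  then show ?case by (intro bexI[of _ 0]) (simp_all add: Fil_zero)
next
  case (add m b c)
  then obtain b' c' where "b' \<in> Fil (q - int l) (Suc m)" "dtt (of_int (int l - A) / of_nat l) b = t b'"
    "c' \<in> Fil (q - int l) (Suc m)" "dtt (of_int (int l - A) / of_nat l) c = t c'" by blast
  then show ?case by (intro bexI[of _ "b' + c'"]) (simp_all add: dtt_add g_t_add Fil_add)
next
  case (dx m b i)
  then obtain b' where "b' \<in> Fil (q - int l) (Suc m)" "dtt (of_int (int l - A) / of_nat l) b = t b'" by blast
  then show ?case using dx(1)
    by (intro bexI[of _ "dx i b'"]) (simp_all add: dx_dtt[symmetric] dx_t Fil_N Fil_dx)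
qed

definition Afil :: "int \<Rightarrow> 'n graph_elt set" where
  "Afil q = (\<Union>m. Fil q m)"

lemma AfilI: "b \<in> Fil q m \<Longrightarrow> b \<in> Afil q"
  by (auto simp: Afil_def)

lemma AfilE: "b \<in> Afil q \<Longrightarrow> (\<And>m. b \<in> Fil q m \<Longrightarrow> thesis) \<Longrightarrow> thesis"
  by (auto simp: Afil_def)

lemma V0D_Afil: "V0D (Afil q)"
proof (rule V0D_I)
  show "b \<in> N" if "b \<in> Afil q" for b using that by (elim AfilE) (rule Fil_N)
  show "0 \<in> Afil q" by (rule AfilI[of _ _ 0]) (rule Fil_zero)
  show "b + c \<in> Afil q" if "b \<in> Afil q" "c \<in> Afil q" for b c
  proof -
    obtain m where "b \<in> Fil q m" using \<open>b \<in> Afil q\<close> by (rule AfilE)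
    moreover obtain m' where "c \<in> Fil q m'" using \<open>c \<in> Afil q\<close> by (rule AfilE)
    ultimately have "b + c \<in> Fil q (max m m')" by (intro Fil_add) (auto intro: Fil_mono)
    then show ?thesis by (rule AfilI)
  qed
  show "g_mul g b \<in> Afil q" if "g \<in> polyfun" "b \<in> Afil q" for g b
    using that by (auto intro: AfilI Fil_mul elim!: AfilE)
  show "dx i b \<in> Afil q" if "b \<in> Afil q" for i b
    using that by (elim AfilE) (rule AfilI[OF Fil_dx])
  show "t b \<in> Afil q" if "b \<in> Afil q" for b
    using that by (elim AfilE) (rule AfilI[OF Fil_mono[OF Fil_t]], auto)
  show "Dt b \<in> Afil q" if "b \<in> Afil q" for b
    using that by (elim AfilE) (rule AfilI[OF Fil_Dt])
qed

lemma Afil_antimono: "q \<le> q' \<Longrightarrow> Afil q' \<subseteq> Afil q"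
  by (auto simp: Afil_def intro: Fil_mono)

lemma V0D_poly:
  assumes "V0D Q" "\<And>\<gamma>. r \<le> kap \<gamma> j \<Longrightarrow> g_mul (peval (mon \<gamma> 1)) (cc j) \<in> Q"
    and "\<And>\<gamma>. \<gamma> \<in> supp G \<Longrightarrow> r \<le> kap \<gamma> j"
  shows "g_mul (peval G) (cc j) \<in> Q"
proof -
  have "supp G \<subseteq> {\<gamma>. r \<le> kap \<gamma> j}" using assms(3) by blast
  then show ?thesis
  proof (induction G rule: mpol_induct_supp)
    case (mon \<gamma> a)
    have "mon \<gamma> a = mon 0 a * mon \<gamma> 1" by (simp add: mult_single del: single_of_nat)
    then have "g_mul (peval (mon \<gamma> a)) (cc j) = sc a (g_mul (peval (mon \<gamma> 1)) (cc j))"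
      by (simp only: peval_simps g_mul_mult)
    then show ?case using V0D_sc[OF assms(1) assms(2)] mon by simp
  qed (simp_all add: g_mul_add_left peval_simps V0D_D(2,3)[OF assms(1)])
qed

text \<open>Induction on \<open>j\<close>. If \<open>x\<^sup>\<gamma>\<close> has large weight it is
  \<open>\<Sum> f\<^sub>i h\<^sub>i\<close>, and \<open>f\<^sub>i h\<^sub>i
  c\<^sub>j\<^sub>+\<^sub>1 = (\<partial>\<^sub>i h\<^sub>i) c\<^sub>j - \<partial>\<^sub>i
  (h\<^sub>i c\<^sub>j)\<close> without loss of \<open>kap\<close>; if its weight is small,
  \<open>r \<le> kap \<gamma> j\<close> bounds \<open>j\<close>. For \<open>j = 0\<close> variables
  are split off.\<close>

lemma V0D_fin_gen_Afil: "V0D_fin_gen f \<alpha> (Afil r)"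
proof -
  obtain B where B: "\<And>\<kappa>. B \<le> wt \<kappa> \<Longrightarrow> \<exists>h. mon \<kappa> 1 = (\<Sum>j\<in>UNIV. dv j P * h j) \<and>
     (\<forall>j. \<forall>\<mu>\<in>supp (h j). wt \<mu> + l = wt \<kappa> + W j)"
    using monomial_in_jacobian by blast
  \<comment> \<open>Large enough for two purposes: for \<open>j = 0\<close> a monomial of weight
    above \<open>E\<close> can lose a variable while \<open>kap\<close> stays at least
    \<open>r\<close>, and weight below \<open>B\<close> forces \<open>j \<le> E\<close>.\<close>
  define E where "E = B + nat \<bar>r\<bar> + nat A + Wsum"
  define S where "S = (\<lambda>(\<gamma>, j). g_mul (peval (mon \<gamma> 1)) (cc j)) ` {(\<gamma>, j). wt \<gamma> \<le> E \<and> j \<le> E \<and> r \<le> kap \<gamma> j}"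
  have W_le: "W i \<le> Wsum" for i by (rule member_le_sum) auto
  have "finite {\<gamma>. wt \<gamma> \<le> E}"
  proof (rule finite_subset)
    show "{\<gamma>. wt \<gamma> \<le> E} \<subseteq> (UNIV :: 'n set) \<rightarrow>\<^sub>E {..E}"
    proof (clarsimp simp: PiE_def extensional_def)
      fix \<gamma> i assume "wt \<gamma> \<le> E"
      moreover have "W i * \<gamma> i \<le> wt \<gamma>" unfolding wt_def by (rule member_le_sum) auto
      moreover have "1 * \<gamma> i \<le> W i * \<gamma> i" using W_pos[of i] by (intro mult_right_mono) auto
      ultimately show "\<gamma> i \<le> E" by linarith
    qed
  qed (simp add: finite_PiE)
  then have "finite {(\<gamma>, j). wt \<gamma> \<le> E \<and> j \<le> E \<and> r \<le> kap \<gamma> j}"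
    by (intro finite_subset[OF _ finite_cartesian_product[of "{\<gamma>. wt \<gamma> \<le> E}" "{..E}"]]) auto
  then have fin: "finite S" by (simp add: S_def)
  have sub: "S \<subseteq> Afil r" unfolding S_def by (auto intro!: AfilI[OF Fil_gen[OF lessI]])
  have "Afil r \<subseteq> Q" if Q: "V0D Q" "S \<subseteq> Q" for Q
  proof -
    have small: "g_mul (peval (mon \<gamma> 1)) (cc j) \<in> Q" if "wt \<gamma> \<le> E" "j \<le> E" "r \<le> kap \<gamma> j" for \<gamma> j
      using that Q(2) unfolding S_def by auto
    have gens: "g_mul (peval (mon \<gamma> 1)) (cc j) \<in> Q" if "r \<le> kap \<gamma> j" for \<gamma> j
      using that
    proof (induction j arbitrary: \<gamma>)
      case 0
      then show ?case
      proof (induction "wt \<gamma>" arbitrary: \<gamma> rule: less_induct)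
        case less
        show ?case
        proof (cases "wt \<gamma> \<le> E")
          case True
          then show ?thesis using less.prems by (intro small) auto
        next
          case False
          then have "\<gamma> \<noteq> 0" by (auto simp: wt_def zero_fun_apply)
          then obtain i where i: "\<gamma> i \<noteq> 0" by (auto simp: fun_eq_iff zero_fun_apply)
          define \<gamma>' where "\<gamma>' = \<gamma> - unit i"
          have \<gamma>: "\<gamma> = unit i + \<gamma>'"
            using i by (auto simp: \<gamma>'_def fun_eq_iff unit_def plus_fun_apply minus_apply)
          have wt: "wt \<gamma> = W i + wt \<gamma>'" unfolding \<gamma> wt_add wt_unit ..
          have "g_mul (peval (mon \<gamma>' 1)) (cc 0) \<in> Q"
          proof (rule less.hyps)
            show "wt \<gamma>' < wt \<gamma>" using wt W_pos[of i] by simp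
            show "r \<le> kap \<gamma>' 0" using wt W_le[of i] False unfolding kap_def E_def by linarith
          qed
          then have "g_mul (peval (var i)) (g_mul (peval (mon \<gamma>' 1)) (cc 0)) \<in> Q"
            by (rule V0D_D(4)[OF Q(1) peval_polyfun])
          moreover have "var i * mon \<gamma>' 1 = mon \<gamma> 1" by (simp add: var_def mult_single \<gamma>)
          ultimately show ?thesis by (metis g_mul_mult peval_simps(2))
        qed
      qed
    next
      case (Suc j)
      show ?case
      proof (cases "B \<le> wt \<gamma>")
        case False
        have "int (Suc j) \<le> int l * int (Suc j)" using l_pos by (cases l) auto
        then have "Suc j \<le> E" using False Suc.prems A_pos unfolding kap_def E_def by linarith
        then show ?thesis using False Suc.prems by (intro small) (auto simp: E_def)
      next
        case True
        then obtain h where h: "mon \<gamma> 1 = (\<Sum>i\<in>UNIV. dv i P * h i)"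
          "\<And>i \<mu>. \<mu> \<in> supp (h i) \<Longrightarrow> wt \<mu> + l = wt \<gamma> + W i" using B by metis
        have "r \<le> kap \<mu> j" if "\<mu> \<in> supp (h i)" for i \<mu>
          using h(2)[OF that] Suc.prems by (simp add: kap_def algebra_simps)
        then have 1: "g_mul (peval (h i)) (cc j) \<in> Q" for i by (intro V0D_poly[OF Q(1) Suc.IH])
        have "r \<le> kap \<mu> j" if "\<mu> \<in> supp (dv i (h i))" for i \<mu>
        proof -
          have "\<mu> + unit i \<in> supp (h i)" using that by (auto simp: in_keys_iff coef_dv)
          then have "wt \<mu> + W i + l = wt \<gamma> + W i" using h(2) by (metis wt_add wt_unit)
          then show ?thesis using Suc.prems by (simp add: kap_def algebra_simps)
        qed
        then have 2: "g_mul (peval (dv i (h i))) (cc j) \<in> Q" for i by (intro V0D_poly[OF Q(1) Suc.IH])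
        have "g_mul (peval (dv i P * h i)) (cc (Suc j))
            = g_mul (peval (dv i (h i))) (cc j) - dx i (g_mul (peval (h i)) (cc j))" for i
          unfolding dx_mul[OF peval_polyfun cc_N] dx_cc pd_peval
          by (simp add: g_mul_def fun_eq_iff minus_apply plus_fun_apply uminus_apply times_fun_apply peval_simps)
        then have "g_mul (peval (dv i P * h i)) (cc (Suc j)) \<in> Q" for i
          using 1 2 by (simp add: V0D_diff[OF Q(1)] V0D_D(5)[OF Q(1)])
        then have "(\<Sum>i\<in>UNIV. g_mul (peval (dv i P * h i)) (cc (Suc j))) \<in> Q"
          by (rule V0D_sum[OF Q(1)])
        then show ?thesis unfolding g_mul_sum_left h(1) peval_sum .
      qed
    qed
    have "b \<in> Q" if "b \<in> Fil r m" for b m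
      using that
    proof (induction rule: Fil_induct)
      case (gen j m \<gamma> a)
      then show ?case by (intro V0D_poly[OF Q(1) gens]) (auto split: if_splits)
    qed (auto intro: V0D_D[OF Q(1)])
    then show ?thesis by (auto simp: Afil_def)
  qed
  then show ?thesis using fin sub V0D_Afil unfolding V0D_fin_gen_def by blast
qed

text \<open>The power of \<open>t\<close> is chosen such that the index of \<open>Afil\<close> lies between \<open>1 - A\<close> and \<open>l - A\<close>.\<close>

definition Vz :: "int \<Rightarrow> 'n graph_elt set" where
  "Vz q = tz ((q + A - 1) div int l) ` Afil (q - int l * ((q + A - 1) div int l))"

lemma Vz_eq:
  assumes "1 - A \<le> r" "r \<le> int l - A"
  shows "Vz (r + int l * k) = tz k ` Afil r"
proof -
  have "(r + int l * k + A - 1) div int l = (r + A - 1 + k * int l) div int l" by (simp add: algebra_simps)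
  also have "\<dots> = k" using assms l_pos by (subst div_mult_self1) auto
  finally show ?thesis by (simp add: Vz_def)
qed

lemma Vz_cases:
  obtains r k where "1 - A \<le> r" "r \<le> int l - A" "q = r + int l * k" "Vz q = tz k ` Afil r"
proof -
  define k where "k = (q + A - 1) div int l"
  have "(q + A - 1) mod int l = q + A - 1 - int l * k" by (simp add: k_def minus_mult_div_eq_mod)
  moreover have "0 \<le> (q + A - 1) mod int l" "(q + A - 1) mod int l < int l" using l_pos by auto
  ultimately have r: "1 - A \<le> q - int l * k" "q - int l * k \<le> int l - A" by linarith+
  show ?thesis by (rule that[OF r, of k]) (use Vz_eq[OF r, of k] in auto)
qed

lemma V0D_Vz: "V0D (Vz q)"
  unfolding Vz_def by (intro V0D_tz V0D_Afil)

lemma t_Vz: "t ` Vz q = Vz (q + int l)"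
proof -
  obtain r k where r: "1 - A \<le> r" "r \<le> int l - A" "q = r + int l * k" "Vz q = tz k ` Afil r"
    by (rule Vz_cases)
  have "Vz (q + int l) = tz (k + 1) ` Afil r" using Vz_eq[OF r(1,2), of "k + 1"] by (simp add: r(3) algebra_simps)
  moreover have "t (tz k b) = tz (k + 1) b" if "b \<in> Afil r" for b
    using V0D_D(1)[OF V0D_Afil] that by (intro t_tz) blast
  ultimately show ?thesis unfolding r(4) image_image by (simp cong: image_cong)
qed

lemma Vz_Suc: "Vz (q + 1) \<subseteq> Vz q"
proof -
  obtain r k where r: "1 - A \<le> r" "r \<le> int l - A" "q = r + int l * k" "Vz q = tz k ` Afil r"
    by (rule Vz_cases)
  show ?thesis
  proof (cases "r = int l - A")
    case False
    have q: "q + 1 = r + 1 + int l * k" unfolding r(3) by simp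
    have "Vz (q + 1) = tz k ` Afil (r + 1)"
      unfolding q by (rule Vz_eq) (use False r in simp_all)
    then show ?thesis unfolding r(4) by (simp only: image_mono[OF Afil_antimono] zle_add1_eq_le zless_add1_eq le_add_same_cancel1 zero_le_one)
  next
    case True
    \<comment> \<open>Past the upper end of the window the power of \<open>t\<close> increases and
      the index restarts at \<open>1 - A\<close>; the inclusion holds because \<open>t\<close>
      raises the index by \<open>l\<close>.\<close>
    have q: "q + 1 = 1 - A + int l * (k + 1)" unfolding r(3) True by (simp add: algebra_simps)
    have "Vz (q + 1) = tz (k + 1) ` Afil (1 - A)"
      unfolding q by (rule Vz_eq) (use l_pos in simp_all)
    moreover have "tz (k + 1) b \<in> tz k ` Afil r" if b: "b \<in> Afil (1 - A)" for b
    proof -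
      have "b \<in> N" using b V0D_D(1)[OF V0D_Afil] by blast
      moreover have "t b \<in> Afil r"
        using b True by (elim AfilE) (rule AfilI[OF Fil_mono[OF Fil_t]], auto)
      ultimately show ?thesis by (auto simp flip: t_tz simp flip: tz_t)
    qed
    ultimately show ?thesis unfolding r(4) by (simp add: image_subset_iff)
  qed
qed

lemma Vz_antimono: "q \<le> q' \<Longrightarrow> Vz q' \<subseteq> Vz q"
proof (induction q' rule: int_ge_induct)
  case (step i)
  then show ?case using Vz_Suc[of i] by blast
qed simp

text \<open>\<open>\<partial>\<^sub>t\<close> is
  \<open>t\<^sup>-\<^sup>1 (\<partial>\<^sub>t t - 1)\<close>, and
  \<open>\<partial>\<^sub>t t - 1\<close> preserves every step.\<close>

lemma dt_Vz:
  assumes "b \<in> Vz q"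
  shows "g_dt b \<in> Vz (q - int l)"
proof -
  obtain r k where r: "1 - A \<le> r" "r \<le> int l - A" "q = r + int l * k" "Vz q = tz k ` Afil r"
    by (rule Vz_cases)
  obtain c where c: "c \<in> Afil r" "b = tz k c" using assms r(4) by blast
  have N: "c \<in> N" "b \<in> N" using c V0D_D(1)[OF V0D_Afil] by (auto intro: tz_N)
  have "t (g_dt b) = dtt 1 b" by (rule t_dt')
  also have "\<dots> = tz k (dtt (1 - of_int k) c)" using tz_dtt[OF N(1), of k "1 - of_int k"] c by simp
  finally have "t (g_dt b) = t (tz (k - 1) (dtt (1 - of_int k) c))" using N by (simp add: t_tz N_dtt)
  then have "g_dt b = tz (k - 1) (dtt (1 - of_int k) c)"
    by (rule t_cancel[rotated 2]) (simp_all add: N N_dt tz_N N_dtt)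
  moreover have "dtt (1 - of_int k) c \<in> Afil r" by (rule V0D_dtt[OF V0D_Afil c(1)])
  moreover have "Vz (q - int l) = tz (k - 1) ` Afil r"
    using Vz_eq[OF r(1,2), of "k - 1"] by (simp add: r(3) algebra_simps)
  ultimately show ?thesis by blast
qed

text \<open>The first factor raises the index in the window by one. If this leaves the window, the
  second factor turns the result into \<open>t\<close> times an element of index
  \<open>1 - A\<close>, as the next step requires.\<close>

lemma Vz_nilpotent:
  assumes "b \<in> Vz q" "of_nat l * a = of_int q"
  shows "dtt a (dtt a b) \<in> Vz (q + 1)"
proof -
  obtain r k where r: "1 - A \<le> r" "r \<le> int l - A" "q = r + int l * k" "Vz q = tz k ` Afil r"
    by (rule Vz_cases)
  obtain c where c: "c \<in> Afil r" "b = tz k c" using assms r(4) by blast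
  have N: "c \<in> N" using c V0D_D(1)[OF V0D_Afil] by auto
  define a' where "a' = (of_int r / of_nat l :: rat)"
  have "a = (of_int r + of_nat l * of_int k) / of_nat l"
    using assms(2) l_pos unfolding r(3) by (simp add: field_simps)
  then have a': "a = a' + of_int k" using l_pos by (simp add: a'_def add_divide_distrib)
  have eq: "dtt a (tz k x) = tz k (dtt a' x)" if "x \<in> N" for x
    using tz_dtt[OF that, of k a'] by (simp add: a')
  have 1: "dtt a' c \<in> Afil (r + 1)"
    using c(1) unfolding a'_def by (elim AfilE) (rule AfilI[OF Fil_euler])
  have eq2: "dtt a (dtt a b) = tz k (dtt a' (dtt a' c))" by (simp add: c eq N N_dtt)
  show ?thesis
  proof (cases "r = int l - A")
    case False
    then have "Vz (q + 1) = tz k ` Afil (r + 1)" using r Vz_eq[of "r + 1" k] by (simp add: algebra_simps)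
    then show ?thesis unfolding eq2 using V0D_dtt[OF V0D_Afil 1] by blast
  next
    case True
    obtain m where "dtt a' c \<in> Fil (r + 1) m" using 1 by (rule AfilE)
    from Fil_top[OF this] obtain d where d: "d \<in> Fil (r + 1 - int l) (Suc m)" "dtt a' (dtt a' c) = t d"
      unfolding a'_def True by blast
    have "d \<in> Afil (1 - A)" using d(1) True by (auto intro: AfilI)
    moreover have q: "q + 1 = 1 - A + int l * (k + 1)" unfolding r(3) True by (simp add: algebra_simps)
    have "Vz (q + 1) = tz (k + 1) ` Afil (1 - A)"
      unfolding q by (rule Vz_eq) (use l_pos in simp_all)
    moreover have "tz k (t d) = tz (k + 1) d" using Fil_N[OF d(1)] by (simp add: tz_t t_tz)
    ultimately show ?thesis unfolding eq2 d(2) by simp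
  qed
qed

section \<open>Rational indices and the axioms of the V-filtration\<close>

definition VV :: "rat \<Rightarrow> 'n graph_elt set" where
  "VV a = Vz \<lceil>of_nat l * a\<rceil>"

lemma VV_int: "VV (of_int q / of_nat l) = Vz q"
  using l_pos by (simp add: VV_def)

lemma cc_0: "cc 0 = g_delta (loc_elt f 1 e)"
  by (auto simp: fun_eq_iff cc_apply g_delta_def loc_elt_def cf_def one_fun_apply zero_fun_apply)

lemma UN_VV: "(\<Union>a. VV a) = N"
proof
  show "(\<Union>a. VV a) \<subseteq> N" using V0D_D(1)[OF V0D_Vz] by (auto simp: VV_def)
  have "\<exists>q. b \<in> Vz q" if "b \<in> N" for b
    using that
  proof (induction rule: graph_module_induct)
    case (delta u)
    then obtain g k where g: "g \<in> polyfun" "u = loc_elt f g k" by (rule LocE)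
    obtain G where G: "f ^ e * g = peval G"
      using g(1) f_poly polyfun_iff_peval[of "f ^ e * g"] by (auto intro: polyfun_mult polyfun_power)
    have "(t ^^ k) (g_delta u) = g_delta (f ^ k * u)" by (rule t_pow_delta)
    also have "f ^ k * u = peval G * loc_elt f 1 e"
      by (auto simp: g(2) G[symmetric] fun_eq_iff times_fun_apply power_fun_apply loc_elt_def one_fun_apply)
    finally have "(t ^^ k) (g_delta u) = g_mul (peval G) (cc 0)" by (simp add: cc_0 g_mul_delta)
    moreover have "(t ^^ k) (g_delta u) = tz (int k) (g_delta u)" by (simp add: tz_def)
    ultimately have "tz (- int k) (g_mul (peval G) (cc 0)) = g_delta u"
      using tz_tz[OF N_delta[OF delta], of "- int k" "int k"] by simp
    moreover have "g_mul (peval G) (cc 0) \<in> Afil (1 - A)"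
    proof (intro AfilI Fil_poly)
      fix \<gamma>
      have "W i \<le> Wsum" for i by (rule member_le_sum) auto
      then have "1 \<le> Wsum" using W_pos by (metis One_nat_def Suc_leI le_trans)
      then show "1 - A \<le> kap \<gamma> 0" unfolding kap_def by linarith
    qed auto
    ultimately have "g_delta u \<in> Vz (1 - A + int l * (- int k))"
      using A_le l_pos by (subst Vz_eq) (simp_all, metis imageI)
    then show ?case by blast
  next
    case (dt b)
    then show ?case using dt_Vz by blast
  next
    case (add b c)
    then obtain q q' where "b \<in> Vz q" "c \<in> Vz q'" by blast
    then have "b \<in> Vz (min q q')" "c \<in> Vz (min q q')"
      using Vz_antimono[of "min q q'" q] Vz_antimono[of "min q q'" q'] by auto
    then show ?case using V0D_D(3)[OF V0D_Vz] by blast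
  qed
  then show "N \<subseteq> (\<Union>a. VV a)" using VV_int by blast
qed

lemma KM_VV: "KM VV"
  unfolding KM_filtration_def
proof (intro conjI allI impI)
  show "antimono VV"
    unfolding VV_def by (intro antimonoI Vz_antimono ceiling_mono mult_left_mono) auto
  show "(\<Union>a. VV a) = N" by (rule UN_VV)
  show "\<exists>l::nat. l > 0 \<and> (\<forall>a. VV a = VV (of_int \<lceil>of_nat l * a\<rceil> / of_nat l))"
    unfolding VV_int using l_pos by (intro exI[of _ l]) (simp add: VV_int, simp add: VV_def)
  show "V0D_fin_gen f \<alpha> (VV a)" for a
    unfolding VV_def Vz_def by (intro V0D_fin_gen_tz V0D_fin_gen_Afil)
  have t: "t ` VV a = VV (a + 1)" for a
    using ceiling_add_of_int[of "of_nat l * a" "int l"] unfolding VV_def t_Vz by (simp add: distrib_left)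
  show "t ` VV a \<subseteq> VV (a + 1)" "0 < a \<Longrightarrow> t ` VV a = VV (a + 1)" for a using t by auto
  show "g_dt ` VV a \<subseteq> VV (a - 1)" for a
    using ceiling_diff_of_int[of "of_nat l * a" "int l"] dt_Vz unfolding VV_def by (auto simp: right_diff_distrib)
  show "\<exists>r. \<forall>b\<in>VV a. (dtt a ^^ r) b \<in> V_gt VV a" for a
  proof -
    have "a < of_int (\<lfloor>of_nat l * a\<rfloor> + 1) / of_nat l"
      using l_pos floor_correct[of "of_nat l * a"] by (simp add: field_simps)
    then have gt: "Vz (\<lfloor>of_nat l * a\<rfloor> + 1) \<subseteq> V_gt VV a"
      using V_in_gt[of a "of_int (\<lfloor>of_nat l * a\<rfloor> + 1) / of_nat l" VV] by (simp only: VV_int)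
    show ?thesis
    proof (cases "of_nat l * a \<in> \<int>")
      case True
      then obtain q where q: "of_nat l * a = of_int q" by (auto elim: Ints_cases)
      have "dtt a (dtt a b) \<in> V_gt VV a" if "b \<in> VV a" for b
        using Vz_nilpotent[of b q a] gt that by (auto simp: VV_def q)
      then show ?thesis by (intro exI[of _ 2]) (simp add: numeral_2_eq_2)
    next
      case False
      then have "\<lceil>of_nat l * a\<rceil> = \<lfloor>of_nat l * a\<rfloor> + 1" by (metis Ints_of_int ceiling_altdef)
      then show ?thesis using gt by (intro exI[of _ 0]) (auto simp: VV_def)
    qed
  qed
qed

lemma V_gt_VV: "V_gt VV 0 = Vz 1"
proof
  show "V_gt VV 0 \<subseteq> Vz 1"
  proof
    fix b assume "b \<in> V_gt VV 0"
    then have "\<exists>a::rat>0. b \<in> Vz \<lceil>of_nat l * a\<rceil>" by (auto simp: V_gt_def VV_def)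
    then obtain a :: rat where "0 < a" "b \<in> Vz \<lceil>of_nat l * a\<rceil>" by blast
    moreover have "1 \<le> \<lceil>of_nat l * a\<rceil>" using \<open>0 < a\<close> l_pos using zero_less_ceiling[of "of_nat l * a"] by (simp add: int_one_le_iff_zero_less)
    ultimately show "b \<in> Vz 1" using Vz_antimono by blast
  qed
  show "Vz 1 \<subseteq> V_gt VV 0"
    using V_in_gt[of 0 "of_int 1 / of_nat l" VV] l_pos unfolding VV_int by simp
qed

sublocale km_setting f \<alpha> VV
proof
  show "KM VV" by (rule KM_VV)
  show "t ` VV 0 = VV 1" using t_Vz[of 0] by (simp add: VV_def)
  show "Dt (Dt x) \<in> V_gt VV 0" if "x \<in> VV 0" for x
    using Vz_nilpotent[of x 0 0] that by (simp add: V_gt_VV VV_def dtt_0)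
qed

lemma VV_0: "VV 0 = Afil 0"
proof -
  have "Vz 0 = tz 0 ` Afil 0" using Vz_eq[of 0 0] A_pos A_le by simp
  then show ?thesis by (simp add: VV_def)
qed

lemma Vp_eq: "V_gt VV 0 = (if A < int l then Afil 1 else t ` Afil (1 - int l))"
proof (cases "A < int l")
  case True
  then show ?thesis unfolding V_gt_VV using Vz_eq[of 1 0] A_pos by simp
next
  case False
  then have "Vz 1 = tz 1 ` Afil (1 - int l)" using Vz_eq[of "1 - int l" 1] A_le l_pos by simp
  also have "\<dots> = t ` Afil (1 - int l)"
  proof (rule image_cong[OF refl])
    fix x assume "x \<in> Afil (1 - int l)"
    then have "x \<in> N" using V0D_D(1)[OF V0D_Afil] by blast
    then show "tz 1 x = t x" using t_tz[of x 0] by simp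
  qed
  finally show ?thesis unfolding V_gt_VV using False by simp
qed

end

section \<open>Strictness\<close>

lemma multi_index_induct [case_names zero unit]:
  fixes \<beta> :: "'n::finite \<Rightarrow> nat"
  assumes "Q 0" "\<And>\<beta> i. Q \<beta> \<Longrightarrow> Q (unit i + \<beta>)"
  shows "Q \<beta>"
proof (induction "sum \<beta> UNIV" arbitrary: \<beta>)
  case 0
  then have "\<beta> = 0" by (auto simp: fun_eq_iff zero_fun_apply)
  then show ?case using assms(1) by simp
next
  case (Suc k)
  then obtain i where "\<beta> i \<noteq> 0" by fastforce
  then have \<beta>: "\<beta> = unit i + (\<beta> - unit i)" by (auto simp: fun_eq_iff unit_def plus_fun_apply minus_apply)
  have "sum \<beta> UNIV = sum (unit i) UNIV + sum (\<beta> - unit i) UNIV"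
    by (subst \<beta>) (simp add: plus_fun_apply sum.distrib)
  moreover have "sum (unit i) UNIV = (1::nat)" by (simp add: unit_def)
  ultimately have "k = sum (\<beta> - unit i) UNIV" using Suc.hyps(2) by simp
  then show ?case using assms(2)[of "\<beta> - unit i" i] Suc.hyps(1) \<beta> by metis
qed

lemma polyfun_line:
  assumes "g \<in> polyfun"
  shows "\<exists>p. \<forall>s. g (\<chi> i. x $ i + s * y $ i) = poly p s"
  using assms
proof induction
  case (const c)
  show ?case by (intro exI[of _ "[:c:]"]) simp
next
  case (coord i)
  show ?case by (intro exI[of _ "[:x $ i, y $ i:]"]) simp
next
  case (add p q)
  then obtain p' q' where "\<forall>s. p (\<chi> i. x $ i + s * y $ i) = poly p' s" "\<forall>s. q (\<chi> i. x $ i + s * y $ i) = poly q' s"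
    by blast
  then show ?case by (intro exI[of _ "p' + q'"]) simp
next
  case (mult p q)
  then obtain p' q' where "\<forall>s. p (\<chi> i. x $ i + s * y $ i) = poly p' s" "\<forall>s. q (\<chi> i. x $ i + s * y $ i) = poly q' s"
    by blast
  then show ?case by (intro exI[of _ "p' * q'"]) simp
qed

text \<open>On the line joining \<open>x\<close> to \<open>y\<close> both functions are univariate
  polynomials with product zero, and the one for \<open>g\<close> is nonzero at
  \<open>y\<close>.\<close>

lemma polyfun_cancel:
  assumes "g \<in> polyfun" "h \<in> polyfun" "g y \<noteq> 0" "\<And>x. g x \<noteq> 0 \<Longrightarrow> h x = 0"
  shows "h x = 0"
proof -
  obtain p where p: "\<And>s. g (\<chi> i. x $ i + s * (y - x) $ i) = poly p s" using polyfun_line[OF assms(1)] by metis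
  obtain q where q: "\<And>s. h (\<chi> i. x $ i + s * (y - x) $ i) = poly q s" using polyfun_line[OF assms(2)] by metis
  have "poly (p * q) s = 0" for s using assms(4) unfolding poly_mult p[symmetric] q[symmetric] by auto
  then have "p * q = 0" using poly_all_0_iff_0 by blast
  moreover have "p \<noteq> 0" using p[of 1] assms(3) by auto
  ultimately have "q = 0" by simp
  then show ?thesis using q[of 0] by simp
qed

context loc_module
begin

text \<open>The order of the variables is immaterial since the \<open>dx i\<close> commute on
  \<open>N\<close>; \<open>dxs_0\<close> and \<open>dxs_unit\<close> characterize the operator
  there.\<close>

definition dxs :: "('n \<Rightarrow> nat) \<Rightarrow> 'n graph_elt \<Rightarrow> 'n graph_elt" where
  "dxs \<beta> = foldr (\<lambda>i. dx i ^^ \<beta> i) (SOME xs. set xs = UNIV \<and> distinct xs)"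

lemma dx_pow_N: "b \<in> N \<Longrightarrow> (dx i ^^ k) b \<in> N"
  by (induction k) (simp_all add: N_dx)

lemma dx_pow_commute: "b \<in> N \<Longrightarrow> dx i ((dx j ^^ k) b) = (dx j ^^ k) (dx i b)"
  by (induction k) (simp_all add: dx_pow_N dx_commute[of _ i j])

lemma dxs_0 [simp]: "dxs 0 b = b"
proof -
  have "foldr (\<lambda>i. dx i ^^ 0 i) xs b = b" for xs :: "'n list" by (induction xs) (simp_all add: zero_fun_apply)
  then show ?thesis by (simp add: dxs_def)
qed

lemma dxs_unit:
  assumes "b \<in> N"
  shows "dxs (unit i + \<beta>) b = dx i (dxs \<beta> b)"
proof -
  have N: "foldr (\<lambda>i. dx i ^^ \<beta> i) xs b \<in> N" for xs by (induction xs) (simp_all add: assms dx_pow_N)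
  have "foldr (\<lambda>j. dx j ^^ (unit i + \<beta>) j) xs b
    = (if i \<in> set xs then dx i (foldr (\<lambda>i. dx i ^^ \<beta> i) xs b) else foldr (\<lambda>i. dx i ^^ \<beta> i) xs b)"
    if "distinct xs" for xs
    using that
  proof (induction xs)
    case (Cons j xs)
    then show ?case
      by (auto simp: plus_fun_apply unit_def N dx_pow_commute)
  qed simp
  moreover have "\<exists>xs. set xs = (UNIV :: 'n set) \<and> distinct xs" by (rule finite_distinct_list) simp
  then have "set (SOME xs. set xs = (UNIV :: 'n set) \<and> distinct xs) = UNIV \<and> distinct (SOME xs. set xs = (UNIV :: 'n set) \<and> distinct xs)"
    by (rule someI_ex)
  ultimately show ?thesis by (simp add: dxs_def)
qed

lemma dxs_N: "b \<in> N \<Longrightarrow> dxs \<beta> b \<in> N"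
  by (induction \<beta> rule: multi_index_induct) (simp_all add: dxs_unit N_dx)

lemma dxs_add: "b \<in> N \<Longrightarrow> c \<in> N \<Longrightarrow> dxs \<beta> (b + c) = dxs \<beta> b + dxs \<beta> c"
  by (induction \<beta> rule: multi_index_induct) (simp_all add: dxs_unit dx_add dxs_N N_add)

lemma dxs_zero: "dxs \<beta> 0 = 0"
  by (induction \<beta> rule: multi_index_induct) (simp_all add: dxs_unit N_zero)

lemma dxs_diff: "b \<in> N \<Longrightarrow> c \<in> N \<Longrightarrow> dxs \<beta> (b - c) = dxs \<beta> b - dxs \<beta> c"
  by (induction \<beta> rule: multi_index_induct) (simp_all add: dxs_unit dx_diff dxs_N N_diff)

lemma dxs_sc: "b \<in> N \<Longrightarrow> dxs \<beta> (sc c b) = sc c (dxs \<beta> b)"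
  by (induction \<beta> rule: multi_index_induct) (simp_all add: dxs_unit dx_sc dxs_N N_sc)

lemma dxs_dx: "b \<in> N \<Longrightarrow> dxs \<beta> (dx i b) = dx i (dxs \<beta> b)"
  by (induction \<beta> rule: multi_index_induct) (simp_all add: dxs_unit dx_commute[of _ i] dxs_N N_dx)

lemma dxs_tz: "b \<in> N \<Longrightarrow> tz k (dxs \<beta> b) = dxs \<beta> (tz k b)"
  by (induction \<beta> rule: multi_index_induct) (simp_all add: dxs_unit tz_dx dxs_N tz_N)

lemma dxs_Dt: "b \<in> N \<Longrightarrow> Dt (dxs \<beta> b) = dxs \<beta> (Dt b)"
  by (induction \<beta> rule: multi_index_induct) (simp_all add: dxs_unit dx_Dt[symmetric] dxs_N N_dt N_t)

lemma dx_top: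
  assumes "\<And>k. p < k \<Longrightarrow> b k = 0"
  shows "dx i b (Suc p) = - (pd i f * b p)" "\<And>k. Suc p < k \<Longrightarrow> dx i b k = 0"
proof -
  have c: "conn f \<alpha> i 0 = 0"
    using conn_const_mult[OF Loc_zero, of i 0] by simp
  show "dx i b (Suc p) = - (pd i f * b p)" using assms[of "Suc p"] by (simp add: g_dx_def c)
  show "dx i b k = 0" if "Suc p < k" for k
    using assms[of k] assms[of "k - 1"] that by (cases k) (simp_all add: g_dx_def c)
qed

text \<open>The symbol: in highest order in \<open>\<partial>\<^sub>t\<close> each
  \<open>\<partial>\<^sub>i\<close> acts as multiplication by \<open>- f\<^sub>i\<close>.\<close>

lemma dxs_top:
  assumes "b \<in> N" "\<And>k. p < k \<Longrightarrow> b k = 0"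
  shows "dxs \<beta> b (p + sum \<beta> UNIV) x = (\<Prod>i\<in>UNIV. (- pd i f x) ^ \<beta> i) * b p x"
    "p + sum \<beta> UNIV < k \<Longrightarrow> dxs \<beta> b k = 0"
proof (induction \<beta> arbitrary: k rule: multi_index_induct)
  case zero
  {
    case 1
    then show ?case by (simp add: zero_fun_apply)
  next
    case 2
    then show ?case using assms(2) by (simp add: zero_fun_apply)
  }
next
  case (unit \<beta> i)
  have s: "p + sum (unit i + \<beta>) UNIV = Suc (p + sum \<beta> UNIV)"
    by (simp add: plus_fun_apply sum.distrib unit_def)
  have prod: "(\<Prod>j\<in>UNIV. (- pd j f x) ^ (unit i + \<beta>) j) = - pd i f x * (\<Prod>j\<in>UNIV. (- pd j f x) ^ \<beta> j)"
    by (simp add: plus_fun_apply power_add prod.distrib prod_unit)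
  note t = dx_top[where p = "p + sum \<beta> UNIV" and b = "dxs \<beta> b" and i = i]
  {
    case 1
    show ?case
      unfolding s dxs_unit[OF assms(1)] prod
      using t(1) unit by (simp add: uminus_apply times_fun_apply)
  next
    case 2
    then show ?case unfolding s dxs_unit[OF assms(1)] using t(2) unit by blast
  }
qed

end

section \<open>Symbols and their lifts\<close>

context weighted_module
begin

lemma Fil_dxs: "b \<in> Fil q m \<Longrightarrow> dxs \<beta> b \<in> Fil q (m + sum \<beta> UNIV)"
proof (induction \<beta> rule: multi_index_induct)
  case (unit \<beta> i)
  have "m + sum (unit i + \<beta>) UNIV = Suc (m + sum \<beta> UNIV)"
    by (simp add: plus_fun_apply sum.distrib unit_def)
  then show ?case using unit by (simp add: dxs_unit Fil_N Fil_dx)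
qed (simp add: zero_fun_apply)

lemma Fil_order: "b \<in> Fil q m \<Longrightarrow> m \<le> k \<Longrightarrow> b k = 0"
proof (induction arbitrary: k rule: Fil_induct)
  case (gen j m \<gamma> a)
  then show ?case by (simp add: g_mul_def cc_above)
next
  case (dx m b i)
  show ?case
  proof (cases m)
    case 0
    then have "b = 0" using dx(2) by (auto simp: fun_eq_iff zero_fun_apply)
    then show ?thesis by (simp add: zero_fun_apply)
  next
    case (Suc m')
    then show ?thesis using dx_top(2)[of m' b k i] dx by simp
  qed
qed (simp_all add: zero_fun_apply plus_fun_apply)

text \<open>Lift of the symbol \<open>x\<^sup>\<gamma> Y\<^sup>\<beta>\<close> to order
  \<open>m\<close>. The index \<open>m - |\<beta>|\<close> is a truncated subtraction, whence the
  bounds on \<open>degY\<close> below.\<close>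

definition lift_mon :: "nat \<Rightarrow> ('n + 'n \<Rightarrow> nat) \<Rightarrow> 'n graph_elt" where
  "lift_mon m \<kappa> = dxs (\<lambda>i. \<kappa> (Inr i)) (g_mul (peval (mon (\<lambda>i. \<kappa> (Inl i)) 1)) (cc (m - degY \<kappa>)))"

definition lift :: "nat \<Rightarrow> ('n + 'n) mpol \<Rightarrow> 'n graph_elt" where
  "lift m = lin_ext (\<lambda>\<kappa> c. sc c (lift_mon m \<kappa>))"

lemma lift_zero [simp]: "lift m 0 = 0"
  by (simp add: lift_def)

lemma lift_add: "lift m (G + H) = lift m G + lift m H"
  unfolding lift_def by (rule lin_ext_add) (simp_all add: sc_add)

lemma lift_sum: "lift m (\<Sum>i\<in>I. G i) = (\<Sum>i\<in>I. lift m (G i))"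
  by (induction I rule: infinite_finite_induct) (simp_all add: lift_add)

lemma lift_single: "lift m (mon \<kappa> c) = sc c (lift_mon m \<kappa>)"
  unfolding lift_def by (rule lin_ext_single) simp

lemma lift_mon_N: "lift_mon m \<kappa> \<in> N"
  unfolding lift_mon_def by (intro dxs_N N_mul cc_N peval_polyfun)

lemma lift_N: "lift m G \<in> N"
  by (induction G rule: mpol_induct) (simp_all add: lift_add lift_single N_add N_sc N_zero lift_mon_N)

lemma lift_diff: "lift m (G - H) = lift m G - lift m H"
  using lift_add[of m "G - H" H] by simp

lemma lift_mon_Fil:
  assumes "degY \<kappa> \<le> m" "q + int l * int m + A - int Wsum \<le> om \<kappa>"
  shows "lift_mon m \<kappa> \<in> Fil q (Suc m)"
proof -
  have d: "sum (\<lambda>i. \<kappa> (Inr i)) UNIV = degY \<kappa>" by (simp add: degY_def)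
  have "int l * int (m - degY \<kappa>) = int l * int m - int l * int (degY \<kappa>)"
    using assms(1) by (simp add: of_nat_diff right_diff_distrib)
  then have "q \<le> kap (\<lambda>i. \<kappa> (Inl i)) (m - degY \<kappa>)"
    using assms(2) by (simp add: kap_def om_def)
  then have "lift_mon m \<kappa> \<in> Fil q (Suc (m - degY \<kappa>) + degY \<kappa>)"
    unfolding lift_mon_def d[symmetric] by (intro Fil_dxs Fil_gen) auto
  then show ?thesis using assms(1) by simp
qed

lemma lift_Fil:
  assumes "\<And>\<kappa>. \<kappa> \<in> supp G \<Longrightarrow> degY \<kappa> \<le> m \<and> q + int l * int m + A - int Wsum \<le> om \<kappa>"
  shows "lift m G \<in> Fil q (Suc m)"
proof -
  have "supp G \<subseteq> {\<kappa>. degY \<kappa> \<le> m \<and> q + int l * int m + A - int Wsum \<le> om \<kappa>}" using assms by blast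
  then show ?thesis
    by (induction G rule: mpol_induct_supp)
      (simp_all add: lift_add lift_single Fil_zero Fil_add Fil_sc lift_mon_Fil)
qed

lemma dx_lift:
  assumes "\<And>\<kappa>. \<kappa> \<in> supp G \<Longrightarrow> degY \<kappa> \<le> m"
  shows "dx i (lift m G) = lift (Suc m) (var (Inr i) * G)"
proof -
  have "supp G \<subseteq> {\<kappa>. degY \<kappa> \<le> m}" using assms by blast
  then show ?thesis
  proof (induction G rule: mpol_induct_supp)
    case (mon \<kappa> c)
    have 1: "(\<lambda>j. (unit (Inr i) + \<kappa>) (Inl j)) = (\<lambda>j. \<kappa> (Inl j))"
      "(\<lambda>j. (unit (Inr i) + \<kappa>) (Inr j)) = unit i + (\<lambda>j. \<kappa> (Inr j))"
      by (auto simp: fun_eq_iff plus_fun_apply unit_def)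
    have "lift_mon (Suc m) (unit (Inr i) + \<kappa>) = dx i (lift_mon m \<kappa>)"
      unfolding lift_mon_def 1 by (simp add: dxs_unit N_mul cc_N peval_polyfun)
    then show ?case by (simp add: var_def mult_single lift_single dx_sc lift_mon_N)
  qed (simp_all add: lift_add distrib_left dx_add lift_N)
qed

lemma lift_emb: "lift m (emb p * mon \<kappa> c)
  = sc c (dxs (\<lambda>i. \<kappa> (Inr i)) (g_mul (peval (p * mon (\<lambda>i. \<kappa> (Inl i)) 1)) (cc (m - degY \<kappa>))))"
proof (induction p rule: mpol_induct)
  case (mon \<mu> a)
  have 1: "(\<lambda>j. (case_sum \<mu> (\<lambda>_. 0) + \<kappa>) (Inl j)) = \<mu> + (\<lambda>j. \<kappa> (Inl j))"
    "(\<lambda>j. (case_sum \<mu> (\<lambda>_. 0) + \<kappa>) (Inr j)) = (\<lambda>j. \<kappa> (Inr j))"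
    by (auto simp: fun_eq_iff plus_fun_apply zero_fun_apply)
  have 2: "degY (case_sum \<mu> (\<lambda>_. 0) + \<kappa>) = degY \<kappa>" by (simp add: degY_def plus_fun_apply zero_fun_apply)
  have 3: "mon \<mu> a * mon (\<lambda>i. \<kappa> (Inl i)) 1 = mon 0 a * mon (\<mu> + (\<lambda>i. \<kappa> (Inl i))) 1"
    by (simp add: mult_single del: single_of_nat)
  have 4: "peval (mon \<mu> a * mon (\<lambda>i. \<kappa> (Inl i)) 1) = (\<lambda>_. a) * peval (mon (\<mu> + (\<lambda>i. \<kappa> (Inl i))) 1)"
    unfolding 3 peval_simps ..
  show ?case
    unfolding emb_single 4 unfolding mult_single lift_single lift_mon_def 1 2
    by (simp add: g_mul_mult[symmetric] dxs_sc N_mul cc_N peval_polyfun g_mul_const_mult mult.commute)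
qed (simp_all add: emb_add distrib_right lift_add peval_simps g_mul_add_left g_mul_add dxs_zero dxs_add N_mul cc_N
    peval_polyfun polyfun_mult)

text \<open>
  Since \<open>f\<^sub>i c\<^sub>j\<^sub>+\<^sub>1 = - \<partial>\<^sub>i c\<^sub>j\<close>, multiplication of the symbol by \<open>Y\<^sub>i + f\<^sub>i\<close> lowers the order.
\<close>

lemma lift_Fx:
  assumes "\<And>\<kappa>. \<kappa> \<in> supp H \<Longrightarrow> degY \<kappa> \<le> m"
  shows "lift (Suc m) (Fx i * H) = lift m (dv (Inl i) H) - dx i (lift m H)"
proof -
  have "supp H \<subseteq> {\<kappa>. degY \<kappa> \<le> m}" using assms by blast
  then show ?thesis
  proof (induction H rule: mpol_induct_supp)
    case (mon \<kappa> c)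
    define \<beta> where "\<beta> = (\<lambda>j. \<kappa> (Inr j))"
    define \<gamma> where "\<gamma> = (\<lambda>j. \<kappa> (Inl j))"
    define g where "g = mon \<gamma> (1::complex)"
    define j where "j = m - degY \<kappa>"
    have j: "Suc m - degY \<kappa> = Suc j" using mon by (simp add: j_def)
    have "lift (Suc m) (Fx i * mon \<kappa> c) = sc c (dxs \<beta> (g_mul (peval (dv i P * g)) (cc (Suc j))))"
      unfolding Fx_def lift_emb j \<beta>_def g_def \<gamma>_def ..
    also have "g_mul (peval (dv i P * g)) (cc (Suc j)) = g_mul (peval (dv i g)) (cc j) - dx i (g_mul (peval g) (cc j))"
      unfolding dx_mul[OF peval_polyfun cc_N] dx_cc pd_peval
      by (simp add: g_mul_def fun_eq_iff minus_apply plus_fun_apply uminus_apply times_fun_apply peval_simps)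
    also have "sc c (dxs \<beta> \<dots>) = sc c (dxs \<beta> (g_mul (peval (dv i g)) (cc j))) - sc c (dx i (dxs \<beta> (g_mul (peval g) (cc j))))"
      by (simp add: dxs_diff dxs_dx N_mul cc_N peval_polyfun N_dx g_mul_diff)
    also have "sc c (dx i (dxs \<beta> (g_mul (peval g) (cc j)))) = dx i (lift m (mon \<kappa> c))"
      unfolding lift_single lift_mon_def
      by (simp add: dx_sc dxs_N N_mul cc_N peval_polyfun \<beta>_def g_def \<gamma>_def j_def)
    also have "sc c (dxs \<beta> (g_mul (peval (dv i g)) (cc j))) = lift m (dv (Inl i) (mon \<kappa> c))"
    proof -
      have 1: "(\<lambda>k. (\<kappa> - unit (Inl i)) (Inl k)) = \<gamma> - unit i" "(\<lambda>k. (\<kappa> - unit (Inl i)) (Inr k)) = \<beta>"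
        by (auto simp: fun_eq_iff minus_apply unit_def \<gamma>_def \<beta>_def)
      have 2: "degY (\<kappa> - unit (Inl i)) = degY \<kappa>" by (simp add: degY_def minus_apply unit_def)
      have "dv i g = mon 0 (of_nat (\<gamma> i)) * mon (\<gamma> - unit i) 1"
        by (simp add: g_def dv_single mult_single del: single_of_nat)
      then show ?thesis
        unfolding dv_single lift_single lift_mon_def 1 2 j_def[symmetric]
        by (simp add: peval_simps g_mul_mult[symmetric] dxs_sc N_mul cc_N peval_polyfun g_mul_const_mult
            \<gamma>_def mult.commute del: single_of_nat)
    qed
    finally show ?case .
  qed (simp_all add: lift_add distrib_left dx_add lift_N dv_add)
qed

lemma lift_YF:
  assumes "\<And>\<kappa>. \<kappa> \<in> supp H \<Longrightarrow> degY \<kappa> \<le> m"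
  shows "lift (Suc m) (YF i * H) = lift m (dv (Inl i) H)"
  by (simp add: distrib_right lift_add lift_Fx[OF assms] dx_lift[OF assms])

lemma cc_top: "cc j j x = (if f x = 0 then 0 else 1 / f x ^ e)"
  by (simp add: cc_apply cf_def)

lemma lift_top:
  assumes "\<And>\<kappa>. \<kappa> \<in> supp G \<Longrightarrow> degY \<kappa> \<le> m" "f x \<noteq> 0"
  shows "lift m G m x = ev (case_sum (\<lambda>i. x $ i) (\<lambda>i. - pd i f x)) G / f x ^ e"
proof -
  have "supp G \<subseteq> {\<kappa>. degY \<kappa> \<le> m}" using assms by blast
  then show ?thesis
  proof (induction G rule: mpol_induct_supp)
    case (mon \<kappa> c)
    let ?b = "g_mul (peval (mon (\<lambda>i. \<kappa> (Inl i)) 1)) (cc (m - degY \<kappa>))"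
    have d: "m = (m - degY \<kappa>) + sum (\<lambda>i. \<kappa> (Inr i)) UNIV" using mon by (simp add: degY_def)
    have "dxs (\<lambda>i. \<kappa> (Inr i)) ?b ((m - degY \<kappa>) + sum (\<lambda>i. \<kappa> (Inr i)) UNIV) x
      = (\<Prod>i\<in>UNIV. (- pd i f x) ^ \<kappa> (Inr i)) * ?b (m - degY \<kappa>) x"
    proof (rule dxs_top(1))
      show "?b \<in> N" by (intro N_mul cc_N peval_polyfun)
      show "?b k = 0" if "m - degY \<kappa> < k" for k using that by (simp add: g_mul_def cc_above)
    qed
    then have "lift_mon m \<kappa> m x = (\<Prod>i\<in>UNIV. (- pd i f x) ^ \<kappa> (Inr i)) * ?b (m - degY \<kappa>) x"
      unfolding lift_mon_def by (subst (2) d)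
    also have "?b (m - degY \<kappa>) x = (\<Prod>i\<in>UNIV. (x $ i) ^ \<kappa> (Inl i)) / f x ^ e"
      using assms(2) by (simp add: g_mul_def times_fun_apply cc_top peval_def ev_single)
    finally show ?case
      unfolding lift_single by (simp add: g_mul_def times_fun_apply ev_single prod_UNIV_sum algebra_simps)
  qed (simp_all add: lift_add plus_fun_apply zero_fun_apply add_divide_distrib)
qed

text \<open>The top coefficient gives the relation where \<open>f \<noteq> 0\<close>; by
  \<open>polyfun_cancel\<close> it extends to the whole graph \<open>Y = - grad f\<close>, as
  \<open>divide_YF_weighted\<close> requires.\<close>

lemma symbol_vanishes:
  assumes "\<And>\<kappa>. \<kappa> \<in> supp G \<Longrightarrow> degY \<kappa> \<le> m" "lift m G m = 0"
  shows "ev (case_sum z (\<lambda>i. - ev z (dv i P))) G = 0"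
proof -
  let ?h = "\<lambda>x. ev (case_sum (\<lambda>i. x $ i) (\<lambda>i. - pd i f x)) G"
  have h: "?h \<in> polyfun"
  proof (induction G rule: mpol_induct)
    case (mon \<kappa> c)
    have "pd i f \<in> polyfun" for i by (intro pd_polyfun f_poly)
    then have "(\<lambda>x. - pd i f x) \<in> polyfun" for i
      using polyfun_uminus[of "pd i f"] by (simp add: fun_Compl_def)
    then show ?case unfolding ev_single prod_UNIV_sum sum.case
      by (intro polyfun.mult polyfun.const polyfun_prod polyfun_power' polyfun.coord)
  qed (simp_all add: polyfun.add polyfun_const)
  have zero: "?h x = 0" if "f x \<noteq> 0" for x
    using lift_top[of G m x] assms that by (simp add: zero_fun_apply)
  obtain y where "f y \<noteq> 0" using f_nz by blast
  from polyfun_cancel[OF f_poly h this zero, of "\<chi> i. z i"]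
  have "ev (case_sum (\<lambda>i. (\<chi> i. z i) $ i) (\<lambda>i. - pd i f (\<chi> i. z i))) G = 0" .
  moreover have "($) (\<chi> i. z i) = z" by (simp add: fun_eq_iff)
  ultimately show ?thesis unfolding pd_peval by (simp add: peval_def)
qed

lemma lift_emb_0: "lift m (emb p) = g_mul (peval p) (cc m)"
proof -
  have "(mon 0 1 :: ('n + 'n) mpol) = 1" "(mon 0 1 :: 'n mpol) = 1" by simp_all
  moreover have "(\<lambda>i. (0 :: 'n + 'n \<Rightarrow> nat) (Inr i)) = 0" "(\<lambda>i. (0 :: 'n + 'n \<Rightarrow> nat) (Inl i)) = 0"
    by (auto simp: fun_eq_iff zero_fun_apply)
  moreover have "degY (0 :: 'n + 'n \<Rightarrow> nat) = 0" by (simp add: degY_def zero_fun_apply)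
  ultimately show ?thesis using lift_emb[of m p 0 1] by simp
qed

text \<open>For a generator of order exactly \<open>m\<close> one has
  \<open>kap = om - l m - A + Wsum\<close>, which explains the bound on \<open>om\<close>;
  generators of smaller order already lie in \<open>Fil q m\<close>.\<close>

lemma Fil_symbol:
  assumes "b \<in> Fil q (Suc m)"
  shows "\<exists>G. (\<forall>\<kappa>\<in>supp G. degY \<kappa> \<le> m \<and> q + int l * int m + A - int Wsum \<le> om \<kappa>) \<and> b - lift m G \<in> Fil q m"
proof -
  have "\<forall>m. m' = Suc m \<longrightarrow> (\<exists>G. (\<forall>\<kappa>\<in>supp G. degY \<kappa> \<le> m \<and> q + int l * int m + A - int Wsum \<le> om \<kappa>)
      \<and> b - lift m G \<in> Fil q m)" if "b \<in> Fil q m'" for m'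
    using that
  proof (induction rule: Fil_induct)
    case (gen j m' \<gamma> a)
    show ?case
    proof (intro allI impI)
      fix m assume m: "m' = Suc m"
      show "\<exists>G. (\<forall>\<kappa>\<in>supp G. degY \<kappa> \<le> m \<and> q + int l * int m + A - int Wsum \<le> om \<kappa>)
        \<and> g_mul (peval (mon \<gamma> a)) (cc j) - lift m G \<in> Fil q m"
      proof (cases "j = m")
        case True
        have "degY \<kappa> \<le> m \<and> q + int l * int m + A - int Wsum \<le> om \<kappa>" if "\<kappa> \<in> supp (emb (mon \<gamma> a))" for \<kappa>
          using that gen True by (auto simp: emb_single degY_def om_def kap_def zero_fun_apply split: if_splits)
        then show ?thesis using True
          by (intro exI[of _ "emb (mon \<gamma> a)"]) (simp add: lift_emb_0 Fil_zero)
      next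
        case False
        then have "g_mul (peval (mon \<gamma> a)) (cc j) \<in> Fil q m" using gen m by (intro Fil_gen) auto
        then show ?thesis by (intro exI[of _ 0]) simp
      qed
    qed
  next
    case (zero m')
    then show ?case by (auto intro!: exI[of _ 0] simp: Fil_zero)
  next
    case (add m' b c)
    show ?case
    proof (intro allI impI)
      fix m assume m: "m' = Suc m"
      obtain G where G: "\<forall>\<kappa>\<in>supp G. degY \<kappa> \<le> m \<and> q + int l * int m + A - int Wsum \<le> om \<kappa>" "b - lift m G \<in> Fil q m"
        using add m by blast
      obtain H where H: "\<forall>\<kappa>\<in>supp H. degY \<kappa> \<le> m \<and> q + int l * int m + A - int Wsum \<le> om \<kappa>" "c - lift m H \<in> Fil q m"
        using add m by blast
      have "(b - lift m G) + (c - lift m H) \<in> Fil q m" by (rule Fil_add[OF G(2) H(2)])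
      then have "b + c - lift m (G + H) \<in> Fil q m" by (simp add: lift_add algebra_simps)
      then show "\<exists>G. (\<forall>\<kappa>\<in>supp G. degY \<kappa> \<le> m \<and> q + int l * int m + A - int Wsum \<le> om \<kappa>) \<and> b + c - lift m G \<in> Fil q m"
        using G(1) H(1) keys_add[of G H] by (intro exI[of _ "G + H"]) blast
    qed
  next
    case (dx m' b i)
    show ?case
    proof (intro allI impI)
      fix m assume "Suc m' = Suc m"
      then have m: "m' = m" by simp
      show "\<exists>G. (\<forall>\<kappa>\<in>supp G. degY \<kappa> \<le> m \<and> q + int l * int m + A - int Wsum \<le> om \<kappa>) \<and> dx i b - lift m G \<in> Fil q m"
      proof (cases m)
        case 0
        then have "b = 0" using Fil_order[OF dx.hyps(1)] m by (auto simp: fun_eq_iff zero_fun_apply)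
        then show ?thesis by (intro exI[of _ 0]) (simp add: Fil_zero)
      next
        case (Suc k)
        then obtain G where G: "\<forall>\<kappa>\<in>supp G. degY \<kappa> \<le> k \<and> q + int l * int k + A - int Wsum \<le> om \<kappa>" "b - lift k G \<in> Fil q k"
          using dx.IH m by blast
        have "dx i (b - lift k G) \<in> Fil q m" unfolding Suc by (rule Fil_dx[OF G(2)])
        moreover have "dx i (b - lift k G) = dx i b - lift m (var (Inr i) * G)"
          using G(1) dx_lift[of G k i] by (simp add: Suc dx_diff Fil_N[OF dx.hyps(1)] lift_N)
        moreover have "degY \<kappa> \<le> m \<and> q + int l * int m + A - int Wsum \<le> om \<kappa>" if \<kappa>: "\<kappa> \<in> supp (var (Inr i) * G)" for \<kappa>
        proof -
          obtain \<mu> \<nu> where "\<mu> \<in> supp (var (Inr i) :: ('n + 'n) mpol)" "\<nu> \<in> supp G" "\<kappa> = \<mu> + \<nu>"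
            using \<kappa> by (rule supp_mult_cases)
          then have "\<kappa> = unit (Inr i) + \<nu>" "\<nu> \<in> supp G" by (auto simp: var_def split: if_splits)
          then show ?thesis using G(1) by (auto simp: Suc distrib_left)
        qed
        ultimately show ?thesis by (intro exI[of _ "var (Inr i) * G"]) auto
      qed
    qed
  qed
  then show ?thesis using assms by blast
qed

lemma om_dv:
  assumes "\<And>\<kappa>. \<kappa> \<in> supp H \<Longrightarrow> degY \<kappa> \<le> m \<and> r + int (W i) \<le> om \<kappa>" "\<kappa> \<in> supp (dv (Inl i) H)"
  shows "degY \<kappa> \<le> m \<and> r \<le> om \<kappa>"
proof -
  have "\<kappa> + unit (Inl i) \<in> supp H" using assms(2) by (auto simp: in_keys_iff coef_dv)
  moreover have "om (unit (Inl i)) = int (W i)"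
  proof -
    have "(\<lambda>j. unit (Inl i :: 'n + 'n) (Inl j)) = unit i" by (auto simp: unit_def)
    then show ?thesis by (simp add: om_def)
  qed
  ultimately show ?thesis using assms(1)[of "\<kappa> + unit (Inl i)"] by simp
qed

text \<open>The bound \<open>q \<le> l - A\<close> is the weight bound of
  \<open>divide_YF_weighted\<close> after the shift between \<open>kap\<close> and
  \<open>om\<close>; so orders are strict up to the upper end of the window.\<close>

lemma Fil_strict_Suc:
  assumes "b \<in> Fil q (Suc m)" "b m = 0" "q \<le> int l - A"
  shows "b \<in> Fil q m"
proof -
  obtain G where G: "\<forall>\<kappa>\<in>supp G. degY \<kappa> \<le> m \<and> q + int l * int m + A - int Wsum \<le> om \<kappa>" "b - lift m G \<in> Fil q m"
    using Fil_symbol[OF assms(1)] by blast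
  have "(b - lift m G) m = 0" using Fil_order[OF G(2)] by blast
  then have "lift m G m = 0" using assms(2) by (simp add: minus_apply)
  then have "ev (case_sum z (\<lambda>i. - ev z (dv i P))) G = 0" for z
    using G(1) by (intro symbol_vanishes[of G m]) auto
  then obtain H where H: "G = (\<Sum>i\<in>UNIV. YF i * H i)"
    "\<forall>i. \<forall>\<kappa>\<in>supp (H i). Suc (degY \<kappa>) \<le> m \<and> q + int l * int m + A - int Wsum - int l + int (W i) \<le> om \<kappa>"
    using divide_YF_weighted[of G m "q + int l * int m + A - int Wsum"] G(1) assms(3) by auto
  have "lift m (YF i * H i) \<in> Fil q m" for i
  proof (cases m)
    case 0
    then have "supp (H i) = {}" using H(2) by auto
    then show ?thesis by (simp add: Fil_zero)
  next
    case (Suc k)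
    have Hi: "degY \<kappa> \<le> k \<and> q + int l * int k + A - int Wsum + int (W i) \<le> om \<kappa>" if "\<kappa> \<in> supp (H i)" for \<kappa>
      using H(2) that by (auto simp: Suc distrib_left algebra_simps)
    have "lift m (YF i * H i) = lift k (dv (Inl i) (H i))"
      unfolding Suc using Hi by (intro lift_YF) auto
    then show ?thesis unfolding Suc using om_dv[OF Hi] by (simp add: lift_Fil)
  qed
  then have "lift m G \<in> Fil q m" unfolding H(1) lift_sum by (rule Fil_sum)
  then have "(b - lift m G) + lift m G \<in> Fil q m" by (rule Fil_add[OF G(2)])
  then show ?thesis by simp
qed

lemma Fil_strict:
  assumes "b \<in> Afil q" "\<And>j. m \<le> j \<Longrightarrow> b j = 0" "q \<le> int l - A"
  shows "b \<in> Fil q m"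
proof -
  have "b \<in> Fil q (m + d) \<Longrightarrow> b \<in> Fil q m" for d
  proof (induction d)
    case (Suc d)
    have "b (m + d) = 0" by (rule assms(2)) simp
    then have "b \<in> Fil q (m + d)" using Suc.prems assms(3) by (rule_tac Fil_strict_Suc) simp_all
    then show ?case by (rule Suc.IH)
  qed simp
  moreover obtain m' where "b \<in> Fil q m'" using assms(1) by (rule AfilE)
  then have "b \<in> Fil q (m + m')" by (rule Fil_mono) auto
  ultimately show ?thesis .
qed

text \<open>Here \<alpha>' = 1 and
  \<open>\<partial>\<^sub>t t c\<^sub>j = t c\<^sub>j\<^sub>+\<^sub>1\<close>, so
  \<open>\<partial>\<^sub>t t\<close> yields \<open>t\<close> times the lift of the same symbol to
  the next order.\<close>

lemma Dt_lift:
  assumes "A = int l" "\<And>\<kappa>. \<kappa> \<in> supp G \<Longrightarrow> degY \<kappa> \<le> m"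
  shows "Dt (lift m G) = t (lift (Suc m) G)"
proof -
  have "\<alpha>' = 1" using \<alpha>'_l l_pos assms(1) by (simp del: of_rat_add)
  then have c: "Dt (cc j) = t (cc (Suc j))" for j unfolding Dt_cc' by simp
  have t_dxs: "t (dxs \<beta> b) = dxs \<beta> (t b)" if "b \<in> N" for b \<beta>
    using dxs_tz[OF that, of 1] that t_tz[of _ 0] by (simp add: dxs_N)
  have "supp G \<subseteq> {\<kappa>. degY \<kappa> \<le> m}" using assms by blast
  then show ?thesis
  proof (induction G rule: mpol_induct_supp)
    case (mon \<kappa> a)
    then have j: "Suc m - degY \<kappa> = Suc (m - degY \<kappa>)" by auto
    let ?g = "g_mul (peval (mon (\<lambda>i. \<kappa> (Inl i)) 1))" and ?\<beta> = "\<lambda>i. \<kappa> (Inr i)"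
    have N: "?g (cc k) \<in> N" for k by (intro N_mul cc_N peval_polyfun)
    have "Dt (lift_mon m \<kappa>) = dxs ?\<beta> (Dt (?g (cc (m - degY \<kappa>))))"
      unfolding lift_mon_def by (rule dxs_Dt[OF N])
    also have "\<dots> = dxs ?\<beta> (t (?g (cc (Suc (m - degY \<kappa>)))))" by (simp only: Dt_mul c, simp only: t_mul)
    also have "\<dots> = t (lift_mon (Suc m) \<kappa>)" unfolding lift_mon_def j by (rule t_dxs[OF N, symmetric])
    finally have "Dt (lift_mon m \<kappa>) = t (lift_mon (Suc m) \<kappa>)" .
    then show ?case by (simp only: lift_single Dt_mul, simp only: t_mul)
  qed (simp_all add: lift_add g_t_add g_dt_add)
qed

lemma Dt_Fil_top:
  assumes "A = int l" "b \<in> Fil q m"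
  shows "\<exists>c\<in>Fil (q - int l) (Suc m). Dt b = t c"
  using Fil_top[OF assms(2)] by (simp add: assms(1) dtt_0)

lemma supp_YF_mult:
  assumes "\<kappa> \<in> supp (var (Inr i) * H)"
  shows "\<exists>\<nu>\<in>supp H. om \<kappa> = int l + om \<nu>"
proof -
  obtain \<mu> \<nu> where "\<mu> \<in> supp (var (Inr i) :: ('n + 'n) mpol)" "\<nu> \<in> supp H" "\<kappa> = \<mu> + \<nu>"
    using assms by (rule supp_mult_cases)
  then show ?thesis by (auto simp: var_def split: if_splits)
qed

text \<open>Dimension at least two enters here; the strict inequality gives the estimate of the
  degree in \<open>Y\<close> in \<open>kernel_Fil\<close>.\<close>

lemma W_less_Wsum:
  assumes "2 \<le> CARD('n)"
  shows "W i < Wsum"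
proof -
  have "\<exists>j. j \<noteq> i"
  proof (rule ccontr)
    assume "\<nexists>j. j \<noteq> i"
    then have "UNIV = {i}" by auto
    then have "CARD('n) = 1" by (metis card_1_singleton_iff One_nat_def)
    then show False using assms by simp
  qed
  then obtain j where "j \<noteq> i" by blast
  then have "W i + W j = sum W {i, j}" by simp
  also have "\<dots> \<le> Wsum" by (rule sum_mono2) auto
  finally show ?thesis using W_pos[of j] by simp
qed

text \<open>
  If \<open>\<partial>\<^sub>t t\<close> annihilates \<open>b\<close> modulo \<open>V\<^sup>>\<^sup>0\<close>, then the part of lowest weight of the symbol of \<open>b\<close> is
  \<open>\<Sum>f\<^sub>i H\<^sub>i\<close> by exactness of the symbol sequence, and \<open>lift_Fx\<close> moves it to higher weight or lower order.
\<close>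

lemma kernel_Fil:
  assumes n: "2 \<le> CARD('n)" and A: "A = int l"
    and "b \<in> Fil 0 m" "c \<in> Afil (1 - int l)" "Dt b = t c"
  shows "b \<in> Fil 1 m"
  using assms(3-5)
proof (induction m arbitrary: b c)
  case 0
  then have "b = 0" using Fil_order[of b 0 0] by (auto simp: fun_eq_iff zero_fun_apply)
  then show ?case by (simp add: Fil_zero)
next
  case (Suc m)
  \<comment> \<open>The weight \<open>om\<close> that corresponds to \<open>kap = 0\<close> in order
    \<open>m\<close> when \<open>A = l\<close>.\<close>
  define r where "r = int l * int m + int l - int Wsum"
  obtain G where "\<forall>\<kappa>\<in>supp G. degY \<kappa> \<le> m \<and> 0 + int l * int m + A - int Wsum \<le> om \<kappa>" and bG: "b - lift m G \<in> Fil 0 m"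
    using Fil_symbol[OF Suc.prems(1)] by blast
  then have G: "degY \<kappa> \<le> m \<and> r \<le> om \<kappa>" if "\<kappa> \<in> supp G" for \<kappa> using that by (auto simp: r_def A)
  obtain c0 where c0: "c0 \<in> Fil (- int l) (Suc m)" "Dt (b - lift m G) = t c0"
    using Dt_Fil_top[OF A bG] by auto
  have cN: "c \<in> N" using Suc.prems(2) V0D_D(1)[OF V0D_Afil] by blast
  \<comment> \<open>So \<open>c\<close> in order \<open>m + 1\<close> has the symbol that
    \<open>b\<close> has in order \<open>m\<close>. As \<open>c\<close> lies in a higher weight
    step, strictness provides a second symbol \<open>G'\<close> of weight above \<open>r\<close>,
    and \<open>G - G'\<close> vanishes on the graph.\<close>
  have "t c = t (c0 + lift (Suc m) G)"
    using c0(2) Suc.prems(3) Dt_lift[OF A, of G m] G by (simp add: g_t_add g_t_diff g_dt_diff algebra_simps)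
  then have c: "c = c0 + lift (Suc m) G"
    by (rule t_cancel[rotated 2]) (simp_all add: cN N_add lift_N Fil_N[OF c0(1)])
  have "lift (Suc m) G \<in> Fil (- int l) (Suc (Suc m))"
    using G by (intro lift_Fil) (auto simp: r_def A algebra_simps le_SucI)
  then have "c \<in> Fil (- int l) (Suc (Suc m))"
    unfolding c by (intro Fil_add Fil_mono[OF c0(1)]) auto
  then have "c \<in> Fil (1 - int l) (Suc (Suc m))"
    using Suc.prems(2) A l_pos by (intro Fil_strict) (auto intro: Fil_order)
  then obtain G' where G'0: "\<forall>\<kappa>\<in>supp G'. degY \<kappa> \<le> Suc m \<and> 1 - int l + int l * int (Suc m) + A - int Wsum \<le> om \<kappa>"
    and cG': "c - lift (Suc m) G' \<in> Fil (1 - int l) (Suc m)" using Fil_symbol by blast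
  then have G': "degY \<kappa> \<le> Suc m \<and> r + 1 \<le> om \<kappa>" if "\<kappa> \<in> supp G'" for \<kappa>
    using that by (auto simp: r_def A algebra_simps)
  have d: "supp (G - G') \<subseteq> supp G \<union> supp G'" by (rule supp_diff)
  then have GG': "degY \<kappa> \<le> Suc m \<and> r \<le> om \<kappa>" if "\<kappa> \<in> supp (G - G')" for \<kappa>
    using that G G' by fastforce
  have "lift (Suc m) (G - G') = (c - lift (Suc m) G') - c0" by (simp add: c lift_diff)
  then have "lift (Suc m) (G - G') (Suc m) = 0"
    using Fil_order[OF cG', of "Suc m"] Fil_order[OF c0(1), of "Suc m"] by (simp add: minus_apply)
  then have "ev (case_sum z (\<lambda>i. - ev z (dv i P))) (G - G') = 0" for z
    using GG' by (intro symbol_vanishes[of "G - G'" "Suc m"]) auto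
  moreover have "r \<le> int l * int (Suc m) + int l - int Wsum" by (simp add: r_def algebra_simps)
  ultimately obtain H where H: "G - G' = (\<Sum>i\<in>UNIV. YF i * H i)"
    "\<forall>i. \<forall>\<kappa>\<in>supp (H i). Suc (degY \<kappa>) \<le> Suc m \<and> r - int l + int (W i) \<le> om \<kappa>"
    using divide_YF_weighted[of "G - G'" "Suc m" r] GG' by blast
  define H' where "H' i = restr (\<lambda>\<kappa>. om \<kappa> = r - int l + int (W i)) (H i)" for i
  have YF: "restr (\<lambda>\<kappa>. om \<kappa> = r) (YF i * H i) = Fx i * H' i" for i
  proof -
    have "restr (\<lambda>\<kappa>. om \<kappa> = r) (var (Inr i) * H i) = 0"
    proof (rule restr_0)
      fix \<kappa> assume "\<kappa> \<in> supp (var (Inr i) * H i)"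
      then obtain \<nu> where "\<nu> \<in> supp (H i)" "om \<kappa> = int l + om \<nu>" using supp_YF_mult by blast
      then have "r + int (W i) \<le> om \<kappa>" using H(2) by fastforce
      then show "om \<kappa> \<noteq> r" using W_pos[of i] by simp
    qed
    moreover have "restr (\<lambda>\<kappa>. om \<kappa> = (int l - int (W i)) + (r - int l + int (W i))) (Fx i * H i) = Fx i * H' i"
      unfolding H'_def by (rule restr_mult_homogeneous) (simp_all add: supp_Fx(1))
    ultimately show ?thesis by (simp add: distrib_right restr_add)
  qed
  \<comment> \<open>\<open>G'\<close> has no part of weight \<open>r\<close>, and the products of
    \<open>Y\<^sub>i\<close> with \<open>H i\<close> start above \<open>r\<close>; so the lowest
    part of \<open>G\<close> comes from the \<open>Fx i\<close> alone.\<close>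
  have "restr (\<lambda>\<kappa>. om \<kappa> = r) G = restr (\<lambda>\<kappa>. om \<kappa> = r) (G - G')"
  proof (rule poly_mapping_eqI)
    fix \<kappa>
    have "coef G' \<kappa> = 0" if "om \<kappa> = r" using G'[of \<kappa>] that by (auto simp: in_keys_iff)
    then show "coef (restr (\<lambda>\<kappa>. om \<kappa> = r) G) \<kappa> = coef (restr (\<lambda>\<kappa>. om \<kappa> = r) (G - G')) \<kappa>"
      by (simp add: coef_restr lookup_minus)
  qed
  then have G0: "restr (\<lambda>\<kappa>. om \<kappa> = r) G = (\<Sum>i\<in>UNIV. Fx i * H' i)"
    by (simp only: H(1) restr_sum YF)
  have step: "\<exists>u\<in>Fil 0 m. \<exists>v\<in>Fil 1 (Suc m). lift m (Fx i * H' i) = u + v" for i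
  proof -
    \<comment> \<open>The weight \<open>l m + W i - Wsum\<close> is less than \<open>l m\<close>, so
      degree \<open>m\<close> in \<open>Y\<close> is excluded; this leaves room for
      \<open>lift_Fx\<close> to lower the order.\<close>
    have H': "degY \<kappa> < m \<and> om \<kappa> = r - int l + int (W i)" if "\<kappa> \<in> supp (H' i)" for \<kappa>
    proof -
      have om: "om \<kappa> = r - int l + int (W i)" using that by (simp add: H'_def supp_restr)
      then have "int l * int (degY \<kappa>) < int l * int m"
        using om_ge_degY[of \<kappa>] W_less_Wsum[OF n, of i] unfolding r_def by linarith
      then show ?thesis using om l_pos by simp
    qed
    show ?thesis
    proof (cases m)
      case 0
      then have "\<kappa> \<notin> supp (H' i)" for \<kappa> using H'[of \<kappa>] by auto
      then have "supp (H' i) = {}" by blast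
      then have "H' i = 0" by (simp only: keys_eq_empty)
      then show ?thesis by (intro bexI[of _ 0]) (simp_all add: Fil_zero)
    next
      case (Suc k)
      have Hk: "degY \<kappa> \<le> k \<and> r - int l + int (W i) \<le> om \<kappa>" if "\<kappa> \<in> supp (H' i)" for \<kappa>
        using H'[OF that] Suc by simp
      have rk: "r - int l = int l * int k + int l - int Wsum" by (simp add: r_def Suc algebra_simps)
      have eq: "lift m (Fx i * H' i) = lift k (dv (Inl i) (H' i)) + - dx i (lift k (H' i))"
        unfolding Suc using Hk by (subst lift_Fx) auto
      have "lift k (dv (Inl i) (H' i)) \<in> Fil 0 (Suc k)"
        using om_dv[OF Hk] by (intro lift_Fil) (simp add: rk A)
      moreover have "lift k (H' i) \<in> Fil 1 (Suc k)"
      proof (rule lift_Fil)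
        fix \<kappa> assume "\<kappa> \<in> supp (H' i)"
        from Hk[OF this] show "degY \<kappa> \<le> k \<and> 1 + int l * int k + A - int Wsum \<le> om \<kappa>"
          using W_pos[of i] unfolding rk A by linarith
      qed
      then have "- dx i (lift k (H' i)) \<in> Fil 1 (Suc m)" unfolding Suc by (intro Fil_uminus Fil_dx)
      ultimately show ?thesis using eq unfolding Suc by blast
    qed
  qed
  obtain u v where uv: "\<And>i. u i \<in> Fil 0 m" "\<And>i. v i \<in> Fil 1 (Suc m)" "\<And>i. lift m (Fx i * H' i) = u i + v i"
    using step by metis
  \<comment> \<open>\<open>b1\<close> collects what has reached weight 1. The rest of
    \<open>b\<close> has lower order and still satisfies the hypothesis, because
    \<open>Dt b1\<close> is \<open>t\<close> times an element of index \<open>1 - l\<close>.\<close>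
  define b1 where "b1 = lift m (restr (\<lambda>\<kappa>. om \<kappa> \<noteq> r) G) + (\<Sum>i\<in>UNIV. v i)"
  have "lift m (restr (\<lambda>\<kappa>. om \<kappa> \<noteq> r) G) \<in> Fil 1 (Suc m)"
  proof (rule lift_Fil)
    fix \<kappa> assume "\<kappa> \<in> supp (restr (\<lambda>\<kappa>. om \<kappa> \<noteq> r) G)"
    then have "om \<kappa> \<noteq> r" "degY \<kappa> \<le> m \<and> r \<le> om \<kappa>" using G by (auto simp: supp_restr)
    then show "degY \<kappa> \<le> m \<and> 1 + int l * int m + A - int Wsum \<le> om \<kappa>"
      unfolding r_def A by linarith
  qed
  then have b1: "b1 \<in> Fil 1 (Suc m)" unfolding b1_def by (intro Fil_add Fil_sum uv)
  have "lift m G = lift m (restr (\<lambda>\<kappa>. om \<kappa> = r) G) + lift m (restr (\<lambda>\<kappa>. om \<kappa> \<noteq> r) G)"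
    by (subst restr_split[of G "\<lambda>\<kappa>. om \<kappa> = r"]) (rule lift_add)
  then have "b - b1 = (b - lift m G) + (\<Sum>i\<in>UNIV. u i)"
    by (simp add: b1_def G0 lift_sum uv(3) sum.distrib)
  moreover have "(b - lift m G) + (\<Sum>i\<in>UNIV. u i) \<in> Fil 0 m" by (intro Fil_add bG Fil_sum uv(1))
  ultimately have b0: "b - b1 \<in> Fil 0 m" by (simp only:)
  obtain c1 where c1: "c1 \<in> Fil (1 - int l) (Suc (Suc m))" "Dt b1 = t c1"
    using Dt_Fil_top[OF A b1] by blast
  have "b - b1 \<in> Fil 1 m"
  proof (rule Suc.IH[OF b0])
    show "c - c1 \<in> Afil (1 - int l)" by (intro V0D_diff[OF V0D_Afil] Suc.prems(2) AfilI[OF c1(1)])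
    show "Dt (b - b1) = t (c - c1)" using c1(2) Suc.prems(3) by (simp add: g_t_diff g_dt_diff)
  qed
  then have "(b - b1) + b1 \<in> Fil 1 (Suc m)" by (intro Fil_add b1) (rule Fil_mono, auto)
  then show ?case by simp
qed

section \<open>Hodge filtration of the weight steps\<close>

lemma order_Fil: "b \<in> Afil q \<Longrightarrow> order_le (int k) b \<Longrightarrow> q \<le> int l - A \<Longrightarrow> b \<in> Fil q (Suc k)"
  by (rule Fil_strict) auto

lemma Fil_order_le: "b \<in> Fil q (Suc k) \<Longrightarrow> order_le (int k) b"
  using Fil_order by auto

text \<open>Index 0 is inside the window, so \<open>\<partial>\<^sub>t t\<close> vanishes on
  \<open>gr\<^sub>V\<^sup>0\<close>: its image is zero and its kernel everything.
  \<open>Suc k\<close> appears because \<open>Fil\<close> bounds the order strictly.\<close>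

theorem hodge_weight_lt:
  assumes "A < int l"
  shows "weight_W f \<alpha> (int CARD('n) + 1) = Loc"
    "hodge_F f \<alpha> (int k) \<inter> weight_W f \<alpha> (int CARD('n)) = {b 0 | b. b \<in> Fil 1 (Suc k)}"
proof -
  have Vp: "V_gt VV 0 = Afil 1" using Vp_eq assms by simp
  have T: "dtt 0 b \<in> Afil 1" if "b \<in> Afil 0" for b
    using that by (elim AfilE) (use Fil_euler[of b 0] in \<open>auto intro: AfilI\<close>)
  have Im: "phi.ImT = Afil 1"
  proof
    show "phi.ImT \<subseteq> Afil 1"
      unfolding VV_0 Vp img_mod_def using T by (auto simp: set_plus_def intro: V0D_D(3)[OF V0D_Afil])
    show "Afil 1 \<subseteq> phi.ImT" using phi.B_Im unfolding Vp .
  qed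
  have Ker: "phi.KerT = VV 0"
    unfolding ker_mod_def using T unfolding VV_0 Vp by blast
  show "weight_W f \<alpha> (int CARD('n) + 1) = Loc"
    unfolding weight_W_eq WW_def by (simp add: phi.mfil_def Ker PL_V0)
  have W: "weight_W f \<alpha> (int CARD('n)) = PL phi.ImT"
    unfolding weight_W_eq WW_def by (simp add: phi.mfil_def)
  show "hodge_F f \<alpha> (int k) \<inter> weight_W f \<alpha> (int CARD('n)) = {b 0 | b. b \<in> Fil 1 (Suc k)}"
    unfolding W hodge_F_inter_PL[OF adm_phi(1)] unfolding Im
    using order_Fil[of _ 1 k] Fil_order_le[of _ 1 k] AfilI[of _ 1 "Suc k"] assms by force
qed

text \<open>Index 0 is the upper end of the window. The kernel of
  \<open>\<partial>\<^sub>t t\<close> is found by \<open>kernel_Fil\<close>, after strictness at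
  \<open>q = 0\<close>, the largest index that \<open>Fil_strict\<close> admits here.\<close>

theorem hodge_weight_eq:
  assumes "2 \<le> CARD('n)" "A = int l"
  shows "weight_W f \<alpha> (int CARD('n) + 2) = Loc"
    "hodge_F f \<alpha> (int k) \<inter> weight_W f \<alpha> (int CARD('n) + 1) = {b 0 | b. b \<in> Fil 1 (Suc k)}"
proof -
  have Vp: "V_gt VV 0 = t ` Afil (1 - int l)" using Vp_eq assms by simp
  have Ker: "phi.KerT = {b \<in> Afil 0. Dt b \<in> t ` Afil (1 - int l)}"
    unfolding ker_mod_def VV_0 Vp dtt_0 ..
  show "weight_W f \<alpha> (int CARD('n) + 2) = Loc"
    unfolding weight_W_eq WW_def by (simp add: phi.mfil_def PL_V0)
  have W: "weight_W f \<alpha> (int CARD('n) + 1) = PL phi.KerT"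
    unfolding weight_W_eq WW_def by (simp add: phi.mfil_def)
  have "b \<in> phi.KerT \<and> order_le (int k) b \<longleftrightarrow> b \<in> Fil 1 (Suc k)" for b
  proof
    assume b: "b \<in> phi.KerT \<and> order_le (int k) b"
    then obtain c where "b \<in> Afil 0" "c \<in> Afil (1 - int l)" "Dt b = t c" unfolding Ker by blast
    then show "b \<in> Fil 1 (Suc k)" using order_Fil[of b 0 k] b assms by (intro kernel_Fil[of b _ c]) auto
  next
    assume b: "b \<in> Fil 1 (Suc k)"
    obtain c where "c \<in> Fil (1 - int l) (Suc (Suc k))" "Dt b = t c" using Dt_Fil_top[OF assms(2) b] by blast
    moreover have "b \<in> Afil 0" using b by (intro AfilI[OF Fil_mono]) auto
    ultimately show "b \<in> phi.KerT \<and> order_le (int k) b" unfolding Ker using Fil_order_le[OF b] AfilI by blast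
  qed
  then show "hodge_F f \<alpha> (int k) \<inter> weight_W f \<alpha> (int CARD('n) + 1) = {b 0 | b. b \<in> Fil 1 (Suc k)}"
    unfolding W hodge_F_inter_PL[OF adm_phi(2)] by blast
qed

end

section \<open>Comparison with the formula\<close>

context weighted_module
begin

lemma cf_0_nz: "cf j 0 \<noteq> 0"
proof -
  have "(0::rat) < of_nat l * (\<alpha> + of_nat e)" unfolding A_eq[symmetric] using A_pos by simp
  then have "0 < \<alpha> + of_nat e" using l_pos by (simp add: zero_less_mult_iff)
  then have "0 < \<alpha> + of_nat e + of_nat k" for k by (simp add: add_pos_nonneg)
  then have "\<alpha>' + of_nat k \<noteq> 0" for k
    by (metis less_irrefl of_rat_add of_rat_eq_0_iff of_rat_of_nat_eq)
  then have "- \<alpha>' \<noteq> of_nat k" for k by (metis add.right_inverse)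
  then have "pochhammer \<alpha>' j \<noteq> 0" unfolding pochhammer_eq_0_iff by (metis add.inverse_inverse)
  then show ?thesis by (simp add: cf_def)
qed

text \<open>Spanned by the coefficients at 0 of the generators with \<open>kap \<ge> 1\<close>, up
  to the nonzero factor \<open>cf j 0\<close>; \<open>low_eq\<close> identifies it with the terms of
  the formula.\<close>

definition low :: "nat \<Rightarrow> (complex ^ 'n \<Rightarrow> complex) set" where
  "low j = {loc_elt f (peval G) (j + e) | G. \<forall>\<gamma>\<in>supp G. 1 \<le> kap \<gamma> j}"

definition low_D :: "nat \<Rightarrow> (complex ^ 'n \<Rightarrow> complex) set" where
  "low_D m = {g * foldr (conn f \<alpha>) \<beta> u | g \<beta> u j. g \<in> polyfun \<and> j + length \<beta> < m \<and> u \<in> low j}"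

lemma low_Loc: "u \<in> low j \<Longrightarrow> u \<in> Loc"
  by (auto simp: low_def intro: LocI peval_polyfun)

lemma foldr_conn_Loc: "u \<in> Loc \<Longrightarrow> foldr (conn f \<alpha>) \<beta> u \<in> Loc"
  by (induction \<beta>) (simp_all add: conn_Loc)

lemma low_D_Loc: "u \<in> low_D m \<Longrightarrow> u \<in> Loc"
  by (auto simp: low_D_def intro: Loc_mult foldr_conn_Loc low_Loc)

lemma span_low_D_Loc: "u \<in> add_span (low_D m) \<Longrightarrow> u \<in> Loc"
  by (induction rule: add_span_induct) (auto intro: Loc_zero Loc_add low_D_Loc)

lemma conn_low_D:
  assumes "u \<in> add_span (low_D m)"
  shows "conn f \<alpha> i u \<in> add_span (low_D (Suc m))"
  using assms
proof (induction rule: add_span_induct)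
  case zero
  show ?case by (simp add: add_span_zero)
next
  case (base x)
  then obtain g \<beta> u j where x: "x = g * foldr (conn f \<alpha>) \<beta> u" "g \<in> polyfun" "j + length \<beta> < m" "u \<in> low j"
    unfolding low_D_def by blast
  have L: "foldr (conn f \<alpha>) \<beta> u \<in> Loc" by (intro foldr_conn_Loc low_Loc[OF x(4)])
  have "pd i g * foldr (conn f \<alpha>) \<beta> u \<in> low_D (Suc m)"
    unfolding low_D_def using x pd_polyfun[OF x(2)] less_SucI by blast
  moreover have "g * foldr (conn f \<alpha>) (i # \<beta>) u \<in> low_D (Suc m)"
  proof -
    have "j + length (i # \<beta>) < Suc m" using x by simp
    then show ?thesis unfolding low_D_def using x(2,4) by blast
  qed
  ultimately show ?case unfolding x(1) conn_mult[OF x(2) L]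
    by (intro add_span_add add_span_base) simp_all
next
  case (add x y)
  then show ?case by (simp add: conn_add span_low_D_Loc add_span_add)
qed

lemma cc_at_0: "g_mul (peval G) (cc j) 0 = loc_elt f (peval (mon 0 (cf j 0) * G)) (j + e)"
  by (auto simp: fun_eq_iff g_mul_def cc_apply loc_elt_def peval_simps times_fun_apply)

lemma supp_const_mult: "\<kappa> \<in> supp (mon 0 c * G :: 'n mpol) \<Longrightarrow> \<kappa> \<in> supp G"
  by (erule supp_mult_cases) (auto split: if_splits)

lemma dx_at_0: "dx i b 0 = conn f \<alpha> i (b 0)"
  by (simp add: g_dx_def)

text \<open>Passing to the coefficient at 0 is linear over polynomials and turns \<open>dx i\<close>
  into the connection.\<close>

lemma Fil_at_0: "b \<in> Fil 1 m \<Longrightarrow> b 0 \<in> add_span (low_D m)"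
proof (induction rule: Fil_induct)
  case (gen j m \<gamma> a)
  let ?u = "loc_elt f (peval (mon 0 (cf j 0) * mon \<gamma> a)) (j + e)"
  have "\<forall>\<kappa>\<in>supp (mon 0 (cf j 0) * mon \<gamma> a). 1 \<le> kap \<kappa> j"
    using gen(2) by (auto dest!: supp_const_mult split: if_splits)
  then have "?u \<in> low j" unfolding low_def by blast
  then have "1 * foldr (conn f \<alpha>) [] ?u \<in> low_D m"
    unfolding low_D_def using gen(1) polyfun_const(3) by fastforce
  then show ?case unfolding cc_at_0 by (intro add_span_base) simp
next
  case (zero m)
  then show ?case by (simp add: add_span_zero zero_fun_apply)
next
  case (add m b c)
  then show ?case unfolding plus_fun_apply[of b c 0] by (intro add_span_add)
next
  case (dx m b i)
  then show ?case unfolding dx_at_0 by (intro conn_low_D)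
qed

lemma low_D_at_0:
  assumes "u \<in> low_D m"
  shows "\<exists>b\<in>Fil 1 m. u = b 0"
proof -
  obtain g \<beta> v j where u: "u = g * foldr (conn f \<alpha>) \<beta> v" "g \<in> polyfun" "j + length \<beta> < m" "v \<in> low j"
    using assms unfolding low_D_def by blast
  obtain G where G: "v = loc_elt f (peval G) (j + e)" "\<forall>\<gamma>\<in>supp G. 1 \<le> kap \<gamma> j"
    using u(4) unfolding low_def by blast
  \<comment> \<open>Dividing by \<open>cf j 0\<close>, a rising factorial of the positive number
    \<alpha>', makes the coefficient at 0 equal to \<open>v\<close>.\<close>
  define b where "b = g_mul (peval (mon 0 (1 / cf j 0) * G)) (cc j)"
  have b: "b \<in> Fil 1 (Suc j)"
    unfolding b_def using G(2) by (intro Fil_poly) (auto dest: supp_const_mult)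
  have b0: "b 0 = v"
    using cf_0_nz[of j] unfolding b_def cc_at_0 G(1)
    by (auto simp: fun_eq_iff loc_elt_def peval_simps times_fun_apply)
  have "foldr dx \<beta> b \<in> Fil 1 (Suc j + length \<beta>) \<and> foldr dx \<beta> b 0 = foldr (conn f \<alpha>) \<beta> v"
  proof (induction \<beta>)
    case (Cons i \<beta>)
    then show ?case using Fil_dx[of "foldr dx \<beta> b" 1 "Suc j + length \<beta>" i] by (simp add: dx_at_0)
  qed (simp add: b b0)
  then have "g_mul g (foldr dx \<beta> b) \<in> Fil 1 m" "g_mul g (foldr dx \<beta> b) 0 = u"
    using u(2,3) by (auto simp: u(1) g_mul_def intro: Fil_mul[unfolded g_mul_def] Fil_mono)
  then show ?thesis by blast
qed

lemma Fil_eq_low_D: "{b 0 | b. b \<in> Fil 1 m} = add_span (low_D m)"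
proof
  show "{b 0 | b. b \<in> Fil 1 m} \<subseteq> add_span (low_D m)" using Fil_at_0 by blast
  show "add_span (low_D m) \<subseteq> {b 0 | b. b \<in> Fil 1 m}"
  proof (rule add_span_least)
    show "low_D m \<subseteq> {b 0 | b. b \<in> Fil 1 m}" using low_D_at_0 by blast
    have "(0 :: 'n graph_elt) 0 = 0" by (simp add: zero_fun_apply)
    then show "0 \<in> {b 0 | b. b \<in> Fil 1 m}" using Fil_zero by (metis (mono_tags, lifting) mem_Collect_eq)
    fix x y assume "x \<in> {b 0 | b. b \<in> Fil 1 m}" "y \<in> {b 0 | b. b \<in> Fil 1 m}"
    then obtain b c where "b \<in> Fil 1 m" "c \<in> Fil 1 m" "x = b 0" "y = c 0" by blast
    then show "x + y \<in> {b 0 | b. b \<in> Fil 1 m}"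
      using Fil_add[of b 1 m c] by (intro CollectI exI[of _ "b + c"]) (simp add: plus_fun_apply)
  qed
qed

lemma FD_low_D: "add_span (\<Union>j::nat. FD f \<alpha> (int k - int j) (low j)) = add_span (low_D (Suc k))"
proof
  show "add_span (\<Union>j::nat. FD f \<alpha> (int k - int j) (low j)) \<subseteq> add_span (low_D (Suc k))"
  proof (rule add_span_least)
    show "(\<Union>j::nat. FD f \<alpha> (int k - int j) (low j)) \<subseteq> add_span (low_D (Suc k))"
    proof (intro UN_least)
      fix j
      show "FD f \<alpha> (int k - int j) (low j) \<subseteq> add_span (low_D (Suc k))"
        unfolding FD_def
      proof (rule add_span_mono, rule subsetI)
        fix x assume "x \<in> {g * foldr (conn f \<alpha>) \<beta> u | g \<beta> u. g \<in> polyfun \<and> int (length \<beta>) \<le> int k - int j \<and> u \<in> low j}"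
        then obtain g \<beta> u where "x = g * foldr (conn f \<alpha>) \<beta> u" "g \<in> polyfun" "int (length \<beta>) \<le> int k - int j" "u \<in> low j"
          by blast
        moreover from this have "j + length \<beta> < Suc k" by linarith
        ultimately show "x \<in> low_D (Suc k)" unfolding low_D_def by blast
      qed
    qed
  qed (auto intro: add_span_zero add_span_add)
  show "add_span (low_D (Suc k)) \<subseteq> add_span (\<Union>j::nat. FD f \<alpha> (int k - int j) (low j))"
  proof (rule add_span_mono, rule subsetI)
    fix x assume "x \<in> low_D (Suc k)"
    then obtain g \<beta> u j where x: "x = g * foldr (conn f \<alpha>) \<beta> u" "g \<in> polyfun" "j + length \<beta> < Suc k" "u \<in> low j"
      unfolding low_D_def by blast
    then have "int (length \<beta>) \<le> int k - int j" by linarith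
    then have "x \<in> FD f \<alpha> (int k - int j) (low j)"
      unfolding FD_def using x by (intro add_span_base) blast
    then show "x \<in> (\<Union>j::nat. FD f \<alpha> (int k - int j) (low j))" by blast
  qed
qed

end

section \<open>From rational to integral weights\<close>

lemma common_denominator:
  fixes S :: "rat set"
  assumes "finite S"
  shows "\<exists>l::nat. l > 0 \<and> (\<forall>x\<in>S. of_nat l * x \<in> \<int>)"
  using assms
proof induction
  case (insert x S)
  then obtain l :: nat where l: "l > 0" "\<forall>x\<in>S. of_nat l * x \<in> \<int>" by blast
  obtain a b where q: "quotient_of x = (a, b)" by (cases "quotient_of x")
  have b: "b > 0" by (rule quotient_of_denom_pos[OF q])
  have "of_nat (nat b) * x = of_int a"
    using quotient_of_div[OF q] b by simp
  then have "of_nat (l * nat b) * y \<in> \<int>" if "y \<in> insert x S" for y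
  proof (cases "y = x")
    case True
    have "of_nat (l * nat b) * x = of_nat l * (of_nat (nat b) * x)" by simp
    also have "\<dots> \<in> \<int>" unfolding \<open>of_nat (nat b) * x = of_int a\<close> by (intro Ints_mult) simp_all
    finally show ?thesis using True by simp
  next
    case False
    have "of_nat (l * nat b) * y = of_nat (nat b) * (of_nat l * y)" by simp
    also have "\<dots> \<in> \<int>" using l(2) that False Ints_mult[OF Ints_of_nat, of "of_nat l * y" "nat b"] by blast
    finally show ?thesis .
  qed
  then show ?case using l(1) b by (intro exI[of _ "l * nat b"]) auto
qed (auto intro: exI[of _ 1])

definition wrat :: "rat ^ 'n \<Rightarrow> ('n::finite \<Rightarrow> nat) \<Rightarrow> rat" where
  "wrat w \<kappa> = (\<Sum>i\<in>UNIV. w $ i * of_nat (\<kappa> i))"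

lemma euler_add: "g \<in> polyfun \<Longrightarrow> h \<in> polyfun \<Longrightarrow> euler w (g + h) = euler w g + euler w h"
  by (simp add: fun_eq_iff euler_def pd_add plus_fun_apply distrib_left sum.distrib)

lemma euler_mon: "euler w (peval (mon \<kappa> c)) = peval (mon \<kappa> (of_rat (wrat w \<kappa>) * c))"
proof
  fix x
  have "x $ i * pd i (peval (mon \<kappa> c)) x = of_nat (\<kappa> i) * peval (mon \<kappa> c) x" for i
  proof (cases "\<kappa> i = 0")
    case False
    then have "unit i + (\<kappa> - unit i) = \<kappa>" by (auto simp: fun_eq_iff unit_def plus_fun_apply minus_apply)
    then have "var i * dv i (mon \<kappa> c) = mon 0 (of_nat (\<kappa> i)) * mon \<kappa> c"
      by (simp add: var_def dv_single mult_single del: single_of_nat)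
    then have "peval (var i) x * peval (dv i (mon \<kappa> c)) x = peval (mon 0 (of_nat (\<kappa> i))) x * peval (mon \<kappa> c) x"
      by (metis peval_simps(2) times_fun_apply)
    then show ?thesis by (simp add: pd_peval peval_simps del: single_of_nat)
  qed (simp add: pd_peval dv_single peval_simps zero_fun_apply)
  then have "euler w (peval (mon \<kappa> c)) x = (\<Sum>i\<in>UNIV. of_rat (w $ i) * of_nat (\<kappa> i)) * peval (mon \<kappa> c) x"
    by (simp add: euler_def mult.assoc sum_distrib_right)
  also have "(\<Sum>i\<in>UNIV. of_rat (w $ i) * of_nat (\<kappa> i)) = (of_rat (wrat w \<kappa>) :: complex)"
    by (simp add: wrat_def of_rat_sum of_rat_mult)
  finally show "euler w (peval (mon \<kappa> c)) x = peval (mon \<kappa> (of_rat (wrat w \<kappa>) * c)) x"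
    by (simp add: peval_def ev_single)
qed

lemma euler_peval: "euler w (peval G) = peval (lin_ext (\<lambda>\<kappa> c. mon \<kappa> (of_rat (wrat w \<kappa>) * c)) G)"
proof (induction G rule: mpol_induct)
  case zero
  then show ?case using euler_mon[of w 0 0] by simp
next
  case (mon \<kappa> c)
  then show ?case by (simp add: euler_mon lin_ext_single)
next
  case (add p q)
  have "lin_ext (\<lambda>\<kappa> c. mon \<kappa> (of_rat (wrat w \<kappa>) * c)) (p + q) = lin_ext (\<lambda>\<kappa> c. mon \<kappa> (of_rat (wrat w \<kappa>) * c)) p
    + lin_ext (\<lambda>\<kappa> c. mon \<kappa> (of_rat (wrat w \<kappa>) * c)) q"
    by (rule lin_ext_add) (simp_all add: distrib_left single_add)
  then show ?case by (simp add: peval_simps euler_add peval_polyfun add)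
qed

lemma euler_homogeneous:
  assumes "euler w (peval G) = (\<lambda>x. of_rat \<rho> * peval G x)" "\<kappa> \<in> supp G"
  shows "wrat w \<kappa> = \<rho>"
proof -
  let ?E = "lin_ext (\<lambda>\<kappa> c. mon \<kappa> (of_rat (wrat w \<kappa>) * c)) G"
  have "peval ?E = peval (mon 0 (of_rat \<rho>) * G)"
    unfolding euler_peval[symmetric] assms(1) peval_simps by (simp add: fun_eq_iff times_fun_apply)
  then have "?E = mon 0 (of_rat \<rho>) * G" by (rule peval_inj)
  then have "coef ?E \<kappa> = coef (mon 0 (of_rat \<rho>) * G) \<kappa>" by simp
  moreover have "coef ?E \<kappa> = of_rat (wrat w \<kappa>) * coef G \<kappa>"
    unfolding lin_ext_def using assms(2) by (simp add: lookup_sum lookup_single when_def)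
  moreover have "coef (mon 0 a * G) \<kappa> = a * coef G \<kappa>" for a :: complex
    by (induction G rule: mpol_induct) (simp_all add: mult_single lookup_single when_def distrib_left lookup_add del: single_of_nat)
  ultimately show ?thesis using assms(2) by (simp add: in_keys_iff)
qed

text \<open>Eigenfunctions of the Euler field are combinations of monomials of a single weight, so
  the condition can be read off monomial by monomial.\<close>

lemma O_gt_eq:
  fixes w :: "rat ^ 'n::finite"
  shows "O_gt w \<gamma> = {peval G | G. \<forall>\<kappa>\<in>supp G. \<gamma> < wrat w \<kappa>}"
proof
  show "O_gt w \<gamma> \<subseteq> {peval G | G. \<forall>\<kappa>\<in>supp G. \<gamma> < wrat w \<kappa>}"
    unfolding O_gt_def
  proof (rule add_span_least)
    show "{g \<in> polyfun. \<exists>\<rho>>\<gamma>. euler w g = (\<lambda>x. of_rat \<rho> * g x)} \<subseteq> {peval G | G. \<forall>\<kappa>\<in>supp G. \<gamma> < wrat w \<kappa>}"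
    proof
      fix g assume "g \<in> {g \<in> polyfun. \<exists>\<rho>>\<gamma>. euler w g = (\<lambda>x. of_rat \<rho> * g x)}"
      then obtain \<rho> G where "g = peval G" "\<gamma> < \<rho>" "euler w g = (\<lambda>x. of_rat \<rho> * g x)"
        by (auto simp: polyfun_iff_peval)
      then show "g \<in> {peval G | G. \<forall>\<kappa>\<in>supp G. \<gamma> < wrat w \<kappa>}" using euler_homogeneous by blast
    qed
    show "0 \<in> {peval G | G. \<forall>\<kappa>\<in>supp G. \<gamma> < wrat w \<kappa>}"
      by (intro CollectI exI[of _ 0]) (simp add: peval_simps)
    fix x y assume "x \<in> {peval G | G. \<forall>\<kappa>\<in>supp G. \<gamma> < wrat w \<kappa>}" "y \<in> {peval G | G. \<forall>\<kappa>\<in>supp G. \<gamma> < wrat w \<kappa>}"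
    then obtain G H where "x = peval G" "y = peval H" "\<forall>\<kappa>\<in>supp G. \<gamma> < wrat w \<kappa>" "\<forall>\<kappa>\<in>supp H. \<gamma> < wrat w \<kappa>" by blast
    moreover from this have "x + y = peval (G + H)" by (simp add: peval_simps)
    ultimately show "x + y \<in> {peval G | G. \<forall>\<kappa>\<in>supp G. \<gamma> < wrat w \<kappa>}" using keys_add[of G H] by blast
  qed
  show "{peval G | G. \<forall>\<kappa>\<in>supp G. \<gamma> < wrat w \<kappa>} \<subseteq> O_gt w \<gamma>"
  proof
    fix g assume "g \<in> {peval G | G. \<forall>\<kappa>\<in>supp G. \<gamma> < wrat w \<kappa>}"
    then obtain G where G: "g = peval G" "supp G \<subseteq> {\<kappa>. \<gamma> < wrat w \<kappa>}" by blast
    from G(2) have "peval G \<in> O_gt w \<gamma>"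
    proof (induction G rule: mpol_induct_supp)
      case (mon \<kappa> c)
      have "euler w (peval (mon \<kappa> c)) = (\<lambda>x. of_rat (wrat w \<kappa>) * peval (mon \<kappa> c) x)"
        unfolding euler_mon by (simp add: fun_eq_iff peval_def ev_single)
      then show ?case unfolding O_gt_def using mon by (intro add_span_base) (auto simp: peval_polyfun)
    qed (simp_all add: peval_simps O_gt_def add_span_zero add_span_add)
    then show "g \<in> O_gt w \<gamma>" using G(1) by simp
  qed
qed

lemma ev_scale:
  assumes "\<And>\<kappa>. \<kappa> \<in> supp G \<Longrightarrow> (\<Sum>i\<in>UNIV. W i * \<kappa> i) = d"
  shows "ev (\<lambda>i. s ^ W i * x i) G = s ^ d * ev x G"
proof -
  have "supp G \<subseteq> {\<kappa>. (\<Sum>i\<in>UNIV. W i * \<kappa> i) = d}" using assms by blast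
  then show ?thesis
  proof (induction G rule: mpol_induct_supp)
    case (mon \<kappa> c)
    have "(\<Prod>i\<in>UNIV. (s ^ W i * x i) ^ \<kappa> i) = s ^ (\<Sum>i\<in>UNIV. W i * \<kappa> i) * (\<Prod>i\<in>UNIV. x i ^ \<kappa> i)"
      by (simp add: power_mult_distrib prod.distrib power_mult power_sum)
    then show ?case using mon by (simp add: ev_single)
  qed (simp_all add: distrib_left)
qed

text \<open>
  The singular locus is stable under the weighted scaling action, so it contains a curve through the origin
  as soon as it contains a second point.
\<close>

lemma isolated_critical:
  fixes P :: "'n::finite mpol"
  assumes W: "\<And>i. 0 < W i" and hom: "\<And>\<kappa>. \<kappa> \<in> supp P \<Longrightarrow> (\<Sum>i\<in>UNIV. W i * \<kappa> i) = l"
    and eu: "euler w (peval P) = peval P" and iso: "0 isolated_in sing (peval P)"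
    and x: "\<And>i. ev x (dv i P) = 0"
  shows "x j = 0"
proof -
  define y where "y s = (\<chi> i. s ^ W i * x i)" for s :: complex
  have pd0: "pd i (peval P) (y s) = 0" for i s
  proof -
    have "ev (\<lambda>j. s ^ W j * x j) (dv i P) = s ^ (l - W i) * ev x (dv i P)"
    proof (rule ev_scale)
      fix \<kappa> assume "\<kappa> \<in> supp (dv i P)"
      then have "\<kappa> + unit i \<in> supp P" by (simp add: in_keys_iff coef_dv)
      then have "(\<Sum>j\<in>UNIV. W j * (\<kappa> + unit i) j) = l" by (rule hom)
      moreover have "(\<Sum>j\<in>UNIV. W j * unit i j) = W i" by (rule sum_unit)
      ultimately show "(\<Sum>j\<in>UNIV. W j * \<kappa> j) = l - W i"
        by (simp add: plus_fun_apply distrib_left sum.distrib)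
    qed
    moreover have "(\<lambda>j. y s $ j) = (\<lambda>j. s ^ W j * x j)" by (simp add: y_def fun_eq_iff)
    ultimately show ?thesis unfolding pd_peval by (simp only: peval_def x mult_zero_right)
  qed
  \<comment> \<open>By Euler's identity \<open>f\<close> vanishes at its critical points.\<close>
  have sing: "y s \<in> sing (peval P)" for s
  proof -
    have "peval P (y s) = euler w (peval P) (y s)" using eu by simp
    then show ?thesis by (simp add: sing_def pd0 euler_def)
  qed
  obtain T where T: "open T" "T \<inter> sing (peval P) = {0}"
    using iso by (auto simp: isolated_in_def)
  \<comment> \<open>As \<open>s\<close> tends to 0 the curve tends to the origin, so for some
    \<open>s \<noteq> 0\<close> it meets the isolating neighbourhood and is therefore at the
    origin.\<close>
  have "(y \<longlongrightarrow> y 0) (at 0)"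
    unfolding y_def by (intro tendsto_vec_lambda tendsto_intros)
  moreover have "y 0 = 0" using W by (simp add: y_def vec_eq_iff zero_power zero_fun_apply)
  ultimately have "(y \<longlongrightarrow> 0) (at 0)" by simp
  then have "\<forall>\<^sub>F s in at 0. y s \<in> T" using T by (intro topological_tendstoD) auto
  moreover have "\<forall>\<^sub>F s in at (0::complex). s \<noteq> 0" by (rule eventually_neq_at_within)
  ultimately have "\<forall>\<^sub>F s in at 0. y s \<in> T \<and> s \<noteq> 0" by (rule eventually_conj)
  then obtain s where s: "y s \<in> T" "s \<noteq> 0" using eventually_happens'[OF at_neq_bot] by blast
  then have "y s = 0" using T sing by blast
  then have "y s $ j = 0" by simp
  then show ?thesis using s(2) by (simp add: y_def)
qed

lemma weighted_moduleI:
  fixes f :: "complex ^ 'n::finite \<Rightarrow> complex" and w :: "rat ^ 'n"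
  assumes f: "f \<in> polyfun" and w: "\<forall>i. w $ i > 0" and eu: "euler w f = f" and iso: "0 isolated_in sing f"
    and \<alpha>: "0 < \<alpha> + of_nat e" "\<alpha> + of_nat e \<le> 1"
  shows "\<exists>W l P A. weighted_module W l P \<alpha> e A \<and> f = peval P \<and> (\<forall>i. of_nat l * w $ i = of_nat (W i))"
proof -
  obtain P where P: "f = peval P" using f by (auto simp: polyfun_iff_peval)
  \<comment> \<open>\<open>\<alpha>\<close> is included so that \<open>A\<close> is an integer and
    the eigenvalues of \<open>\<partial>\<^sub>t t\<close> lie on the grid.\<close>
  obtain l :: nat where l: "l > 0" "\<forall>x\<in>insert \<alpha> (range (($) w)). of_nat l * x \<in> \<int>"
    using common_denominator[of "insert \<alpha> (range (($) w))"] by auto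
  have "\<exists>k::nat. of_nat l * w $ i = of_nat k" for i
  proof -
    have "of_nat l * w $ i \<in> \<int>" using l(2) by blast
    moreover have "0 \<le> of_nat l * w $ i" using w by (simp add: less_imp_le)
    ultimately show ?thesis by (metis Nats_altdef2 Nats_cases mem_Collect_eq)
  qed
  then obtain W where W: "\<And>i. of_nat l * w $ i = of_nat (W i)" by metis
  have "of_nat l * (\<alpha> + of_nat e) \<in> \<int>"
    using l(2) by (simp add: distrib_left)
  then obtain A where A: "of_int A = of_nat l * (\<alpha> + of_nat e)" by (metis Ints_cases)
  have W_pos: "0 < W i" for i
  proof -
    have "(0::rat) < of_nat (W i)" unfolding W[symmetric] using l(1) w by simp
    then show ?thesis by simp
  qed
  have hom: "(\<Sum>i\<in>UNIV. W i * \<kappa> i) = l" if "\<kappa> \<in> supp P" for \<kappa>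
  proof -
    have "wrat w \<kappa> = 1" using eu that P by (intro euler_homogeneous[of w P]) simp_all
    then have "of_nat (\<Sum>i\<in>UNIV. W i * \<kappa> i) = (of_nat l :: rat)"
      by (simp add: W[symmetric] wrat_def sum_distrib_left[symmetric] mult.assoc)
    then show ?thesis by (simp only: of_nat_eq_iff)
  qed
  have crit: "x j = 0" if "\<And>i. ev x (dv i P) = 0" for x j
    by (rule isolated_critical[OF W_pos hom _ _ that, of w]) (use eu iso P in auto)
  \<comment> \<open>For \<open>f = 0\<close> every point would be critical, for instance the one
    with all coordinates 1.\<close>
  have "\<exists>x. f x \<noteq> 0"
  proof (rule ccontr)
    assume "\<nexists>x. f x \<noteq> 0"
    then have "peval P = 0" by (auto simp: P fun_eq_iff zero_fun_apply)
    then have "P = 0" by (rule peval_eq_0)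
    then show False using crit[of "\<lambda>_. 1"] by simp
  qed
  moreover have "0 < A" "A \<le> int l"
  proof -
    have "(0::rat) < of_int A" unfolding A using l(1) \<alpha> by simp
    then show "0 < A" by simp
    have "(of_int A :: rat) \<le> of_nat l" unfolding A using \<alpha>(2) by (simp add: mult_left_le)
    then show "A \<le> int l" by linarith
  qed
  ultimately have "weighted_module W l P \<alpha> e A"
    using f crit hom W_pos l(1) A unfolding P by unfold_locales auto
  then show ?thesis using P W by blast
qed

text \<open>Multiplied by \<open>l\<close>, the strict inequality between rationals becomes one
  between integers, which is the bound \<open>1 \<le> kap \<kappa> j\<close>.\<close>

lemma (in weighted_module) low_eq:
  assumes "\<forall>i. of_nat l * w $ i = of_nat (W i)"
  shows "low j = {loc_elt f g (j + e) | g. g \<in> O_gt w (\<alpha> + of_nat e + of_nat j - (\<Sum>i\<in>UNIV. w $ i))}"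
proof -
  have "\<alpha> + of_nat e + of_nat j - (\<Sum>i\<in>UNIV. w $ i) < wrat w \<kappa> \<longleftrightarrow> 1 \<le> kap \<kappa> j" for \<kappa>
  proof -
    have wt: "of_nat l * wrat w \<kappa> = of_int (int (wt \<kappa>))"
      using assms by (simp add: wrat_def wt_def sum_distrib_left mult.assoc[symmetric])
    have ws: "of_nat l * (\<Sum>i\<in>UNIV. w $ i) = of_int (int Wsum)"
      using assms by (simp add: sum_distrib_left)
    have "\<alpha> + of_nat e + of_nat j - (\<Sum>i\<in>UNIV. w $ i) < wrat w \<kappa> \<longleftrightarrow>
      of_nat l * (\<alpha> + of_nat e + of_nat j - (\<Sum>i\<in>UNIV. w $ i)) < of_nat l * wrat w \<kappa>"
      using l_pos by simp
    also have "of_nat l * (\<alpha> + of_nat e + of_nat j - (\<Sum>i\<in>UNIV. w $ i)) = of_int (A + int l * int j - int Wsum)"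
      using A_eq ws by (simp add: right_diff_distrib distrib_left)
    finally show ?thesis unfolding wt of_int_less_iff by (simp add: kap_def algebra_simps) linarith
  qed
  then show ?thesis unfolding low_def O_gt_eq by auto
qed

theorem theorem3p25:
  fixes f :: "complex ^ 'n \<Rightarrow> complex" and w :: "rat ^ 'n"
  assumes "CARD('n) \<ge> 2"
    and "f \<in> polyfun"
    and "\<forall>i. w $ i > 0"
    and "euler w f = f"
    and "0 isolated_in sing f"
  shows "\<forall>k::nat.
     (\<forall>\<alpha>::rat. 0 < \<alpha> \<and> \<alpha> < 1 \<longrightarrow>
        weight_W f \<alpha> (int CARD('n) + 1) = localization f \<and>
        hodge_F f \<alpha> (int k) \<inter> weight_W f \<alpha> (int CARD('n)) =
          add_span (\<Union>j::nat. FD f \<alpha> (int k - int j)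
            {loc_elt f g j | g. g \<in> O_gt w (\<alpha> + of_nat j - (\<Sum>i\<in>UNIV. w $ i))})) \<and>
     (weight_W f 0 (int CARD('n) + 2) = localization f \<and>
        hodge_F f 0 (int k) \<inter> weight_W f 0 (int CARD('n) + 1) =
          add_span (\<Union>j::nat. FD f 0 (int k - int j)
            {loc_elt f g (j + 1) | g. g \<in> O_gt w (1 + of_nat j - (\<Sum>i\<in>UNIV. w $ i))}))"
proof (intro allI conjI impI)
  fix k :: nat
  {
    fix \<alpha> :: rat assume \<alpha>: "0 < \<alpha> \<and> \<alpha> < 1"
    obtain W l P A where M: "weighted_module W l P \<alpha> 0 A" and P: "f = peval P"
      and W: "\<forall>i. of_nat l * w $ i = of_nat (W i)"
      using weighted_moduleI[OF assms(2-5), of \<alpha> 0] \<alpha> by auto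
    interpret weighted_module W l P \<alpha> 0 A by (rule M)
    have "(of_int A :: rat) < of_nat l" unfolding A_eq using \<alpha> l_pos by simp
    then have A: "A < int l" by linarith
    show "weight_W f \<alpha> (int CARD('n) + 1) = localization f"
      unfolding P by (rule hodge_weight_lt(1)[OF A])
    show "hodge_F f \<alpha> (int k) \<inter> weight_W f \<alpha> (int CARD('n)) =
        add_span (\<Union>j::nat. FD f \<alpha> (int k - int j)
          {loc_elt f g j | g. g \<in> O_gt w (\<alpha> + of_nat j - (\<Sum>i\<in>UNIV. w $ i))})"
      using FD_low_D[of k] unfolding P hodge_weight_lt(2)[OF A] Fil_eq_low_D low_eq[OF W] by simp
  }
  \<comment> \<open>For \<alpha> = 0 the choice \<open>e = 1\<close> gives \<alpha>' = 1 and
    accounts for the additional pole in \<open>f\<^sup>-\<^sup>j\<^sup>-\<^sup>1\<close>.\<close>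
  obtain W l P A where M: "weighted_module W l P 0 1 A" and P: "f = peval P"
    and W: "\<forall>i. of_nat l * w $ i = of_nat (W i)"
    using weighted_moduleI[OF assms(2-5), of 0 1] by auto
  interpret weighted_module W l P 0 1 A by (rule M)
  have "(of_int A :: rat) = of_nat l" unfolding A_eq by simp
  then have A: "A = int l" by (metis of_int_eq_iff of_int_of_nat_eq)
  show "weight_W f 0 (int CARD('n) + 2) = localization f"
    unfolding P by (rule hodge_weight_eq(1)[OF assms(1) A])
  show "hodge_F f 0 (int k) \<inter> weight_W f 0 (int CARD('n) + 1) =
      add_span (\<Union>j::nat. FD f 0 (int k - int j)
        {loc_elt f g (j + 1) | g. g \<in> O_gt w (1 + of_nat j - (\<Sum>i\<in>UNIV. w $ i))})"
    using FD_low_D[of k] unfolding P hodge_weight_eq(2)[OF assms(1) A] Fil_eq_low_D low_eq[OF W] by simp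
qed

end
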